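(* Let $d,r,s\in\mathbb{N}$ with $s>d/2$ and let $B\in\mathbb{R}^{d\times d}$ be a Frolov matrix. Then there is a constant $c>0$ (that may depend on $B$ and $r$ or $s$) such that for every $n\in\mathbb{N}$ there is some $a_n>0$ so that $\widetilde{M}_{a_n,B}$ uses at most $n$ function values of any $f\in L^1([0,1]^d)$ and satisfies: (1) $\mathbb{E}\big(\widetilde{M}_{a_n,B}(f)\big)=I_d(f)$ for every $f\in L^1([0,1]^d)$; (2) if $n>1$, $\mathbb{E}\,\big|\widetilde{M}_{a_n,B}(f)-I_d(f)\big|\le c\,n^{-r-1/2}\,(\log n)^{\frac{d-1}{2}}\,\Vert f\Vert_{H^{r,\mathrm{mix}}([0,1]^d)}$ for every $f\in H^{r,\mathrm{mix}}([0,1]^d)$; (3) if $n>1$, $\sup_\omega\big|\widetilde{M}^\omega_{a_n,B}(f)-I_d(f)\big|\le c\,n^{-r}\,(\log n)^{\frac{d-1}{2}}\,\Vert f\Vert_{H^{r,\mathrm{mix}}([0,1]^d)}$ for every $f\in H^{r,\mathrm{mix}}([0,1]^d)$; (4) $\mathbb{E}\,\big|\widetilde{M}_{a_n,B}(f)-I_d(f)\big|\le c\,n^{-s/d-1/2}\,\Vert f\Vert_{H^s([0,1]^d)}$ for every $f\in H^s([0,1]^d)$; (5) $\sup_\omega\big|\widetilde{M}^\omega_{a_n,B}(f)-I_d(f)\big|\le c\,n^{-s/d}\,\Vert f\Vert_{H^s([0,1]^d)}$ for every $f\in H^s([0,1]^d)$. Here the suprema are taken over all realizations $\widetilde{M}^\omega_{a_n,B}$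 of $\widetilde{M}_{a_n,B}$.
   Context: $I_d(f)=\int_{[0,1]^d}f(x)\,dx$. Frolov matrix: a matrix $B\in\mathbb{R}^{d\times d}$ such that (a) $B$ is invertible; (b) $\big|\prod_{j=1}^d(Bm)_j\big|\ge 1$ for every $m\in\mathbb{Z}^d\setminus\{0\}$; (c) for all $x,y\in\mathbb{R}^d$ the box $[x,y]=\{z\in\mathbb{R}^d: z_j\text{ lies between }x_j\text{ and }y_j\text{ for }j=1,\dots,d\}$ with volume $V=\prod_{j=1}^d|x_j-y_j|$ contains at most $V+1$ points of the form $Bm$, $m\in\mathbb{Z}^d$. Fix an infinitely differentiable $\psi:\mathbb{R}\to\mathbb{R}$ with $\psi=0$ on $(-\infty,0)$, $\psi=1$ on $(1,\infty)$ and such that $\psi|_{(0,1)}:(0,1)\to(0,1)$ is a diffeomorphism (constants may depend on $\psi$). Put $\Psi(x)=(\psi(x_1),\dots,\psi(x_d))^\top$ and $|D\Psi(x)|=\prod_{i=1}^d\psi'(x_i)$. For invertible $S\in\mathbb{R}^{d\times d}$, $v\in\mathbb{R}^d$ and $f:[0,1]^d\to\mathbb{R}$ let $$\widetilde{Q}_{S,v}(f)=\frac{1}{|\det S|}\sum_{m\in\mathbb{Z}^d}f\big(\Psi(S^{-\top}(m+v))\big)\cdot\big|D\Psi(S^{-\top}(m+v))\big| .$$ The factor $|D\Psi(S^{-\top}(m+v))|$ vanishes if $S^{-\top}(m+v)\notin[0,1]^d$, so the sum is finite; the number of function values used by $\widetilde{Q}_{S,v}$ is the number of $m\in\mathbb{Z}^d$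 with $S^{-\top}(m+v)\in[0,1]^d$. For a Frolov matrix $B$ and $a>0$, the randomized method $\widetilde{M}_{a,B}$ is $\widetilde{Q}_{a\bar{u}B,v}$ with $\bar{u}=\mathrm{diag}(u_1,\dots,u_d)$, where $u$ and $v$ are independent random vectors, uniformly distributed in $[1,2^{1/d}]^d$ and $[0,1]^d$ respectively. A realization $\widetilde{M}^\omega_{a,B}$ is a rule $\widetilde{Q}_{a\bar{u}B,v}$ with fixed $u\in[1,2^{1/d}]^d$, $v\in[0,1]^d$; "uses at most $n$ function values" means that every realization does. Spaces (real-valued functions, weak derivatives $D^\alpha$): $H^{r,\mathrm{mix}}([0,1]^d)$ is the set of $f\in L^2([0,1]^d)$ with $D^\alpha f\in L^2([0,1]^d)$ for all $\alpha\in\{0,\dots,r\}^d$, with norm $\Vert f\Vert_{H^{r,\mathrm{mix}}([0,1]^d)}^2=\sum_{\alpha\in\{0,\dots,r\}^d}\Vert D^\alpha f\Vert_{L^2([0,1]^d)}^2$. $H^s([0,1]^d)$ is the set of $f\in L^2([0,1]^d)$ with $D^\alpha f\in L^2([0,1]^d)$ for all $\alpha\in\mathbb{N}_0^d$ with $\Vert\alpha\Vert_1\le s$, with norm $\Vert f\Vert_{H^s([0,1]^d)}^2=\sum_{\Vert\alpha\Vert_1\le s}\Vert D^\alpha f\Vert_{L^2([0,1]^d)}^2$. Elements of these spaces (for $r\ge1$, $s>d/2$) are identified with their continuous representatives. *)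

theory Defs
  imports "HOL-Probability.Probability"
begin

abbreviation unit_cube :: "(real^'d::finite) set" where
  "unit_cube \<equiv> cbox 0 1"

definition int_lattice :: "(real^'d::finite) set" where
  "int_lattice = {m. \<forall>i. m $ i \<in> \<int>}"

definition cube_integral :: "(real^'d::finite \<Rightarrow> real) \<Rightarrow> real" where
  "cube_integral f = (LINT x|lebesgue_on unit_cube. f x)"

definition L1_cube :: "(real^'d::finite \<Rightarrow> real) set" where
  "L1_cube = {f. integrable (lebesgue_on unit_cube) f}"


section \<open>Frolov matrices\<close>

definition box_between :: "real^'d::finite \<Rightarrow> real^'d \<Rightarrow> (real^'d) set" where
  "box_between x y = {z. \<forall>j. min (x $ j) (y $ j) \<le> z $ j \<and> z $ j \<le> max (x $ j) (y $ j)}"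

definition frolov_matrix :: "real^'d^'d::finite \<Rightarrow> bool" where
  "frolov_matrix B \<longleftrightarrow>
     invertible B \<and>
     (\<forall>m\<in>int_lattice - {0}. \<bar>\<Prod>j\<in>UNIV. (B *v m) $ j\<bar> \<ge> 1) \<and>
     (\<forall>x y. let pts = (\<lambda>m. B *v m) ` int_lattice \<inter> box_between x y
            in finite pts \<and> real (card pts) \<le> (\<Prod>j\<in>UNIV. \<bar>x $ j - y $ j\<bar>) + 1)"


section \<open>The cubature rule and its randomization\<close>

definition smooth_real_on :: "real set \<Rightarrow> (real \<Rightarrow> real) \<Rightarrow> bool" where
  "smooth_real_on U h \<longleftrightarrow> (\<forall>k. \<forall>x\<in>U. ((deriv ^^ k) h) differentiable (at x))"

definition diffeo_on :: "real set \<Rightarrow> real set \<Rightarrow> (real \<Rightarrow> real) \<Rightarrow> bool" where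
  "diffeo_on U V h \<longleftrightarrow>
     bij_betw h U V \<and> smooth_real_on U h \<and> smooth_real_on V (the_inv_into U h)"

definition admissible_psi :: "(real \<Rightarrow> real) \<Rightarrow> bool" where
  "admissible_psi \<psi> \<longleftrightarrow>
     smooth_real_on UNIV \<psi> \<and> (\<forall>x<0. \<psi> x = 0) \<and> (\<forall>x>1. \<psi> x = 1) \<and>
     diffeo_on {0<..<1} {0<..<1} \<psi>"

definition Psi :: "(real \<Rightarrow> real) \<Rightarrow> real^'d::finite \<Rightarrow> real^'d" where
  "Psi \<psi> x = (\<chi> i. \<psi> (x $ i))"

definition DPsi :: "(real \<Rightarrow> real) \<Rightarrow> real^'d::finite \<Rightarrow> real" where
  "DPsi \<psi> x = (\<Prod>i\<in>UNIV. deriv \<psi> (x $ i))"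

definition node :: "real^'d^'d::finite \<Rightarrow> real^'d \<Rightarrow> real^'d \<Rightarrow> real^'d" where
  "node S v m = matrix_inv (transpose S) *v (m + v)"

text \<open>Only finitely many summands are nonzero if \<open>S\<close> is invertible.\<close>

definition Q_rule ::
  "(real \<Rightarrow> real) \<Rightarrow> real^'d^'d::finite \<Rightarrow> real^'d \<Rightarrow> (real^'d \<Rightarrow> real) \<Rightarrow> real" where
  "Q_rule \<psi> S v f =
     1 / \<bar>det S\<bar> *
     (\<Sum>\<^sub>\<infinity>m\<in>int_lattice. f (Psi \<psi> (node S v m)) * DPsi \<psi> (node S v m))"

definition diag_matrix :: "real^'d::finite \<Rightarrow> real^'d^'d" where
  "diag_matrix u = (\<chi> i j. if i = j then u $ i else 0)"

definition dilation :: "real \<Rightarrow> real^'d^'d::finite \<Rightarrow> real^'d \<Rightarrow> real^'d^'d" where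
  "dilation a B u = a *\<^sub>R (diag_matrix u ** B)"

definition u_box :: "(real^'d::finite) set" where
  "u_box = cbox 1 (\<chi> i. 2 powr (1 / real CARD('d)))"

text \<open>The sample space consists of the pairs \<open>(u, v)\<close>. Independence of \<open>u\<close> and \<open>v\<close> is the
  product measure; the completion makes every Lebesgue (not merely Borel) measurable integrand
  yield a measurable random variable.\<close>

definition realizations :: "((real^'d::finite) \<times> (real^'d)) set" where
  "realizations = u_box \<times> unit_cube"

definition uv_measure :: "((real^'d::finite) \<times> (real^'d)) measure" where
  "uv_measure =
     completion (uniform_measure lborel u_box \<Otimes>\<^sub>M uniform_measure lborel unit_cube)"

definition M_method ::
  "(real \<Rightarrow> real) \<Rightarrow> real \<Rightarrow> real^'d^'d::finite \<Rightarrow> (real^'d) \<times> (real^'d) \<Rightarrow> (real^'d \<Rightarrow> real) \<Rightarrow> real"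
  where "M_method \<psi> a B \<omega> f = Q_rule \<psi> (dilation a B (fst \<omega>)) (snd \<omega>) f"

definition uses_at_most :: "nat \<Rightarrow> real \<Rightarrow> real^'d^'d::finite \<Rightarrow> bool" where
  "uses_at_most n a B \<longleftrightarrow>
     (\<forall>(u, v)\<in>realizations.
        let pts = {m \<in> int_lattice. node (dilation a B u) v m \<in> unit_cube}
        in finite pts \<and> card pts \<le> n)"

text \<open>Both errors are taken in \<open>[0, \<infinity>]\<close>, so that neither the expectation nor the supremum
  can degenerate to an arbitrary default value.\<close>

definition mean_error ::
  "(real \<Rightarrow> real) \<Rightarrow> real \<Rightarrow> real^'d^'d::finite \<Rightarrow> (real^'d \<Rightarrow> real) \<Rightarrow> ennreal" where
  "mean_error \<psi> a B f =
     (\<integral>\<^sup>+ \<omega>. ennreal \<bar>M_method \<psi> a B \<omega> f - cube_integral f\<bar> \<partial>uv_measure)"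

definition worst_error ::
  "(real \<Rightarrow> real) \<Rightarrow> real \<Rightarrow> real^'d^'d::finite \<Rightarrow> (real^'d \<Rightarrow> real) \<Rightarrow> ennreal" where
  "worst_error \<psi> a B f =
     (SUP \<omega>\<in>realizations. ennreal \<bar>M_method \<psi> a B \<omega> f - cube_integral f\<bar>)"


section \<open>Sobolev spaces on the unit cube\<close>

definition L2_cube :: "(real^'d::finite \<Rightarrow> real) set" where
  "L2_cube = {f \<in> borel_measurable (lebesgue_on unit_cube).
                integrable (lebesgue_on unit_cube) (\<lambda>x. (f x)\<^sup>2)}"

definition L2_norm_cube :: "(real^'d::finite \<Rightarrow> real) \<Rightarrow> real" where
  "L2_norm_cube f = sqrt (LINT x|lebesgue_on unit_cube. (f x)\<^sup>2)"

definition partial_deriv :: "'d::finite \<Rightarrow> (real^'d \<Rightarrow> real) \<Rightarrow> real^'d \<Rightarrow> real" where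
  "partial_deriv i \<phi> x = frechet_derivative \<phi> (at x) (axis i 1)"

definition iter_partial :: "'d::finite list \<Rightarrow> (real^'d \<Rightarrow> real) \<Rightarrow> real^'d \<Rightarrow> real" where
  "iter_partial js \<phi> = foldr partial_deriv js \<phi>"

definition test_function :: "(real^'d::finite \<Rightarrow> real) \<Rightarrow> bool" where
  "test_function \<phi> \<longleftrightarrow>
     (\<forall>js x. iter_partial js \<phi> differentiable (at x)) \<and>
     (\<exists>K. compact K \<and> K \<subseteq> box 0 1 \<and> (\<forall>x. x \<notin> K \<longrightarrow> \<phi> x = 0))"

text \<open>Multi-indices are functions \<open>\<alpha>\<close> on the coordinates. The classical derivative
  \<open>D\<^sup>\<alpha> \<phi>\<close> is \<open>iter_partial js \<phi>\<close> for any list \<open>js\<close> containing each \<open>i\<close> exactly \<open>\<alpha> i\<close> times; by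
  symmetry of mixed partial derivatives the order does not matter for test functions. The
  predicate is used only for \<open>f\<close> and \<open>g\<close> in \<open>L2_cube\<close>, where both integrands are integrable.\<close>

definition is_weak_deriv ::
  "('d \<Rightarrow> nat) \<Rightarrow> (real^'d::finite \<Rightarrow> real) \<Rightarrow> (real^'d \<Rightarrow> real) \<Rightarrow> bool" where
  "is_weak_deriv \<alpha> f g \<longleftrightarrow>
     (\<forall>\<phi> js. test_function \<phi> \<longrightarrow> (\<forall>i. count_list js i = \<alpha> i) \<longrightarrow>
        (LINT x|lebesgue_on unit_cube. f x * iter_partial js \<phi> x) =
        (-1) ^ (\<Sum>i\<in>UNIV. \<alpha> i) * (LINT x|lebesgue_on unit_cube. g x * \<phi> x))"

text \<open>The weak derivative is unique up to null sets, so the choice does not affect the norms.\<close>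

definition weak_deriv :: "('d \<Rightarrow> nat) \<Rightarrow> (real^'d::finite \<Rightarrow> real) \<Rightarrow> real^'d \<Rightarrow> real" where
  "weak_deriv \<alpha> f = (SOME g. g \<in> L2_cube \<and> is_weak_deriv \<alpha> f g)"

definition sobolev_space :: "('d \<Rightarrow> nat) set \<Rightarrow> (real^'d::finite \<Rightarrow> real) set" where
  "sobolev_space A = {f \<in> L2_cube. \<forall>\<alpha>\<in>A. \<exists>g\<in>L2_cube. is_weak_deriv \<alpha> f g}"

definition sobolev_norm :: "('d \<Rightarrow> nat) set \<Rightarrow> (real^'d::finite \<Rightarrow> real) \<Rightarrow> real" where
  "sobolev_norm A f = sqrt (\<Sum>\<alpha>\<in>A. (L2_norm_cube (weak_deriv \<alpha> f))\<^sup>2)"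

definition mix_indices :: "nat \<Rightarrow> ('d::finite \<Rightarrow> nat) set" where
  "mix_indices r = {\<alpha>. \<forall>i. \<alpha> i \<le> r}"

definition iso_indices :: "nat \<Rightarrow> ('d::finite \<Rightarrow> nat) set" where
  "iso_indices s = {\<alpha>. (\<Sum>i\<in>UNIV. \<alpha> i) \<le> s}"

text \<open>Elements are identified with their continuous representatives.\<close>

definition H_mix :: "nat \<Rightarrow> (real^'d::finite \<Rightarrow> real) set" where
  "H_mix r = {f \<in> sobolev_space (mix_indices r). continuous_on unit_cube f}"

definition H_iso :: "nat \<Rightarrow> (real^'d::finite \<Rightarrow> real) set" where
  "H_iso s = {f \<in> sobolev_space (iso_indices s). continuous_on unit_cube f}"

abbreviation H_mix_norm :: "nat \<Rightarrow> (real^'d::finite \<Rightarrow> real) \<Rightarrow> real" where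
  "H_mix_norm r \<equiv> sobolev_norm (mix_indices r)"

abbreviation H_iso_norm :: "nat \<Rightarrow> (real^'d::finite \<Rightarrow> real) \<Rightarrow> real" where
  "H_iso_norm s \<equiv> sobolev_norm (iso_indices s)"

end

theory Submission
  imports Defs
begin

text \<open>The smooth functions are dense in a Sobolev space in a sense strong enough to reduce the error
  bounds to them. For smooth \<open>f\<close> the integrand \<open>g = (f \<circ> \<Psi>) |D\<Psi>|\<close> is smooth, supported in the cube and has the
  same integral, and its Sobolev norm is controlled by that of \<open>f\<close>: each derivative of \<open>g\<close> is a sum of
  products of a derivative of \<open>f\<close> at \<open>\<Psi>(x)\<close> with weights in the single coordinates. The error
  of the rule with matrix \<open>S\<close>, as a function of the shift \<open>v\<close>, is one-periodic, and its Fourier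
  coefficient at \<open>k \<noteq> 0\<close> is the Fourier transform of \<open>g\<close> at \<open>S k\<close>. The Cauchy-Schwarz inequality
  bounds the sum of these coefficients by a weighted \<open>l\<^sup>2\<close> sum, controlled by the Sobolev norm, and a sum
  of inverse weights over the Frolov lattice, which is counted in dyadic boxes; this is the worst case
  bound. In mean square over \<open>v\<close> the error is the sum of the squared coefficients. Averaging over the
  dilation \<open>u\<close> spreads each lattice point over a box, so that this sum becomes an integral over
  \<open>{\<xi>. a^d \<le> |\<xi>\<^sub>1 \<cdots> \<xi>\<^sub>d|}\<close> with the additional factor \<open>a^(-d)\<close>, of order \<open>1 / n\<close>.\<close>

text \<open>Differentiating \<open>(f \<circ> \<Psi>) |D\<Psi>|\<close> produces weights that need
  not be bounded by the Jacobian unless all derivatives fall on \<open>f\<close>.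

  The error is wanted pointwise in the shift, so its Fourier series must converge to it: absolute
  summability of the coefficients provides a continuous sum, and the uniqueness of Fourier
  coefficients of continuous functions identifies this sum with the error.

  Condition (b) keeps the boxes used for counting at volume one or more, which turns the count
  \<open>V + 1\<close> of condition (c) into a multiple of \<open>V\<close>. The weighted sum is
  controlled by Bessel's inequality at the cost of a factor \<open>N / |det S|\<close> for
  \<open>N\<close> nodes, bounded because \<open>N\<close> and \<open>a^d\<close> are comparable.

  Unbiasedness comes from the shift: the nodes of a fixed dilation tile the space. The integrand is
  only Lebesgue measurable there, so it is exchanged for a Borel version that agrees with it at the
  nodes almost surely.\<close>

lemma matrix_inv_mult:
  fixes A :: "real^'n^'n::finite"
  assumes "invertible A"
  shows "matrix_inv A ** A = mat 1" "A ** matrix_inv A = mat 1"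
proof -
  have "A ** matrix_inv A = mat 1 \<and> matrix_inv A ** A = mat 1"
    unfolding matrix_inv_def using assms unfolding invertible_def by (rule someI_ex)
  then show "matrix_inv A ** A = mat 1" "A ** matrix_inv A = mat 1" by auto
qed

lemma borel_measurable_vec_nth [measurable (raw)]:
  assumes "f \<in> borel_measurable M"
  shows "(\<lambda>x. (f x :: real^'n::finite) $ i) \<in> borel_measurable M"
  using assms by (rule measurable_compose)
    (intro borel_measurable_continuous_onI continuous_intros)

section \<open>Integration along coordinate lines\<close>

lemma pair_sigma_finite_lborel:
  "pair_sigma_finite (lborel :: 'a::euclidean_space measure) (lborel :: 'b::euclidean_space measure)"
  by (intro pair_sigma_finite.intro lborel.sigma_finite_measure_axioms)

lemma nn_integral_lborel_translate:
  fixes f :: "'a::euclidean_space \<Rightarrow> ennreal"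
  assumes [measurable]: "f \<in> borel_measurable borel"
  shows "(\<integral>\<^sup>+x. f (x + c) \<partial>lborel) = (\<integral>\<^sup>+x. f x \<partial>lborel)"
proof -
  have "(\<integral>\<^sup>+x. f x \<partial>lborel) = (\<integral>\<^sup>+x. f x \<partial>distr lborel borel ((+) c))"
    by (simp add: lborel_distr_plus)
  also have "\<dots> = (\<integral>\<^sup>+x. f (c + x) \<partial>lborel)"
    by (subst nn_integral_distr) auto
  finally show ?thesis by (simp add: add.commute)
qed

lemma integral_lborel_translate:
  fixes f :: "'a::euclidean_space \<Rightarrow> 'b::{banach, second_countable_topology}"
  assumes [measurable]: "f \<in> borel_measurable borel"
  shows "(\<integral>x. f (x + c) \<partial>lborel) = (\<integral>x. f x \<partial>lborel)"
proof -
  have "(\<integral>x. f x \<partial>lborel) = (\<integral>x. f x \<partial>distr lborel borel ((+) c))"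
    by (simp add: lborel_distr_plus)
  also have "\<dots> = (\<integral>x. f (c + x) \<partial>lborel)"
    by (subst integral_distr) auto
  finally show ?thesis by (simp add: add.commute)
qed

text \<open>The window \<open>indicator {0..1} (x $ i)\<close> has mass one on every line in
  direction \<open>i\<close>. Tonelli on \<open>real^'d\<close> times \<open>real\<close> and a
  translation then isolate one coordinate without splitting the type \<open>real^'d\<close> into a
  product.\<close>

lemma nn_integral_coordinate:
  fixes F :: "real^'d::finite \<Rightarrow> ennreal"
  assumes [measurable]: "F \<in> borel_measurable borel"
  shows "(\<integral>\<^sup>+x. F x \<partial>lborel) =
    (\<integral>\<^sup>+x. indicator {0..1} (x $ i) * (\<integral>\<^sup>+s. F (x + s *\<^sub>R axis i 1) \<partial>lborel) \<partial>lborel)"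
proof -
  have "(\<integral>\<^sup>+x. indicator {0..1} (x $ i) * (\<integral>\<^sup>+s. F (x + s *\<^sub>R axis i 1) \<partial>lborel) \<partial>lborel)
      = (\<integral>\<^sup>+x. (\<integral>\<^sup>+s. indicator {0..1} (x $ i) * F (x + s *\<^sub>R axis i 1) \<partial>lborel) \<partial>lborel)"
    by (simp add: nn_integral_cmult)
  also have "\<dots> = (\<integral>\<^sup>+s. (\<integral>\<^sup>+x. indicator {0..1} (x $ i) * F (x + s *\<^sub>R axis i 1) \<partial>lborel) \<partial>lborel)"
    by (rule pair_sigma_finite.Fubini'[OF pair_sigma_finite_lborel, symmetric]) measurable
  also have "\<dots> = (\<integral>\<^sup>+s. (\<integral>\<^sup>+x. indicator {0..1} (x $ i - s) * F x \<partial>lborel) \<partial>lborel)"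
  proof (rule nn_integral_cong)
    fix s :: real
    show "(\<integral>\<^sup>+x. indicator {0..1} (x $ i) * F (x + s *\<^sub>R axis i 1) \<partial>lborel)
        = (\<integral>\<^sup>+x. indicator {0..1} (x $ i - s) * F x \<partial>lborel)"
      using nn_integral_lborel_translate[of "\<lambda>x. indicator {0..1} (x $ i - s) * F x" "s *\<^sub>R axis i 1"]
      by (simp add: axis_def)
  qed
  also have "\<dots> = (\<integral>\<^sup>+x. (\<integral>\<^sup>+s. indicator {0..1} (x $ i - s) * F x \<partial>lborel) \<partial>lborel)"
    by (rule pair_sigma_finite.Fubini'[OF pair_sigma_finite_lborel]) measurable
  also have "\<dots> = (\<integral>\<^sup>+x. F x \<partial>lborel)"
  proof (rule nn_integral_cong)
    fix x :: "real^'d"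
    have "(\<integral>\<^sup>+s. indicator {0..1} (x $ i - s) * F x \<partial>lborel)
        = (\<integral>\<^sup>+s. indicator {x $ i - 1..x $ i} s \<partial>lborel) * F x"
      by (subst nn_integral_multc[symmetric]) (auto intro!: nn_integral_cong split: split_indicator)
    then show "(\<integral>\<^sup>+s. indicator {0..1} (x $ i - s) * F x \<partial>lborel) = F x" by simp
  qed
  finally show ?thesis ..
qed

lemma nn_integral_coordinate_mono:
  fixes F G :: "real^'d::finite \<Rightarrow> ennreal"
  assumes "F \<in> borel_measurable borel" "G \<in> borel_measurable borel"
    and "\<And>x. (\<integral>\<^sup>+s. F (x + s *\<^sub>R axis i 1) \<partial>lborel) \<le> (\<integral>\<^sup>+s. G (x + s *\<^sub>R axis i 1) \<partial>lborel)"
  shows "(\<integral>\<^sup>+x. F x \<partial>lborel) \<le> (\<integral>\<^sup>+x. G x \<partial>lborel)"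
  unfolding nn_integral_coordinate[OF assms(1), of i] nn_integral_coordinate[OF assms(2), of i]
  by (intro nn_integral_mono mult_left_mono assms) auto

text \<open>The same window for signed or complex integrands: both double integrals below converge
  absolutely, with total mass the \<open>L\<^sup>1\<close> norm of \<open>F\<close>, so Fubini
  applies. Integration by parts and the orthogonality of the characters rest on this.\<close>

lemma integral_coordinate_zero:
  fixes F :: "real^'d::finite \<Rightarrow> 'b::{banach, second_countable_topology}"
  assumes int: "integrable lborel F"
    and zero: "\<And>x. (\<integral>s. F (x + s *\<^sub>R axis i 1) \<partial>lborel) = 0"
  shows "(\<integral>x. F x \<partial>lborel) = 0"
proof -
  have F[measurable]: "F \<in> borel_measurable borel" using int by auto
  let ?g = "\<lambda>x s. indicator {0..1::real} (x $ i) *\<^sub>R F (x + s *\<^sub>R axis i 1)"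
  let ?h = "\<lambda>x s. indicator {0..1::real} (x $ i - s) *\<^sub>R F x"
  have fin: "(\<integral>\<^sup>+x. ennreal (norm (F x)) \<partial>lborel) < \<infinity>"
    using int by (simp add: integrable_iff_bounded)
  have ig: "integrable (lborel \<Otimes>\<^sub>M lborel) (case_prod ?g)"
  proof (subst integrable_iff_bounded, intro conjI)
    show "case_prod ?g \<in> borel_measurable (lborel \<Otimes>\<^sub>M lborel)" by measurable
    have "(\<integral>\<^sup>+z. ennreal (norm (case_prod ?g z)) \<partial>(lborel \<Otimes>\<^sub>M lborel))
      = (\<integral>\<^sup>+x. (\<integral>\<^sup>+s. ennreal (norm (?g x s)) \<partial>lborel) \<partial>lborel)"
      by (subst lborel.nn_integral_fst[symmetric]) (auto simp del: norm_scaleR)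
    also have "\<dots> = (\<integral>\<^sup>+x. indicator {0..1} (x $ i) * (\<integral>\<^sup>+s. ennreal (norm (F (x + s *\<^sub>R axis i 1))) \<partial>lborel) \<partial>lborel)"
      by (subst nn_integral_cmult[symmetric]) (auto intro!: nn_integral_cong split: split_indicator)
    also have "\<dots> < \<infinity>" using fin by (subst nn_integral_coordinate[symmetric]) auto
    finally show "(\<integral>\<^sup>+z. ennreal (norm (case_prod ?g z)) \<partial>(lborel \<Otimes>\<^sub>M lborel)) < \<infinity>" .
  qed
  have ih: "integrable (lborel \<Otimes>\<^sub>M lborel) (case_prod ?h)"
  proof (subst integrable_iff_bounded, intro conjI)
    show "case_prod ?h \<in> borel_measurable (lborel \<Otimes>\<^sub>M lborel)" by measurable
    have "(\<integral>\<^sup>+z. ennreal (norm (case_prod ?h z)) \<partial>(lborel \<Otimes>\<^sub>M lborel))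
      = (\<integral>\<^sup>+x. (\<integral>\<^sup>+s. ennreal (norm (?h x s)) \<partial>lborel) \<partial>lborel)"
      by (subst lborel.nn_integral_fst[symmetric]) (auto simp del: norm_scaleR)
    also have "\<dots> = (\<integral>\<^sup>+x. (\<integral>\<^sup>+s. indicator {x $ i - 1..x $ i} s \<partial>lborel) * ennreal (norm (F x)) \<partial>lborel)"
      by (subst nn_integral_multc[symmetric])
        (auto intro!: nn_integral_cong split: split_indicator)
    also have "\<dots> < \<infinity>" using fin by simp
    finally show "(\<integral>\<^sup>+z. ennreal (norm (case_prod ?h z)) \<partial>(lborel \<Otimes>\<^sub>M lborel)) < \<infinity>" .
  qed
  have "0 = (\<integral>x. (\<integral>s. ?g x s \<partial>lborel) \<partial>lborel)" by (simp add: zero)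
  also have "\<dots> = (\<integral>s. (\<integral>x. ?g x s \<partial>lborel) \<partial>lborel)"
    using pair_sigma_finite.Fubini_integral[OF pair_sigma_finite_lborel, of "?g"] ig by simp
  also have "\<dots> = (\<integral>s. (\<integral>x. ?h x s \<partial>lborel) \<partial>lborel)"
  proof (rule Bochner_Integration.integral_cong[OF refl])
    fix s :: real
    show "(\<integral>x. ?g x s \<partial>lborel) = (\<integral>x. ?h x s \<partial>lborel)"
      using integral_lborel_translate[of "\<lambda>x. ?h x s" "s *\<^sub>R axis i 1"]
      by (simp add: axis_def)
  qed
  also have "\<dots> = (\<integral>x. (\<integral>s. ?h x s \<partial>lborel) \<partial>lborel)"
    using pair_sigma_finite.Fubini_integral[OF pair_sigma_finite_lborel, of "?h"] ih by simp
  also have "\<dots> = (\<integral>x. F x \<partial>lborel)"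
  proof (rule Bochner_Integration.integral_cong[OF refl])
    fix x :: "real^'d"
    have "(\<integral>s. ?h x s \<partial>lborel) = (\<integral>s. indicator {x $ i - 1..x $ i} s *\<^sub>R F x \<partial>lborel)"
      by (rule Bochner_Integration.integral_cong[OF refl]) (auto split: split_indicator)
    also have "\<dots> = F x" by simp
    finally show "(\<integral>s. ?h x s \<partial>lborel) = F x" .
  qed
  finally show ?thesis ..
qed

text \<open>One-dimensional substitution on each line in direction \<open>i\<close>. The offset
  \<open>\<alpha> x\<close> may vary from line to line, which covers both shears, with
  \<open>c = 1\<close>, and scalings of one coordinate.\<close>

lemma nn_integral_coordinate_affine:
  fixes h :: "real^'d::finite \<Rightarrow> ennreal"
  assumes [measurable]: "h \<in> borel_measurable borel" "T \<in> borel_measurable borel"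
    and "c \<noteq> 0"
    and T: "\<And>x s. T (x + s *\<^sub>R axis i 1) = x + (\<alpha> x + c * s) *\<^sub>R axis i 1"
  shows "ennreal \<bar>c\<bar> * (\<integral>\<^sup>+x. h (T x) \<partial>lborel) = (\<integral>\<^sup>+x. h x \<partial>lborel)"
proof -
  have "ennreal \<bar>c\<bar> * (\<integral>\<^sup>+x. h (T x) \<partial>lborel)
      = (\<integral>\<^sup>+x. ennreal \<bar>c\<bar> * h (T x) \<partial>lborel)"
    by (subst nn_integral_cmult) auto
  also have "\<dots> = (\<integral>\<^sup>+x. indicator {0..1} (x $ i) *
      (\<integral>\<^sup>+s. ennreal \<bar>c\<bar> * h (x + (\<alpha> x + c * s) *\<^sub>R axis i 1) \<partial>lborel) \<partial>lborel)"
    by (subst nn_integral_coordinate[where i = i]) (auto simp: T)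
  also have "\<dots> = (\<integral>\<^sup>+x. h x \<partial>lborel)"
  proof -
    have "(\<integral>\<^sup>+s. ennreal \<bar>c\<bar> * h (x + (\<alpha> x + c * s) *\<^sub>R axis i 1) \<partial>lborel)
        = (\<integral>\<^sup>+s. h (x + s *\<^sub>R axis i 1) \<partial>lborel)" for x
      using nn_integral_real_affine[of "\<lambda>s. h (x + s *\<^sub>R axis i 1)" c "\<alpha> x"] \<open>c \<noteq> 0\<close>
      by (simp add: nn_integral_cmult)
    then show ?thesis by (simp add: nn_integral_coordinate[where F = h and i = i])
  qed
  finally show ?thesis .
qed

section \<open>Linear change of variables\<close>

definition preserves_volume :: "real^'d^'d::finite \<Rightarrow> bool" where
  "preserves_volume A \<longleftrightarrow> (\<forall>h\<in>borel_measurable borel.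
     ennreal \<bar>det A\<bar> * (\<integral>\<^sup>+x. h (A *v x) \<partial>lborel) = (\<integral>\<^sup>+x. h x \<partial>lborel))"

lemma borel_measurable_matrix_vector_mult [measurable (raw)]:
  fixes A :: "real^'n^'m::finite"
  assumes "f \<in> borel_measurable M"
  shows "(\<lambda>x. A *v f x) \<in> borel_measurable M"
  using assms by (rule measurable_compose)
    (intro borel_measurable_continuous_onI linear_continuous_on matrix_vector_mul_bounded_linear)

definition row_add :: "'d \<Rightarrow> 'd \<Rightarrow> real \<Rightarrow> real^'d^'d \<Rightarrow> real^'d^'d::finite" where
  "row_add i j t A = (\<chi> k. if k = i then row i A + t *s row j A else row k A)"

definition row_scale :: "'d \<Rightarrow> real \<Rightarrow> real^'d^'d \<Rightarrow> real^'d^'d::finite" where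
  "row_scale i t A = (\<chi> k. if k = i then t *s row i A else row k A)"

lemma row_add_nth: "row_add i j t A $ k $ l = (if k = i then A $ i $ l + t * A $ j $ l else A $ k $ l)"
  by (simp add: row_add_def row_def)

lemma row_scale_nth: "row_scale i t A $ k $ l = (if k = i then t * A $ i $ l else A $ k $ l)"
  by (simp add: row_scale_def row_def)

lemma det_row_add: "i \<noteq> j \<Longrightarrow> det (row_add i j t A) = det (A :: real^'d^'d::finite)"
  unfolding row_add_def by (rule det_row_operation)

lemma det_row_scale: "det (row_scale i t A) = t * det (A :: real^'d^'d::finite)"
proof -
  have "(\<chi> k. if k = i then row i A else row k A) = A"
    by (simp add: row_def vec_eq_iff)
  then show ?thesis
    unfolding row_scale_def using det_row_mul[of i t "\<lambda>k. row i A" "\<lambda>k. row k A"] by simp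
qed

text \<open>\<open>A *v x\<close> arises from \<open>row_add i j t A *v x\<close> by the inverse
  shear, which keeps volume. The implication runs from the reduced matrix back to \<open>A\<close>,
  the direction in which elimination uses it.\<close>

lemma preserves_volume_row_addI:
  assumes "i \<noteq> j" and P: "preserves_volume (row_add i j t A)"
  shows "preserves_volume (A :: real^'d^'d::finite)"
  unfolding preserves_volume_def
proof
  fix h :: "real^'d \<Rightarrow> ennreal" assume [measurable]: "h \<in> borel_measurable borel"
  let ?T = "\<lambda>y :: real^'d. y + (- t * y $ j) *\<^sub>R axis i 1"
  have "h (A *v x) = h (?T (row_add i j t A *v x))" for x
  proof -
    have "A *v x = ?T (row_add i j t A *v x)"
      using \<open>i \<noteq> j\<close> unfolding vec_eq_iff
      by (auto simp: matrix_vector_mult_def row_add_nth axis_def sum.distrib sum_negf sum_distrib_left algebra_simps)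
    then show ?thesis by simp
  qed
  then have "ennreal \<bar>det A\<bar> * (\<integral>\<^sup>+x. h (A *v x) \<partial>lborel)
    = ennreal \<bar>det (row_add i j t A)\<bar> * (\<integral>\<^sup>+x. h (?T (row_add i j t A *v x)) \<partial>lborel)"
    using det_row_add[OF \<open>i \<noteq> j\<close>, of t A] by (simp only:)
  also have "\<dots> = (\<integral>\<^sup>+x. h (?T x) \<partial>lborel)"
    using P[unfolded preserves_volume_def, rule_format, of "\<lambda>y. h (?T y)"] by simp
  also have "\<dots> = ennreal \<bar>1\<bar> * (\<integral>\<^sup>+x. h (?T x) \<partial>lborel)" by simp
  also have "\<dots> = (\<integral>\<^sup>+x. h x \<partial>lborel)"
    by (rule nn_integral_coordinate_affine[where i = i and \<alpha> = "\<lambda>x. - t * x $ j"])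
      (use \<open>i \<noteq> j\<close> in \<open>auto simp: axis_def algebra_simps\<close>)
  finally show "ennreal \<bar>det A\<bar> * (\<integral>\<^sup>+x. h (A *v x) \<partial>lborel) = (\<integral>\<^sup>+x. h x \<partial>lborel)" .
qed

lemma preserves_volume_row_scaleI:
  assumes "t \<noteq> 0" and P: "preserves_volume (row_scale i t A)"
  shows "preserves_volume (A :: real^'d^'d::finite)"
  unfolding preserves_volume_def
proof
  fix h :: "real^'d \<Rightarrow> ennreal" assume [measurable]: "h \<in> borel_measurable borel"
  let ?T = "\<lambda>y :: real^'d. y + ((1 / t - 1) * y $ i) *\<^sub>R axis i 1"
  have "h (A *v x) = h (?T (row_scale i t A *v x))" for x
  proof -
    have "A *v x = ?T (row_scale i t A *v x)"
      using \<open>t \<noteq> 0\<close> unfolding vec_eq_iff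
      by (auto simp: matrix_vector_mult_def row_scale_nth axis_def mult.assoc sum_distrib_left[symmetric] field_simps)
    then show ?thesis by simp
  qed
  then have "ennreal \<bar>det A\<bar> * (\<integral>\<^sup>+x. h (A *v x) \<partial>lborel)
    = ennreal \<bar>1 / t\<bar> * (ennreal \<bar>det (row_scale i t A)\<bar> * (\<integral>\<^sup>+x. h (?T (row_scale i t A *v x)) \<partial>lborel))"
    using \<open>t \<noteq> 0\<close> by (simp add: det_row_scale mult.assoc[symmetric] ennreal_mult'[symmetric] abs_mult)
  also have "\<dots> = ennreal \<bar>1 / t\<bar> * (\<integral>\<^sup>+x. h (?T x) \<partial>lborel)"
    using P[unfolded preserves_volume_def, rule_format, of "\<lambda>y. h (?T y)"] by simp
  also have "\<dots> = (\<integral>\<^sup>+x. h x \<partial>lborel)"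
    by (rule nn_integral_coordinate_affine[where i = i and \<alpha> = "\<lambda>x. (1 / t - 1) * x $ i"])
      (use \<open>t \<noteq> 0\<close> in \<open>auto simp: axis_def algebra_simps\<close>)
  finally show "ennreal \<bar>det A\<bar> * (\<integral>\<^sup>+x. h (A *v x) \<partial>lborel) = (\<integral>\<^sup>+x. h x \<partial>lborel)" .
qed

text \<open>Row \<open>j\<close> is never modified, and a row not yet treated is still the row of
  \<open>A\<close>. The rows in \<open>M\<close> can therefore be treated one after another while
  the result keeps a closed form in terms of \<open>A\<close>.\<close>

lemma preserves_volume_clear_rowsI:
  fixes A :: "real^'d^'d::finite"
  assumes "finite M" "j \<notin> M"
    and "preserves_volume (\<chi> k l. if k \<in> M then A $ k $ l - A $ k $ j * A $ j $ l else A $ k $ l)"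
  shows "preserves_volume A"
  using assms
proof (induction M)
  case empty
  then show ?case by (simp add: vec_lambda_eta)
next
  case (insert i M)
  let ?A = "\<chi> k l. if k \<in> M then A $ k $ l - A $ k $ j * A $ j $ l else A $ k $ l"
  have "row_add i j (- A $ i $ j) ?A
     = (\<chi> k l. if k \<in> insert i M then A $ k $ l - A $ k $ j * A $ j $ l else A $ k $ l)"
    using insert.hyps insert.prems(1) unfolding vec_eq_iff by (auto simp: row_add_nth)
  then have "preserves_volume ?A"
    using insert.prems by (intro preserves_volume_row_addI[of i j "- A $ i $ j" ?A]) auto
  then show ?case using insert by auto
qed

lemma invertible_row_ops:
  fixes A :: "real^'d^'d::finite"
  shows "i \<noteq> j \<Longrightarrow> invertible A \<Longrightarrow> invertible (row_add i j t A)"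
    and "t \<noteq> 0 \<Longrightarrow> invertible A \<Longrightarrow> invertible (row_scale i t A)"
  by (simp_all add: invertible_det_nz det_row_add det_row_scale)

text \<open>Gauss-Jordan elimination; \<open>- K\<close> is the set of columns that are already standard. The
  library proves the transformation formula only for well-ordered index types.\<close>

lemma preserves_volume_aux:
  fixes A :: "real^'d^'d::finite"
  assumes "finite K" "invertible A" "\<And>i k. k \<notin> K \<Longrightarrow> A $ i $ k = (if i = k then 1 else 0)"
  shows "preserves_volume A"
  using assms
proof (induction K arbitrary: A)
  case empty
  then have "A = mat 1" by (simp add: vec_eq_iff mat_def)
  then show ?case by (simp add: preserves_volume_def)
next
  case (insert j K)
  \<comment> \<open>Normalize the pivot row, then clear column \<open>j\<close> in all other rows;
    this column becomes standard and the induction hypothesis applies.\<close>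
  have pivot: "preserves_volume A" if inv: "invertible A" and std: "\<And>i k. k \<notin> insert j K \<Longrightarrow> A $ i $ k = (if i = k then 1 else 0)"
    and piv: "A $ j $ j \<noteq> 0" for A
  proof (rule preserves_volume_row_scaleI[of "1 / A $ j $ j" j])
    let ?S = "row_scale j (1 / A $ j $ j) A"
    show "1 / A $ j $ j \<noteq> 0" using piv by simp
    show "preserves_volume ?S"
    proof (rule preserves_volume_clear_rowsI[of "UNIV - {j}" j])
      let ?C = "\<chi> k l. if k \<in> UNIV - {j} then ?S $ k $ l - ?S $ k $ j * ?S $ j $ l else ?S $ k $ l"
      have det_clear: "det (\<chi> k l. if k \<in> M then X $ k $ l - X $ k $ j * X $ j $ l else X $ k $ l) = det X"
        if "finite M" "j \<notin> M" for M and X :: "real^'d^'d"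
        using that
      proof (induction M)
        case empty
        then show ?case by (simp add: vec_lambda_eta)
      next
        case (insert i M)
        let ?A = "\<chi> k l. if k \<in> M then X $ k $ l - X $ k $ j * X $ j $ l else X $ k $ l"
        have "row_add i j (- X $ i $ j) ?A
           = (\<chi> k l. if k \<in> insert i M then X $ k $ l - X $ k $ j * X $ j $ l else X $ k $ l)"
          using insert.hyps insert.prems(1) unfolding vec_eq_iff by (auto simp: row_add_nth)
        moreover have "det (row_add i j (- X $ i $ j) ?A) = det ?A"
          using insert by (intro det_row_add) auto
        ultimately show ?case using insert by auto
      qed
      have "invertible ?S"
        using invertible_row_ops(2)[OF _ inv, of "1 / A $ j $ j" j] piv by simp
      then have "invertible ?C"
        unfolding invertible_det_nz by (subst det_clear) auto
      then show "preserves_volume ?C"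
        using std piv insert.hyps by (intro insert.IH) (auto simp: row_scale_nth)
    qed auto
  qed
  show ?case
  proof (cases "A $ j $ j = 0")
    case False
    then show ?thesis using insert.prems by (intro pivot)
  next
    case True
    have "\<exists>i\<in>insert j K. A $ i $ j \<noteq> 0"
    proof (rule ccontr)
      assume neg: "\<not> ?thesis"
      \<comment> \<open>If column \<open>j\<close> vanished in the rows of
        \<open>insert j K\<close>, it would be a combination of the standard columns outside
        \<open>insert j K\<close>; \<open>?z\<close> records this relation as a kernel
        vector.\<close>
      let ?z = "(\<chi> k. if k = j then 1 else if k \<in> K then 0 else - A $ k $ j) :: real^'d"
      have "(A *v ?z) $ i = 0" for i
      proof -
        have "(A *v ?z) $ i = (\<Sum>k\<in>UNIV. A $ i $ k * ?z $ k)"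
          by (simp add: matrix_vector_mult_def)
        also have "\<dots> = (\<Sum>k\<in>UNIV. (if k = j then A $ i $ j else 0) + (if k = i then (if i \<in> insert j K then 0 else - A $ i $ j) else 0))"
          using insert.prems(2) insert.hyps by (intro sum.cong) auto
        also have "\<dots> = 0"
          using neg by (simp add: sum.distrib)
        finally show ?thesis .
      qed
      then have "A *v ?z = 0" by (simp add: vec_eq_iff)
      then have "?z = 0"
        using insert.prems(1) matrix_left_invertible_ker[of A] unfolding invertible_def by blast
      then show False by (auto simp: vec_eq_iff dest: spec[of _ j])
    qed
    then obtain i where i: "i \<in> insert j K" "A $ i $ j \<noteq> 0" by blast
    with True have "i \<noteq> j" by auto
    \<comment> \<open>Adding row \<open>i\<close> to row \<open>j\<close> produces a nonzero pivot,
      and \<open>i \<in> insert j K\<close> keeps the finished columns standard.\<close>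
    then show ?thesis
      using i True insert.prems insert.hyps
      by (intro preserves_volume_row_addI[of j i 1 A] pivot invertible_row_ops) (auto simp: row_add_nth)
  qed
qed

lemma nn_integral_linear_change:
  fixes A :: "real^'d^'d::finite"
  assumes "invertible A" "h \<in> borel_measurable borel"
  shows "ennreal \<bar>det A\<bar> * (\<integral>\<^sup>+x. h (A *v x) \<partial>lborel) = (\<integral>\<^sup>+x. h x \<partial>lborel)"
  using preserves_volume_aux[of UNIV A] assms unfolding preserves_volume_def by auto

lemma integral_linear_change:
  fixes A :: "real^'d^'d::finite" and h :: "real^'d \<Rightarrow> 'b::{banach, second_countable_topology}"
  assumes inv: "invertible A" and [measurable]: "h \<in> borel_measurable borel"
  shows "\<bar>det A\<bar> *\<^sub>R (\<integral>x. h (A *v x) \<partial>lborel) = (\<integral>x. h x \<partial>lborel)"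
proof -
  have "lborel = density (distr lborel borel ((*v) A)) (\<lambda>_. ennreal \<bar>det A\<bar>)" (is "_ = ?D")
  proof (rule measure_eqI)
    fix X :: "(real^'d) set" assume "X \<in> sets lborel"
    then have [measurable]: "X \<in> sets borel" by simp
    show "emeasure lborel X = emeasure ?D X"
    proof -
      have "emeasure ?D X = (\<integral>\<^sup>+x. indicator X x \<partial>?D)" by simp
      also have "\<dots> = ennreal \<bar>det A\<bar> * (\<integral>\<^sup>+x. indicator X (A *v x) \<partial>lborel)"
        by (subst nn_integral_density) (simp_all add: nn_integral_distr nn_integral_cmult del: nn_integral_indicator)
      finally show ?thesis
        using nn_integral_linear_change[OF inv, of "indicator X"] by simp
    qed
  qed simp
  then have "(\<integral>x. h x \<partial>lborel) = (\<integral>x. h x \<partial>?D)" by simp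
  also have "\<dots> = \<bar>det A\<bar> *\<^sub>R (\<integral>x. h (A *v x) \<partial>lborel)"
    by (subst integral_density) (auto simp: integral_distr)
  finally show ?thesis ..
qed

lemma integrable_linear_change:
  fixes A :: "real^'d^'d::finite" and h :: "real^'d \<Rightarrow> 'b::{banach, second_countable_topology}"
  assumes inv: "invertible A" and int: "integrable lborel h"
  shows "integrable lborel (\<lambda>x. h (A *v x))"
proof -
  have [measurable]: "h \<in> borel_measurable borel" using int by auto
  have "ennreal \<bar>det A\<bar> * (\<integral>\<^sup>+x. ennreal (norm (h (A *v x))) \<partial>lborel) < \<infinity>"
    using int by (subst nn_integral_linear_change[OF inv]) (auto simp: integrable_iff_bounded)
  moreover have "ennreal \<bar>det A\<bar> \<noteq> 0" using inv by (simp add: invertible_det_nz)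
  ultimately show ?thesis
    by (auto simp: integrable_iff_bounded ennreal_mult_less_top)
qed

section \<open>Tiling by the integer lattice\<close>

lemma countable_int_lattice: "countable (int_lattice :: (real^'d::finite) set)"
proof -
  have "int_lattice \<subseteq> range (\<lambda>f::'d \<Rightarrow> int. (\<chi> i. of_int (f i)) :: real^'d)"
  proof
    fix m :: "real^'d" assume "m \<in> int_lattice"
    then have "\<forall>i. \<exists>n. m $ i = of_int n" by (auto simp: int_lattice_def Ints_def)
    then obtain f where "\<And>i. m $ i = of_int (f i)" by metis
    then show "m \<in> range (\<lambda>f::'d \<Rightarrow> int. (\<chi> i. of_int (f i)) :: real^'d)"
      by (intro image_eqI[of _ _ f]) (auto simp: vec_eq_iff)
  qed
  then show ?thesis using countable_subset by fast
qed

definition floor_vec :: "real^'d::finite \<Rightarrow> real^'d" where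
  "floor_vec x = (\<chi> i. of_int \<lfloor>x $ i\<rfloor>)"

text \<open>Half open, so that its integer translates partition the space exactly; it agrees with
  \<open>unit_cube\<close> up to a null set.\<close>

definition half_open_cube :: "(real^'d::finite) set" where
  "half_open_cube = {x. \<forall>i. 0 \<le> x $ i \<and> x $ i < 1}"

lemma floor_vec_in_int_lattice: "floor_vec x \<in> int_lattice"
  by (simp add: floor_vec_def int_lattice_def)

lemma half_open_cube_sub_iff:
  assumes "m \<in> int_lattice"
  shows "x - m \<in> half_open_cube \<longleftrightarrow> m = floor_vec x"
proof -
  have "\<forall>i. \<exists>n. m $ i = of_int n" using assms by (auto simp: int_lattice_def Ints_def)
  then obtain f where f: "\<And>i. m $ i = of_int (f i)" by metis
  have "0 \<le> x $ i - of_int (f i) \<and> x $ i - of_int (f i) < 1 \<longleftrightarrow> f i = \<lfloor>x $ i\<rfloor>" for i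
    by linarith
  then show ?thesis by (simp add: half_open_cube_def floor_vec_def vec_eq_iff f)
qed

lemma half_open_cube_measurable [measurable]: "half_open_cube \<in> sets borel"
  unfolding half_open_cube_def by measurable

lemma mem_unit_cube: "x \<in> unit_cube \<longleftrightarrow> (\<forall>i. 0 \<le> x $ i \<and> x $ i \<le> 1)"
  by (auto simp: mem_box_cart)

lemma AE_half_open_cube:
  "AE x in lborel. x \<in> half_open_cube \<longleftrightarrow> x \<in> (unit_cube :: (real^'d::finite) set)"
proof -
  have "negligible (cbox 0 1 - box 0 (1 :: real^'d))" by (rule negligible_frontier_interval)
  then have "AE x in lebesgue. x \<notin> cbox 0 1 - box 0 (1 :: real^'d)"
    unfolding negligible_iff_null_sets by (rule AE_not_in)
  then have "AE x in lborel. x \<notin> cbox 0 1 - box 0 (1 :: real^'d)"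
    by (simp add: AE_completion_iff)
  then show ?thesis
  proof (rule AE_mp, intro AE_I2 impI)
    fix x :: "real^'d" assume "x \<notin> cbox 0 1 - box 0 1"
    then show "x \<in> half_open_cube \<longleftrightarrow> x \<in> unit_cube"
      by (auto simp: mem_unit_cube half_open_cube_def mem_box_cart less_imp_le)
  qed
qed

lemma unit_cube_measurable [measurable]: "unit_cube \<in> sets borel" by simp

lemma nn_integral_tiling:
  fixes H :: "real^'d::finite \<Rightarrow> ennreal"
  assumes [measurable]: "H \<in> borel_measurable borel"
  shows "(\<integral>\<^sup>+x. H x \<partial>lborel) =
    (\<integral>\<^sup>+v. indicator unit_cube v * (\<integral>\<^sup>+m. H (v + m) \<partial>count_space int_lattice) \<partial>lborel)"
proof -
  have "(\<integral>\<^sup>+x. H x \<partial>lborel)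
     = (\<integral>\<^sup>+x. (\<integral>\<^sup>+m. indicator half_open_cube (x - m) * H x \<partial>count_space int_lattice) \<partial>lborel)"
  proof (rule nn_integral_cong)
    fix x :: "real^'d"
    have "(\<integral>\<^sup>+m. indicator half_open_cube (x - m) * H x \<partial>count_space int_lattice)
       = (\<integral>\<^sup>+m. H x * indicator {floor_vec x} m \<partial>count_space int_lattice)"
      by (intro nn_integral_cong) (auto simp: half_open_cube_sub_iff split: split_indicator)
    also have "\<dots> = H x"
      by (subst nn_integral_cmult_indicator) (auto simp: floor_vec_in_int_lattice one_ennreal_def[symmetric])
    finally show "H x = (\<integral>\<^sup>+m. indicator half_open_cube (x - m) * H x \<partial>count_space int_lattice)" ..
  qed
  also have "\<dots> = (\<integral>\<^sup>+m. (\<integral>\<^sup>+x. indicator half_open_cube (x - m) * H x \<partial>lborel) \<partial>count_space int_lattice)"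
    by (rule nn_integral_count_space_nn_integral[OF countable_int_lattice]) measurable
  also have "\<dots> = (\<integral>\<^sup>+m. (\<integral>\<^sup>+v. indicator half_open_cube v * H (v + m) \<partial>lborel) \<partial>count_space int_lattice)"
  proof (rule nn_integral_cong)
    fix m :: "real^'d"
    show "(\<integral>\<^sup>+x. indicator half_open_cube (x - m) * H x \<partial>lborel)
       = (\<integral>\<^sup>+v. indicator half_open_cube v * H (v + m) \<partial>lborel)"
      using nn_integral_lborel_translate[of "\<lambda>x. indicator half_open_cube (x - m) * H x" m] by simp
  qed
  also have "\<dots> = (\<integral>\<^sup>+v. (\<integral>\<^sup>+m. indicator half_open_cube v * H (v + m) \<partial>count_space int_lattice) \<partial>lborel)"
    by (rule nn_integral_count_space_nn_integral[OF countable_int_lattice, symmetric]) measurable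
  also have "\<dots> = (\<integral>\<^sup>+v. indicator unit_cube v * (\<integral>\<^sup>+m. H (v + m) \<partial>count_space int_lattice) \<partial>lborel)"
    by (rule nn_integral_cong_AE, rule AE_mp[OF AE_half_open_cube])
      (auto simp: nn_integral_cmult split: split_indicator)
  finally show ?thesis .
qed

text \<open>For the integrands in question finitely many translates, collected in \<open>F\<close>,
  carry everything that meets the cube. The lattice sum is then finite and commutes with the Bochner
  integral.\<close>

lemma integral_tiling:
  fixes H :: "real^'d::finite \<Rightarrow> 'b::{banach, second_countable_topology}"
  assumes int: "integrable lborel H" and F: "finite F" "F \<subseteq> int_lattice"
    and zero: "\<And>v m. v \<in> unit_cube \<Longrightarrow> m \<in> int_lattice - F \<Longrightarrow> H (v + m) = 0"
  shows "(\<integral>x. H x \<partial>lborel) = (\<integral>v. indicator unit_cube v *\<^sub>R (\<Sum>m\<in>F. H (v + m)) \<partial>lborel)"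
proof -
  have [measurable]: "H \<in> borel_measurable borel" using int by auto
  have sub: "half_open_cube \<subseteq> (unit_cube :: (real^'d) set)"
    by (auto simp: half_open_cube_def mem_unit_cube less_imp_le)
  have int2: "integrable lborel (\<lambda>x. indicator half_open_cube (x - m) *\<^sub>R H x)" for m
    by (rule Bochner_Integration.integrable_bound[OF int]) (auto split: split_indicator)
  have int3: "integrable lborel (\<lambda>v. indicator half_open_cube v *\<^sub>R H (v + m))" for m
  proof -
    have "distr lborel borel (\<lambda>v. v + m) = lborel"
      using lborel_distr_plus[of m] by (simp add: add.commute cong: distr_cong)
    then show ?thesis
      using int2[of m] integrable_distr_eq[of "\<lambda>v. v + m" lborel borel "\<lambda>x. indicator half_open_cube (x - m) *\<^sub>R H x"]
      by simp
  qed
  have "(\<integral>x. H x \<partial>lborel) = (\<integral>x. (\<Sum>m\<in>F. indicator half_open_cube (x - m) *\<^sub>R H x) \<partial>lborel)"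
  proof (rule Bochner_Integration.integral_cong[OF refl])
    fix x :: "real^'d"
    have "(\<Sum>m\<in>F. indicator half_open_cube (x - m) *\<^sub>R H x) = (\<Sum>m\<in>F. if m = floor_vec x then H x else 0)"
      using F half_open_cube_sub_iff[of _ x] by (intro sum.cong) (auto split: split_indicator)
    also have "\<dots> = H x"
    proof (cases "floor_vec x \<in> F")
      case False
      have "x - floor_vec x \<in> unit_cube"
        using half_open_cube_sub_iff[OF floor_vec_in_int_lattice, of x x] sub by auto
      then have "H x = 0"
        using zero[of "x - floor_vec x" "floor_vec x"] False floor_vec_in_int_lattice[of x] by simp
      then show ?thesis by (intro trans[OF sum.neutral]) auto
    qed (use F in simp)
    finally show "H x = (\<Sum>m\<in>F. indicator half_open_cube (x - m) *\<^sub>R H x)" ..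
  qed
  also have "\<dots> = (\<Sum>m\<in>F. (\<integral>x. indicator half_open_cube (x - m) *\<^sub>R H x \<partial>lborel))"
    by (rule Bochner_Integration.integral_sum) (rule int2)
  also have "\<dots> = (\<Sum>m\<in>F. (\<integral>v. indicator half_open_cube v *\<^sub>R H (v + m) \<partial>lborel))"
  proof (rule sum.cong[OF refl])
    fix m :: "real^'d"
    show "(\<integral>x. indicator half_open_cube (x - m) *\<^sub>R H x \<partial>lborel)
       = (\<integral>v. indicator half_open_cube v *\<^sub>R H (v + m) \<partial>lborel)"
      using integral_lborel_translate[of "\<lambda>x. indicator half_open_cube (x - m) *\<^sub>R H x" m] by simp
  qed
  also have "\<dots> = (\<integral>v. (\<Sum>m\<in>F. indicator half_open_cube v *\<^sub>R H (v + m)) \<partial>lborel)"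
    by (rule Bochner_Integration.integral_sum[symmetric]) (rule int3)
  also have "\<dots> = (\<integral>v. indicator unit_cube v *\<^sub>R (\<Sum>m\<in>F. H (v + m)) \<partial>lborel)"
    by (rule integral_cong_AE, measurable, rule AE_mp[OF AE_half_open_cube])
      (auto split: split_indicator)
  finally show ?thesis .
qed

lemma finite_int_lattice_bounded:
  assumes "bounded (K :: (real^'d::finite) set)"
  shows "finite (int_lattice \<inter> K)"
proof -
  obtain b where b: "\<And>x. x \<in> K \<Longrightarrow> norm x \<le> b" using assms bounded_iff by blast
  let ?f = "\<lambda>f :: 'd \<Rightarrow> int. (\<chi> i. of_int (f i)) :: real^'d"
  have "int_lattice \<inter> K \<subseteq> ?f ` (PiE UNIV (\<lambda>_. {-\<lceil>b\<rceil>..\<lceil>b\<rceil>}))"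
  proof
    fix m :: "real^'d" assume m: "m \<in> int_lattice \<inter> K"
    then have "\<forall>i. \<exists>n. m $ i = of_int n" by (auto simp: int_lattice_def Ints_def)
    then obtain f where f: "\<And>i. m $ i = of_int (f i)" by metis
    have "f i \<in> {-\<lceil>b\<rceil>..\<lceil>b\<rceil>}" for i
    proof -
      have "\<bar>m $ i\<bar> \<le> b" using b[of m] component_le_norm_cart[of m i] m by auto
      then have "\<bar>f i\<bar> \<le> \<lceil>b\<rceil>" unfolding f by linarith
      then show ?thesis by auto
    qed
    then show "m \<in> ?f ` (PiE UNIV (\<lambda>_. {-\<lceil>b\<rceil>..\<lceil>b\<rceil>}))"
      by (intro image_eqI[of _ _ f]) (auto simp: vec_eq_iff f)
  qed
  then show ?thesis by (rule finite_subset) (intro finite_imageI finite_PiE; simp)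
qed

section \<open>Slices in one coordinate\<close>

definition upd :: "real^'d::finite \<Rightarrow> 'd \<Rightarrow> real \<Rightarrow> real^'d" where
  "upd x i t = (\<chi> j. if j = i then t else x $ j)"

lemma upd_nth [simp]: "upd x i t $ j = (if j = i then t else x $ j)"
  by (simp add: upd_def)

lemma add_axis_eq_upd: "x + s *\<^sub>R axis i 1 = upd x i (x $ i + s)"
  by (simp add: vec_eq_iff axis_def)

lemma borel_measurable_vec_lambda [measurable (raw)]:
  assumes "\<And>i. (\<lambda>x. f x i) \<in> borel_measurable M"
  shows "(\<lambda>x. (\<chi> i. f x i) :: real^'d::finite) \<in> borel_measurable M"
  unfolding borel_measurable_euclidean_space[where 'c = "real^'d"]
  using assms by (auto simp: Basis_vec_def inner_axis)

lemma upd_measurable [measurable (raw)]: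
  assumes "f \<in> borel_measurable M" "g \<in> borel_measurable M"
  shows "(\<lambda>x. upd (f x) i (g x)) \<in> borel_measurable M"
  using assms unfolding upd_def by (intro borel_measurable_vec_lambda) auto

lemma nn_integral_upd_mono:
  fixes F G :: "real^'d::finite \<Rightarrow> ennreal"
  assumes [measurable]: "F \<in> borel_measurable borel" "G \<in> borel_measurable borel"
    and le: "\<And>x. (\<integral>\<^sup>+t. F (upd x i t) \<partial>lborel) \<le> (\<integral>\<^sup>+t. G (upd x i t) \<partial>lborel)"
  shows "(\<integral>\<^sup>+x. F x \<partial>lborel) \<le> (\<integral>\<^sup>+x. G x \<partial>lborel)"
proof (rule nn_integral_coordinate_mono[OF assms(1,2), where i = i])
  fix x :: "real^'d"
  have "(\<integral>\<^sup>+s. H (x + s *\<^sub>R axis i 1) \<partial>lborel) = (\<integral>\<^sup>+t. H (upd x i t) \<partial>lborel)"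
    if [measurable]: "H \<in> borel_measurable borel" for H :: "real^'d \<Rightarrow> ennreal"
    using nn_integral_lborel_translate[of "\<lambda>t. H (upd x i t)" "x $ i"]
    by (simp add: add_axis_eq_upd add.commute)
  then show "(\<integral>\<^sup>+s. F (x + s *\<^sub>R axis i 1) \<partial>lborel) \<le> (\<integral>\<^sup>+s. G (x + s *\<^sub>R axis i 1) \<partial>lborel)"
    using le[of x] by simp
qed

lemma nn_integral_upd_eq:
  fixes F G :: "real^'d::finite \<Rightarrow> ennreal"
  assumes "F \<in> borel_measurable borel" "G \<in> borel_measurable borel"
    and "\<And>x. (\<integral>\<^sup>+t. F (upd x i t) \<partial>lborel) = (\<integral>\<^sup>+t. G (upd x i t) \<partial>lborel)"
  shows "(\<integral>\<^sup>+x. F x \<partial>lborel) = (\<integral>\<^sup>+x. G x \<partial>lborel)"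
  using assms by (intro antisym nn_integral_upd_mono[where i = i]) auto


lemma prod_remove_upd:
  fixes f :: "'d::finite \<Rightarrow> real \<Rightarrow> 'b::comm_monoid_mult"
  shows "(\<Prod>j\<in>UNIV. f j (upd x i t $ j)) = f i t * (\<Prod>j\<in>UNIV - {i}. f j (x $ j))"
  by (subst prod.remove[of _ i]) (auto intro!: prod.cong)

lemma prod_indicator_unit_cube:
  "(\<Prod>j\<in>UNIV. indicator {0..1} (x $ j)) = (indicator unit_cube x :: 'b::comm_semiring_1)"
proof (cases "x \<in> unit_cube")
  case False
  then obtain j where "x $ j \<notin> {0..1}" by (auto simp: mem_unit_cube)
  then have "(\<Prod>j\<in>UNIV. indicator {0..1} (x $ j)) = (0 :: 'b)"
    by (intro prod_zero bexI[of _ j]) auto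
  then show ?thesis using False by simp
qed (auto simp: mem_unit_cube)

subsection \<open>The transition function\<close>

lemma deriv_funpow_const_on_open:
  fixes f :: "real \<Rightarrow> real"
  assumes "open S" "\<And>x. x \<in> S \<Longrightarrow> f x = c" "x \<in> S"
  shows "(deriv ^^ Suc k) f x = 0"
  using assms(3)
proof (induction k arbitrary: x)
  case 0
  have "(f has_field_derivative 0) (at x)"
    by (rule has_field_derivative_transform_within_open[of "\<lambda>_. c" _ x S]) (use assms 0 in auto)
  then show ?case by (simp add: DERIV_imp_deriv)
next
  case (Suc k)
  have "((deriv ^^ Suc k) f has_field_derivative 0) (at x)"
    by (rule has_field_derivative_transform_within_open[of "\<lambda>_. 0" _ x S])
      (use assms(1) Suc in \<open>auto simp del: funpow.simps\<close>)
  then show ?case by (simp add: DERIV_imp_deriv)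
qed

context
  fixes \<psi> :: "real \<Rightarrow> real"
  assumes adm: "admissible_psi \<psi>"
begin

lemma psi_funpow_deriv:
  "((deriv ^^ k) \<psi> has_real_derivative (deriv ^^ Suc k) \<psi> x) (at x)"
  using adm DERIV_deriv_iff_real_differentiable[of "(deriv ^^ k) \<psi>" x]
  by (simp add: admissible_psi_def smooth_real_on_def)

lemma psi_deriv: "(\<psi> has_real_derivative deriv \<psi> x) (at x)"
  using psi_funpow_deriv[of 0 x] by simp

lemma psi_funpow_cont: "continuous_on A ((deriv ^^ k) \<psi>)"
  by (intro continuous_at_imp_continuous_on ballI DERIV_isCont[OF psi_funpow_deriv])

lemma psi_cont: "continuous_on A \<psi>"
  using psi_funpow_cont[of A 0] by simp

lemma psi_deriv_cont: "continuous_on A (deriv \<psi>)"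
  using psi_funpow_cont[of A 1] by simp

text \<open>Admissibility speaks only of \<open>x < 0\<close>; continuity carries the value to the
  endpoint.\<close>

lemma psi_le_0: "x \<le> 0 \<Longrightarrow> \<psi> x = 0"
proof -
  have "closure {..<0} \<subseteq> {x. \<psi> x = 0}"
    using adm by (intro closure_minimal closed_Collect_eq psi_cont continuous_intros)
      (auto simp: admissible_psi_def)
  then show "x \<le> 0 \<Longrightarrow> \<psi> x = 0" by auto
qed

lemma psi_ge_1: "1 \<le> x \<Longrightarrow> \<psi> x = 1"
proof -
  have "closure {1<..} \<subseteq> {x. \<psi> x = 1}"
    using adm by (intro closure_minimal closed_Collect_eq psi_cont continuous_intros)
      (auto simp: admissible_psi_def)
  then show "1 \<le> x \<Longrightarrow> \<psi> x = 1" by auto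
qed

lemma psi_funpow_outside:
  assumes "x \<le> 0 \<or> 1 \<le> x"
  shows "(deriv ^^ Suc k) \<psi> x = 0"
proof -
  let ?Z = "{x. (deriv ^^ Suc k) \<psi> x = 0}"
  have "closed ?Z"
    by (intro closed_Collect_eq psi_funpow_cont continuous_intros)
  moreover have "{..<0} \<subseteq> ?Z" "{1<..} \<subseteq> ?Z"
    using deriv_funpow_const_on_open[of "{..<0}" \<psi> 0 _ k] deriv_funpow_const_on_open[of "{1<..}" \<psi> 1 _ k] adm
    by (auto simp: admissible_psi_def simp del: funpow.simps)
  ultimately have "closure {..<0} \<subseteq> ?Z" "closure {1<..} \<subseteq> ?Z"
    by (simp_all only: closure_minimal)
  then show ?thesis using assms by auto
qed

lemma psi_deriv_outside: "x \<le> 0 \<or> 1 \<le> x \<Longrightarrow> deriv \<psi> x = 0"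
  using psi_funpow_outside[of x 0] by simp

lemma psi_in_open: "0 < x \<Longrightarrow> x < 1 \<Longrightarrow> 0 < \<psi> x \<and> \<psi> x < 1"
  using adm by (auto simp: admissible_psi_def diffeo_on_def bij_betw_def)

lemma psi_range: "0 \<le> \<psi> x \<and> \<psi> x \<le> 1"
  using psi_le_0[of x] psi_ge_1[of x] psi_in_open[of x] by (cases "x \<le> 0"; cases "1 \<le> x") auto

text \<open>The diffeomorphism hypothesis gives injectivity on the open interval. A continuous
  injection is monotone, and \<open>\<psi> 0 = 0\<close> lying below all other values fixes the
  direction. As a consequence \<open>deriv \<psi>\<close> is nonnegative and can serve as a Jacobian
  without absolute values.\<close>

lemma psi_mono: "x \<le> y \<Longrightarrow> \<psi> x \<le> \<psi> y"
proof (cases "x = y \<or> x \<le> 0 \<or> 1 \<le> y")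
  case True
  then show "x \<le> y \<Longrightarrow> \<psi> x \<le> \<psi> y"
    using psi_range[of y] psi_range[of x] psi_le_0[of x] psi_ge_1[of y] by auto
next
  case False
  assume "x \<le> y"
  with False have xy: "0 < x" "x < y" "y < 1" by auto
  have "inj_on \<psi> {0<..<1}"
    using adm by (auto simp: admissible_psi_def diffeo_on_def bij_betw_def)
  then have "inj_on \<psi> {0..y}"
  proof -
    assume inj: "inj_on \<psi> {0<..<1}"
    show ?thesis
    proof (rule inj_onI)
      fix a b assume ab: "a \<in> {0..y}" "b \<in> {0..y}" "\<psi> a = \<psi> b"
      have "a = 0 \<longleftrightarrow> b = 0"
        using ab psi_le_0[of 0] psi_in_open[of a] psi_in_open[of b] xy by force
      then show "a = b"
        using ab xy inj_onD[OF inj, of a b] by force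
    qed
  qed
  then have "(\<psi> 0 < \<psi> x \<and> \<psi> x < \<psi> y) \<or> (\<psi> y < \<psi> x \<and> \<psi> x < \<psi> 0)"
    using xy by (intro continuous_inj_imp_mono psi_cont) auto
  then show "\<psi> x \<le> \<psi> y" using psi_le_0[of 0] psi_range[of x] by auto
qed

lemma psi_deriv_nonneg: "0 \<le> deriv \<psi> x"
  by (rule mono_on_imp_deriv_nonneg[of UNIV \<psi>]) (auto intro!: mono_onI psi_mono psi_deriv)

lemma psi_measurable: "\<psi> \<in> borel_measurable borel"
  by (intro borel_measurable_continuous_onI psi_cont)

lemma psi_deriv_measurable: "deriv \<psi> \<in> borel_measurable borel"
  by (intro borel_measurable_continuous_onI psi_deriv_cont)

lemma nn_integral_psi:
  fixes f :: "real \<Rightarrow> ennreal"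
  assumes "f \<in> borel_measurable borel"
  shows "(\<integral>\<^sup>+t. f (\<psi> t) * ennreal (deriv \<psi> t) \<partial>lborel) = (\<integral>\<^sup>+t. f t * indicator {0..1} t \<partial>lborel)"
proof -
  have "(\<integral>\<^sup>+t. f t * indicator {0..1} t \<partial>lborel) = (\<integral>\<^sup>+t. f t * indicator {\<psi> 0..\<psi> 1} t \<partial>lborel)"
    using psi_le_0[of 0] psi_ge_1[of 1] by simp
  also have "\<dots> = (\<integral>\<^sup>+t. f (\<psi> t) * ennreal (deriv \<psi> t) * indicator {0..1} t \<partial>lborel)"
    using assms psi_deriv psi_deriv_cont psi_deriv_nonneg by (intro nn_integral_substitution_aux) auto
  also have "\<dots> = (\<integral>\<^sup>+t. f (\<psi> t) * ennreal (deriv \<psi> t) \<partial>lborel)"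
    using psi_deriv_outside by (intro nn_integral_cong) (auto split: split_indicator)
  finally show ?thesis ..
qed

text \<open>Interpolates between the identity for \<open>K = {}\<close> and
  \<open>Psi \<psi>\<close> for \<open>K = UNIV\<close>, so that the change of variables, and later
  the \<open>L\<^sup>2\<close> bounds, can be proved one coordinate at a time by induction on
  \<open>K\<close>.\<close>

definition partial_Psi :: "'d set \<Rightarrow> real^'d::finite \<Rightarrow> real^'d" where
  "partial_Psi K x = (\<chi> i. if i \<in> K then \<psi> (x $ i) else x $ i)"

lemma partial_Psi_measurable:
  assumes "f \<in> borel_measurable M"
  shows "(\<lambda>x. partial_Psi K (f x)) \<in> borel_measurable M"
proof -
  note [measurable] = psi_measurable assms
  have "(\<lambda>x. if i \<in> K then \<psi> (f x $ i) else f x $ i) \<in> borel_measurable M" for i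
    by (cases "i \<in> K") simp_all
  then show ?thesis unfolding partial_Psi_def by (rule borel_measurable_vec_lambda)
qed

lemma partial_Psi_upd:
  "partial_Psi K (upd x i t) = upd (partial_Psi K x) i (if i \<in> K then \<psi> t else t)"
  by (simp add: partial_Psi_def vec_eq_iff)

text \<open>In the induction step, substitution in the new coordinate exchanges its cutoff
  \<open>indicator {0..1}\<close> for the weight \<open>deriv \<psi>\<close>, while all other
  coordinates are frozen.\<close>

lemma nn_integral_partial_Psi:
  fixes F :: "real^'d::finite \<Rightarrow> ennreal"
  assumes [measurable]: "F \<in> borel_measurable borel" and "finite K"
  shows "(\<integral>\<^sup>+x. F (partial_Psi K x) * (\<Prod>j\<in>UNIV. if j \<in> K then ennreal (deriv \<psi> (x $ j)) else indicator {0..1} (x $ j)) \<partial>lborel)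
    = (\<integral>\<^sup>+x. F x * (\<Prod>j\<in>UNIV. indicator {0..1} (x $ j)) \<partial>lborel)"
  using \<open>finite K\<close>
proof (induction K)
  case empty
  then show ?case by (simp add: partial_Psi_def vec_lambda_eta)
next
  case (insert i K)
  note [measurable] = psi_measurable psi_deriv_measurable partial_Psi_measurable
  let ?w = "\<lambda>K j t. if j \<in> K then ennreal (deriv \<psi> t) else indicator {0..1} t"
  have "(\<integral>\<^sup>+x. F (partial_Psi (insert i K) x) * (\<Prod>j\<in>UNIV. ?w (insert i K) j (x $ j)) \<partial>lborel)
    = (\<integral>\<^sup>+x. F (partial_Psi K x) * (\<Prod>j\<in>UNIV. ?w K j (x $ j)) \<partial>lborel)"
  proof (rule nn_integral_upd_eq[where i = i])
    fix x :: "real^'d"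
    define W where "W = (\<Prod>j\<in>UNIV - {i}. ?w K j (x $ j))"
    have W: "(\<Prod>j\<in>UNIV - {i}. ?w (insert i K) j (x $ j)) = W"
      unfolding W_def by (intro prod.cong) auto
    have ins: "partial_Psi (insert i K) (upd x i t) = upd (partial_Psi K x) i (\<psi> t)" for t
      unfolding partial_Psi_upd by (simp add: vec_eq_iff partial_Psi_def)
    have "(\<integral>\<^sup>+t. F (partial_Psi (insert i K) (upd x i t)) * (\<Prod>j\<in>UNIV. ?w (insert i K) j (upd x i t $ j)) \<partial>lborel)
      = (\<integral>\<^sup>+t. (F (upd (partial_Psi K x) i (\<psi> t)) * W) * ennreal (deriv \<psi> t) \<partial>lborel)"
      unfolding prod_remove_upd[where f = "?w (insert i K)"] W ins
      by (intro nn_integral_cong) (simp add: mult_ac)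
    also have "\<dots> = (\<integral>\<^sup>+t. (F (upd (partial_Psi K x) i t) * W) * indicator {0..1} t \<partial>lborel)"
      by (rule nn_integral_psi) measurable
    also have "\<dots> = (\<integral>\<^sup>+t. F (partial_Psi K (upd x i t)) * (\<Prod>j\<in>UNIV. ?w K j (upd x i t $ j)) \<partial>lborel)"
      unfolding prod_remove_upd[where f = "?w K"] W_def[symmetric] partial_Psi_upd
      using insert.hyps by (intro nn_integral_cong) (simp add: mult_ac)
    finally show "(\<integral>\<^sup>+t. F (partial_Psi (insert i K) (upd x i t)) * (\<Prod>j\<in>UNIV. ?w (insert i K) j (upd x i t $ j)) \<partial>lborel)
      = (\<integral>\<^sup>+t. F (partial_Psi K (upd x i t)) * (\<Prod>j\<in>UNIV. ?w K j (upd x i t $ j)) \<partial>lborel)" .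
  qed measurable
  with insert.IH show ?case by simp
qed

lemma nn_integral_Psi:
  fixes F :: "real^'d::finite \<Rightarrow> ennreal"
  assumes "F \<in> borel_measurable borel"
  shows "(\<integral>\<^sup>+x. F (Psi \<psi> x) * ennreal (DPsi \<psi> x) \<partial>lborel) = (\<integral>\<^sup>+x. F x * indicator unit_cube x \<partial>lborel)"
  using nn_integral_partial_Psi[OF assms, of UNIV] psi_deriv_nonneg
  by (simp add: partial_Psi_def Psi_def DPsi_def prod_ennreal prod_indicator_unit_cube)

lemma Psi_in_cube: "Psi \<psi> x \<in> unit_cube"
  using psi_range by (simp add: mem_unit_cube Psi_def)

lemma DPsi_nonneg: "0 \<le> DPsi \<psi> x"
  unfolding DPsi_def by (intro prod_nonneg psi_deriv_nonneg ballI)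

lemma DPsi_outside: "x \<notin> unit_cube \<Longrightarrow> DPsi \<psi> x = 0"
proof -
  assume "x \<notin> unit_cube"
  then obtain i where "x $ i < 0 \<or> 1 < x $ i" by (auto simp: mem_unit_cube not_le)
  then have "x $ i \<le> 0 \<or> 1 \<le> x $ i" by auto
  then show ?thesis
    unfolding DPsi_def by (intro prod_zero bexI[of _ i] psi_deriv_outside) auto
qed

lemma Psi_cont: "continuous_on A (Psi \<psi> :: real^'d::finite \<Rightarrow> _)"
  unfolding Psi_def by (intro continuous_intros continuous_on_compose2[OF psi_cont[of UNIV]]) auto

lemma DPsi_cont: "continuous_on A (DPsi \<psi> :: real^'d::finite \<Rightarrow> _)"
  unfolding DPsi_def by (intro continuous_intros continuous_on_compose2[OF psi_deriv_cont[of UNIV]]) auto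

lemma Psi_measurable: "(Psi \<psi> :: real^'d::finite \<Rightarrow> _) \<in> borel_measurable borel"
  by (intro borel_measurable_continuous_onI Psi_cont)

lemma DPsi_measurable: "(DPsi \<psi> :: real^'d::finite \<Rightarrow> _) \<in> borel_measurable borel"
  by (intro borel_measurable_continuous_onI DPsi_cont)

end

subsection \<open>Fourier series on the unit cube\<close>

text \<open>The frequency is any real vector: Fourier series use lattice frequencies, but the
  coefficients of the error are transforms at the points \<open>S *v k\<close>.\<close>

definition chr :: "real^'d::finite \<Rightarrow> real^'d \<Rightarrow> complex" where
  "chr k x = cis (2 * pi * (k \<bullet> x))"

lemma chr_add_left: "chr (k + l) x = chr k x * chr l x"
  by (simp add: chr_def cis_mult inner_add_left algebra_simps)

lemma chr_add_right: "chr k (x + y) = chr k x * chr k y"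
  by (simp add: chr_def cis_mult inner_add_right algebra_simps)

lemma chr_0 [simp]: "chr 0 x = 1" "chr k 0 = 1"
  by (simp_all add: chr_def)

lemma norm_chr [simp]: "norm (chr k x) = 1"
  by (simp add: chr_def)

lemma cnj_chr: "cnj (chr k x) = chr (- k) x"
  by (simp add: chr_def cis_cnj)

lemma chr_cont [continuous_intros]:
  "continuous_on A f \<Longrightarrow> continuous_on A g \<Longrightarrow> continuous_on A (\<lambda>x. chr (f x) (g x))"
  unfolding chr_def cis_conv_exp by (intro continuous_intros)

lemma chr_measurable [measurable (raw)]:
  assumes "f \<in> borel_measurable M" "g \<in> borel_measurable M"
  shows "(\<lambda>x. chr (f x) (g x)) \<in> borel_measurable M"
  unfolding chr_def
  by (rule measurable_compose[of "\<lambda>x. 2 * pi * (f x \<bullet> g x)" M borel cis borel])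
    (use assms in \<open>auto intro!: borel_measurable_continuous_onI continuous_intros simp: cis_conv_exp[abs_def]\<close>)

lemma chr_int: "k \<in> int_lattice \<Longrightarrow> m \<in> int_lattice \<Longrightarrow> chr k m = 1"
  unfolding chr_def inner_vec_def by (intro cis_multiple_2pi) (auto simp: int_lattice_def)

lemma int_lattice_closed:
  "0 \<in> int_lattice" "k \<in> int_lattice \<Longrightarrow> l \<in> int_lattice \<Longrightarrow> k + l \<in> int_lattice"
  "k \<in> int_lattice \<Longrightarrow> l \<in> int_lattice \<Longrightarrow> k - l \<in> int_lattice"
  "k \<in> int_lattice \<Longrightarrow> - k \<in> int_lattice" "axis i 1 \<in> int_lattice"
  by (auto simp: int_lattice_def axis_def)

lemma set_integrable_cube:
  fixes f :: "real^'d::finite \<Rightarrow> 'b::euclidean_space"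
  shows "continuous_on unit_cube f \<Longrightarrow> set_integrable lborel unit_cube f"
  unfolding set_integrable_def by (rule borel_integrable_compact) auto

lemma measure_unit_cube: "measure lborel (unit_cube :: (real^'d::finite) set) = 1"
proof -
  have "(0 :: real^'d) \<in> cbox 0 1" by (simp add: mem_box_cart)
  then have "cbox 0 (1 :: real^'d) \<noteq> {}" by blast
  from content_cbox_cart[OF this] show ?thesis by simp
qed

lemma emeasure_unit_cube: "emeasure lborel (unit_cube :: (real^'d::finite) set) = 1"
proof -
  have "emeasure lborel (unit_cube :: (real^'d) set) \<noteq> \<infinity>"
    using emeasure_lborel_cbox_finite[of 0 "1 :: real^'d"] by (rule less_imp_neq)
  then have "emeasure lborel (unit_cube :: (real^'d) set) = ennreal (measure lborel (unit_cube :: (real^'d) set))"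
    by (intro emeasure_eq_ennreal_measure) simp
  then show ?thesis by (simp only: measure_unit_cube ennreal_1)
qed

lemma integral_upd_zero:
  fixes F :: "real^'d::finite \<Rightarrow> 'b::{banach, second_countable_topology}"
  assumes int: "integrable lborel F"
    and zero: "\<And>x. (\<integral>t. F (upd x i t) \<partial>lborel) = 0"
  shows "(\<integral>x. F x \<partial>lborel) = 0"
proof (rule integral_coordinate_zero[OF int, of i])
  fix x :: "real^'d"
  have [measurable]: "F \<in> borel_measurable borel" using int by auto
  show "(\<integral>s. F (x + s *\<^sub>R axis i 1) \<partial>lborel) = 0"
    using integral_lborel_translate[of "\<lambda>t. F (upd x i t)" "x $ i"] zero[of x]
    by (simp add: add_axis_eq_upd add.commute)
qed

lemma indicator_cube_upd:
  "indicator unit_cube (upd x i t) = indicator unit_cube (upd x i 0) * (indicator {0..1} t :: real)"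
  by (auto simp: indicator_def mem_unit_cube)

lemma chr_upd: "chr k (upd x i t) = chr k (upd x i 0) * cis (2 * pi * (k $ i) * t)"
proof -
  have "upd x i t = upd x i 0 + t *\<^sub>R axis i 1" by (simp add: vec_eq_iff axis_def)
  then show ?thesis by (simp add: chr_add_right chr_def[of k "t *\<^sub>R axis i 1"] inner_axis algebra_simps)
qed

lemma integral_cis_int:
  assumes "n \<in> \<int>" "n \<noteq> 0"
  shows "(\<integral>t. indicator {0..1} t *\<^sub>R cis (2 * pi * n * t) \<partial>lborel) = 0"
proof -
  let ?F = "\<lambda>t. cis (2 * pi * n * t) / (2 * pi * n * \<i>)"
  have "(\<integral>t. indicator {0..1} t *\<^sub>R cis (2 * pi * n * t) \<partial>lborel) = ?F 1 - ?F 0"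
  proof (rule integral_FTC_atLeastAtMost)
    fix t :: real
    have "((\<lambda>t. cis (2 * pi * n * t)) has_vector_derivative (2 * pi * n) *\<^sub>R (\<i> * cis (2 * pi * n * t))) (at t within {0..1})"
      unfolding cis_conv_exp
      by (rule has_vector_derivative_eq_rhs, rule field_vector_diff_chain_within[of _ "2 * pi * n * \<i>", unfolded o_def])
        (auto intro!: derivative_eq_intros simp: scaleR_conv_of_real)
    then have "(?F has_vector_derivative (2 * pi * n) *\<^sub>R (\<i> * cis (2 * pi * n * t)) / (2 * pi * n * \<i>)) (at t within {0..1})"
      by (rule has_vector_derivative_divide)
    then show "(?F has_vector_derivative cis (2 * pi * n * t)) (at t within {0..1})"
      using assms by (simp add: scaleR_conv_of_real)
  qed (auto intro!: continuous_intros simp: cis_conv_exp)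
  also have "?F 1 = ?F 0" using cis_multiple_2pi[OF assms(1)] by simp
  finally show ?thesis by simp
qed

lemma integral_chr:
  assumes k: "k \<in> int_lattice"
  shows "(LINT x:unit_cube|lborel. chr k (x :: real^'d::finite)) = (if k = 0 then 1 else 0)"
proof (cases "k = 0")
  case True
  have "integrable lborel (indicator (unit_cube :: (real^'d) set) :: _ \<Rightarrow> real)"
    by (rule integrable_real_indicator) (use emeasure_lborel_cbox_finite[of 0 "1 :: real^'d"] in auto)
  then have "(LINT x:(unit_cube :: (real^'d) set)|lborel. 1 :: complex) = measure lborel (unit_cube :: (real^'d) set) *\<^sub>R 1"
    unfolding set_lebesgue_integral_def by (subst integral_scaleR_left) auto
  then have "(LINT x:(unit_cube :: (real^'d) set)|lborel. 1 :: complex) = 1"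
    by (simp only: measure_unit_cube scaleR_one)
  then show ?thesis unfolding True chr_0 by (simp only: refl if_True)
next
  case False
  then obtain i where i: "k $ i \<noteq> 0" by (auto simp: vec_eq_iff)
  have int: "integrable lborel (\<lambda>x. indicator unit_cube x *\<^sub>R chr k x)"
    by (rule borel_integrable_compact) (auto intro!: continuous_intros)
  have "(\<integral>x. indicator unit_cube x *\<^sub>R chr k x \<partial>lborel) = 0"
  proof (rule integral_upd_zero[OF int, of i])
    fix x :: "real^'d"
    have "(\<integral>t. indicator unit_cube (upd x i t) *\<^sub>R chr k (upd x i t) \<partial>lborel)
      = (\<integral>t. (indicator unit_cube (upd x i 0) *\<^sub>R chr k (upd x i 0)) * (indicator {0..1} t *\<^sub>R cis (2 * pi * (k $ i) * t)) \<partial>lborel)"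
    proof (rule Bochner_Integration.integral_cong[OF refl])
      fix t :: real
      show "indicator unit_cube (upd x i t) *\<^sub>R chr k (upd x i t)
        = (indicator unit_cube (upd x i 0) *\<^sub>R chr k (upd x i 0)) * (indicator {0..1} t *\<^sub>R cis (2 * pi * (k $ i) * t))"
        by (subst indicator_cube_upd, subst chr_upd) (simp add: scaleR_conv_of_real mult_ac)
    qed
    also have "\<dots> = (indicator unit_cube (upd x i 0) *\<^sub>R chr k (upd x i 0)) * (\<integral>t. indicator {0..1} t *\<^sub>R cis (2 * pi * (k $ i) * t) \<partial>lborel)"
      by (rule Bochner_Integration.integral_mult_right_zero)
    also have "\<dots> = 0"
      using integral_cis_int[OF _ i] k by (simp add: int_lattice_def)
    finally show "(\<integral>t. indicator unit_cube (upd x i t) *\<^sub>R chr k (upd x i t) \<partial>lborel) = 0" .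
  qed
  then show ?thesis using False by (simp add: set_lebesgue_integral_def)
qed

text \<open>At a lattice frequency this is a Fourier coefficient on the torus; at an arbitrary real
  frequency it is the Fourier transform of a function supported in the cube. The link between both
  readings is the core of the error analysis.\<close>

definition fourier_coeff :: "(real^'d::finite \<Rightarrow> complex) \<Rightarrow> real^'d \<Rightarrow> complex" where
  "fourier_coeff h k = (LINT x:unit_cube|lborel. h x * chr (- k) x)"

lemma integral_trig_poly_sq:
  fixes c :: "real^'d::finite \<Rightarrow> complex"
  assumes F: "finite F" "F \<subseteq> int_lattice"
  shows "(LINT x:unit_cube|lborel. (\<Sum>k\<in>F. c k * chr k x) * cnj (\<Sum>k\<in>F. c k * chr k x))
    = of_real (\<Sum>k\<in>F. (norm (c k))\<^sup>2)"
proof -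
  have "(LINT x:unit_cube|lborel. (\<Sum>k\<in>F. c k * chr k x) * cnj (\<Sum>k\<in>F. c k * chr k x))
    = (LINT x:unit_cube|lborel. (\<Sum>k\<in>F. \<Sum>l\<in>F. c k * cnj (c l) * chr (k - l) x))"
    by (simp add: sum_product cnj_chr mult_ac chr_add_left[of _ "- _", simplified])
  also have "\<dots> = (\<Sum>k\<in>F. \<Sum>l\<in>F. c k * cnj (c l) * (LINT x:unit_cube|lborel. chr (k - l) x))"
    unfolding set_lebesgue_integral_def
    by (subst scaleR_sum_right, subst Bochner_Integration.integral_sum)
      (auto intro!: sum.cong borel_integrable_compact[unfolded] continuous_intros
        simp: scaleR_sum_right Bochner_Integration.integral_sum borel_integrable_compact continuous_intros
          simp flip: mult_scaleR_right)
  also have "\<dots> = (\<Sum>k\<in>F. \<Sum>l\<in>F. if k = l then c k * cnj (c k) else 0)"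
    using F by (intro sum.cong refl) (auto simp: integral_chr int_lattice_closed subset_iff)
  also have "\<dots> = (\<Sum>k\<in>F. c k * cnj (c k))" using F by simp
  also have "\<dots> = of_real (\<Sum>k\<in>F. (norm (c k))\<^sup>2)"
    by (simp only: of_real_sum complex_norm_square)
  finally show ?thesis .
qed

text \<open>Expansion of the nonnegative integral of \<open>|h - P|\<^sup>2\<close> for the partial
  Fourier sum \<open>P\<close>: both cross terms and the integral of \<open>|P|\<^sup>2\<close>
  equal the same number \<open>S\<close>.\<close>

lemma bessel:
  fixes h :: "real^'d::finite \<Rightarrow> complex"
  assumes h: "continuous_on unit_cube h" and F: "finite F" "F \<subseteq> int_lattice"
  shows "(\<Sum>k\<in>F. (norm (fourier_coeff h k))\<^sup>2) \<le> (LINT x:unit_cube|lborel. (norm (h x))\<^sup>2)"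
proof -
  define c where "c = fourier_coeff h"
  define P where "P x = (\<Sum>k\<in>F. c k * chr k x)" for x
  define S where "S = (\<Sum>k\<in>F. (norm (c k))\<^sup>2)"
  have P: "continuous_on unit_cube P" unfolding P_def by (intro continuous_intros)
  note I = set_integrable_cube[OF continuous_on_mult] continuous_on_cnj h P
  have PP: "(LINT x:unit_cube|lborel. P x * cnj (P x)) = of_real S"
    unfolding P_def S_def by (rule integral_trig_poly_sq[OF F])
  have hP: "(LINT x:unit_cube|lborel. h x * cnj (P x)) = of_real S"
  proof -
    have "(LINT x:unit_cube|lborel. h x * cnj (P x)) = (LINT x:unit_cube|lborel. (\<Sum>k\<in>F. cnj (c k) * (h x * chr (- k) x)))"
      by (simp add: P_def cnj_chr sum_distrib_left mult_ac)
    also have "\<dots> = (\<Sum>k\<in>F. (LINT x:unit_cube|lborel. cnj (c k) * (h x * chr (- k) x)))"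
      unfolding set_lebesgue_integral_def scaleR_sum_right
      by (rule Bochner_Integration.integral_sum)
        (intro borel_integrable_compact compact_cbox continuous_intros h)
    also have "\<dots> = (\<Sum>k\<in>F. cnj (c k) * c k)" by (simp add: c_def fourier_coeff_def)
    finally show ?thesis by (simp only: S_def of_real_sum complex_norm_square mult.commute[of "cnj _"])
  qed
  have Ph: "(LINT x:unit_cube|lborel. P x * cnj (h x)) = of_real S"
  proof -
    have "(LINT x:unit_cube|lborel. P x * cnj (h x)) = (LINT x:unit_cube|lborel. cnj (h x * cnj (P x)))"
      by (simp add: mult.commute)
    also have "\<dots> = cnj (LINT x:unit_cube|lborel. h x * cnj (P x))"
      unfolding set_lebesgue_integral_def
      by (subst Bochner_Integration.integral_cnj[symmetric]) (simp add: scaleR_conv_of_real del: Bochner_Integration.integral_cnj)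
    finally show ?thesis by (simp add: hP)
  qed
  have sq: "(LINT x:unit_cube|lborel. of_real ((norm (f x))\<^sup>2)) = complex_of_real (LINT x:unit_cube|lborel. (norm (f x))\<^sup>2)"
    if "continuous_on unit_cube f" for f :: "real^'d \<Rightarrow> complex"
    using set_integrable_cube[of "\<lambda>x. (norm (f x))\<^sup>2"] that
    unfolding set_integrable_def set_lebesgue_integral_def
    by (subst Bochner_Integration.integral_of_real[symmetric])
      (auto simp: scaleR_conv_of_real continuous_intros simp del: Bochner_Integration.integral_of_real)
  have "complex_of_real (LINT x:unit_cube|lborel. (norm (h x - P x))\<^sup>2)
    = (LINT x:unit_cube|lborel. (h x * cnj (h x) - h x * cnj (P x)) - (P x * cnj (h x) - P x * cnj (P x)))"
    unfolding sq[OF continuous_on_diff[OF h P], symmetric] complex_norm_square by (simp add: algebra_simps)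
  also have "\<dots> = (LINT x:unit_cube|lborel. h x * cnj (h x)) - (LINT x:unit_cube|lborel. h x * cnj (P x))
      - ((LINT x:unit_cube|lborel. P x * cnj (h x)) - (LINT x:unit_cube|lborel. P x * cnj (P x)))"
    by (subst set_integral_diff(2), (intro set_integral_diff(1) set_integrable_cube continuous_intros h P)+)
      (simp add: set_integral_diff(2) set_integrable_cube continuous_intros h P)
  also have "\<dots> = of_real ((LINT x:unit_cube|lborel. (norm (h x))\<^sup>2) - S)"
    unfolding hP Ph PP of_real_diff sq[OF h, symmetric] complex_norm_square by (simp only: diff_self diff_zero)
  finally have "(LINT x:unit_cube|lborel. (norm (h x - P x))\<^sup>2) = (LINT x:unit_cube|lborel. (norm (h x))\<^sup>2) - S"
    unfolding of_real_eq_iff .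
  moreover have "0 \<le> (LINT x:unit_cube|lborel. (norm (h x - P x))\<^sup>2)"
    unfolding set_lebesgue_integral_def by (intro Bochner_Integration.integral_nonneg) auto
  ultimately show ?thesis by (simp add: S_def c_def)
qed

text \<open>Vanishing coefficients make \<open>H\<close> orthogonal to every trigonometric
  polynomial, in particular to the powers \<open>K N\<close> of a nonnegative kernel that equals one
  at \<open>v\<close> and is smaller elsewhere in the cube. If \<open>Re (H v)\<close> were
  positive, the contribution near \<open>v\<close> would be at least a multiple of
  \<open>q1 ^ N\<close>, the rest at most a multiple of \<open>q2 ^ N\<close> with
  \<open>q2 < q1\<close>, and for large \<open>N\<close> the integral could not be zero. The kernel
  is one-periodic and would peak at an opposite face as well, which is why \<open>v\<close> is taken
  in the interior.\<close>

lemma continuous_zero_Fourier_aux: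
  fixes H :: "real^'d::finite \<Rightarrow> complex"
  assumes H: "continuous_on unit_cube H" and zero: "\<And>k. k \<in> int_lattice \<Longrightarrow> fourier_coeff H k = 0"
    and v: "v \<in> box 0 1"
  shows "Re (H v) \<le> 0"
proof (rule ccontr)
  define D where "D = CARD('d)"
  define \<phi> where "\<phi> t = (1 + cos (2 * pi * t)) / 2" for t :: real
  \<comment> \<open>Orthogonality is demanded after multiplication by every character, because
    multiplication by \<open>\<phi>\<close> shifts frequencies by \<open>axis j 1\<close> in both
    directions.\<close>
  define annihilated where "annihilated P \<longleftrightarrow> continuous_on unit_cube P \<and>
      (\<forall>k\<in>int_lattice. (LINT x:unit_cube|lborel. H x * chr k x * complex_of_real (P x)) = 0)" for P :: "real^'d \<Rightarrow> real"
  have \<phi>_chr: "chr k x * complex_of_real (\<phi> (x $ j - v $ j))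
     = chr k x / 2 + (cis (- 2 * pi * v $ j) / 4 * chr (k + axis j 1) x + cis (2 * pi * v $ j) / 4 * chr (k - axis j 1) x)" for k x j
  proof -
    let ?t = "2 * pi * (x $ j - v $ j)"
    have "complex_of_real (\<phi> (x $ j - v $ j)) = 1 / 2 + (cis ?t + cis (- ?t)) / 4"
      by (simp add: \<phi>_def complex_eq_iff)
    moreover have "cis ?t = cis (- 2 * pi * v $ j) * chr (axis j 1) x"
      "cis (- ?t) = cis (2 * pi * v $ j) * chr (- axis j 1) x"
      by (simp_all add: chr_def cis_mult inner_axis' algebra_simps)
    ultimately show ?thesis
      by (simp add: chr_add_left chr_add_left[of k "- axis j 1", simplified] algebra_simps)
  qed
  have one: "annihilated (\<lambda>_. 1)"
    unfolding annihilated_def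
  proof (intro conjI ballI continuous_intros)
    fix k :: "real^'d" assume "k \<in> int_lattice"
    then show "(LINT x:unit_cube|lborel. H x * chr k x * complex_of_real 1) = 0"
      using zero[OF int_lattice_closed(4)] by (simp add: fourier_coeff_def)
  qed
  have step: "annihilated (\<lambda>x. P x * \<phi> (x $ j - v $ j))" if P: "annihilated P" for P j
    unfolding annihilated_def
  proof (intro conjI ballI)
    have Pc: "continuous_on unit_cube P" using P by (simp add: annihilated_def)
    then show "continuous_on unit_cube (\<lambda>x. P x * \<phi> (x $ j - v $ j))"
      unfolding \<phi>_def by (intro continuous_intros) auto
    fix k :: "real^'d" assume k: "k \<in> int_lattice"
    let ?I = "\<lambda>k. (LINT x:unit_cube|lborel. H x * chr k x * complex_of_real (P x))"
    have si: "set_integrable lborel unit_cube (\<lambda>x. c * (H x * chr k x * complex_of_real (P x)))" for k c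
      by (intro set_integrable_cube continuous_intros H Pc)
    have "(LINT x:unit_cube|lborel. H x * chr k x * complex_of_real (P x * \<phi> (x $ j - v $ j)))
      = (LINT x:unit_cube|lborel. 1 / 2 * (H x * chr k x * complex_of_real (P x))
        + (cis (- 2 * pi * v $ j) / 4 * (H x * chr (k + axis j 1) x * complex_of_real (P x))
        + cis (2 * pi * v $ j) / 4 * (H x * chr (k - axis j 1) x * complex_of_real (P x))))"
    proof (rule set_lebesgue_integral_cong)
      show "\<forall>x. x \<in> unit_cube \<longrightarrow> H x * chr k x * complex_of_real (P x * \<phi> (x $ j - v $ j))
        = 1 / 2 * (H x * chr k x * complex_of_real (P x))
        + (cis (- 2 * pi * v $ j) / 4 * (H x * chr (k + axis j 1) x * complex_of_real (P x))
        + cis (2 * pi * v $ j) / 4 * (H x * chr (k - axis j 1) x * complex_of_real (P x)))"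
      proof (intro allI impI)
        fix x :: "real^'d"
        have "H x * chr k x * complex_of_real (P x * \<phi> (x $ j - v $ j))
          = H x * complex_of_real (P x) * (chr k x * complex_of_real (\<phi> (x $ j - v $ j)))"
          by simp
        then show "H x * chr k x * complex_of_real (P x * \<phi> (x $ j - v $ j))
          = 1 / 2 * (H x * chr k x * complex_of_real (P x))
          + (cis (- 2 * pi * v $ j) / 4 * (H x * chr (k + axis j 1) x * complex_of_real (P x))
          + cis (2 * pi * v $ j) / 4 * (H x * chr (k - axis j 1) x * complex_of_real (P x)))"
          unfolding \<phi>_chr by (simp add: algebra_simps)
      qed
    qed simp
    also have "\<dots> = 1 / 2 * ?I k + (cis (- 2 * pi * v $ j) / 4 * ?I (k + axis j 1) + cis (2 * pi * v $ j) / 4 * ?I (k - axis j 1))"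
      by (subst set_integral_add(2)[OF si set_integral_add(1)[OF si si]], subst set_integral_add(2)[OF si si]) simp
    also have "\<dots> = 0"
    proof -
      have "?I l = 0" if "l \<in> int_lattice" for l
        using P that unfolding annihilated_def by blast
      then show ?thesis using k by (simp add: int_lattice_closed)
    qed
    finally show "(LINT x:unit_cube|lborel. H x * chr k x * complex_of_real (P x * \<phi> (x $ j - v $ j))) = 0" .
  qed
  define K where "K N x = (\<Prod>j\<in>UNIV. \<phi> (x $ j - v $ j)) ^ N" for N and x :: "real^'d"
  have prod_step: "annihilated (\<lambda>x. P x * (\<Prod>j\<in>J. \<phi> (x $ j - v $ j)))" if "annihilated P" "finite J" for P J
    using that(2)
  proof (induction J)
    case (insert j J)
    have "annihilated (\<lambda>x. P x * (\<Prod>j\<in>J. \<phi> (x $ j - v $ j)) * \<phi> (x $ j - v $ j))"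
      by (rule step) (rule insert.IH)
    then show ?case using insert.hyps by (simp add: mult_ac)
  qed (use that in simp)
  have K: "annihilated (K N)" for N
  proof (induction N)
    case 0
    then show ?case using one by (simp add: K_def[abs_def])
  next
    case (Suc N)
    then show ?case using prod_step[OF Suc, of UNIV] by (simp add: K_def[abs_def] mult.commute)
  qed
  have Kc: "continuous_on unit_cube (K N)" for N using K by (simp add: annihilated_def)
  have K0: "(LINT x:unit_cube|lborel. Re (H x) * K N x) = 0" for N
  proof -
    have "(LINT x:unit_cube|lborel. H x * complex_of_real (K N x)) = 0"
      using K[of N] int_lattice_closed(1) unfolding annihilated_def by force
    moreover have "integrable lborel (\<lambda>x. indicator unit_cube x *\<^sub>R (H x * complex_of_real (K N x)))"
      by (rule borel_integrable_compact) (intro compact_cbox continuous_intros H Kc)+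
    ultimately show ?thesis
      using integral_Re[of lborel "\<lambda>x. indicator unit_cube x *\<^sub>R (H x * complex_of_real (K N x))"]
      by (simp add: set_lebesgue_integral_def)
  qed
  assume "\<not> Re (H v) \<le> 0"
  define \<epsilon> where "\<epsilon> = Re (H v) / 2"
  have \<epsilon>: "\<epsilon> > 0" using \<open>\<not> Re (H v) \<le> 0\<close> by (simp add: \<epsilon>_def)
  have v_cube: "v \<in> unit_cube" using v box_subset_cbox by blast
  \<comment> \<open>\<open>\<epsilon>\<close> is half of \<open>Re (H v)\<close>, a lower bound for
    \<open>Re H\<close> in the \<open>\<delta>\<close>-neighbourhood of \<open>v\<close>. The
    margins to the faces keep all other points of the cube away from \<open>v\<close> modulo
    one.\<close>
  obtain \<delta> where \<delta>: "0 < \<delta>" "\<delta> < 1 / 2" "\<And>j. \<delta> < v $ j" "\<And>j. v $ j < 1 - \<delta>"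
    and near: "\<And>x. x \<in> unit_cube \<Longrightarrow> (\<And>j. \<bar>x $ j - v $ j\<bar> < \<delta>) \<Longrightarrow> Re (H x) \<ge> \<epsilon>"
  proof -
    obtain d where d: "d > 0" "\<And>x. x \<in> unit_cube \<Longrightarrow> dist x v < d \<Longrightarrow> dist (H x) (H v) < \<epsilon>"
      using H v_cube \<epsilon> unfolding continuous_on_iff by blast
    define m where "m = Min (range (\<lambda>j. min (v $ j) (1 - v $ j)))"
    have "m \<in> range (\<lambda>j. min (v $ j) (1 - v $ j))" unfolding m_def by (rule Min_in) auto
    then have m0: "m > 0" using v by (auto simp: mem_box_cart)
    have m: "m \<le> v $ j" "m \<le> 1 - v $ j" for j
      using Min_le[of "range (\<lambda>j. min (v $ j) (1 - v $ j))" "min (v $ j) (1 - v $ j)"] by (auto simp: m_def)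
    define \<delta> where "\<delta> = min (m / 2) (d / (2 * real D))"
    have Dpos: "real D > 0" by (simp add: D_def)
    have \<delta>0: "\<delta> > 0" using m0 d Dpos by (simp add: \<delta>_def)
    have \<delta>m: "\<delta> \<le> m / 2" by (simp add: \<delta>_def)
    have \<delta>d: "real D * \<delta> \<le> d / 2"
    proof -
      have "real D * \<delta> \<le> real D * (d / (2 * real D))"
        using Dpos by (intro mult_left_mono) (auto simp: \<delta>_def)
      then show ?thesis using Dpos by simp
    qed
    have "Re (H x) \<ge> \<epsilon>" if "x \<in> unit_cube" "\<And>j. \<bar>x $ j - v $ j\<bar> < \<delta>" for x
    proof -
      have "norm (x - v) \<le> (\<Sum>j\<in>UNIV. \<bar>(x - v) $ j\<bar>)" by (rule norm_le_l1_cart)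
      also have "\<dots> \<le> real D * \<delta>"
        using that(2) sum_bounded_above[of UNIV "\<lambda>j. \<bar>(x - v) $ j\<bar>" \<delta>] by (auto simp: D_def less_imp_le)
      also have "\<dots> < d" using \<delta>d d by simp
      finally have "norm (H x - H v) < \<epsilon>" using d(2)[OF that(1)] by (simp add: dist_norm)
      then have "\<bar>Re (H x) - Re (H v)\<bar> < \<epsilon>" using abs_Re_le_cmod[of "H x - H v"] by simp
      then show ?thesis unfolding \<epsilon>_def abs_less_iff by linarith
    qed
    moreover have "\<delta> < 1 / 2" "\<delta> < v $ j" "v $ j < 1 - \<delta>" for j
      using m[of j] \<delta>m m0 by linarith+
    ultimately show thesis using that[of \<delta>] \<delta>0 by blast
  qed
  have \<phi>_bounds: "0 \<le> \<phi> t" "\<phi> t \<le> 1" for t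
    using cos_ge_minus_one[of "2 * pi * t"] cos_le_one[of "2 * pi * t"]
    by (simp_all add: \<phi>_def del: cos_le_one cos_ge_minus_one)
  have \<phi>_abs: "\<phi> \<bar>t\<bar> = \<phi> t" for t
    by (cases "t \<ge> 0") (simp_all add: \<phi>_def)
  \<comment> \<open>Since \<open>\<phi>\<close> has period one, its argument has to stay at distance
    \<open>s\<close> from 0 and from 1 in absolute value.\<close>
  have \<phi>_dec: "\<phi> t \<le> \<phi> s" if "0 \<le> s" "s \<le> \<bar>t\<bar>" "\<bar>t\<bar> \<le> 1 - s" for s t
  proof -
    have "\<phi> t = \<phi> \<bar>t\<bar>" by (simp only: \<phi>_abs)
    also have "\<dots> \<le> \<phi> s"
    proof (cases "\<bar>t\<bar> \<le> 1 / 2")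
      case True
      then show ?thesis using that pi_gt_zero
        by (auto simp: \<phi>_def intro!: cos_monotone_0_pi_le mult_left_mono)
    next
      case False
      have "cos (2 * pi * \<bar>t\<bar>) = cos (2 * pi * (1 - \<bar>t\<bar>))"
        using cos_periodic[of "2 * pi * \<bar>t\<bar> - 2 * pi"] cos_minus[of "2 * pi * \<bar>t\<bar> - 2 * pi"]
        by (simp add: algebra_simps)
      moreover have "cos (2 * pi * (1 - \<bar>t\<bar>)) \<le> cos (2 * pi * s)"
        using that False by (intro cos_monotone_0_pi_le) (auto intro: mult_left_mono)
      ultimately show ?thesis by (simp add: \<phi>_def)
    qed
    finally show ?thesis .
  qed
  define q2 where "q2 = \<phi> \<delta>"
  have q2: "q2 < 1" "0 \<le> q2"
  proof -
    have "cos (2 * pi * \<delta>) < cos 0"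
      using \<delta> by (intro cos_monotone_0_pi) (auto simp: mult_less_cancel_left)
    then show "q2 < 1" "0 \<le> q2" using \<phi>_bounds by (auto simp: q2_def \<phi>_def)
  qed
  \<comment> \<open>\<open>\<phi> \<delta>' ^ D\<close> will be the lower bound of the kernel on the
    box \<open>B\<close>; it tends to one as \<open>\<delta>'\<close> tends to zero, hence exceeds
    the bound \<open>q2\<close> that holds away from \<open>v\<close>.\<close>
  obtain \<delta>' where \<delta>': "0 < \<delta>'" "\<delta>' < \<delta>" "q2 < \<phi> \<delta>' ^ D"
  proof -
    have "isCont (\<lambda>t. \<phi> t ^ D) 0" unfolding \<phi>_def by (intro continuous_intros) auto
    then have "((\<lambda>t. \<phi> t ^ D) \<longlongrightarrow> 1) (at_right 0)"
      unfolding isCont_def by (auto simp: \<phi>_def intro: filterlim_mono at_le)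
    then have "eventually (\<lambda>t. q2 < \<phi> t ^ D) (at_right 0)"
      using q2 by (simp add: order_tendstoD)
    moreover have "eventually (\<lambda>t. t < \<delta> \<and> 0 < t) (at_right 0)"
      using \<delta>(1) by (auto simp: eventually_at_right_field)
    ultimately have "eventually (\<lambda>t. q2 < \<phi> t ^ D \<and> t < \<delta> \<and> 0 < t) (at_right (0::real))"
      by eventually_elim auto
    then have "\<exists>t. q2 < \<phi> t ^ D \<and> t < \<delta> \<and> 0 < t"
      using eventually_happens[of _ "at_right (0::real)"] by auto
    then show thesis using that by auto
  qed
  define q1 where "q1 = \<phi> \<delta>' ^ D"
  have q1: "q1 > 0" "q2 < q1" using \<delta>' q2 by (auto simp: q1_def)
  obtain M where M: "M > 0" "\<And>x. x \<in> unit_cube \<Longrightarrow> norm (H x) \<le> M"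
    using compact_imp_bounded[OF compact_continuous_image[OF H compact_cbox]] unfolding bounded_pos by auto
  define B where "B = cbox (v - (\<chi> j. \<delta>')) (v + (\<chi> j. \<delta>'))"
  have B: "x \<in> B \<longleftrightarrow> (\<forall>j. \<bar>x $ j - v $ j\<bar> \<le> \<delta>')" for x
    unfolding B_def mem_box_cart abs_le_iff by (auto simp: algebra_simps)
  have B_cube: "B \<subseteq> unit_cube"
  proof
    fix x assume "x \<in> B"
    then show "x \<in> unit_cube"
      unfolding B mem_unit_cube using \<delta> \<delta>' by (smt (verit))
  qed
  have mB: "measure lborel B > 0"
    unfolding B_def content_pos_lt_eq using \<delta>'(1) by (auto simp: Basis_vec_def inner_axis)
  have KK: "0 \<le> K N x" "K N x \<le> 1" for N x
    unfolding K_def using \<phi>_bounds by (auto intro!: zero_le_power prod_nonneg power_le_one prod_le_1)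
  \<comment> \<open>Near \<open>v\<close> the product is nonnegative, and on \<open>B\<close> at
    least \<open>\<epsilon> * q1 ^ N\<close>; away from \<open>v\<close> a single factor of the
    kernel already gives the bound \<open>q2\<close>.\<close>
  have pointwise: "\<epsilon> * q1 ^ N * indicator B x - M * q2 ^ N \<le> Re (H x) * K N x" if x: "x \<in> unit_cube" for N x
  proof (cases "\<forall>j. \<bar>x $ j - v $ j\<bar> < \<delta>")
    case True
    have Hx: "\<epsilon> \<le> Re (H x)" using near[OF x] True by auto
    show ?thesis
    proof (cases "x \<in> B")
      case xB: True
      have "q1 ^ N \<le> K N x"
      proof -
        have "(\<Prod>j\<in>(UNIV::'d set). \<phi> \<delta>') \<le> (\<Prod>j\<in>UNIV. \<phi> (x $ j - v $ j))"
        proof (intro prod_mono conjI \<phi>_bounds)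
          fix j :: 'd
          have "cos (2 * pi * \<delta>') \<le> cos (2 * pi * \<bar>x $ j - v $ j\<bar>)"
            using xB \<delta> \<delta>' unfolding B by (intro cos_monotone_0_pi_le) (auto intro: mult_left_mono)
          then have "\<phi> \<delta>' \<le> \<phi> \<bar>x $ j - v $ j\<bar>" by (simp add: \<phi>_def)
          then show "\<phi> \<delta>' \<le> \<phi> (x $ j - v $ j)" by (simp only: \<phi>_abs)
        qed
        then show ?thesis unfolding K_def q1_def D_def using \<phi>_bounds by (intro power_mono) (auto)
      qed
      then have "\<epsilon> * q1 ^ N \<le> Re (H x) * K N x" using Hx \<epsilon> KK q1 by (intro mult_mono) auto
      moreover have "0 \<le> M * q2 ^ N" using M q2 by simp
      ultimately show ?thesis using xB by simp
    next
      case False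
      have "0 \<le> Re (H x) * K N x" using Hx \<epsilon> KK by simp
      moreover have "0 \<le> M * q2 ^ N" using M q2 by simp
      ultimately show ?thesis using False by simp
    qed
  next
    case False
    then obtain j where j: "\<delta> \<le> \<bar>x $ j - v $ j\<bar>" by (auto simp: not_less)
    then have xB: "x \<notin> B" using \<delta>' unfolding B by (metis not_less order_le_less_trans)
    have "\<bar>x $ j - v $ j\<bar> \<le> 1 - \<delta>"
      using x \<delta>(3,4)[of j] by (auto simp: mem_unit_cube abs_le_iff dest: spec[of _ j])
    then have "\<phi> (x $ j - v $ j) \<le> q2" unfolding q2_def using \<delta> j by (intro \<phi>_dec) auto
    moreover have "(\<Prod>j\<in>UNIV. \<phi> (x $ j - v $ j)) \<le> \<phi> (x $ j - v $ j)"
      using \<phi>_bounds by (subst prod.remove[of _ j]) (auto intro!: mult_left_le prod_le_1)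
    ultimately have "K N x \<le> q2 ^ N"
      unfolding K_def using \<phi>_bounds by (intro power_mono prod_nonneg) auto
    moreover have "\<bar>Re (H x)\<bar> \<le> M" using M(2)[OF x] abs_Re_le_cmod[of "H x"] by simp
    ultimately have "\<bar>Re (H x)\<bar> * K N x \<le> M * q2 ^ N" using KK M by (intro mult_mono) auto
    moreover have "- (\<bar>Re (H x)\<bar> * K N x) \<le> Re (H x) * K N x"
      using KK[of N x] abs_ge_minus_self[of "Re (H x) * K N x"] by (simp add: abs_mult)
    ultimately show ?thesis using xB by simp
  qed
  have ineq: "\<epsilon> * q1 ^ N * measure lborel B \<le> M * q2 ^ N" for N
  proof -
    have iB: "integrable lborel (\<lambda>x. \<epsilon> * q1 ^ N * indicator B x)"
      unfolding B_def using emeasure_lborel_cbox_finite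
      by (intro Bochner_Integration.integrable_mult_right integrable_real_indicator) auto
    have iC: "integrable lborel (\<lambda>x. M * q2 ^ N * indicator (unit_cube :: (real^'d) set) x)"
      using emeasure_lborel_cbox_finite
      by (intro Bochner_Integration.integrable_mult_right integrable_real_indicator) auto
    have "\<epsilon> * q1 ^ N * measure lborel B - M * q2 ^ N
        = (\<integral>x. \<epsilon> * q1 ^ N * indicator B x - M * q2 ^ N * indicator (unit_cube :: (real^'d) set) x \<partial>lborel)"
      by (subst Bochner_Integration.integral_diff[OF iB iC])
        (simp only: Bochner_Integration.integral_mult_right_zero Bochner_Integration.integral_indicator
          space_lborel space_borel Int_UNIV_right measure_unit_cube mult_1_right)
    also have "\<dots> \<le> (LINT x:unit_cube|lborel. Re (H x) * K N x)"
      unfolding set_lebesgue_integral_def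
    proof (rule integral_mono)
      show "integrable lborel (\<lambda>x. indicator unit_cube x *\<^sub>R (Re (H x) * K N x))"
        by (rule borel_integrable_compact) (intro compact_cbox continuous_intros H Kc)+
      show "\<epsilon> * q1 ^ N * indicator B x - M * q2 ^ N * indicator unit_cube x \<le> indicator unit_cube x *\<^sub>R (Re (H x) * K N x)" for x
        using pointwise[of x N] B_cube by (auto split: split_indicator)
    qed (rule Bochner_Integration.integrable_diff[OF iB iC])
    finally show ?thesis by (simp add: K0)
  qed
  have "(\<lambda>N. M * (q2 / q1) ^ N) \<longlonglongrightarrow> M * 0"
    using q1 q2 by (intro tendsto_intros LIMSEQ_power_zero) auto
  then have "eventually (\<lambda>N. M * (q2 / q1) ^ N < \<epsilon> * measure lborel B) sequentially"
    using \<epsilon> mB by (intro order_tendstoD) auto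
  then obtain N where "M * (q2 / q1) ^ N < \<epsilon> * measure lborel B"
    using eventually_happens[of _ sequentially] by auto
  then have "M * q2 ^ N < \<epsilon> * measure lborel B * q1 ^ N"
    using q1 by (simp add: power_divide field_simps)
  with ineq[of N] show False by (simp add: mult_ac)
qed

lemma fourier_coeff_cmult: "fourier_coeff (\<lambda>x. c * h x) k = c * fourier_coeff h k"
  by (simp add: fourier_coeff_def mult.assoc)

text \<open>Applied to \<open>cnj (H x) * H\<close>, whose real part at \<open>x\<close> is
  \<open>|H x|\<^sup>2\<close>; the faces of the cube follow by continuity.\<close>

lemma continuous_zero_Fourier:
  fixes H :: "real^'d::finite \<Rightarrow> complex"
  assumes H: "continuous_on unit_cube H" and zero: "\<And>k. k \<in> int_lattice \<Longrightarrow> fourier_coeff H k = 0"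
    and v: "v \<in> unit_cube"
  shows "H v = 0"
proof -
  have "H x = 0" if "x \<in> box 0 1" for x
  proof -
    have "Re (cnj (H x) * H x) \<le> 0"
      using zero that
      by (intro continuous_zero_Fourier_aux[of "\<lambda>y. cnj (H x) * H y"] continuous_intros H)
        (simp_all add: fourier_coeff_cmult)
    then have "(norm (H x))\<^sup>2 \<le> 0" by (simp add: cmod_power2 power2_eq_square[of "Re _"] power2_eq_square[of "Im _"])
    then show ?thesis by simp
  qed
  moreover have "closure (box 0 (1 :: real^'d)) = cbox 0 1"
    by (rule closure_box) (auto simp: box_ne_empty Basis_vec_def inner_axis)
  ultimately show ?thesis
    using continuous_constant_on_closure[of "box 0 1" H 0 v] H v by simp
qed

lemma norm_fourier_coeff_le:
  assumes "continuous_on unit_cube h" "\<And>x. x \<in> unit_cube \<Longrightarrow> norm (h x) \<le> b"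
  shows "norm (fourier_coeff h (k :: real^'d::finite)) \<le> b"
proof -
  have iC: "integrable lborel (\<lambda>x. b * indicator (unit_cube :: (real^'d) set) x)"
    using emeasure_lborel_cbox_finite
    by (intro Bochner_Integration.integrable_mult_right integrable_real_indicator) auto
  have "norm (fourier_coeff h k) \<le> (\<integral>x. norm (indicator unit_cube x *\<^sub>R (h x * chr (- k) x)) \<partial>lborel)"
    unfolding fourier_coeff_def set_lebesgue_integral_def by (rule integral_norm_bound)
  also have "\<dots> \<le> (\<integral>x. b * indicator (unit_cube :: (real^'d) set) x \<partial>lborel)"
    by (intro integral_mono integrable_norm iC borel_integrable_compact compact_cbox continuous_intros assms)
      (use assms in \<open>auto simp: norm_mult split: split_indicator\<close>)
  also have "\<dots> = b"
    by (simp only: Bochner_Integration.integral_mult_right_zero Bochner_Integration.integral_indicator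
        space_lborel space_borel Int_UNIV_right measure_unit_cube mult_1_right)
  finally show ?thesis .
qed

lemma fourier_coeff_diff:
  assumes "continuous_on unit_cube g" "continuous_on unit_cube h"
  shows "fourier_coeff (\<lambda>x. g x - h x) k = fourier_coeff g k - fourier_coeff h k"
  unfolding fourier_coeff_def left_diff_distrib
  by (intro set_integral_diff(2) set_integrable_cube continuous_intros assms)

lemma fourier_coeff_trig_poly:
  assumes "finite K" "K \<subseteq> int_lattice" "k \<in> int_lattice"
  shows "fourier_coeff (\<lambda>x. \<Sum>l\<in>K. c l * chr l x) k = (if k \<in> K then c k else 0)"
proof -
  have "fourier_coeff (\<lambda>x. \<Sum>l\<in>K. c l * chr l x) k = (LINT x:unit_cube|lborel. (\<Sum>l\<in>K. c l * chr (l - k) x))"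
    unfolding fourier_coeff_def sum_distrib_right
    by (simp add: chr_add_left[of _ "- _", simplified] mult_ac)
  also have "\<dots> = (\<Sum>l\<in>K. (LINT x:unit_cube|lborel. c l * chr (l - k) x))"
    unfolding set_lebesgue_integral_def scaleR_sum_right
    by (rule Bochner_Integration.integral_sum)
      (intro borel_integrable_compact compact_cbox continuous_intros)
  also have "\<dots> = (\<Sum>l\<in>K. if l = k then c l else 0)"
    using assms by (intro sum.cong refl) (auto simp: integral_chr int_lattice_closed subset_iff)
  also have "\<dots> = (if k \<in> K then c k else 0)" using assms by simp
  finally show ?thesis .
qed

text \<open>The absolutely convergent series \<open>T\<close> over the nonzero frequencies is
  continuous and has the coefficients of \<open>H\<close> there. Thus \<open>H - c 0 - T\<close> is
  a continuous function all of whose coefficients vanish, and the series represents \<open>H\<close>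
  at every point of the cube.\<close>

lemma fourier_expansion:
  fixes H :: "real^'d::finite \<Rightarrow> complex"
  assumes H: "continuous_on unit_cube H"
    and E: "\<And>K. finite K \<Longrightarrow> K \<subseteq> int_lattice - {0} \<Longrightarrow> (\<Sum>k\<in>K. norm (fourier_coeff H k)) \<le> E"
    and "\<tau> > 0"
  obtains K where "finite K" "K \<subseteq> int_lattice - {0}"
    "\<And>v. v \<in> unit_cube \<Longrightarrow> norm (H v - fourier_coeff H 0 - (\<Sum>k\<in>K. fourier_coeff H k * chr k v)) \<le> \<tau>"
proof -
  define c where "c = fourier_coeff H"
  let ?L = "int_lattice - {0} :: (real^'d) set"
  define P where "P K v = (\<Sum>k\<in>K. c k * chr k v)" for K v
  define T where "T v = (\<Sum>\<^sub>\<infinity>k\<in>?L. c k * chr k v)" for v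
  have "(\<lambda>k. norm (c k)) summable_on ?L"
    using E by (intro nonneg_bdd_above_summable_on bdd_aboveI2[of _ _ E]) (auto simp: c_def)
  then have "uniform_limit unit_cube P T (finite_subsets_at_top ?L)"
    unfolding P_def[abs_def] T_def[abs_def] by (intro Weierstrass_m_test_general) (auto simp: norm_mult)
  note lim = this
  have Pc: "continuous_on A (P K)" for A K unfolding P_def by (intro continuous_intros)
  have Tc: "continuous_on unit_cube T"
    by (rule uniform_limit_theorem[OF _ lim]) (auto intro: Pc)
  have approx: "\<exists>K. finite K \<and> K0 \<subseteq> K \<and> K \<subseteq> ?L \<and> (\<forall>v\<in>unit_cube. norm (T v - P K v) \<le> e)"
    if "e > 0" "finite K0" "K0 \<subseteq> ?L" for e K0
  proof -
    have "eventually (\<lambda>K. \<forall>v\<in>unit_cube. dist (P K v) (T v) < e) (finite_subsets_at_top ?L)"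
      using lim \<open>e > 0\<close> by (rule uniform_limitD)
    then have "\<exists>K1. finite K1 \<and> K1 \<subseteq> ?L \<and> (\<forall>K. finite K \<and> K1 \<subseteq> K \<and> K \<subseteq> ?L \<longrightarrow>
        (\<forall>v\<in>unit_cube. dist (P K v) (T v) < e))"
      by (simp only: eventually_finite_subsets_at_top)
    then obtain K1 where K1: "finite K1" "K1 \<subseteq> ?L"
      and near: "\<forall>K. finite K \<and> K1 \<subseteq> K \<and> K \<subseteq> ?L \<longrightarrow> (\<forall>v\<in>unit_cube. dist (P K v) (T v) < e)"
      by (elim exE conjE)
    have "\<forall>v\<in>unit_cube. dist (P (K0 \<union> K1) v) (T v) < e"
      using near[THEN spec, of "K0 \<union> K1"] K1 that by simp
    then show ?thesis
      using K1(1,2) that by (intro exI[of _ "K0 \<union> K1"]) (auto simp: dist_norm norm_minus_commute less_imp_le)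
  qed
  \<comment> \<open>Coefficients are continuous for uniform convergence, so they can be read off
    from finite partial sums that contain \<open>k\<close>.\<close>
  have Tcoeff: "fourier_coeff T k = (if k = 0 then 0 else c k)" if k: "k \<in> int_lattice" for k
  proof -
    have "norm (fourier_coeff T k - (if k = 0 then 0 else c k)) \<le> e" if e: "e > 0" for e
    proof -
      have "{k} - {0} \<subseteq> ?L" using k by auto
      from approx[OF e finite_Diff[OF finite.insertI[OF finite.emptyI]] this] obtain K where K: "finite K" "{k} - {0} \<subseteq> K" "K \<subseteq> ?L"
        and near: "\<forall>v\<in>unit_cube. norm (T v - P K v) \<le> e"
        by (elim exE conjE) simp_all
      have "fourier_coeff (P K) k = (if k = 0 then 0 else c k)"
        unfolding P_def[abs_def] using K k by (subst fourier_coeff_trig_poly) auto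
      moreover have "norm (fourier_coeff (\<lambda>v. T v - P K v) k) \<le> e"
        by (intro norm_fourier_coeff_le continuous_intros Tc Pc near[rule_format])
      ultimately show ?thesis by (simp add: fourier_coeff_diff Tc Pc)
    qed
    then show ?thesis
      using field_le_epsilon[of "norm (fourier_coeff T k - (if k = 0 then 0 else c k))" 0] by simp
  qed
  have const: "fourier_coeff (\<lambda>_. c 0) k = (if k = 0 then c 0 else 0)" if "k \<in> int_lattice" for k :: "real^'d"
  proof -
    have "fourier_coeff (\<lambda>x. \<Sum>l\<in>{0}. c l * chr l x) k = (if k \<in> {0} then c k else 0)"
      using that by (intro fourier_coeff_trig_poly) (simp_all add: int_lattice_closed(1))
    then show ?thesis by (cases "k = 0") simp_all
  qed
  have HT: "H v - c 0 = T v" if v: "v \<in> unit_cube" for v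
  proof -
    have "(H v - c 0) - T v = 0"
    proof (rule continuous_zero_Fourier[of "\<lambda>v. (H v - c 0) - T v", OF _ _ v])
      show "continuous_on unit_cube (\<lambda>v. H v - c 0 - T v)" by (intro continuous_intros H Tc)
      fix k :: "real^'d" assume k: "k \<in> int_lattice"
      have "fourier_coeff (\<lambda>v. H v - c 0 - T v) k
        = fourier_coeff H k - fourier_coeff (\<lambda>_. c 0) k - fourier_coeff T k"
        by (subst fourier_coeff_diff, (intro continuous_intros H Tc)+)
          (subst fourier_coeff_diff, (intro continuous_intros H Tc)+, rule refl)
      then show "fourier_coeff (\<lambda>v. H v - c 0 - T v) k = 0"
        using const[OF k] Tcoeff[OF k] by (simp add: c_def)
    qed
    then show ?thesis by simp
  qed
  obtain K where K: "finite K" "K \<subseteq> ?L" "\<forall>v\<in>unit_cube. norm (T v - P K v) \<le> \<tau>"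
    using approx[OF \<open>\<tau> > 0\<close>, of "{}"] by blast
  show thesis
  proof (rule that[OF K(1,2)])
    fix v :: "real^'d" assume v: "v \<in> unit_cube"
    then show "norm (H v - fourier_coeff H 0 - (\<Sum>k\<in>K. fourier_coeff H k * chr k v)) \<le> \<tau>"
      using K(3) HT[OF v] unfolding P_def c_def by simp
  qed
qed

lemma fourier_sup_bound:
  fixes H :: "real^'d::finite \<Rightarrow> complex"
  assumes H: "continuous_on unit_cube H"
    and E: "\<And>K. finite K \<Longrightarrow> K \<subseteq> int_lattice - {0} \<Longrightarrow> (\<Sum>k\<in>K. norm (fourier_coeff H k)) \<le> E"
    and v: "v \<in> unit_cube"
  shows "norm (H v - fourier_coeff H 0) \<le> E"
proof (rule field_le_epsilon)
  fix e :: real assume "e > 0"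
  obtain K where K: "finite K" "K \<subseteq> int_lattice - {0}"
    "norm (H v - fourier_coeff H 0 - (\<Sum>k\<in>K. fourier_coeff H k * chr k v)) \<le> e"
  proof (rule fourier_expansion[OF H E \<open>e > 0\<close>])
    fix K
    assume "finite K" "K \<subseteq> int_lattice - {0}"
      and "\<And>v. v \<in> unit_cube \<Longrightarrow> norm (H v - fourier_coeff H 0 - (\<Sum>k\<in>K. fourier_coeff H k * chr k v)) \<le> e"
    with v show thesis by (intro that)
  qed
  have "norm (\<Sum>k\<in>K. fourier_coeff H k * chr k v) \<le> (\<Sum>k\<in>K. norm (fourier_coeff H k))"
    by (rule order_trans[OF norm_sum]) (simp add: norm_mult)
  then show "norm (H v - fourier_coeff H 0) \<le> E + e"
    using K(3) E[OF K(1,2)] norm_triangle_sub[of "H v - fourier_coeff H 0" "\<Sum>k\<in>K. fourier_coeff H k * chr k v"]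
    by linarith
qed

text \<open>The half of Parseval's identity that is opposite to Bessel's inequality. A partial sum
  \<open>P\<close> approximates \<open>H - fourier_coeff H 0\<close> uniformly up to
  \<open>\<tau>\<close>; its own square integral is a finite sum of squared coefficients, and the
  cross term \<open>2 * \<tau> * E\<close> disappears with \<open>\<tau>\<close>.\<close>

lemma fourier_L2_bound:
  fixes H :: "real^'d::finite \<Rightarrow> complex"
  assumes H: "continuous_on unit_cube H"
    and E: "\<And>K. finite K \<Longrightarrow> K \<subseteq> int_lattice - {0} \<Longrightarrow> (\<Sum>k\<in>K. norm (fourier_coeff H k)) \<le> E"
    and W: "\<And>K. finite K \<Longrightarrow> K \<subseteq> int_lattice - {0} \<Longrightarrow> (\<Sum>k\<in>K. (norm (fourier_coeff H k))\<^sup>2) \<le> W"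
  shows "(LINT v:unit_cube|lborel. (norm (H v - fourier_coeff H 0))\<^sup>2) \<le> W"
proof -
  have E0: "E \<ge> 0" using E[of "{}"] by simp
  have bound: "(LINT v:unit_cube|lborel. (norm (H v - fourier_coeff H 0))\<^sup>2) \<le> W + (2 * \<tau> * E + \<tau>\<^sup>2)"
    if "\<tau> > 0" for \<tau>
  proof -
    obtain K where K: "finite K" "K \<subseteq> int_lattice - {0}"
      "\<And>v. v \<in> unit_cube \<Longrightarrow> norm (H v - fourier_coeff H 0 - (\<Sum>k\<in>K. fourier_coeff H k * chr k v)) \<le> \<tau>"
    proof (rule fourier_expansion[OF H E \<open>\<tau> > 0\<close>])
      fix K
      assume "finite K" "K \<subseteq> int_lattice - {0}"
        and "\<And>v. v \<in> unit_cube \<Longrightarrow> norm (H v - fourier_coeff H 0 - (\<Sum>k\<in>K. fourier_coeff H k * chr k v)) \<le> \<tau>"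
      then show thesis by (rule that)
    qed
    define P where "P v = (\<Sum>k\<in>K. fourier_coeff H k * chr k v)" for v
    have Pc: "continuous_on unit_cube P" unfolding P_def by (intro continuous_intros)
    have pt: "(norm (H v - fourier_coeff H 0))\<^sup>2 \<le> (norm (P v))\<^sup>2 + (2 * \<tau> * E + \<tau>\<^sup>2)" if v: "v \<in> unit_cube" for v
    proof -
      have "norm (P v) \<le> (\<Sum>k\<in>K. norm (fourier_coeff H k))"
        unfolding P_def by (rule order_trans[OF norm_sum]) (simp add: norm_mult)
      then have PE: "norm (P v) \<le> E" using E[OF K(1,2)] by linarith
      have "norm (H v - fourier_coeff H 0) \<le> norm (P v) + \<tau>"
        using K(3)[OF v] norm_triangle_sub[of "H v - fourier_coeff H 0" "P v"] by (simp add: P_def)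
      then have "(norm (H v - fourier_coeff H 0))\<^sup>2 \<le> (norm (P v) + \<tau>)\<^sup>2" by (intro power_mono) auto
      also have "\<dots> = (norm (P v))\<^sup>2 + (2 * \<tau> * norm (P v) + \<tau>\<^sup>2)" by (simp add: power2_eq_square algebra_simps)
      also have "\<dots> \<le> (norm (P v))\<^sup>2 + (2 * \<tau> * E + \<tau>\<^sup>2)"
        using PE \<open>\<tau> > 0\<close> by (intro add_mono order_refl mult_left_mono) auto
      finally show ?thesis .
    qed
    have i1: "set_integrable lborel unit_cube (\<lambda>v. (norm (P v))\<^sup>2)"
      by (intro set_integrable_cube continuous_intros Pc)
    have i2: "set_integrable lborel unit_cube (\<lambda>v :: real^'d. 2 * \<tau> * E + \<tau>\<^sup>2)"
      by (intro set_integrable_cube continuous_intros)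
    have "(LINT v:unit_cube|lborel. (norm (H v - fourier_coeff H 0))\<^sup>2)
      \<le> (LINT v:unit_cube|lborel. (norm (P v))\<^sup>2 + (2 * \<tau> * E + \<tau>\<^sup>2))"
      by (intro set_integral_mono set_integral_add(1) i1 i2 pt set_integrable_cube continuous_intros H)
    also have "\<dots> = (LINT v:unit_cube|lborel. (norm (P v))\<^sup>2) + (LINT v:(unit_cube :: (real^'d) set)|lborel. 2 * \<tau> * E + \<tau>\<^sup>2)"
      by (rule set_integral_add(2)[OF i1 i2])
    also have "(LINT v:(unit_cube :: (real^'d) set)|lborel. 2 * \<tau> * E + \<tau>\<^sup>2) = 2 * \<tau> * E + \<tau>\<^sup>2"
      unfolding set_lebesgue_integral_def real_scaleR_def mult.commute[of "indicator _ _"]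
      by (simp only: Bochner_Integration.integral_mult_right_zero Bochner_Integration.integral_indicator
        space_lborel space_borel Int_UNIV_right measure_unit_cube mult_1_right)
    also have "(LINT v:unit_cube|lborel. (norm (P v))\<^sup>2) = (\<Sum>k\<in>K. (norm (fourier_coeff H k))\<^sup>2)"
    proof -
      have "complex_of_real (LINT v:unit_cube|lborel. (norm (P v))\<^sup>2) = (LINT v:unit_cube|lborel. P v * cnj (P v))"
        unfolding set_lebesgue_integral_def complex_norm_square[symmetric]
        by (subst Bochner_Integration.integral_of_real[symmetric])
          (use i1 in \<open>auto simp: scaleR_conv_of_real set_integrable_def simp del: Bochner_Integration.integral_of_real\<close>)
      also have "\<dots> = of_real (\<Sum>k\<in>K. (norm (fourier_coeff H k))\<^sup>2)"
        unfolding P_def using K by (intro integral_trig_poly_sq) auto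
      finally show ?thesis unfolding of_real_eq_iff .
    qed
    finally show ?thesis using W[OF K(1,2)] by linarith
  qed
  have "((\<lambda>\<tau>. W + (2 * \<tau> * E + \<tau>\<^sup>2)) \<longlongrightarrow> W + (2 * 0 * E + 0\<^sup>2)) (at_right (0::real))"
    by (intro tendsto_intros)
  then have "((\<lambda>\<tau>. W + (2 * \<tau> * E + \<tau>\<^sup>2)) \<longlongrightarrow> W) (at_right (0::real))" by simp
  then show ?thesis
  proof (rule tendsto_lowerbound)
    show "eventually (\<lambda>\<tau>. (LINT v:unit_cube|lborel. (norm (H v - fourier_coeff H 0))\<^sup>2) \<le> W + (2 * \<tau> * E + \<tau>\<^sup>2)) (at_right (0::real))"
      using bound by (intro eventually_at_rightI[of 0 1]) auto
  qed simp
qed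

section \<open>Plancherel's inequality\<close>

lemma nn_integral_count_space_le:
  assumes A: "countable A" and le: "\<And>F. finite F \<Longrightarrow> F \<subseteq> A \<Longrightarrow> (\<Sum>x\<in>F. f x) \<le> c"
  shows "(\<integral>\<^sup>+x. f x \<partial>count_space A) \<le> (c :: ennreal)"
proof (cases "A = {}")
  case False
  define F where "F n = from_nat_into A ` {..<n}" for n :: nat
  have F: "finite (F n)" "F n \<subseteq> A" for n
    using from_nat_into[OF False] by (auto simp: F_def)
  have inc: "incseq (\<lambda>n x. f x * indicator (F n) x)"
    by (auto simp: incseq_def le_fun_def F_def split: split_indicator)
  have "(\<integral>\<^sup>+x. f x \<partial>count_space A) = (\<integral>\<^sup>+x. (SUP n. f x * indicator (F n) x) \<partial>count_space A)"
  proof (rule nn_integral_cong)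
    fix x assume "x \<in> space (count_space A)"
    then have "x \<in> A" by simp
    then obtain n where "x = from_nat_into A n" using from_nat_into_surj[OF A] by metis
    then have "x \<in> F (Suc n)" by (auto simp: F_def)
    then have "f x \<le> (SUP n. f x * indicator (F n) x)" by (intro SUP_upper2[of "Suc n"]) auto
    moreover have "(SUP n. f x * indicator (F n) x) \<le> f x" by (intro SUP_least) (auto split: split_indicator)
    ultimately show "f x = (SUP n. f x * indicator (F n) x)" by (rule antisym)
  qed
  also have "\<dots> = (SUP n. (\<integral>\<^sup>+x. f x * indicator (F n) x \<partial>count_space A))"
    by (rule nn_integral_monotone_convergence_SUP[OF inc]) simp
  also have "\<dots> \<le> c"
  proof (rule SUP_least)
    fix n
    have "(\<integral>\<^sup>+x. f x * indicator (F n) x \<partial>count_space A) = (\<Sum>x\<in>F n. f x * indicator (F n) x)"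
      using F by (intro nn_integral_count_space') auto
    also have "\<dots> = (\<Sum>x\<in>F n. f x)" by (intro sum.cong) auto
    also have "\<dots> \<le> c" by (intro le F)
    finally show "(\<integral>\<^sup>+x. f x * indicator (F n) x \<partial>count_space A) \<le> c" .
  qed
  finally show ?thesis .
qed (simp add: nn_integral_empty)

lemma fourier_coeff_measurable [measurable]:
  assumes h: "continuous_on unit_cube h"
  shows "fourier_coeff (h :: real^'d::finite \<Rightarrow> complex) \<in> borel_measurable borel"
proof -
  have [measurable]: "(\<lambda>x. indicator unit_cube x *\<^sub>R h x) \<in> borel_measurable borel"
    using borel_integrable_compact[OF compact_cbox h] by auto
  have "fourier_coeff h = (\<lambda>\<xi>. \<integral>x. (indicator unit_cube x *\<^sub>R h x) * chr (- \<xi>) x \<partial>lborel)"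
    by (auto simp: fourier_coeff_def set_lebesgue_integral_def)
  also have "\<dots> \<in> borel_measurable borel" by measurable
  finally show ?thesis .
qed

text \<open>One half of Plancherel's theorem: integrate Bessel's inequality for the shifted frequencies
  over the unit cube of shifts.\<close>

lemma plancherel_le:
  fixes h :: "real^'d::finite \<Rightarrow> complex"
  assumes h: "continuous_on unit_cube h"
  shows "(\<integral>\<^sup>+\<xi>. ennreal ((norm (fourier_coeff h \<xi>))\<^sup>2) \<partial>lborel) \<le> ennreal (LINT x:unit_cube|lborel. (norm (h x))\<^sup>2)"
proof -
  let ?I = "LINT x:unit_cube|lborel. (norm (h x))\<^sup>2"
  note fourier_coeff_measurable[OF h, measurable]
  have "(\<integral>\<^sup>+\<xi>. ennreal ((norm (fourier_coeff h \<xi>))\<^sup>2) \<partial>lborel)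
    = (\<integral>\<^sup>+v. indicator unit_cube v * (\<integral>\<^sup>+m. ennreal ((norm (fourier_coeff h (v + m)))\<^sup>2) \<partial>count_space int_lattice) \<partial>lborel)"
    by (rule nn_integral_tiling) measurable
  also have "\<dots> \<le> (\<integral>\<^sup>+v. indicator (unit_cube :: (real^'d) set) v * ennreal ?I \<partial>lborel)"
  proof -
    have "(\<integral>\<^sup>+m. ennreal ((norm (fourier_coeff h (v + m)))\<^sup>2) \<partial>count_space int_lattice) \<le> ennreal ?I" for v
    proof (rule nn_integral_count_space_le[OF countable_int_lattice])
    fix F :: "(real^'d) set" assume F: "finite F" "F \<subseteq> int_lattice"
    \<comment> \<open>Shifting the frequency by \<open>v\<close> modulates \<open>h\<close> by a
      character, which leaves \<open>|h|\<close> and hence the right-hand side of Bessel's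
      inequality unchanged.\<close>
    have "fourier_coeff h (v + m) = fourier_coeff (\<lambda>x. h x * chr (- v) x) m" for m
      unfolding fourier_coeff_def by (simp add: chr_add_left[of "- v" "- m", simplified] mult_ac)
    then have "(\<Sum>m\<in>F. (norm (fourier_coeff h (v + m)))\<^sup>2) \<le> (LINT x:unit_cube|lborel. (norm (h x * chr (- v) x))\<^sup>2)"
      using bessel[OF _ F, of "\<lambda>x. h x * chr (- v) x"] h by (simp add: continuous_intros)
    then have "(\<Sum>m\<in>F. (norm (fourier_coeff h (v + m)))\<^sup>2) \<le> ?I" by (simp add: norm_mult)
    then show "(\<Sum>m\<in>F. ennreal ((norm (fourier_coeff h (v + m)))\<^sup>2)) \<le> ennreal ?I"
      by (simp add: ennreal_leI)
    qed
    then show ?thesis by (intro nn_integral_mono mult_left_mono) auto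
  qed
  also have "\<dots> = ennreal ?I"
    by (subst nn_integral_multc) (simp_all add: emeasure_unit_cube)
  finally show ?thesis .
qed

subsection \<open>Periodization of a function along the nodes\<close>

definition node_matrix :: "real^'d^'d::finite \<Rightarrow> real^'d^'d" where
  "node_matrix S = matrix_inv (transpose S)"

lemma node_eq: "node S v m = node_matrix S *v (m + v)"
  by (simp add: node_def node_matrix_def)

lemma invertible_transpose_iff: "invertible (transpose S) \<longleftrightarrow> invertible (S :: real^'d^'d::finite)"
  by (simp add: invertible_det_nz)

lemma node_matrix_props:
  assumes "invertible (S :: real^'d^'d::finite)"
  shows "invertible (node_matrix S)" "\<bar>det S\<bar> * \<bar>det (node_matrix S)\<bar> = 1"
    "transpose S *v (node_matrix S *v x) = x" "node_matrix S *v (transpose S *v x) = x"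
proof -
  have inv: "invertible (transpose S)" using assms by (simp add: invertible_transpose_iff)
  note m = matrix_inv_mult[OF inv, folded node_matrix_def]
  show "transpose S *v (node_matrix S *v x) = x" "node_matrix S *v (transpose S *v x) = x"
    using m by (simp_all add: matrix_vector_mul_assoc del: transpose_matrix_vector)
  have "det (transpose S) * det (node_matrix S) = 1"
    using m(2) by (metis det_mul det_I)
  then show d: "\<bar>det S\<bar> * \<bar>det (node_matrix S)\<bar> = 1"
    by (simp add: det_transpose flip: abs_mult)
  then show "invertible (node_matrix S)"
    by (auto simp: invertible_det_nz)
qed

text \<open>\<open>F\<close> is uniform in the shift, so that the rule is one finite sum of
  continuous functions of \<open>v\<close>; \<open>N\<close> counts, for each single
  \<open>v\<close>, the nodes that really lie in the cube, and may be much smaller than the size of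
  \<open>F\<close>.\<close>

locale cubature =
  fixes S :: "real^'d^'d::finite" and F :: "(real^'d) set" and N :: nat
  assumes S_inv: "invertible S"
    and F: "finite F" "F \<subseteq> int_lattice"
    and cover: "\<And>v m. v \<in> unit_cube \<Longrightarrow> m \<in> int_lattice - F \<Longrightarrow> node S v m \<notin> unit_cube"
    and few: "\<And>v. v \<in> unit_cube \<Longrightarrow> card {m \<in> F. node S v m \<in> unit_cube} \<le> N"
begin

lemma det_S: "\<bar>det S\<bar> > 0"
  using S_inv by (simp add: invertible_det_nz)

text \<open>The value of the rule at the integrand \<open>g\<close> as a function of the shift. The
  type stays open since the rule is real while its Fourier analysis is complex.\<close>

definition periodize :: "(real^'d \<Rightarrow> 'b::real_normed_field) \<Rightarrow> real^'d \<Rightarrow> 'b" where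
  "periodize g v = of_real (1 / \<bar>det S\<bar>) * (\<Sum>m\<in>F. g (node S v m))"

lemma node_cont: "continuous_on A (\<lambda>v. node S v m)"
  unfolding node_eq by (rule linear_continuous_on_compose[OF _ matrix_vector_mul_linear]) (intro continuous_intros)

lemma periodize_cont:
  "continuous_on UNIV g \<Longrightarrow> continuous_on A (periodize g)"
  unfolding periodize_def by (intro continuous_intros continuous_on_compose2[OF _ node_cont]) auto

lemma integral_periodize:
  fixes h :: "real^'d \<Rightarrow> 'b::{banach, real_normed_field, second_countable_topology}"
  assumes h: "integrable lborel h" "\<And>x. x \<notin> unit_cube \<Longrightarrow> h x = 0"
  shows "(LINT v:unit_cube|lborel. (\<Sum>m\<in>F. h (node S v m))) = of_real \<bar>det S\<bar> * (\<integral>x. h x \<partial>lborel)"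
proof -
  let ?A = "node_matrix S"
  have A: "invertible ?A" by (rule node_matrix_props[OF S_inv])
  have [measurable]: "h \<in> borel_measurable borel" using h(1) by auto
  have "(LINT v:unit_cube|lborel. (\<Sum>m\<in>F. h (node S v m)))
    = (\<integral>v. indicator unit_cube v *\<^sub>R (\<Sum>m\<in>F. h (?A *v (v + m))) \<partial>lborel)"
    by (simp add: set_lebesgue_integral_def node_eq add.commute)
  also have "\<dots> = (\<integral>x. h (?A *v x) \<partial>lborel)"
    using cover F h
    by (intro integral_tiling[symmetric] integrable_linear_change[OF A]) (auto simp: node_eq add.commute)
  also have "\<dots> = of_real (\<bar>det S\<bar> * \<bar>det ?A\<bar>) * (\<integral>x. h (?A *v x) \<partial>lborel)"
    by (simp only: node_matrix_props(2)[OF S_inv] of_real_1 mult_1)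
  also have "\<dots> = of_real \<bar>det S\<bar> * (\<integral>x. h x \<partial>lborel)"
    by (subst integral_linear_change[OF A, of h, symmetric]) (simp_all add: scaleR_conv_of_real mult.assoc)
  finally show ?thesis .
qed

lemma integrable_cube_supported:
  fixes h :: "real^'d \<Rightarrow> 'b::euclidean_space"
  assumes "continuous_on UNIV h" "\<And>x. x \<notin> unit_cube \<Longrightarrow> h x = 0"
  shows "integrable lborel h"
proof -
  have "integrable lborel (\<lambda>x. indicator unit_cube x *\<^sub>R h x)"
    by (rule borel_integrable_compact[OF compact_cbox]) (rule continuous_on_subset[OF assms(1)], simp)
  also have "(\<lambda>x. indicator unit_cube x *\<^sub>R h x) = h"
    using assms(2) by (auto split: split_indicator)
  finally show ?thesis .
qed

text \<open>Poisson summation: from \<open>transpose S *v node S v m = m + v\<close> and the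
  integrality of \<open>k \<bullet> m\<close>, the character of frequency \<open>k\<close> at
  \<open>v\<close> equals the character of frequency \<open>S *v k\<close> at every node. Tiling
  then unfolds the sum over the nodes into a single integral.\<close>

lemma fourier_coeff_periodize:
  assumes g: "continuous_on UNIV g" "\<And>x. x \<notin> unit_cube \<Longrightarrow> g x = 0" and k: "k \<in> int_lattice"
  shows "fourier_coeff (periodize g) k = fourier_coeff g (S *v k)"
proof -
  let ?h = "\<lambda>y. g y * chr (- (S *v k)) y"
  have chr_node: "chr (- k) v = chr (- (S *v k)) (node S v m)" if "m \<in> int_lattice" for v m
  proof -
    have "chr (- (S *v k)) (node S v m) = chr (- k) (transpose S *v node S v m)"
    proof -
      have "k \<bullet> (transpose S *v y) = (S *v k) \<bullet> y" for y
        by (metis dot_lmul_matrix inner_commute transpose_matrix_vector)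
      then show ?thesis by (simp add: chr_def del: transpose_matrix_vector)
    qed
    also have "\<dots> = chr (- k) m * chr (- k) v"
      unfolding node_eq node_matrix_props(3)[OF S_inv] by (rule chr_add_right)
    finally show ?thesis using that k by (simp add: chr_int int_lattice_closed)
  qed
  have "fourier_coeff (periodize g) k
    = (LINT v:unit_cube|lborel. complex_of_real (1 / \<bar>det S\<bar>) * (\<Sum>m\<in>F. ?h (node S v m)))"
    unfolding fourier_coeff_def periodize_def mult.assoc sum_distrib_right
    using F chr_node by (intro set_lebesgue_integral_cong) (auto intro!: arg_cong2[of _ _ _ _ "(*)"] sum.cong)
  also have "\<dots> = complex_of_real (1 / \<bar>det S\<bar>) * (of_real \<bar>det S\<bar> * (\<integral>x. ?h x \<partial>lborel))"
    using g by (subst set_integral_mult_right, subst integral_periodize)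
      (auto intro!: integrable_cube_supported continuous_intros)
  also have "\<dots> = (\<integral>x. ?h x \<partial>lborel)" using det_S by simp
  also have "\<dots> = fourier_coeff g (S *v k)"
    unfolding fourier_coeff_def set_lebesgue_integral_def
    using g(2) by (intro Bochner_Integration.integral_cong refl) (auto split: split_indicator)
  finally show ?thesis .
qed

text \<open>Bessel's inequality for the periodization, whose square is estimated by Cauchy-Schwarz
  over its at most \<open>N\<close> nonzero terms; unfolding the sum of squares returns one factor
  \<open>|det S|\<close>. The remaining factor \<open>N / |det S|\<close> is bounded when the nodes
  are about as many as the determinant suggests.\<close>

lemma periodize_bessel:
  fixes g :: "real^'d \<Rightarrow> complex"
  assumes g: "continuous_on UNIV g" "\<And>x. x \<notin> unit_cube \<Longrightarrow> g x = 0"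
    and K: "finite K" "K \<subseteq> int_lattice"
  shows "(\<Sum>k\<in>K. (norm (fourier_coeff g (S *v k)))\<^sup>2) \<le> real N / \<bar>det S\<bar> * (\<integral>x. (norm (g x))\<^sup>2 \<partial>lborel)"
proof -
  have pt: "(norm (periodize g v))\<^sup>2 \<le> (1 / \<bar>det S\<bar>)\<^sup>2 * real N * (\<Sum>m\<in>F. (norm (g (node S v m)))\<^sup>2)"
    if v: "v \<in> unit_cube" for v
  proof -
    let ?M = "{m \<in> F. node S v m \<in> unit_cube}"
    have fin: "finite ?M" using F by simp
    have "norm (\<Sum>m\<in>F. g (node S v m)) = norm (\<Sum>m\<in>?M. g (node S v m))"
      using F g(2) by (intro arg_cong[of _ _ norm] sum.mono_neutral_right) auto
    also have "\<dots> \<le> (\<Sum>m\<in>?M. norm (g (node S v m)))" by (rule norm_sum)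
    finally have "(norm (\<Sum>m\<in>F. g (node S v m)))\<^sup>2 \<le> (\<Sum>m\<in>?M. norm (g (node S v m)))\<^sup>2"
      by (intro power_mono) auto
    also have "\<dots> \<le> (\<Sum>m\<in>?M. (norm (g (node S v m)))\<^sup>2) * real (card ?M)"
      by (rule sum_squared_le_sum_of_squares)
    also have "\<dots> \<le> (\<Sum>m\<in>F. (norm (g (node S v m)))\<^sup>2) * real N"
      using few[OF v] F by (intro mult_mono sum_mono2 sum_nonneg) auto
    finally have le: "(norm (\<Sum>m\<in>F. g (node S v m)))\<^sup>2 \<le> (\<Sum>m\<in>F. (norm (g (node S v m)))\<^sup>2) * real N" .
    have "(norm (periodize g v))\<^sup>2 = (1 / \<bar>det S\<bar>)\<^sup>2 * (norm (\<Sum>m\<in>F. g (node S v m)))\<^sup>2"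
      unfolding periodize_def norm_mult norm_of_real power_mult_distrib by simp
    also have "\<dots> \<le> (1 / \<bar>det S\<bar>)\<^sup>2 * ((\<Sum>m\<in>F. (norm (g (node S v m)))\<^sup>2) * real N)"
      using le by (rule mult_left_mono) simp
    finally show ?thesis by (simp add: mult_ac)
  qed
  have cont: "continuous_on A (\<lambda>v. (norm (g (node S v m)))\<^sup>2)" for A m
    by (intro continuous_intros continuous_on_compose2[OF g(1) node_cont]) auto
  have "(\<Sum>k\<in>K. (norm (fourier_coeff g (S *v k)))\<^sup>2) = (\<Sum>k\<in>K. (norm (fourier_coeff (periodize g) k))\<^sup>2)"
    using K g by (intro sum.cong) (auto simp: fourier_coeff_periodize)
  also have "\<dots> \<le> (LINT v:unit_cube|lborel. (norm (periodize g v))\<^sup>2)"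
    by (intro bessel periodize_cont g K)
  also have "\<dots> \<le> (LINT v:unit_cube|lborel. (1 / \<bar>det S\<bar>)\<^sup>2 * real N * (\<Sum>m\<in>F. (norm (g (node S v m)))\<^sup>2))"
    by (intro set_integral_mono set_integrable_cube continuous_intros periodize_cont g(1) cont pt)
  also have "\<dots> = (1 / \<bar>det S\<bar>)\<^sup>2 * real N * (of_real \<bar>det S\<bar> * (\<integral>x. (norm (g x))\<^sup>2 \<partial>lborel))"
    using g by (subst set_integral_mult_right, subst integral_periodize)
      (auto intro!: integrable_cube_supported continuous_intros)
  also have "\<dots> = real N / \<bar>det S\<bar> * (\<integral>x. (norm (g x))\<^sup>2 \<partial>lborel)"
  proof -
    have "(1 / D)\<^sup>2 * real N * (D * I) = real N / D * I" if "D > 0" for D I :: real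
      using that by (simp add: power2_eq_square)
    from this[OF det_S] show ?thesis by (simp only: of_real_eq_id id_apply)
  qed
  finally show ?thesis .
qed

end

lemma fourier_coeff_zero_freq:
  fixes g :: "real^'d::finite \<Rightarrow> real"
  assumes "\<And>x. x \<notin> unit_cube \<Longrightarrow> g x = 0"
  shows "fourier_coeff (\<lambda>x. complex_of_real (g x)) 0 = of_real (\<integral>x. g x \<partial>lborel)"
proof -
  have "fourier_coeff (\<lambda>x. complex_of_real (g x)) 0 = (\<integral>x. complex_of_real (g x) \<partial>lborel)"
    unfolding fourier_coeff_def set_lebesgue_integral_def
    using assms by (intro Bochner_Integration.integral_cong refl) (auto split: split_indicator)
  then show ?thesis by simp
qed

subsection \<open>Families of iterated partial derivatives\<close>

definition incr :: "'d \<Rightarrow> ('d \<Rightarrow> nat) \<Rightarrow> 'd \<Rightarrow> nat" where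
  "incr i \<alpha> = \<alpha>(i := Suc (\<alpha> i))"

lemma incr_apply [simp]: "incr i \<alpha> j = (if j = i then Suc (\<alpha> i) else \<alpha> j)"
  by (simp add: incr_def)

text \<open>A function bundled with all its partial derivatives; the function itself is the member
  at the zero multi-index. The index records no order of differentiation, so symmetry is built in,
  and derivatives are required only along coordinate lines, which is all that slicing needs.\<close>

definition deriv_family :: "(('d::finite \<Rightarrow> nat) \<Rightarrow> real^'d \<Rightarrow> real) \<Rightarrow> bool" where
  "deriv_family F \<longleftrightarrow> (\<forall>\<beta>. continuous_on UNIV (F \<beta>)) \<and>
     (\<forall>\<beta> i x t. ((\<lambda>t. F \<beta> (upd x i t)) has_real_derivative F (incr i \<beta>) (upd x i t)) (at t))"

lemma deriv_familyD:
  assumes "deriv_family F"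
  shows "continuous_on A (F \<beta>)"
    "((\<lambda>t. F \<beta> (upd x i t)) has_real_derivative F (incr i \<beta>) (upd x i t)) (at t)"
  using assms by (auto simp: deriv_family_def intro: continuous_on_subset)

lemma upd_cont [continuous_intros]:
  "continuous_on A f \<Longrightarrow> continuous_on A g \<Longrightarrow> continuous_on A (\<lambda>t. upd (f t) i (g t))"
proof -
  assume c: "continuous_on A f" "continuous_on A g"
  have "continuous_on A (\<lambda>t. if j = i then g t else f t $ j)" for j
    by (cases "j = i") (auto intro!: c continuous_intros)
  then show ?thesis unfolding upd_def by (rule continuous_on_vec_lambda)
qed

lemma deriv_family_slice_cont:
  assumes "deriv_family F"
  shows "continuous_on A (\<lambda>t. F \<beta> (upd x i t))"
  by (rule continuous_on_compose2[OF deriv_familyD(1)[OF assms]]) (auto intro: continuous_intros)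

text \<open>Integration by parts: \<open>V\<close> is the derivative in direction \<open>i\<close>
  of the product \<open>U\<close> of \<open>F \<alpha>\<close> and the character. As
  \<open>U\<close> vanishes outside the cube, every line integral of \<open>V\<close> is
  zero.\<close>

lemma integral_deriv_family_zero:
  assumes F: "deriv_family F" and supp: "\<And>\<beta> x. x \<notin> unit_cube \<Longrightarrow> F \<beta> x = 0"
  shows "fourier_coeff (\<lambda>x. complex_of_real (F (incr i \<alpha>) x)) \<xi>
    = (2 * pi * \<xi> $ i * \<i>) * fourier_coeff (\<lambda>x. complex_of_real (F \<alpha> x)) \<xi>"
proof -
  let ?c = "2 * pi * (\<xi> $ i) * \<i>"
  define U where "U x = complex_of_real (F \<alpha> x) * chr (- \<xi>) x" for x
  define V where "V x = complex_of_real (F (incr i \<alpha>) x) * chr (- \<xi>) x - ?c * (complex_of_real (F \<alpha> x) * chr (- \<xi>) x)" for x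
  have Vc: "continuous_on A V" for A
    unfolding V_def by (intro continuous_intros deriv_familyD(1)[OF F])
  have V0: "V x = 0" and U0: "U x = 0" if "x \<notin> unit_cube" for x
    using supp that by (simp_all add: V_def U_def)
  have iV: "integrable lborel V"
  proof -
    have "integrable lborel (\<lambda>x. indicator unit_cube x *\<^sub>R V x)"
      by (rule borel_integrable_compact[OF compact_cbox Vc])
    also have "(\<lambda>x. indicator unit_cube x *\<^sub>R V x) = V"
      using V0 by (auto split: split_indicator)
    finally show ?thesis .
  qed
  have "(\<integral>x. V x \<partial>lborel) = 0"
  proof (rule integral_upd_zero[OF iV, of i])
    fix x :: "real^'a"
    have chr_d: "((\<lambda>t. chr (- \<xi>) (upd x i t)) has_vector_derivative - ?c * chr (- \<xi>) (upd x i t)) (at t within A)" for t A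
    proof -
      have "(\<lambda>t. chr (- \<xi>) (upd x i t)) = (\<lambda>t. chr (- \<xi>) (upd x i 0) * cis (- (2 * pi * \<xi> $ i) * t))"
        by (intro ext, subst chr_upd) simp
      moreover have "((\<lambda>t. cis (- (2 * pi * \<xi> $ i) * t)) has_vector_derivative - ?c * cis (- (2 * pi * \<xi> $ i) * t)) (at t within A)"
        unfolding cis_conv_exp
        by (rule has_vector_derivative_eq_rhs, rule field_vector_diff_chain_within[of _ "- ?c", unfolded o_def])
          (auto intro!: derivative_eq_intros)
      ultimately have "((\<lambda>t. chr (- \<xi>) (upd x i t)) has_vector_derivative
         chr (- \<xi>) (upd x i 0) * (- ?c * cis (- (2 * pi * \<xi> $ i) * t))) (at t within A)"
        by (simp only: has_vector_derivative_mult_right)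
      also have "chr (- \<xi>) (upd x i 0) * (- ?c * cis (- (2 * pi * \<xi> $ i) * t)) = - ?c * chr (- \<xi>) (upd x i t)"
        by (subst chr_upd[of _ x i t]) simp
      finally show ?thesis .
    qed
    \<comment> \<open>The interval exceeds the unit interval on both sides, so its endpoints give
      points outside the closed cube, where the boundary terms vanish.\<close>
    have "((\<lambda>t. U (upd x i t)) has_vector_derivative V (upd x i t)) (at t within {-1..2})" for t
    proof -
      have "((\<lambda>t. complex_of_real (F \<alpha> (upd x i t))) has_vector_derivative complex_of_real (F (incr i \<alpha>) (upd x i t))) (at t within {-1..2})"
        using deriv_familyD(2)[OF F, of \<alpha> x i t]
        by (intro has_vector_derivative_of_real)
          (auto simp: has_real_derivative_iff_has_vector_derivative intro: has_vector_derivative_at_within)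
      from has_vector_derivative_mult[OF this chr_d]
      show ?thesis by (simp add: U_def V_def algebra_simps)
    qed
    then have "(\<integral>t. indicator {-1..2} t *\<^sub>R V (upd x i t) \<partial>lborel) = U (upd x i 2) - U (upd x i (-1))"
      by (intro integral_FTC_atLeastAtMost continuous_on_compose2[OF Vc[of UNIV]] continuous_intros) auto
    also have "\<dots> = 0"
    proof -
      have "upd x i 2 \<notin> unit_cube" "upd x i (-1) \<notin> unit_cube" by (auto simp: mem_unit_cube intro!: exI[of _ i])
      then show ?thesis by (simp add: U0)
    qed
    also have "(\<lambda>t. indicator {-1..2} t *\<^sub>R V (upd x i t)) = (\<lambda>t. V (upd x i t))"
    proof
      fix t :: real
      have "upd x i t \<notin> unit_cube" if "t \<notin> {-1..2}" using that by (auto simp: mem_unit_cube intro!: exI[of _ i])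
      then show "indicator {-1..2} t *\<^sub>R V (upd x i t) = V (upd x i t)"
        using V0 by (auto split: split_indicator)
    qed
    finally show "(\<integral>t. V (upd x i t) \<partial>lborel) = 0" .
  qed
  also have "(\<integral>x. V x \<partial>lborel) = (LINT x:unit_cube|lborel. V x)"
    unfolding set_lebesgue_integral_def
    using V0 by (intro Bochner_Integration.integral_cong refl) (auto split: split_indicator)
  also have "\<dots> = fourier_coeff (\<lambda>x. complex_of_real (F (incr i \<alpha>) x)) \<xi> - ?c * fourier_coeff (\<lambda>x. complex_of_real (F \<alpha> x)) \<xi>"
  proof -
    have i1: "set_integrable lborel unit_cube (\<lambda>x. complex_of_real (F \<beta> x) * chr (- \<xi>) x)" for \<beta>
      by (intro set_integrable_cube continuous_intros deriv_familyD(1)[OF F])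
    have i2: "set_integrable lborel unit_cube (\<lambda>x. ?c * (complex_of_real (F \<alpha> x) * chr (- \<xi>) x))"
      by (intro set_integrable_cube continuous_intros deriv_familyD(1)[OF F])
    show ?thesis
      unfolding V_def fourier_coeff_def set_integral_diff(2)[OF i1 i2] set_integral_mult_right ..
  qed
  finally show ?thesis by simp
qed

lemma norm_fourier_coeff_deriv_family:
  fixes F :: "('d::finite \<Rightarrow> nat) \<Rightarrow> real^'d \<Rightarrow> real"
  assumes F: "deriv_family F" and supp: "\<And>\<beta> x. x \<notin> unit_cube \<Longrightarrow> F \<beta> x = 0"
  shows "norm (fourier_coeff (\<lambda>x. complex_of_real (F \<alpha> x)) \<xi>)
    = (\<Prod>j\<in>UNIV. (2 * pi * \<bar>\<xi> $ j\<bar>) ^ \<alpha> j) * norm (fourier_coeff (\<lambda>x. complex_of_real (F (\<lambda>_. 0) x)) \<xi>)"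
proof (induction "\<Sum>j\<in>UNIV. \<alpha> j" arbitrary: \<alpha>)
  case 0
  then have "\<alpha> = (\<lambda>_. 0)" by auto
  then show ?case by simp
next
  case (Suc n)
  then have "\<exists>i. \<alpha> i \<noteq> 0" by (metis sum.neutral old.nat.distinct(2))
  then obtain i where i: "\<alpha> i \<noteq> 0" by blast
  define \<beta> where "\<beta> = \<alpha>(i := \<alpha> i - 1)"
  have \<alpha>: "\<alpha> = incr i \<beta>" using i by (auto simp: \<beta>_def incr_def)
  have "(\<Sum>j\<in>UNIV. \<alpha> j) = Suc (\<Sum>j\<in>UNIV. \<beta> j)"
    unfolding \<alpha> by (simp add: sum.remove[of UNIV i])
  then have n: "n = (\<Sum>j\<in>UNIV. \<beta> j)" using Suc.hyps(2) by simp
  have "(\<Prod>j\<in>UNIV. (2 * pi * \<bar>\<xi> $ j\<bar>) ^ \<alpha> j) = (2 * pi * \<bar>\<xi> $ i\<bar>) * (\<Prod>j\<in>UNIV. (2 * pi * \<bar>\<xi> $ j\<bar>) ^ \<beta> j)"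
    unfolding \<alpha> by (simp add: prod.remove[of UNIV i])
  moreover have "norm (fourier_coeff (\<lambda>x. complex_of_real (F \<alpha> x)) \<xi>)
      = (2 * pi * \<bar>\<xi> $ i\<bar>) * norm (fourier_coeff (\<lambda>x. complex_of_real (F \<beta> x)) \<xi>)"
  proof -
    have "fourier_coeff (\<lambda>x. complex_of_real (F \<alpha> x)) \<xi> = (2 * pi * \<xi> $ i * \<i>) * fourier_coeff (\<lambda>x. complex_of_real (F \<beta> x)) \<xi>"
      unfolding \<alpha> using supp by (rule integral_deriv_family_zero[OF F])
    then show ?thesis by (simp add: norm_mult abs_mult)
  qed
  ultimately show ?case using Suc.hyps(1)[OF n] by simp
qed

subsection \<open>Pulling back along the change of variables\<close>

text \<open>In one variable, the \<open>k\<close>-th derivative of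
  \<open>f (\<psi> t) * deriv \<psi> t\<close> is the sum over \<open>j\<close> of
  \<open>(deriv ^^ j) f (\<psi> t) * pcoef \<psi> k j t\<close>. The start accounts for the
  Jacobian, the recursion is the product and chain rule.\<close>

primrec pcoef :: "(real \<Rightarrow> real) \<Rightarrow> nat \<Rightarrow> nat \<Rightarrow> real \<Rightarrow> real" where
  "pcoef \<psi> 0 = (\<lambda>j x. if j = 0 then deriv \<psi> x else 0)"
| "pcoef \<psi> (Suc k) = (\<lambda>j x. deriv (pcoef \<psi> k j) x +
     (case j of 0 \<Rightarrow> 0 | Suc l \<Rightarrow> pcoef \<psi> k l x * deriv \<psi> x))"

text \<open>The algebra without constants generated by the derivatives of \<open>\<psi>\<close>. It
  is closed under differentiation, and every generator vanishes off the open unit interval; so each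
  \<open>pcoef\<close> is differentiable and inherits this support.\<close>

inductive_set deriv_algebra :: "(real \<Rightarrow> real) \<Rightarrow> (real \<Rightarrow> real) set" for \<psi> where
  zero: "(\<lambda>_. 0) \<in> deriv_algebra \<psi>"
| gen: "(deriv ^^ Suc k) \<psi> \<in> deriv_algebra \<psi>"
| add: "f \<in> deriv_algebra \<psi> \<Longrightarrow> g \<in> deriv_algebra \<psi> \<Longrightarrow> (\<lambda>x. f x + g x) \<in> deriv_algebra \<psi>"
| mult: "f \<in> deriv_algebra \<psi> \<Longrightarrow> g \<in> deriv_algebra \<psi> \<Longrightarrow> (\<lambda>x. f x * g x) \<in> deriv_algebra \<psi>"

context
  fixes \<psi> :: "real \<Rightarrow> real"
  assumes adm: "admissible_psi \<psi>"
begin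

lemma deriv_algebra_closed:
  "f \<in> deriv_algebra \<psi> \<Longrightarrow> deriv f \<in> deriv_algebra \<psi> \<and> (\<forall>x. (f has_real_derivative deriv f x) (at x))"
proof (induction rule: deriv_algebra.induct)
  case zero
  then show ?case using deriv_algebra.zero by simp
next
  case (gen k)
  have "deriv ((deriv ^^ Suc k) \<psi>) = (deriv ^^ Suc (Suc k)) \<psi>" by simp
  then show ?case using deriv_algebra.gen[of "Suc k" \<psi>] psi_funpow_deriv[OF adm, of "Suc k"] by simp
next
  case (add f g)
  have d: "((\<lambda>x. f x + g x) has_real_derivative deriv f x + deriv g x) (at x)" for x
    using add by (intro DERIV_add) auto
  then have "deriv (\<lambda>x. f x + g x) = (\<lambda>x. deriv f x + deriv g x)" by (auto intro: DERIV_imp_deriv)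
  then show ?case using add d by (auto intro: deriv_algebra.intros)
next
  case (mult f g)
  have d: "((\<lambda>x. f x * g x) has_real_derivative deriv f x * g x + f x * deriv g x) (at x)" for x
    using DERIV_mult'[of f "deriv f x" x UNIV g "deriv g x"] mult by (simp add: add.commute)
  then have "deriv (\<lambda>x. f x * g x) = (\<lambda>x. deriv f x * g x + f x * deriv g x)" by (auto intro: DERIV_imp_deriv)
  then show ?case using mult d by (auto intro!: deriv_algebra.intros)
qed

lemma deriv_algebra_outside: "f \<in> deriv_algebra \<psi> \<Longrightarrow> x \<le> 0 \<or> 1 \<le> x \<Longrightarrow> f x = 0"
  by (induction rule: deriv_algebra.induct) (use psi_funpow_outside[OF adm] in auto)

lemma pcoef_mem: "pcoef \<psi> k j \<in> deriv_algebra \<psi>"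
proof (induction k arbitrary: j)
  case 0
  show ?case using deriv_algebra.gen[of 0 \<psi>] deriv_algebra.zero by (cases "j = 0") auto
next
  case (Suc k)
  have "deriv (pcoef \<psi> k j) \<in> deriv_algebra \<psi>" using deriv_algebra_closed[OF Suc] by blast
  moreover have "(\<lambda>x. case j of 0 \<Rightarrow> 0 | Suc l \<Rightarrow> pcoef \<psi> k l x * deriv \<psi> x) \<in> deriv_algebra \<psi>"
    using deriv_algebra.gen[of 0 \<psi>] Suc by (cases j) (auto intro!: deriv_algebra.intros)
  ultimately show ?case by (auto intro: deriv_algebra.add)
qed

lemma pcoef_deriv: "(pcoef \<psi> k j has_real_derivative deriv (pcoef \<psi> k j) x) (at x)"
  using deriv_algebra_closed[OF pcoef_mem] by blast

lemma pcoef_cont: "continuous_on A (pcoef \<psi> k j)"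
  by (intro continuous_at_imp_continuous_on ballI DERIV_isCont[OF pcoef_deriv])

lemma pcoef_measurable: "pcoef \<psi> k j \<in> borel_measurable borel"
  by (intro borel_measurable_continuous_onI pcoef_cont)

lemma pcoef_outside: "x \<notin> {0..1} \<Longrightarrow> pcoef \<psi> k j x = 0"
  using deriv_algebra_outside[OF pcoef_mem, of x k j] by auto

lemma pcoef_above: "k < j \<Longrightarrow> pcoef \<psi> k j = (\<lambda>_. 0)"
  by (induction k arbitrary: j) (auto split: nat.split)

lemma pcoef_diag: "pcoef \<psi> k k = (\<lambda>x. deriv \<psi> x ^ Suc k)"
  by (induction k) (auto simp: pcoef_above)

lemma pcoef_bounded: obtains M where "0 \<le> M" "\<And>x. (pcoef \<psi> k j x)\<^sup>2 \<le> M"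
proof -
  obtain b where b: "\<And>x. x \<in> {0..1} \<Longrightarrow> \<bar>pcoef \<psi> k j x\<bar> \<le> b"
    using compact_imp_bounded[OF compact_continuous_image[OF pcoef_cont compact_Icc[of 0 1]]]
    unfolding bounded_iff by (metis imageI real_norm_def)
  have "(pcoef \<psi> k j x)\<^sup>2 \<le> b\<^sup>2" for x
    using b[of x] pcoef_outside[of x k j] by (cases "x \<in> {0..1}") (auto simp: abs_le_square_iff[symmetric])
  then show thesis using that[of "b\<^sup>2"] by simp
qed

text \<open>The diagonal weight is the power \<open>deriv \<psi> x ^ Suc k\<close>. Of its square,
  \<open>2 * k + 1\<close> factors are bounded by a constant and the last one is kept as the
  Jacobian of the substitution.\<close>

lemma pcoef_diag_bounded: obtains M where "0 \<le> M" "\<And>x. (pcoef \<psi> k k x)\<^sup>2 \<le> M * deriv \<psi> x"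
proof -
  obtain b where b: "0 \<le> b" "\<And>x. (pcoef \<psi> 0 0 x)\<^sup>2 \<le> b" using pcoef_bounded[of 0 0] by blast
  have le: "deriv \<psi> x \<le> sqrt b" for x using b(2)[of x] by (simp add: real_le_rsqrt)
  have "(pcoef \<psi> k k x)\<^sup>2 \<le> sqrt b ^ (2 * k + 1) * deriv \<psi> x" for x
  proof -
    have "(pcoef \<psi> k k x)\<^sup>2 = deriv \<psi> x ^ (2 * k + 1) * deriv \<psi> x"
      by (simp add: pcoef_diag power_mult_distrib power_mult[symmetric] power2_eq_square mult.commute
          flip: power_add mult_2)
    also have "\<dots> \<le> sqrt b ^ (2 * k + 1) * deriv \<psi> x"
      using psi_deriv_nonneg[OF adm] le by (intro mult_right_mono power_mono) auto
    finally show ?thesis .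
  qed
  then show thesis by (rule that[rotated]) (use b(1) in simp)
qed

end

text \<open>The one-dimensional Sobolev inequality in squared form. The fundamental theorem of
  calculus for \<open>\<phi>\<^sup>2\<close> gives
  \<open>(\<phi> y)\<^sup>2 \<le> (\<phi> s)\<^sup>2 + ?I\<close> for every \<open>s\<close> in the
  unit interval, and averaging over \<open>s\<close> removes the unknown value.\<close>

lemma sq_le_integral_deriv:
  fixes \<phi> :: "real \<Rightarrow> real"
  assumes d: "\<And>t. (\<phi> has_real_derivative \<phi>' t) (at t)" and c: "continuous_on UNIV \<phi>'"
    and y: "y \<in> {0..1}"
  shows "(\<phi> y)\<^sup>2 \<le> (\<integral>t. indicator {0..1} t *\<^sub>R (2 * (\<phi> t)\<^sup>2 + (\<phi>' t)\<^sup>2) \<partial>lborel)"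
proof -
  have c0: "continuous_on A \<phi>" for A
    by (intro continuous_at_imp_continuous_on ballI DERIV_isCont[OF d])
  have c1: "continuous_on A \<phi>'" for A by (rule continuous_on_subset[OF c]) simp
  let ?I = "\<integral>t. indicator {0..1} t *\<^sub>R ((\<phi> t)\<^sup>2 + (\<phi>' t)\<^sup>2) \<partial>lborel"
  have ci: "integrable lborel (\<lambda>t. indicator {a..b} t *\<^sub>R f t)" if "continuous_on UNIV f" for a b and f :: "real \<Rightarrow> real"
    by (rule borel_integrable_compact[OF compact_Icc]) (rule continuous_on_subset[OF that], simp)
  have ftc: "\<bar>(\<phi> b)\<^sup>2 - (\<phi> a)\<^sup>2\<bar> \<le> ?I" if "0 \<le> a" "a \<le> b" "b \<le> 1" for a b
  proof -
    have "((\<lambda>t. (\<phi> t)\<^sup>2) has_vector_derivative 2 * \<phi> t * \<phi>' t) (at t within {a..b})" for t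
      unfolding has_real_derivative_iff_has_vector_derivative[symmetric]
      by (rule DERIV_subset[of _ _ _ UNIV]) (auto intro!: derivative_eq_intros d)
    then have "(\<integral>t. indicator {a..b} t *\<^sub>R (2 * \<phi> t * \<phi>' t) \<partial>lborel) = (\<phi> b)\<^sup>2 - (\<phi> a)\<^sup>2"
      using that by (intro integral_FTC_atLeastAtMost continuous_intros c0 c1) auto
    then have "\<bar>(\<phi> b)\<^sup>2 - (\<phi> a)\<^sup>2\<bar> \<le> (\<integral>t. norm (indicator {a..b} t *\<^sub>R (2 * \<phi> t * \<phi>' t)) \<partial>lborel)"
      using integral_norm_bound[of lborel "\<lambda>t. indicator {a..b} t *\<^sub>R (2 * \<phi> t * \<phi>' t)"] by simp
    also have "\<dots> \<le> ?I"
    proof (intro integral_mono integrable_norm ci continuous_intros c0 c1)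
      fix t :: real
      have "\<bar>2 * \<phi> t * \<phi>' t\<bar> \<le> (\<phi> t)\<^sup>2 + (\<phi>' t)\<^sup>2"
        using sum_squares_bound[of "\<bar>\<phi> t\<bar>" "\<bar>\<phi>' t\<bar>"] by (simp add: abs_mult)
      then show "norm (indicator {a..b} t *\<^sub>R (2 * \<phi> t * \<phi>' t)) \<le> indicator {0..1} t *\<^sub>R ((\<phi> t)\<^sup>2 + (\<phi>' t)\<^sup>2)"
        using that by (auto split: split_indicator)
    qed
    finally show ?thesis .
  qed
  have le: "(\<phi> y)\<^sup>2 \<le> (\<phi> s)\<^sup>2 + ?I" if "s \<in> {0..1}" for s
    using ftc[of s y] ftc[of y s] y that by (cases "s \<le> y") (auto simp: abs_le_iff)
  have const: "(\<integral>s. indicator {0..1::real} s *\<^sub>R c \<partial>lborel) = (c::real)" for c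
    by simp
  have "(\<phi> y)\<^sup>2 = (\<integral>s. indicator {0..1::real} s *\<^sub>R (\<phi> y)\<^sup>2 \<partial>lborel)" by (rule const[symmetric])
  also have "\<dots> \<le> (\<integral>s. indicator {0..1::real} s *\<^sub>R ((\<phi> s)\<^sup>2 + ?I) \<partial>lborel)"
    by (intro integral_mono ci continuous_intros c0) (use le in \<open>auto split: split_indicator\<close>)
  also have "\<dots> = (\<integral>s. indicator {0..1::real} s *\<^sub>R (\<phi> s)\<^sup>2 \<partial>lborel) + (\<integral>s. indicator {0..1::real} s *\<^sub>R ?I \<partial>lborel)"
    unfolding scaleR_add_right by (intro Bochner_Integration.integral_add ci continuous_intros c0)
  also have "\<dots> = (\<integral>s. indicator {0..1::real} s *\<^sub>R (\<phi> s)\<^sup>2 \<partial>lborel) + ?I" unfolding const ..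
  also have "\<dots> = (\<integral>t. indicator {0..1} t *\<^sub>R (2 * (\<phi> t)\<^sup>2 + (\<phi>' t)\<^sup>2) \<partial>lborel)"
    by (subst Bochner_Integration.integral_add[symmetric], (intro ci continuous_intros c0 c1)+)
      (auto intro!: Bochner_Integration.integral_cong simp: algebra_simps)
  finally show ?thesis .
qed

context
  fixes \<psi> :: "real \<Rightarrow> real"
  assumes adm: "admissible_psi \<psi>"
begin

text \<open>On the diagonal the weight absorbs the Jacobian; below it the weight need not be bounded by
  the Jacobian, and one derivative of \<open>\<phi>\<close> is spent on a sup-norm bound instead.\<close>

lemma pcoef_integral_bound:
  obtains M :: real where "M \<ge> 0"
    "\<And>\<phi> \<phi>'. (\<And>t. (\<phi> has_real_derivative \<phi>' t) (at t)) \<Longrightarrow> continuous_on UNIV \<phi>' \<Longrightarrow>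
       (\<integral>\<^sup>+t. ennreal ((\<phi> (\<psi> t))\<^sup>2) * ennreal ((pcoef \<psi> k j t)\<^sup>2) \<partial>lborel)
       \<le> ennreal M * ((\<integral>\<^sup>+t. ennreal ((\<phi> t)\<^sup>2) * indicator {0..1} t \<partial>lborel) +
           (if j < k then (\<integral>\<^sup>+t. ennreal ((\<phi>' t)\<^sup>2) * indicator {0..1} t \<partial>lborel) else 0))"
proof -
  have meas: "\<phi> \<in> borel_measurable borel" if "\<And>t. (\<phi> has_real_derivative \<phi>' t) (at t)" for \<phi> \<phi>' :: "real \<Rightarrow> real"
    by (intro borel_measurable_continuous_onI continuous_at_imp_continuous_on ballI DERIV_isCont[OF that])
  note [measurable] = psi_measurable[OF adm] psi_deriv_measurable[OF adm] pcoef_measurable[OF adm]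
  consider "k < j" | "j = k" | "j < k" by linarith
  then show thesis
  proof cases
    case 1
    then show thesis using that[of 0] by (simp add: pcoef_above[OF adm])
  next
    case 2
    obtain M where M: "0 \<le> M" "\<And>x. (pcoef \<psi> k k x)\<^sup>2 \<le> M * deriv \<psi> x"
      using pcoef_diag_bounded[OF adm, of k] by blast
    show thesis
    proof (rule that[OF M(1)])
      fix \<phi> \<phi>' :: "real \<Rightarrow> real"
      assume d: "\<And>t. (\<phi> has_real_derivative \<phi>' t) (at t)"
      note meas[OF d, measurable]
      have "(\<integral>\<^sup>+t. ennreal ((\<phi> (\<psi> t))\<^sup>2) * ennreal ((pcoef \<psi> k j t)\<^sup>2) \<partial>lborel)
        \<le> (\<integral>\<^sup>+t. ennreal M * (ennreal ((\<phi> (\<psi> t))\<^sup>2) * ennreal (deriv \<psi> t)) \<partial>lborel)"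
      proof (rule nn_integral_mono)
        fix t :: real
        have "ennreal ((\<phi> (\<psi> t))\<^sup>2) * ennreal ((pcoef \<psi> k j t)\<^sup>2) \<le> ennreal ((\<phi> (\<psi> t))\<^sup>2) * ennreal (M * deriv \<psi> t)"
          using M(2)[of t] 2 by (intro mult_left_mono ennreal_leI) auto
        then show "ennreal ((\<phi> (\<psi> t))\<^sup>2) * ennreal ((pcoef \<psi> k j t)\<^sup>2) \<le> ennreal M * (ennreal ((\<phi> (\<psi> t))\<^sup>2) * ennreal (deriv \<psi> t))"
          using M(1) psi_deriv_nonneg[OF adm, of t] by (simp add: ennreal_mult mult_ac)
      qed
      also have "\<dots> = ennreal M * (\<integral>\<^sup>+t. ennreal ((\<phi> t)\<^sup>2) * indicator {0..1} t \<partial>lborel)"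
        by (subst nn_integral_cmult, measurable) (subst nn_integral_psi[OF adm, of "\<lambda>t. ennreal ((\<phi> t)\<^sup>2)"], auto)
      finally show "(\<integral>\<^sup>+t. ennreal ((\<phi> (\<psi> t))\<^sup>2) * ennreal ((pcoef \<psi> k j t)\<^sup>2) \<partial>lborel)
       \<le> ennreal M * ((\<integral>\<^sup>+t. ennreal ((\<phi> t)\<^sup>2) * indicator {0..1} t \<partial>lborel) +
           (if j < k then (\<integral>\<^sup>+t. ennreal ((\<phi>' t)\<^sup>2) * indicator {0..1} t \<partial>lborel) else 0))"
        using 2 by simp
    qed
  next
    case 3
    obtain M where M: "0 \<le> M" "\<And>x. (pcoef \<psi> k j x)\<^sup>2 \<le> M" using pcoef_bounded[OF adm, of k j] by blast
    \<comment> \<open>The 2 comes from the term \<open>2 * (\<phi> t)\<^sup>2\<close> of the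
      sup-norm bound.\<close>
    show thesis
    proof (rule that[of "2 * M"])
      show "0 \<le> 2 * M" using M(1) by simp
      fix \<phi> \<phi>' :: "real \<Rightarrow> real"
      assume d: "\<And>t. (\<phi> has_real_derivative \<phi>' t) (at t)" and c: "continuous_on UNIV \<phi>'"
      note meas[OF d, measurable] borel_measurable_continuous_onI[OF c, measurable]
      let ?R = "(\<integral>\<^sup>+t. ennreal ((\<phi> t)\<^sup>2) * indicator {0..1} t \<partial>lborel) + (\<integral>\<^sup>+t. ennreal ((\<phi>' t)\<^sup>2) * indicator {0..1} t \<partial>lborel)"
      let ?B = "\<integral>t. indicator {0..1} t *\<^sub>R (2 * (\<phi> t)\<^sup>2 + (\<phi>' t)\<^sup>2) \<partial>lborel"
      have c0: "continuous_on A \<phi>" for A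
        by (intro continuous_at_imp_continuous_on ballI DERIV_isCont[OF d])
      have B: "ennreal ?B \<le> 2 * ?R"
      proof -
        have "ennreal ?B = (\<integral>\<^sup>+t. ennreal (indicator {0..1} t *\<^sub>R (2 * (\<phi> t)\<^sup>2 + (\<phi>' t)\<^sup>2)) \<partial>lborel)"
          by (intro nn_integral_eq_integral[symmetric] borel_integrable_compact compact_Icc continuous_intros c0
            continuous_on_subset[OF c]) auto
        also have "\<dots> \<le> (\<integral>\<^sup>+t. 2 * (ennreal ((\<phi> t)\<^sup>2) * indicator {0..1} t + ennreal ((\<phi>' t)\<^sup>2) * indicator {0..1} t) \<partial>lborel)"
        proof (rule nn_integral_mono)
          fix t :: real
          have "ennreal (2 * (\<phi> t)\<^sup>2 + (\<phi>' t)\<^sup>2) \<le> ennreal (2 * ((\<phi> t)\<^sup>2 + (\<phi>' t)\<^sup>2))" by (rule ennreal_leI) simp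
          also have "\<dots> = 2 * (ennreal ((\<phi> t)\<^sup>2) + ennreal ((\<phi>' t)\<^sup>2))"
            by (simp add: ennreal_mult)
          finally show "ennreal (indicator {0..1} t *\<^sub>R (2 * (\<phi> t)\<^sup>2 + (\<phi>' t)\<^sup>2)) \<le> 2 * (ennreal ((\<phi> t)\<^sup>2) * indicator {0..1} t + ennreal ((\<phi>' t)\<^sup>2) * indicator {0..1} t)"
            by (simp split: split_indicator)
        qed
        also have "\<dots> = 2 * ?R"
          by (subst nn_integral_cmult, measurable) (subst nn_integral_add, auto)
        finally show ?thesis .
      qed
      have "(\<integral>\<^sup>+t. ennreal ((\<phi> (\<psi> t))\<^sup>2) * ennreal ((pcoef \<psi> k j t)\<^sup>2) \<partial>lborel)
        \<le> (\<integral>\<^sup>+t. (ennreal ?B * ennreal M) * indicator {0..1::real} t \<partial>lborel)"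
      proof (rule nn_integral_mono)
        fix t :: real
        show "ennreal ((\<phi> (\<psi> t))\<^sup>2) * ennreal ((pcoef \<psi> k j t)\<^sup>2) \<le> (ennreal ?B * ennreal M) * indicator {0..1} t"
        proof (cases "t \<in> {0..1}")
          case True
          have "ennreal ((\<phi> (\<psi> t))\<^sup>2) * ennreal ((pcoef \<psi> k j t)\<^sup>2) \<le> ennreal ?B * ennreal M"
            using sq_le_integral_deriv[OF d c, of "\<psi> t"] psi_range[OF adm, of t] M(2)[of t]
            by (intro mult_mono ennreal_leI) auto
          then show ?thesis using True by simp
        next
          case False
          then show ?thesis using pcoef_outside[OF adm, of t k j] by simp
        qed
      qed
      also have "\<dots> = ennreal ?B * ennreal M" by (subst nn_integral_cmult_indicator) auto
      also have "\<dots> \<le> 2 * ?R * ennreal M" by (rule mult_right_mono[OF B]) simp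
      also have "\<dots> = ennreal (2 * M) * ?R" using M(1) by (simp add: ennreal_mult mult_ac)
      finally show "(\<integral>\<^sup>+t. ennreal ((\<phi> (\<psi> t))\<^sup>2) * ennreal ((pcoef \<psi> k j t)\<^sup>2) \<partial>lborel)
       \<le> ennreal (2 * M) * ((\<integral>\<^sup>+t. ennreal ((\<phi> t)\<^sup>2) * indicator {0..1} t \<partial>lborel) +
           (if j < k then (\<integral>\<^sup>+t. ennreal ((\<phi>' t)\<^sup>2) * indicator {0..1} t \<partial>lborel) else 0))"
        using 3 by simp
    qed
  qed
qed

text \<open>The member at \<open>\<alpha>\<close> is the derivative of order \<open>\<alpha>\<close>
  of \<open>(f \<circ> Psi \<psi>) * DPsi \<psi>\<close>, where \<open>f\<close> is the member of
  \<open>F\<close> at zero: the one-dimensional expansion with weights \<open>pcoef\<close>, taken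
  in every coordinate.\<close>

definition pullback :: "(('d::finite \<Rightarrow> nat) \<Rightarrow> real^'d \<Rightarrow> real) \<Rightarrow> ('d \<Rightarrow> nat) \<Rightarrow> real^'d \<Rightarrow> real" where
  "pullback F \<alpha> x = (\<Sum>\<beta>\<in>{..\<alpha>}. F \<beta> (Psi \<psi> x) * (\<Prod>i\<in>UNIV. pcoef \<psi> (\<alpha> i) (\<beta> i) (x $ i)))"

lemma finite_multiindices: "finite {..\<alpha> :: 'd::finite \<Rightarrow> nat}"
proof -
  have "{..\<alpha>} = PiE UNIV (\<lambda>i. {..\<alpha> i})" by (auto simp: le_fun_def PiE_def Pi_iff)
  then show ?thesis by (simp add: finite_PiE)
qed

lemma pullback_zero:
  fixes F :: "('d::finite \<Rightarrow> nat) \<Rightarrow> real^'d \<Rightarrow> real"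
  shows "pullback F (\<lambda>_. 0) x = F (\<lambda>_. 0) (Psi \<psi> x) * DPsi \<psi> x"
proof -
  have "{..(\<lambda>_::'d. 0::nat)} = {\<lambda>_. 0}" by (auto simp: le_fun_def)
  then show ?thesis unfolding pullback_def by (simp only: sum.insert sum.empty finite.emptyI empty_iff not_False_eq_True add_0_right) (simp add: DPsi_def)
qed

lemma pullback_outside: "x \<notin> unit_cube \<Longrightarrow> pullback F \<alpha> x = 0"
proof -
  assume "x \<notin> unit_cube"
  then obtain i where "x $ i \<notin> {0..1}" by (auto simp: mem_unit_cube)
  then have "(\<Prod>i\<in>UNIV. pcoef \<psi> (\<alpha> i) (\<beta> i) (x $ i)) = 0" for \<beta>
    by (intro prod_zero bexI[of _ i] pcoef_outside[OF adm]) auto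
  then show ?thesis unfolding pullback_def by (simp only: mult_zero_right sum.neutral_const)
qed

lemma Psi_upd: "Psi \<psi> (upd x i t) = upd (Psi \<psi> x) i (\<psi> t)"
  by (simp add: Psi_def vec_eq_iff)

text \<open>Differentiation in coordinate \<open>i\<close> hits either the weight
  \<open>pcoef \<psi> (\<alpha> i) (\<beta> i)\<close> or the argument of \<open>F \<beta>\<close>.
  The two resulting sums combine through the recursion of \<open>pcoef\<close>.\<close>

lemma pullback_family:
  fixes F :: "('d::finite \<Rightarrow> nat) \<Rightarrow> real^'d \<Rightarrow> real"
  assumes F: "deriv_family F"
  shows "deriv_family (pullback F)"
  unfolding deriv_family_def
proof (intro conjI allI)
  fix \<alpha> :: "'d \<Rightarrow> nat"
  show "continuous_on UNIV (pullback F \<alpha>)"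
    unfolding pullback_def
    by (intro continuous_intros continuous_on_compose2[OF deriv_familyD(1)[OF F] Psi_cont[OF adm]]
        continuous_on_compose2[OF pcoef_cont[OF adm, of UNIV]]) auto
  fix i and x :: "real^'d" and t
  let ?y = "upd (Psi \<psi> x) i (\<psi> t)"
  define R where "R \<beta> = (\<Prod>j\<in>UNIV - {i}. pcoef \<psi> (\<alpha> j) (\<beta> j) (x $ j))" for \<beta>
  have prod1: "(\<Prod>j\<in>UNIV. pcoef \<psi> (\<alpha> j) (\<beta> j) (upd x i t $ j)) = pcoef \<psi> (\<alpha> i) (\<beta> i) t * R \<beta>" for \<beta> t
    unfolding R_def by (rule prod_remove_upd[where f = "\<lambda>j. pcoef \<psi> (\<alpha> j) (\<beta> j)"])
  have prod2: "(\<Prod>j\<in>UNIV. pcoef \<psi> (incr i \<alpha> j) (\<beta> j) (upd x i t $ j)) = pcoef \<psi> (Suc (\<alpha> i)) (\<beta> i) t * R \<beta>" for \<beta>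
  proof -
    have "(\<Prod>j\<in>UNIV - {i}. pcoef \<psi> (incr i \<alpha> j) (\<beta> j) (x $ j)) = R \<beta>"
      unfolding R_def by (intro prod.cong) auto
    then show ?thesis
      using prod_remove_upd[where f = "\<lambda>j. pcoef \<psi> (incr i \<alpha> j) (\<beta> j)" and x = x and i = i and t = t]
      by (simp only: incr_apply if_True refl)
  qed
  have R_incr: "R (incr i \<beta>) = R \<beta>" for \<beta> unfolding R_def by (intro prod.cong) auto
  let ?D = "\<lambda>\<beta>. F (incr i \<beta>) ?y * deriv \<psi> t * (pcoef \<psi> (\<alpha> i) (\<beta> i) t * R \<beta>)
      + F \<beta> ?y * (deriv (pcoef \<psi> (\<alpha> i) (\<beta> i)) t * R \<beta>)"
  have chain: "((\<lambda>t. F \<beta> (upd (Psi \<psi> x) i (\<psi> t))) has_real_derivative F (incr i \<beta>) ?y * deriv \<psi> t) (at t)" for \<beta>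
    by (rule DERIV_chain2[OF deriv_familyD(2)[OF F] psi_deriv[OF adm]])
  have der: "((\<lambda>t. pullback F \<alpha> (upd x i t)) has_real_derivative (\<Sum>\<beta>\<in>{..\<alpha>}. ?D \<beta>)) (at t)"
    unfolding pullback_def prod1 Psi_upd
  proof (rule DERIV_sum)
    fix \<beta>
    have "((\<lambda>t. pcoef \<psi> (\<alpha> i) (\<beta> i) t * R \<beta>) has_real_derivative deriv (pcoef \<psi> (\<alpha> i) (\<beta> i)) t * R \<beta>) (at t)"
      by (rule DERIV_cmult_right[OF pcoef_deriv[OF adm]])
    from DERIV_mult[OF chain this]
    show "((\<lambda>t. F \<beta> (upd (Psi \<psi> x) i (\<psi> t)) * (pcoef \<psi> (\<alpha> i) (\<beta> i) t * R \<beta>)) has_real_derivative ?D \<beta>) (at t)"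
      by (simp add: algebra_simps)
  qed
  have mono: "{..\<alpha>} \<subseteq> {..incr i \<alpha>}" by (auto simp: le_fun_def incr_def intro: le_SucI)
  \<comment> \<open>The range may be enlarged to \<open>{..incr i \<alpha>}\<close>, as the weight
    is zero above the diagonal.\<close>
  have "(\<Sum>\<beta>\<in>{..\<alpha>}. F \<beta> ?y * (deriv (pcoef \<psi> (\<alpha> i) (\<beta> i)) t * R \<beta>))
    = (\<Sum>\<beta>\<in>{..incr i \<alpha>}. F \<beta> ?y * (deriv (pcoef \<psi> (\<alpha> i) (\<beta> i)) t * R \<beta>))"
  proof (rule sum.mono_neutral_left[OF finite_multiindices mono], intro ballI)
    fix \<beta> assume \<beta>: "\<beta> \<in> {..incr i \<alpha>} - {..\<alpha>}"
    then have "\<not> \<beta> i \<le> \<alpha> i" unfolding le_fun_def by (auto simp: le_fun_def split: if_splits)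
    then show "F \<beta> ?y * (deriv (pcoef \<psi> (\<alpha> i) (\<beta> i)) t * R \<beta>) = 0"
      by (simp add: pcoef_above[OF adm])
  qed
  \<comment> \<open>The chain rule raised the index of \<open>F\<close>; reindexing by
    \<open>incr i\<close> turns this into a lowered index of \<open>pcoef\<close>, the
    \<open>Suc\<close> case of its recursion.\<close>
  moreover have "(\<Sum>\<beta>\<in>{..\<alpha>}. F (incr i \<beta>) ?y * deriv \<psi> t * (pcoef \<psi> (\<alpha> i) (\<beta> i) t * R \<beta>))
    = (\<Sum>\<beta>\<in>{..incr i \<alpha>}. F \<beta> ?y * ((case \<beta> i of 0 \<Rightarrow> 0 | Suc l \<Rightarrow> pcoef \<psi> (\<alpha> i) l t * deriv \<psi> t) * R \<beta>))"
  proof -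
    have inj: "inj_on (incr i) {..\<alpha>}"
    proof (rule inj_onI)
      fix \<beta> \<gamma> :: "'d \<Rightarrow> nat" assume eq: "incr i \<beta> = incr i \<gamma>"
      show "\<beta> = \<gamma>"
      proof
        fix j show "\<beta> j = \<gamma> j" using fun_cong[OF eq, of j] by (cases "j = i") auto
      qed
    qed
    have img: "incr i ` {..\<alpha>} = {\<beta> \<in> {..incr i \<alpha>}. \<beta> i \<noteq> 0}"
    proof (intro equalityI subsetI)
      fix \<beta> assume \<beta>: "\<beta> \<in> {\<beta> \<in> {..incr i \<alpha>}. \<beta> i \<noteq> 0}"
      then have "\<beta> = incr i (\<beta>(i := \<beta> i - 1))" by (auto simp: incr_def)
      moreover have "\<beta>(i := \<beta> i - 1) \<in> {..\<alpha>}"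
        using \<beta> by (auto simp: le_fun_def split: if_splits dest: spec[of _ i])
      ultimately show "\<beta> \<in> incr i ` {..\<alpha>}" by blast
    qed (auto simp: le_fun_def)
    have "(\<Sum>\<beta>\<in>{..incr i \<alpha>}. F \<beta> ?y * ((case \<beta> i of 0 \<Rightarrow> 0 | Suc l \<Rightarrow> pcoef \<psi> (\<alpha> i) l t * deriv \<psi> t) * R \<beta>))
      = (\<Sum>\<beta>\<in>incr i ` {..\<alpha>}. F \<beta> ?y * ((case \<beta> i of 0 \<Rightarrow> 0 | Suc l \<Rightarrow> pcoef \<psi> (\<alpha> i) l t * deriv \<psi> t) * R \<beta>))"
      unfolding img by (rule sum.mono_neutral_right[OF finite_multiindices]) auto
    also have "\<dots> = (\<Sum>\<beta>\<in>{..\<alpha>}. F (incr i \<beta>) ?y * (pcoef \<psi> (\<alpha> i) (\<beta> i) t * deriv \<psi> t * R \<beta>))"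
      unfolding sum.reindex[OF inj] by (simp add: R_incr)
    finally show ?thesis by (simp add: mult_ac)
  qed
  ultimately have "(\<Sum>\<beta>\<in>{..\<alpha>}. ?D \<beta>) = (\<Sum>\<beta>\<in>{..incr i \<alpha>}. F \<beta> ?y * (pcoef \<psi> (Suc (\<alpha> i)) (\<beta> i) t * R \<beta>))"
    unfolding sum.distrib by (simp add: algebra_simps flip: sum.distrib)
  also have "\<dots> = pullback F (incr i \<alpha>) (upd x i t)"
    unfolding pullback_def prod2 Psi_upd ..
  finally show "((\<lambda>t. pullback F \<alpha> (upd x i t)) has_real_derivative pullback F (incr i \<alpha>) (upd x i t)) (at t)"
    using der by simp
qed

text \<open>Coordinates enter \<open>K\<close> one at a time. Each step costs at most one more
  derivative in the new direction \<open>i\<close>, and only if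
  \<open>\<beta> i < \<alpha> i\<close>, so the derivatives that occur stay below
  \<open>\<alpha>\<close>. The constant is uniform in \<open>F\<close>.\<close>

lemma partial_Psi_L2_bound:
  fixes \<alpha> :: "'d::finite \<Rightarrow> nat"
  assumes "finite K"
  shows "\<exists>C\<ge>0. \<forall>F \<beta>. deriv_family F \<longrightarrow> \<beta> \<le> \<alpha> \<longrightarrow>
    (\<integral>\<^sup>+x. ennreal ((F \<beta> (partial_Psi \<psi> K x))\<^sup>2) *
       (\<Prod>j\<in>UNIV. if j \<in> K then ennreal ((pcoef \<psi> (\<alpha> j) (\<beta> j) (x $ j))\<^sup>2) else indicator {0..1} (x $ j)) \<partial>lborel)
    \<le> ennreal C * (\<Sum>\<gamma>\<in>{..\<alpha>}. \<integral>\<^sup>+x. ennreal ((F \<gamma> x)\<^sup>2) * indicator unit_cube (x :: real^'d) \<partial>lborel)"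
  using assms
proof (induction K)
  case empty
  show ?case
  proof (intro exI[of _ 1] conjI allI impI)
    fix F :: "('d \<Rightarrow> nat) \<Rightarrow> real^'d \<Rightarrow> real" and \<beta> assume "\<beta> \<le> \<alpha>"
    let ?N = "\<lambda>\<gamma>. \<integral>\<^sup>+x. ennreal ((F \<gamma> x)\<^sup>2) * indicator unit_cube x \<partial>lborel"
    have "?N \<beta> \<le> (\<Sum>\<gamma>\<in>{..\<alpha>}. ?N \<gamma>)"
      using \<open>\<beta> \<le> \<alpha>\<close> finite_multiindices by (intro member_le_sum) auto
    then show "(\<integral>\<^sup>+x. ennreal ((F \<beta> (partial_Psi \<psi> {} x))\<^sup>2) *
       (\<Prod>j\<in>UNIV. if j \<in> {} then ennreal ((pcoef \<psi> (\<alpha> j) (\<beta> j) (x $ j))\<^sup>2) else indicator {0..1} (x $ j)) \<partial>lborel)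
       \<le> ennreal 1 * (\<Sum>\<gamma>\<in>{..\<alpha>}. ?N \<gamma>)"
      by (simp add: partial_Psi_def[OF adm] vec_lambda_eta prod_indicator_unit_cube)
  qed simp
next
  case (insert i K)
  let ?w = "\<lambda>K \<beta> j t. if j \<in> K then ennreal ((pcoef \<psi> (\<alpha> j) (\<beta> j) t)\<^sup>2) else indicator {0..1} t"
  let ?H = "\<lambda>F K \<beta>. \<integral>\<^sup>+x. ennreal ((F \<beta> (partial_Psi \<psi> K x))\<^sup>2) * (\<Prod>j\<in>UNIV. ?w K \<beta> j (x $ j)) \<partial>lborel"
  let ?N = "\<lambda>F. \<Sum>\<gamma>\<in>{..\<alpha>}. \<integral>\<^sup>+x. ennreal ((F \<gamma> x)\<^sup>2) * indicator unit_cube (x :: real^'d) \<partial>lborel"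
  obtain C where C: "C \<ge> 0" "\<And>F \<beta>. deriv_family F \<Longrightarrow> \<beta> \<le> \<alpha> \<Longrightarrow> ?H F K \<beta> \<le> ennreal C * ?N F"
    using insert.IH by blast
  have "\<exists>M. \<forall>j. M j \<ge> 0 \<and> (\<forall>\<phi> \<phi>'. (\<forall>t. (\<phi> has_real_derivative \<phi>' t) (at t)) \<longrightarrow> continuous_on UNIV \<phi>' \<longrightarrow>
       (\<integral>\<^sup>+t. ennreal ((\<phi> (\<psi> t))\<^sup>2) * ennreal ((pcoef \<psi> (\<alpha> i) j t)\<^sup>2) \<partial>lborel)
       \<le> ennreal (M j) * ((\<integral>\<^sup>+t. ennreal ((\<phi> t)\<^sup>2) * indicator {0..1} t \<partial>lborel) +
           (if j < \<alpha> i then (\<integral>\<^sup>+t. ennreal ((\<phi>' t)\<^sup>2) * indicator {0..1} t \<partial>lborel) else 0)))"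
  proof (rule choice, rule allI)
    fix j
    show "\<exists>M. M \<ge> 0 \<and> (\<forall>\<phi> \<phi>'. (\<forall>t. (\<phi> has_real_derivative \<phi>' t) (at t)) \<longrightarrow> continuous_on UNIV \<phi>' \<longrightarrow>
       (\<integral>\<^sup>+t. ennreal ((\<phi> (\<psi> t))\<^sup>2) * ennreal ((pcoef \<psi> (\<alpha> i) j t)\<^sup>2) \<partial>lborel)
       \<le> ennreal M * ((\<integral>\<^sup>+t. ennreal ((\<phi> t)\<^sup>2) * indicator {0..1} t \<partial>lborel) +
           (if j < \<alpha> i then (\<integral>\<^sup>+t. ennreal ((\<phi>' t)\<^sup>2) * indicator {0..1} t \<partial>lborel) else 0)))"
      by (rule pcoef_integral_bound[of "\<alpha> i" j]) blast
  qed
  then obtain M where M0: "\<And>j. M j \<ge> 0" and M: "\<And>j \<phi> \<phi>'. (\<And>t. (\<phi> has_real_derivative \<phi>' t) (at t)) \<Longrightarrow> continuous_on UNIV \<phi>' \<Longrightarrow>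
       (\<integral>\<^sup>+t. ennreal ((\<phi> (\<psi> t))\<^sup>2) * ennreal ((pcoef \<psi> (\<alpha> i) j t)\<^sup>2) \<partial>lborel)
       \<le> ennreal (M j) * ((\<integral>\<^sup>+t. ennreal ((\<phi> t)\<^sup>2) * indicator {0..1} t \<partial>lborel) +
           (if j < \<alpha> i then (\<integral>\<^sup>+t. ennreal ((\<phi>' t)\<^sup>2) * indicator {0..1} t \<partial>lborel) else 0))"
    by blast
  define M' where "M' = (\<Sum>j\<le>\<alpha> i. M j)"
  have M': "M j \<le> M'" if "j \<le> \<alpha> i" for j
    unfolding M'_def using that M0 by (intro member_le_sum) auto
  have M'0: "0 \<le> M'" unfolding M'_def using M0 by (intro sum_nonneg) auto
  note [measurable] = pcoef_measurable[OF adm] partial_Psi_measurable[OF adm] psi_measurable[OF adm]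
  show ?case
  \<comment> \<open>Two integrals, those for \<open>\<beta>\<close> and for
    \<open>incr i \<beta>\<close>, are bounded by the induction hypothesis; hence the factor
    2.\<close>
  proof (intro exI[of _ "2 * M' * C"] conjI allI impI)
    show "0 \<le> 2 * M' * C" using M'0 C by simp
    fix F :: "('d \<Rightarrow> nat) \<Rightarrow> real^'d \<Rightarrow> real" and \<beta>
    assume F: "deriv_family F" and \<beta>: "\<beta> \<le> \<alpha>"
    have [measurable]: "F \<gamma> \<in> borel_measurable borel" for \<gamma>
      by (intro borel_measurable_continuous_onI deriv_familyD(1)[OF F])
    let ?G = "\<lambda>x. ennreal M' * (ennreal ((F \<beta> (partial_Psi \<psi> K x))\<^sup>2) * (\<Prod>j\<in>UNIV. ?w K \<beta> j (x $ j)) +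
      (if \<beta> i < \<alpha> i then ennreal ((F (incr i \<beta>) (partial_Psi \<psi> K x))\<^sup>2) * (\<Prod>j\<in>UNIV. ?w K (incr i \<beta>) j (x $ j)) else 0))"
    have "?H F (insert i K) \<beta> \<le> (\<integral>\<^sup>+x. ?G x \<partial>lborel)"
    proof (rule nn_integral_upd_mono[where i = i])
      fix x :: "real^'d"
      define W where "W = (\<Prod>j\<in>UNIV - {i}. ?w K \<beta> j (x $ j))"
      have W1: "(\<Prod>j\<in>UNIV - {i}. ?w (insert i K) \<beta> j (x $ j)) = W"
        and W2: "(\<Prod>j\<in>UNIV - {i}. ?w K (incr i \<beta>) j (x $ j)) = W"
        unfolding W_def by (intro prod.cong; auto)+
      let ?z = "partial_Psi \<psi> K x"
      have ins: "partial_Psi \<psi> (insert i K) (upd x i t) = upd ?z i (\<psi> t)" for t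
        by (simp add: vec_eq_iff partial_Psi_def[OF adm])
      have notin: "partial_Psi \<psi> K (upd x i t) = upd ?z i t" for t
        using insert.hyps by (simp add: vec_eq_iff partial_Psi_def[OF adm])
      have "(\<integral>\<^sup>+t. ennreal ((F \<beta> (partial_Psi \<psi> (insert i K) (upd x i t)))\<^sup>2) * (\<Prod>j\<in>UNIV. ?w (insert i K) \<beta> j (upd x i t $ j)) \<partial>lborel)
        = (\<integral>\<^sup>+t. W * (ennreal ((F \<beta> (upd ?z i (\<psi> t)))\<^sup>2) * ennreal ((pcoef \<psi> (\<alpha> i) (\<beta> i) t)\<^sup>2)) \<partial>lborel)"
        unfolding prod_remove_upd[where f = "?w (insert i K) \<beta>"] W1 ins
        by (intro nn_integral_cong) (simp add: mult_ac)
      also have "\<dots> = W * (\<integral>\<^sup>+t. ennreal ((F \<beta> (upd ?z i (\<psi> t)))\<^sup>2) * ennreal ((pcoef \<psi> (\<alpha> i) (\<beta> i) t)\<^sup>2) \<partial>lborel)"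
        using psi_measurable[OF adm] by (intro nn_integral_cmult) measurable
      also have "\<dots> \<le> W * (ennreal M' * ((\<integral>\<^sup>+t. ennreal ((F \<beta> (upd ?z i t))\<^sup>2) * indicator {0..1} t \<partial>lborel) +
           (if \<beta> i < \<alpha> i then (\<integral>\<^sup>+t. ennreal ((F (incr i \<beta>) (upd ?z i t))\<^sup>2) * indicator {0..1} t \<partial>lborel) else 0)))"
      proof (rule mult_left_mono)
        have "(\<integral>\<^sup>+t. ennreal ((F \<beta> (upd ?z i (\<psi> t)))\<^sup>2) * ennreal ((pcoef \<psi> (\<alpha> i) (\<beta> i) t)\<^sup>2) \<partial>lborel)
          \<le> ennreal (M (\<beta> i)) * ((\<integral>\<^sup>+t. ennreal ((F \<beta> (upd ?z i t))\<^sup>2) * indicator {0..1} t \<partial>lborel) +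
           (if \<beta> i < \<alpha> i then (\<integral>\<^sup>+t. ennreal ((F (incr i \<beta>) (upd ?z i t))\<^sup>2) * indicator {0..1} t \<partial>lborel) else 0))"
          by (rule M[of "\<lambda>t. F \<beta> (upd ?z i t)" "\<lambda>t. F (incr i \<beta>) (upd ?z i t)"])
            (intro deriv_familyD(2)[OF F] deriv_family_slice_cont[OF F])+
        also have "\<dots> \<le> ennreal M' * ((\<integral>\<^sup>+t. ennreal ((F \<beta> (upd ?z i t))\<^sup>2) * indicator {0..1} t \<partial>lborel) +
           (if \<beta> i < \<alpha> i then (\<integral>\<^sup>+t. ennreal ((F (incr i \<beta>) (upd ?z i t))\<^sup>2) * indicator {0..1} t \<partial>lborel) else 0))"
          using \<beta> by (intro mult_right_mono ennreal_leI M') (auto simp: le_fun_def)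
        finally show "(\<integral>\<^sup>+t. ennreal ((F \<beta> (upd ?z i (\<psi> t)))\<^sup>2) * ennreal ((pcoef \<psi> (\<alpha> i) (\<beta> i) t)\<^sup>2) \<partial>lborel)
          \<le> ennreal M' * ((\<integral>\<^sup>+t. ennreal ((F \<beta> (upd ?z i t))\<^sup>2) * indicator {0..1} t \<partial>lborel) +
           (if \<beta> i < \<alpha> i then (\<integral>\<^sup>+t. ennreal ((F (incr i \<beta>) (upd ?z i t))\<^sup>2) * indicator {0..1} t \<partial>lborel) else 0))" .
      qed simp
      also have "\<dots> = (\<integral>\<^sup>+t. ?G (upd x i t) \<partial>lborel)"
        unfolding prod_remove_upd[where f = "?w K \<beta>"] prod_remove_upd[where f = "?w K (incr i \<beta>)"]
          W_def[symmetric] W2 notin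
        using insert.hyps
        by (cases "\<beta> i < \<alpha> i")
          (simp_all add: nn_integral_cmult[symmetric] nn_integral_add[symmetric] distrib_left mult_ac)
      finally show "(\<integral>\<^sup>+t. ennreal ((F \<beta> (partial_Psi \<psi> (insert i K) (upd x i t)))\<^sup>2) * (\<Prod>j\<in>UNIV. ?w (insert i K) \<beta> j (upd x i t $ j)) \<partial>lborel)
        \<le> (\<integral>\<^sup>+t. ?G (upd x i t) \<partial>lborel)" .
    qed measurable
    also have "\<dots> = ennreal M' * (?H F K \<beta> + (if \<beta> i < \<alpha> i then ?H F K (incr i \<beta>) else 0))"
      by (cases "\<beta> i < \<alpha> i") (simp_all add: nn_integral_cmult nn_integral_add)
    also have "\<dots> \<le> ennreal M' * (ennreal C * ?N F + ennreal C * ?N F)"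
    proof (intro mult_left_mono add_mono)
      show "?H F K \<beta> \<le> ennreal C * ?N F" by (rule C(2)[OF F \<beta>])
      have "incr i \<beta> \<le> \<alpha>" if "\<beta> i < \<alpha> i" using that \<beta> by (auto simp: le_fun_def)
      then show "(if \<beta> i < \<alpha> i then ?H F K (incr i \<beta>) else 0) \<le> ennreal C * ?N F"
        using C(2)[OF F] by auto
    qed simp
    also have "\<dots> = ennreal (2 * M' * C) * ?N F"
      using M'0 C(1) by (simp add: ennreal_mult mult_ac flip: mult_2)
    finally show "?H F (insert i K) \<beta> \<le> ennreal (2 * M' * C) * ?N F" .
  qed
qed

lemma pullback_L2_bound:
  fixes \<alpha> :: "'d::finite \<Rightarrow> nat"
  shows "\<exists>C\<ge>0. \<forall>F. deriv_family F \<longrightarrow> (\<integral>x. (pullback F \<alpha> (x :: real^'d))\<^sup>2 \<partial>lborel)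
    \<le> C * (\<Sum>\<gamma>\<in>{..\<alpha>}. LINT x:unit_cube|lborel. (F \<gamma> x)\<^sup>2)"
proof -
  obtain C where C0: "C \<ge> 0" and C: "\<And>F \<beta>. deriv_family F \<Longrightarrow> \<beta> \<le> \<alpha> \<Longrightarrow>
    (\<integral>\<^sup>+x. ennreal ((F \<beta> (partial_Psi \<psi> UNIV x))\<^sup>2) *
       (\<Prod>j\<in>UNIV. if j \<in> UNIV then ennreal ((pcoef \<psi> (\<alpha> j) (\<beta> j) (x $ j))\<^sup>2) else indicator {0..1} (x $ j)) \<partial>lborel)
    \<le> ennreal C * (\<Sum>\<gamma>\<in>{..\<alpha>}. \<integral>\<^sup>+x. ennreal ((F \<gamma> x)\<^sup>2) * indicator unit_cube (x :: real^'d) \<partial>lborel)"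
    using partial_Psi_L2_bound[of "UNIV :: 'd set" \<alpha>] by auto
  let ?n = "real (card {..\<alpha>})"
  show ?thesis
  \<comment> \<open>The number of terms enters twice: in the Cauchy-Schwarz inequality for the sum
    over \<open>\<beta>\<close>, and in adding up the bounds of its terms.\<close>
  proof (intro exI[of _ "?n * (?n * C)"] conjI allI impI)
    show "0 \<le> ?n * (?n * C)" using C0 by simp
    fix F :: "('d \<Rightarrow> nat) \<Rightarrow> real^'d \<Rightarrow> real" assume F: "deriv_family F"
    have Fm [measurable]: "F \<gamma> \<in> borel_measurable borel" for \<gamma>
      by (intro borel_measurable_continuous_onI deriv_familyD(1)[OF F])
    note [measurable] = pcoef_measurable[OF adm] Psi_measurable[OF adm]
    let ?S = "\<Sum>\<gamma>\<in>{..\<alpha>}. LINT x:unit_cube|lborel. (F \<gamma> x)\<^sup>2"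
    have S0: "0 \<le> ?S"
      unfolding set_lebesgue_integral_def by (intro sum_nonneg Bochner_Integration.integral_nonneg) auto
    have N: "(\<Sum>\<gamma>\<in>{..\<alpha>}. \<integral>\<^sup>+x. ennreal ((F \<gamma> x)\<^sup>2) * indicator unit_cube x \<partial>lborel) = ennreal ?S"
    proof -
      have "(\<integral>\<^sup>+x. ennreal ((F \<gamma> x)\<^sup>2) * indicator unit_cube x \<partial>lborel) = ennreal (LINT x:unit_cube|lborel. (F \<gamma> x)\<^sup>2)" for \<gamma>
      proof -
        have "(\<integral>\<^sup>+x. ennreal ((F \<gamma> x)\<^sup>2) * indicator unit_cube x \<partial>lborel)
          = (\<integral>\<^sup>+x. ennreal (indicator unit_cube x *\<^sub>R (F \<gamma> x)\<^sup>2) \<partial>lborel)"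
          by (intro nn_integral_cong) (auto split: split_indicator)
        also have "\<dots> = ennreal (LINT x:unit_cube|lborel. (F \<gamma> x)\<^sup>2)"
          unfolding set_lebesgue_integral_def
          by (intro nn_integral_eq_integral borel_integrable_compact compact_cbox continuous_intros deriv_familyD(1)[OF F]) auto
        finally show ?thesis .
      qed
      then show ?thesis
        by (simp add: sum_ennreal set_lebesgue_integral_def Bochner_Integration.integral_nonneg)
    qed
    let ?T = "\<lambda>\<beta> x. F \<beta> (Psi \<psi> x) * (\<Prod>i\<in>UNIV. pcoef \<psi> (\<alpha> i) (\<beta> i) (x $ i))"
    have T: "(\<integral>\<^sup>+x. ennreal ((?T \<beta> x)\<^sup>2) \<partial>lborel) \<le> ennreal (C * ?S)" if "\<beta> \<in> {..\<alpha>}" for \<beta>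
    proof -
      have "(\<integral>\<^sup>+x. ennreal ((?T \<beta> x)\<^sup>2) \<partial>lborel) = (\<integral>\<^sup>+x. ennreal ((F \<beta> (partial_Psi \<psi> UNIV x))\<^sup>2) *
       (\<Prod>j\<in>UNIV. if j \<in> UNIV then ennreal ((pcoef \<psi> (\<alpha> j) (\<beta> j) (x $ j))\<^sup>2) else indicator {0..1} (x $ j)) \<partial>lborel)"
        by (intro nn_integral_cong)
          (simp add: partial_Psi_def[OF adm] Psi_def prod_ennreal power_mult_distrib ennreal_mult prod_power_distrib prod_nonneg)
      also have "\<dots> \<le> ennreal C * ennreal ?S" using C[OF F, of \<beta>] that unfolding N by simp
      finally show ?thesis using C0 S0 by (simp add: ennreal_mult)
    qed
    have "(\<integral>\<^sup>+x. ennreal ((pullback F \<alpha> x)\<^sup>2) \<partial>lborel) \<le> (\<integral>\<^sup>+x. ennreal ?n * (\<Sum>\<beta>\<in>{..\<alpha>}. ennreal ((?T \<beta> x)\<^sup>2)) \<partial>lborel)"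
    proof (rule nn_integral_mono)
      fix x :: "real^'d"
      have "(pullback F \<alpha> x)\<^sup>2 \<le> (\<Sum>\<beta>\<in>{..\<alpha>}. (?T \<beta> x)\<^sup>2) * ?n"
        unfolding pullback_def by (rule sum_squared_le_sum_of_squares)
      then have "ennreal ((pullback F \<alpha> x)\<^sup>2) \<le> ennreal (?n * (\<Sum>\<beta>\<in>{..\<alpha>}. (?T \<beta> x)\<^sup>2))"
        by (intro ennreal_leI) (simp add: mult.commute)
      also have "\<dots> = ennreal ?n * (\<Sum>\<beta>\<in>{..\<alpha>}. ennreal ((?T \<beta> x)\<^sup>2))"
        by (subst ennreal_mult) (auto intro: sum_nonneg simp: sum_ennreal)
      finally show "ennreal ((pullback F \<alpha> x)\<^sup>2) \<le> ennreal ?n * (\<Sum>\<beta>\<in>{..\<alpha>}. ennreal ((?T \<beta> x)\<^sup>2))" .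
    qed
    also have "\<dots> = ennreal ?n * (\<Sum>\<beta>\<in>{..\<alpha>}. \<integral>\<^sup>+x. ennreal ((?T \<beta> x)\<^sup>2) \<partial>lborel)"
      by (subst nn_integral_cmult, measurable) (subst nn_integral_sum, measurable)
    also have "\<dots> \<le> ennreal ?n * (\<Sum>\<beta>\<in>{..\<alpha>}. ennreal (C * ?S))"
      by (intro mult_left_mono sum_mono T) auto
    also have "\<dots> = ennreal (?n * (?n * C) * ?S)"
      using C0 S0 by (simp add: ennreal_mult ennreal_of_nat_eq_real_of_nat mult_ac)
    finally have le: "(\<integral>\<^sup>+x. ennreal ((pullback F \<alpha> x)\<^sup>2) \<partial>lborel) \<le> ennreal (?n * (?n * C) * ?S)" .
    have "(\<integral>x. (pullback F \<alpha> x)\<^sup>2 \<partial>lborel) = enn2real (\<integral>\<^sup>+x. ennreal ((pullback F \<alpha> x)\<^sup>2) \<partial>lborel)"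
      using borel_measurable_continuous_onI[OF deriv_familyD(1)[OF pullback_family[OF F]], of \<alpha>]
      by (intro integral_eq_nn_integral) auto
    also have "\<dots> \<le> ?n * (?n * C) * ?S"
      using le C0 S0 by (intro enn2real_leI) auto
    finally show "(\<integral>x. (pullback F \<alpha> x)\<^sup>2 \<partial>lborel) \<le> ?n * (?n * C) * ?S" .
  qed
qed

end

subsection \<open>Approximation by smooth functions\<close>

lemma nn_integral_affine:
  fixes H :: "real^'d::finite \<Rightarrow> ennreal"
  assumes [measurable]: "H \<in> borel_measurable borel" and c: "c \<noteq> 0"
  shows "ennreal (\<bar>c\<bar> ^ CARD('d)) * (\<integral>\<^sup>+x. H (t + c *\<^sub>R x) \<partial>lborel) = (\<integral>\<^sup>+x. H x \<partial>lborel)"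
proof -
  have "(\<integral>\<^sup>+x. H x \<partial>lborel) = (\<integral>\<^sup>+x. H x \<partial>density (distr lborel borel (\<lambda>x. t + c *\<^sub>R x)) (\<lambda>_. ennreal (\<bar>c\<bar> ^ CARD('d))))"
    using lborel_affine[OF c, of t] by simp
  also have "\<dots> = ennreal (\<bar>c\<bar> ^ CARD('d)) * (\<integral>\<^sup>+x. H (t + c *\<^sub>R x) \<partial>lborel)"
    by (subst nn_integral_density) (auto simp: nn_integral_distr nn_integral_cmult)
  finally show ?thesis ..
qed

lemma tensor_has_derivative:
  fixes u :: "'d::finite \<Rightarrow> real \<Rightarrow> real"
  assumes "\<And>i. (u i has_real_derivative u' i) (at (y $ i))"
  shows "((\<lambda>y :: real^'d. C * (\<Prod>i\<in>UNIV. u i (y $ i))) has_derivative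
    (\<lambda>v. C * (\<Sum>i\<in>UNIV. u' i * v $ i * (\<Prod>j\<in>UNIV - {i}. u j (y $ j))))) (at y)"
proof -
  have "((\<lambda>y :: real^'d. u i (y $ i)) has_derivative (\<lambda>v. u' i * v $ i)) (at y)" for i
    using has_derivative_compose[of "\<lambda>y :: real^'d. y $ i" "\<lambda>v. v $ i" y UNIV "u i" "\<lambda>t. u' i * t"]
      assms[of i] has_field_derivative_def[of "u i" "u' i" "at (y $ i)"]
    by (auto intro: bounded_linear_imp_has_derivative bounded_linear_vec_nth)
  then show ?thesis by (intro has_derivative_mult_right has_derivative_prod)
qed

text \<open>For a tensor product, differentiation acts factor by factor in any order. The bumps used
  as test functions have this form, so their iterated partial derivatives are explicit.\<close>

lemma iter_partial_tensor:
  fixes u :: "'d::finite \<Rightarrow> nat \<Rightarrow> real \<Rightarrow> real"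
  assumes u: "\<And>i k t. (u i k has_real_derivative u i (Suc k) t) (at t)"
  shows "iter_partial js (\<lambda>y :: real^'d. C * (\<Prod>i\<in>UNIV. u i 0 (y $ i))) = (\<lambda>y. C * (\<Prod>i\<in>UNIV. u i (count_list js i) (y $ i)))"
proof (induction js)
  case Nil
  then show ?case by (simp add: iter_partial_def)
next
  case (Cons j js)
  have "partial_deriv j (\<lambda>y :: real^'d. C * (\<Prod>i\<in>UNIV. u i (count_list js i) (y $ i))) y
      = C * (\<Prod>i\<in>UNIV. u i (count_list (j # js) i) (y $ i))" for y
  proof -
    have "partial_deriv j (\<lambda>y :: real^'d. C * (\<Prod>i\<in>UNIV. u i (count_list js i) (y $ i))) y
      = C * (\<Sum>i\<in>UNIV. u i (Suc (count_list js i)) (y $ i) * axis j 1 $ i * (\<Prod>l\<in>UNIV - {i}. u l (count_list js l) (y $ l)))"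
      unfolding partial_deriv_def
      by (subst frechet_derivative_at[OF tensor_has_derivative[of "\<lambda>i. u i (count_list js i)" "\<lambda>i. u i (Suc (count_list js i)) (y $ i)" y C, OF u], symmetric]) simp
    also have "(\<Sum>i\<in>UNIV. u i (Suc (count_list js i)) (y $ i) * axis j 1 $ i * (\<Prod>l\<in>UNIV - {i}. u l (count_list js l) (y $ l)))
      = (\<Sum>i\<in>UNIV. if i = j then u j (Suc (count_list js j)) (y $ j) * (\<Prod>l\<in>UNIV - {j}. u l (count_list js l) (y $ l)) else 0)"
      by (intro sum.cong) (auto simp: axis_def)
    also have "\<dots> = (\<Prod>i\<in>UNIV. u i (count_list (j # js) i) (y $ i))"
      by (subst prod.remove[of _ j]) (auto intro!: prod.cong)
    finally show ?thesis .
  qed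
  moreover have "iter_partial (j # js) \<phi> = partial_deriv j (iter_partial js \<phi>)" for \<phi> :: "real^'d \<Rightarrow> real"
    by (simp add: iter_partial_def)
  ultimately show ?case using Cons by auto
qed

text \<open>Needed to instantiate \<open>is_weak_deriv\<close>, which ranges over lists of
  directions.\<close>

lemma exists_multiindex_list:
  fixes \<beta> :: "'d::finite \<Rightarrow> nat"
  shows "\<exists>js. \<forall>i. count_list js i = \<beta> i"
proof (induction "\<Sum>j\<in>UNIV. \<beta> j" arbitrary: \<beta>)
  case 0
  then show ?case by (intro exI[of _ "[]"]) auto
next
  case (Suc n)
  then have "\<exists>i. \<beta> i \<noteq> 0" by (metis sum.neutral old.nat.distinct(2))
  then obtain i where i: "\<beta> i \<noteq> 0" by blast
  define \<gamma> where "\<gamma> = \<beta>(i := \<beta> i - 1)"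
  have \<beta>: "\<beta> = incr i \<gamma>" using i by (auto simp: \<gamma>_def incr_def)
  have "(\<Sum>j\<in>UNIV. \<beta> j) = Suc (\<Sum>j\<in>UNIV. \<gamma> j)"
    unfolding \<beta> by (simp add: sum.remove[of UNIV i])
  then obtain js where "\<forall>j. count_list js j = \<gamma> j" using Suc by fastforce
  then show ?case by (intro exI[of _ "i # js"]) (auto simp: \<beta>)
qed

text \<open>Fubini and translations are applied to Borel functions on the whole space; a Lebesgue
  measurable function on the cube is therefore exchanged for a Borel version extended by
  zero.\<close>

lemma lebesgue_on_cube_borel:
  fixes g :: "real^'d::finite \<Rightarrow> real"
  assumes g: "g \<in> borel_measurable (lebesgue_on unit_cube)"
  obtains g0 where "g0 \<in> borel_measurable borel" "\<And>x. x \<notin> unit_cube \<Longrightarrow> g0 x = 0"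
    "AE x in lborel. x \<in> unit_cube \<longrightarrow> g0 x = g x"
proof -
  have "(\<lambda>x. if x \<in> unit_cube then g x else 0) \<in> borel_measurable lebesgue"
    using g by (subst borel_measurable_if) auto
  then have "(\<lambda>x. if x \<in> unit_cube then g x else 0) \<in> borel_measurable (completion lborel)" .
  then obtain g1 where g1: "g1 \<in> borel_measurable lborel" "AE x in lborel. (if x \<in> unit_cube then g x else 0) = g1 x"
    using completion_ex_borel_measurable_real by blast
  have "(\<lambda>x. if x \<in> unit_cube then g1 x else 0) \<in> borel_measurable borel"
    using g1(1) by measurable
  moreover have "AE x in lborel. x \<in> unit_cube \<longrightarrow> (if x \<in> unit_cube then g1 x else 0) = g x"
    using g1(2) by eventually_elim auto
  ultimately show thesis using that[of "\<lambda>x. if x \<in> unit_cube then g1 x else 0"] by auto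
qed

lemma lebesgue_on_cube_transfer:
  fixes g g0 :: "real^'d::finite \<Rightarrow> real"
  assumes g: "g \<in> borel_measurable (lebesgue_on unit_cube)"
    and g0 [measurable]: "g0 \<in> borel_measurable borel" and out: "\<And>x. x \<notin> unit_cube \<Longrightarrow> g0 x = 0"
    and eq: "AE x in lborel. x \<in> unit_cube \<longrightarrow> g0 x = g x"
  shows "(LINT x|lebesgue_on unit_cube. g x) = (\<integral>x. g0 x \<partial>lborel)"
    and "integrable (lebesgue_on unit_cube) g \<longleftrightarrow> integrable lborel g0"
proof -
  have m: "(\<lambda>x. indicator unit_cube x *\<^sub>R g x) \<in> borel_measurable lebesgue"
    using g by (simp add: borel_measurable_restrict_space_iff)
  have m0: "g0 \<in> borel_measurable lebesgue" by (intro measurable_completion) simp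
  have ae: "AE x in lebesgue. indicator unit_cube x *\<^sub>R g x = g0 x"
    using AE_completion[OF eq] by eventually_elim (use out in \<open>auto split: split_indicator\<close>)
  have "(LINT x|lebesgue_on unit_cube. g x) = (\<integral>x. indicator unit_cube x *\<^sub>R g x \<partial>lebesgue)"
    by (subst integral_restrict_space) (auto simp: set_lebesgue_integral_def)
  also have "\<dots> = (\<integral>x. g0 x \<partial>lebesgue)" by (rule integral_cong_AE[OF m m0 ae])
  also have "\<dots> = (\<integral>x. g0 x \<partial>lborel)" by (rule integral_completion) simp
  finally show "(LINT x|lebesgue_on unit_cube. g x) = (\<integral>x. g0 x \<partial>lborel)" .
  have "integrable (lebesgue_on unit_cube) g \<longleftrightarrow> integrable lebesgue (\<lambda>x. indicator unit_cube x *\<^sub>R g x)"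
    by (subst integrable_restrict_space) (auto simp: set_integrable_def)
  also have "\<dots> \<longleftrightarrow> integrable lebesgue g0" by (rule integrable_cong_AE[OF m m0 ae])
  also have "\<dots> \<longleftrightarrow> integrable lborel g0" by (rule integrable_completion) simp
  finally show "integrable (lebesgue_on unit_cube) g \<longleftrightarrow> integrable lborel g0" .
qed

section \<open>Mollification inside the unit cube\<close>

context
  fixes \<psi> :: "real \<Rightarrow> real"
  assumes adm: "admissible_psi \<psi>"
begin

text \<open>The derivative of order \<open>\<beta>\<close> in \<open>x\<close> of the smoothing
  kernel. The bump in each coordinate is \<open>deriv \<psi>\<close>, a smooth probability density
  on the unit interval, at scale \<open>h\<close>; every derivative brings out the inner factor
  \<open>- (1 - 2 * h) / h\<close>.\<close>

definition mollifier_deriv :: "real \<Rightarrow> ('d::finite \<Rightarrow> nat) \<Rightarrow> real^'d \<Rightarrow> real^'d \<Rightarrow> real" where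
  "mollifier_deriv h \<beta> x y = (1 / h) ^ CARD('d) *
     (\<Prod>i\<in>UNIV. (- (1 - 2 * h) / h) ^ \<beta> i * (deriv ^^ Suc (\<beta> i)) \<psi> ((y $ i - (1 - 2 * h) * x $ i - h / 2) / h))"

text \<open>The first argument of the kernel is mapped into the inner cube of side \<open>1 - 2 h\<close>, so that for
  \<open>x\<close> in the unit cube the bump stays inside and is a test function in \<open>y\<close>.\<close>

definition mollifier :: "real \<Rightarrow> real^'d::finite \<Rightarrow> real^'d \<Rightarrow> real" where
  "mollifier h x y = (1 / h) ^ CARD('d) * DPsi \<psi> ((1 / h) *\<^sub>R (y - (1 - 2 * h) *\<^sub>R x - (\<chi> i. h / 2)))"

lemma mollifier_eq: "mollifier h x y = (1 / h) ^ CARD('d) * (\<Prod>i\<in>UNIV. deriv \<psi> ((y $ i - (1 - 2 * h) * x $ i - h / 2) / h))"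
  for x :: "real^'d::finite"
  by (simp add: mollifier_def DPsi_def)

lemma mollifier_deriv_0: "mollifier_deriv h (\<lambda>_. 0) x y = mollifier h x y"
  by (simp add: mollifier_eq mollifier_deriv_def)

lemma mollifier_cont:
  fixes f g :: "'a::topological_space \<Rightarrow> real^'d::finite"
  shows "continuous_on A f \<Longrightarrow> continuous_on A g \<Longrightarrow> continuous_on A (\<lambda>z. mollifier h (f z) (g z))"
  unfolding mollifier_def by (intro continuous_intros continuous_on_compose2[OF DPsi_cont[OF adm, of UNIV]]) auto

lemma mollifier_deriv_cont:
  fixes f g :: "'a::topological_space \<Rightarrow> real^'d::finite"
  assumes "continuous_on A f" "continuous_on A g"
  shows "continuous_on A (\<lambda>z. mollifier_deriv h \<beta> (f z) (g z))"
  unfolding mollifier_deriv_def divide_inverse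
  by (intro continuous_intros continuous_on_compose2[OF psi_funpow_cont[OF adm, of UNIV]] assms) auto

lemma mollifier_deriv_upd:
  assumes "h \<noteq> 0"
  shows "((\<lambda>t. mollifier_deriv h \<beta> (upd x i t) y) has_real_derivative mollifier_deriv h (incr i \<beta>) (upd x i t) y) (at t)"
proof -
  let ?u = "\<lambda>\<beta> i t. (- (1 - 2 * h) / h) ^ \<beta> i * (deriv ^^ Suc (\<beta> i)) \<psi> ((y $ i - (1 - 2 * h) * t - h / 2) / h)"
  let ?R = "\<Prod>j\<in>UNIV - {i}. ?u \<beta> j (x $ j)"
  have e1: "mollifier_deriv h \<beta> (upd x i t) y = (1 / h) ^ CARD('a) * (?u \<beta> i t * ?R)" for t
    unfolding mollifier_deriv_def by (subst prod_remove_upd[where f = "?u \<beta>"]) simp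
  have R: "(\<Prod>j\<in>UNIV - {i}. ?u (incr i \<beta>) j (x $ j)) = ?R" by (intro prod.cong) auto
  have e2: "mollifier_deriv h (incr i \<beta>) (upd x i t) y = (1 / h) ^ CARD('a) * (?u (incr i \<beta>) i t * ?R)"
    unfolding mollifier_deriv_def by (subst prod_remove_upd[where f = "?u (incr i \<beta>)"]) (simp only: R)
  have "((\<lambda>t. (deriv ^^ Suc (\<beta> i)) \<psi> ((y $ i - (1 - 2 * h) * t - h / 2) / h)) has_real_derivative
     (deriv ^^ Suc (Suc (\<beta> i))) \<psi> ((y $ i - (1 - 2 * h) * t - h / 2) / h) * (- (1 - 2 * h) / h)) (at t)"
    by (rule DERIV_chain2[OF psi_funpow_deriv[OF adm]])
      (use assms in \<open>auto intro!: derivative_eq_intros simp: divide_simps\<close>)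
  from DERIV_cmult[OF DERIV_cmult_right[OF DERIV_cmult[OF this]]]
  show ?thesis unfolding e1 e2
    by (rule DERIV_cong) (simp only: incr_apply simp_thms if_True power_Suc mult_ac)
qed

lemma mollifier_nonneg: "0 < h \<Longrightarrow> 0 \<le> mollifier h x y"
  unfolding mollifier_def by (intro mult_nonneg_nonneg DPsi_nonneg[OF adm]) simp

text \<open>In coordinate \<open>i\<close> the bump lives between
  \<open>(1 - 2 * h) * x $ i + h / 2\<close> and \<open>(1 - 2 * h) * x $ i + 3 * h / 2\<close>. For
  \<open>x\<close> in the cube this interval keeps the distance \<open>h / 2\<close> from both
  faces.\<close>

lemma mollifier_nz:
  assumes "0 < h" "h \<le> 1 / 4" "x \<in> unit_cube" "mollifier h x y \<noteq> 0"
  shows "h / 2 \<le> y $ i" "y $ i \<le> 1 - h / 2" "\<bar>y $ i - x $ i\<bar> \<le> 4 * h"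
proof -
  have "(1 / h) *\<^sub>R (y - (1 - 2 * h) *\<^sub>R x - (\<chi> i. h / 2)) \<in> unit_cube"
    using DPsi_outside[OF adm] assms(4) unfolding mollifier_def by (metis mult_zero_right)
  then have "0 \<le> (y $ i - (1 - 2 * h) * x $ i - h / 2) / h" "(y $ i - (1 - 2 * h) * x $ i - h / 2) / h \<le> 1"
    by (auto simp: mem_unit_cube)
  then have 1: "(1 - 2 * h) * x $ i + h / 2 \<le> y $ i" "y $ i \<le> (1 - 2 * h) * x $ i + h / 2 + h"
    using assms(1) by (auto simp: field_simps)
  have x: "0 \<le> x $ i" "x $ i \<le> 1" using assms(3) by (auto simp: mem_unit_cube)
  have a: "0 \<le> (1 - 2 * h) * x $ i" using x assms by (intro mult_nonneg_nonneg) auto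
  have b: "(1 - 2 * h) * x $ i \<le> 1 - 2 * h" using x assms by (intro mult_left_le) auto
  have c: "0 \<le> 2 * h * x $ i" "2 * h * x $ i \<le> 2 * h" using x assms by (auto intro: mult_left_le)
  show "h / 2 \<le> y $ i" "y $ i \<le> 1 - h / 2" using 1 a b by linarith+
  have "x $ i - 2 * h * x $ i + h / 2 \<le> y $ i" "y $ i \<le> x $ i - 2 * h * x $ i + h / 2 + h"
    using 1 by (simp_all add: left_diff_distrib)
  then show "\<bar>y $ i - x $ i\<bar> \<le> 4 * h" using c assms(1) unfolding abs_le_iff by linarith
qed

lemma nn_integral_DPsi: "(\<integral>\<^sup>+x. ennreal (DPsi \<psi> (x :: real^'d::finite)) \<partial>lborel) = 1"
  using nn_integral_Psi[OF adm, of "\<lambda>_. 1"] by (simp add: emeasure_unit_cube)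

lemma nn_integral_mollifier_y:
  assumes h: "h > 0"
  shows "(\<integral>\<^sup>+y. ennreal (mollifier h x (y :: real^'d::finite)) \<partial>lborel) = 1"
proof -
  note [measurable] = DPsi_measurable[OF adm]
  have "ennreal (\<bar>1 / h\<bar> ^ CARD('d)) * (\<integral>\<^sup>+y. ennreal (DPsi \<psi> ((- (1 / h) *\<^sub>R ((1 - 2 * h) *\<^sub>R x + (\<chi> i. h / 2))) + (1 / h) *\<^sub>R (y :: real^'d))) \<partial>lborel) = 1"
    using h by (subst nn_integral_affine) (auto simp: nn_integral_DPsi)
  then have "(\<integral>\<^sup>+y. ennreal ((1 / h) ^ CARD('d)) * ennreal (DPsi \<psi> ((- (1 / h) *\<^sub>R ((1 - 2 * h) *\<^sub>R x + (\<chi> i. h / 2))) + (1 / h) *\<^sub>R (y :: real^'d))) \<partial>lborel) = 1"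
    using h by (subst nn_integral_cmult) auto
  moreover have "mollifier h x y = (1 / h) ^ CARD('d) * DPsi \<psi> ((- (1 / h) *\<^sub>R ((1 - 2 * h) *\<^sub>R x + (\<chi> i. h / 2))) + (1 / h) *\<^sub>R y)" for y
  proof -
    have "(1 / h) *\<^sub>R (y - (1 - 2 * h) *\<^sub>R x - (\<chi> i. h / 2)) = (- (1 / h) *\<^sub>R ((1 - 2 * h) *\<^sub>R x + (\<chi> i. h / 2))) + (1 / h) *\<^sub>R y"
      by (simp add: vec_eq_iff diff_divide_distrib add_divide_distrib)
    then show ?thesis unfolding mollifier_def by (simp only:)
  qed
  ultimately show ?thesis using h by (simp only: ennreal_mult' zero_le_power zero_le_divide_1_iff less_imp_le)
qed

text \<open>Seen as a function of \<open>x\<close>, the bump is stretched by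
  \<open>1 / (1 - 2 * h)\<close> in each coordinate at unchanged height, so its mass is
  \<open>(1 - 2 * h) ^ (- d)\<close>, and \<open>h \<le> 1 / 4\<close> bounds the stretching by
  2.\<close>

lemma nn_integral_mollifier_x:
  assumes h: "0 < h" "h \<le> 1 / 4"
  shows "(\<integral>\<^sup>+x. ennreal (mollifier h x (y :: real^'d::finite)) \<partial>lborel) \<le> ennreal (2 ^ CARD('d))"
proof -
  note [measurable] = DPsi_measurable[OF adm]
  let ?c = "- (1 - 2 * h) / h"
  have c: "?c \<noteq> 0" "\<bar>?c\<bar> = (1 - 2 * h) / h" using h by auto
  let ?I = "\<integral>\<^sup>+x. ennreal (DPsi \<psi> ((1 / h) *\<^sub>R (y - (\<chi> i. h / 2)) + ?c *\<^sub>R (x :: real^'d))) \<partial>lborel"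
  have one: "ennreal (\<bar>?c\<bar> ^ CARD('d)) * ?I = 1"
    using c by (subst nn_integral_affine) (auto simp: nn_integral_DPsi)
  have "(\<integral>\<^sup>+x. ennreal (mollifier h x y) \<partial>lborel) = (\<integral>\<^sup>+x. ennreal ((1 / h) ^ CARD('d)) * ennreal (DPsi \<psi> ((1 / h) *\<^sub>R (y - (\<chi> i. h / 2)) + ?c *\<^sub>R (x :: real^'d))) \<partial>lborel)"
  proof (rule nn_integral_cong)
    fix x :: "real^'d"
    have "(1 / h) *\<^sub>R (y - (1 - 2 * h) *\<^sub>R x - (\<chi> i. h / 2)) = (1 / h) *\<^sub>R (y - (\<chi> i. h / 2)) + ?c *\<^sub>R x"
      using h by (simp add: vec_eq_iff field_simps)
    then show "ennreal (mollifier h x y) = ennreal ((1 / h) ^ CARD('d)) * ennreal (DPsi \<psi> ((1 / h) *\<^sub>R (y - (\<chi> i. h / 2)) + ?c *\<^sub>R x))"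
      unfolding mollifier_def using h by (simp only: ennreal_mult' zero_le_power zero_le_divide_1_iff less_imp_le)
  qed
  also have "\<dots> = ennreal ((1 / h) ^ CARD('d)) * ?I"
    by (subst nn_integral_cmult) auto
  also have "\<dots> \<le> ennreal (2 ^ CARD('d) * \<bar>?c\<bar> ^ CARD('d)) * ?I"
  proof (intro mult_right_mono ennreal_leI)
    have "(1 / h) ^ CARD('d) \<le> (2 * \<bar>?c\<bar>) ^ CARD('d)"
      unfolding c using h by (intro power_mono) (auto simp: field_simps)
    then show "(1 / h) ^ CARD('d) \<le> 2 ^ CARD('d) * \<bar>?c\<bar> ^ CARD('d)" by (simp only: power_mult_distrib)
  qed simp
  also have "\<dots> = ennreal (2 ^ CARD('d)) * (ennreal (\<bar>?c\<bar> ^ CARD('d)) * ?I)"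
    by (simp add: ennreal_mult mult.assoc)
  finally show ?thesis unfolding one by simp
qed

text \<open>Both variables enter through \<open>y - (1 - 2 * h) * x\<close>, so an
  \<open>x\<close>-derivative is \<open>- (1 - 2 * h)\<close> times a \<open>y\<close>-derivative.
  Weak derivatives are tested in \<open>y\<close>, whereas smoothness of the mollified function
  concerns \<open>x\<close>; the second claim connects the two.\<close>

lemma mollifier_test_function:
  fixes x :: "real^'d::finite"
  assumes h: "0 < h" "h \<le> 1 / 4" and x: "x \<in> unit_cube"
  shows "test_function (mollifier h x)"
    and "\<And>js. (\<And>i. count_list js i = \<beta> i) \<Longrightarrow>
      (1 - 2 * h) ^ (\<Sum>i\<in>UNIV. \<beta> i) * ((-1) ^ (\<Sum>i\<in>UNIV. \<beta> i) * iter_partial js (mollifier h x) y) = mollifier_deriv h \<beta> x y"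
proof -
  define u where "u i k t = (1 / h) ^ k * (deriv ^^ Suc k) \<psi> ((t - (1 - 2 * h) * x $ i - h / 2) / h)" for i k t
  have u: "(u i k has_real_derivative u i (Suc k) t) (at t)" for i k t
  proof -
    have "((\<lambda>t. (deriv ^^ Suc k) \<psi> ((t - (1 - 2 * h) * x $ i - h / 2) / h)) has_real_derivative
      (deriv ^^ Suc (Suc k)) \<psi> ((t - (1 - 2 * h) * x $ i - h / 2) / h) * (1 / h)) (at t)"
      by (rule DERIV_chain2[OF psi_funpow_deriv[OF adm]])
        (use h in \<open>auto intro!: derivative_eq_intros\<close>)
    from DERIV_cmult[OF this, of "(1 / h) ^ k"]
    show ?thesis unfolding u_def[abs_def] by (rule DERIV_cong) (simp only: power_Suc mult_ac)
  qed
  have m: "mollifier h x = (\<lambda>y. (1 / h) ^ CARD('d) * (\<Prod>i\<in>UNIV. u i 0 (y $ i)))"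
    by (auto simp: mollifier_eq u_def)
  have ip: "iter_partial js (mollifier h x) = (\<lambda>y. (1 / h) ^ CARD('d) * (\<Prod>i\<in>UNIV. u i (count_list js i) (y $ i)))" for js
    unfolding m by (rule iter_partial_tensor[where u = u]) (rule u)
  show "test_function (mollifier h x)"
    unfolding test_function_def
  proof (intro conjI allI)
    fix js and y :: "real^'d"
    show "iter_partial js (mollifier h x) differentiable (at y)"
      unfolding ip differentiable_def
      by (intro exI) (rule tensor_has_derivative[where u = "\<lambda>i. u i (count_list js i)" and u' = "\<lambda>i. u i (Suc (count_list js i)) (y $ i)"], rule u)
    let ?K = "cbox (\<chi> i. h / 2) (\<chi> i. 1 - h / 2) :: (real^'d) set"
    have "?K \<subseteq> box 0 1"
    proof
      fix y assume "y \<in> ?K"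
      then have y: "h / 2 \<le> y $ i" "y $ i \<le> 1 - h / 2" for i by (auto simp: mem_box_cart)
      have "0 < y $ i" "y $ i < 1" for i using y[of i] h(1) by linarith+
      then show "y \<in> box 0 1" by (simp add: mem_box_cart)
    qed
    moreover have "mollifier h x y = 0" if "y \<notin> ?K" for y
      using mollifier_nz(1,2)[OF h x, of y] that by (auto simp: mem_box_cart)
    ultimately show "\<exists>K. compact K \<and> K \<subseteq> box 0 1 \<and> (\<forall>y. y \<notin> K \<longrightarrow> mollifier h x y = 0)"
      by (intro exI[of _ ?K]) auto
  qed
  fix js assume js: "\<And>i. count_list js i = \<beta> i"
  have "(\<Prod>i\<in>UNIV. (- (1 - 2 * h) / h) ^ \<beta> i * (deriv ^^ Suc (\<beta> i)) \<psi> ((y $ i - (1 - 2 * h) * x $ i - h / 2) / h))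
    = (\<Prod>i\<in>UNIV. ((1 - 2 * h) ^ \<beta> i * (-1) ^ \<beta> i) * u i (\<beta> i) (y $ i))"
    by (intro prod.cong refl) (simp add: u_def power_divide power_mult_distrib[symmetric] del: funpow.simps)
  also have "\<dots> = ((1 - 2 * h) ^ (\<Sum>i\<in>UNIV. \<beta> i) * (-1) ^ (\<Sum>i\<in>UNIV. \<beta> i)) * (\<Prod>i\<in>UNIV. u i (\<beta> i) (y $ i))"
    by (simp add: prod.distrib power_sum)
  finally show "(1 - 2 * h) ^ (\<Sum>i\<in>UNIV. \<beta> i) * ((-1) ^ (\<Sum>i\<in>UNIV. \<beta> i) * iter_partial js (mollifier h x) y) = mollifier_deriv h \<beta> x y"
    unfolding mollifier_deriv_def ip js by (simp only: mult_ac)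
qed

definition mollify :: "real \<Rightarrow> (real^'d::finite \<Rightarrow> real) \<Rightarrow> ('d \<Rightarrow> nat) \<Rightarrow> real^'d \<Rightarrow> real" where
  "mollify h f \<beta> x = (LINT y:unit_cube|lborel. f y * mollifier_deriv h \<beta> x y)"

text \<open>All derivatives fall on the kernel, so continuity of \<open>f\<close> and the Leibniz
  rule under the integral suffice.\<close>

lemma mollify_family:
  assumes f: "continuous_on unit_cube f" and h: "h \<noteq> 0"
  shows "deriv_family (mollify h f)"
proof -
  have eq: "mollify h f \<beta> x = integral unit_cube (\<lambda>y. f y * mollifier_deriv h \<beta> x y)" for \<beta> x
    unfolding mollify_def
    by (intro set_borel_integral_eq_integral(2) set_integrable_cube continuous_intros f mollifier_deriv_cont)
  have fsnd: "continuous_on (U \<times> unit_cube) (\<lambda>z. f (snd z))" for U :: "'b::topological_space set"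
    by (rule continuous_on_compose2[OF f]) (auto intro: continuous_intros)
  show ?thesis
    unfolding deriv_family_def
  proof (intro conjI allI)
    fix \<beta> :: "'a \<Rightarrow> nat"
    have "continuous_on UNIV (\<lambda>x. integral (cbox 0 1) (\<lambda>y. f y * mollifier_deriv h \<beta> x y))"
      by (rule integral_continuous_on_param)
        (auto simp: case_prod_beta intro!: continuous_on_mult fsnd mollifier_deriv_cont continuous_intros)
    then show "continuous_on UNIV (mollify h f \<beta>)" by (simp add: eq[abs_def])
    fix i and x :: "real^'a" and t :: real
    have "((\<lambda>t. integral (cbox 0 1) (\<lambda>y. f y * mollifier_deriv h \<beta> (upd x i t) y)) has_field_derivative
      integral (cbox 0 1) (\<lambda>y. f y * mollifier_deriv h (incr i \<beta>) (upd x i t) y)) (at t within UNIV)"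
    proof (rule leibniz_rule_field_derivative)
      show "((\<lambda>t. f y * mollifier_deriv h \<beta> (upd x i t) y) has_real_derivative f y * mollifier_deriv h (incr i \<beta>) (upd x i t) y) (at t within UNIV)" for t y
        by (intro DERIV_cmult mollifier_deriv_upd h)
      show "(\<lambda>y. f y * mollifier_deriv h \<beta> (upd x i t) y) integrable_on cbox 0 1" for t
        by (intro integrable_continuous continuous_intros f mollifier_deriv_cont)
      show "continuous_on (UNIV \<times> cbox 0 1) (\<lambda>(t, y). f y * mollifier_deriv h (incr i \<beta>) (upd x i t) y)"
        by (auto simp: case_prod_beta intro!: continuous_on_mult fsnd mollifier_deriv_cont continuous_intros)
    qed auto
    then show "((\<lambda>t. mollify h f \<beta> (upd x i t)) has_real_derivative mollify h f (incr i \<beta>) (upd x i t)) (at t)"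
      by (simp add: eq)
  qed
qed

lemma mollifier_integrable:
  fixes x :: "real^'d::finite"
  assumes "h > 0"
  shows "integrable lborel (mollifier h x)" "(\<integral>y. mollifier h x y \<partial>lborel) = 1"
proof -
  have [measurable]: "mollifier h x \<in> borel_measurable borel"
    by (intro borel_measurable_continuous_onI mollifier_cont continuous_intros)
  have "has_bochner_integral lborel (mollifier h x) 1"
    using nn_integral_mollifier_y[OF assms, of x] mollifier_nonneg[OF assms]
    by (intro has_bochner_integral_nn_integral) auto
  then show "integrable lborel (mollifier h x)" "(\<integral>y. mollifier h x y \<partial>lborel) = 1"
    by (simp_all add: has_bochner_integral_iff)
qed

lemma mollifier_outside:
  assumes "0 < h" "h \<le> 1 / 4" "x \<in> unit_cube" "y \<notin> unit_cube"
  shows "mollifier h x y = 0"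
proof (rule ccontr)
  assume "mollifier h x y \<noteq> 0"
  from mollifier_nz(1,2)[OF assms(1-3) this] have "y \<in> unit_cube"
    using assms(1) unfolding mem_unit_cube by (meson half_gt_zero le_diff_eq less_add_same_cancel1 less_eq_real_def order_trans)
  with assms(4) show False by simp
qed

lemma mollify_sup:
  fixes f :: "real^'d::finite \<Rightarrow> real"
  assumes f: "continuous_on unit_cube f" and "e > 0"
  shows "\<exists>h0>0. \<forall>h. 0 < h \<longrightarrow> h \<le> h0 \<longrightarrow> (\<forall>x\<in>unit_cube. \<bar>mollify h f (\<lambda>_. 0) x - f x\<bar> \<le> e)"
proof -
  obtain \<delta> where \<delta>: "\<delta> > 0" "\<And>x y. x \<in> unit_cube \<Longrightarrow> y \<in> unit_cube \<Longrightarrow> dist y x < \<delta> \<Longrightarrow> dist (f y) (f x) < e"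
    using compact_uniformly_continuous[OF f compact_cbox] \<open>e > 0\<close> unfolding uniformly_continuous_on_def by meson
  \<comment> \<open>The \<open>l\<^sup>1\<close> norm bounds the distance between \<open>x\<close>
    and the support of the bump by \<open>4 * h * d\<close>, at most \<open>\<delta> / 2\<close>;
    the cap \<open>1 / 4\<close> keeps the bump in the cube.\<close>
  define h0 where "h0 = min (1 / 4) (\<delta> / (8 * real CARD('d)))"
  have card: "real CARD('d) > 0" by simp
  have h0: "h0 > 0" using \<delta> card by (simp add: h0_def)
  have "\<bar>mollify h f (\<lambda>_. 0) x - f x\<bar> \<le> e" if h: "0 < h" "h \<le> h0" and x: "x \<in> unit_cube" for h and x :: "real^'d"
  proof -
    have h4: "h \<le> 1 / 4" using h by (simp add: h0_def)
    have mc: "continuous_on A (mollifier h x)" for A by (intro mollifier_cont continuous_intros)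
    have near: "\<bar>f y - f x\<bar> * mollifier h x y \<le> e * mollifier h x y" if y: "y \<in> unit_cube" for y
    proof (cases "mollifier h x y = 0")
      case False
      have "norm (y - x) \<le> (\<Sum>j\<in>UNIV. \<bar>(y - x) $ j\<bar>)" by (rule norm_le_l1_cart)
      also have "\<dots> \<le> real CARD('d) * (4 * h)"
        using mollifier_nz(3)[OF h(1) h4 x False] by (intro sum_bounded_above) auto
      also have "\<dots> \<le> real CARD('d) * (4 * (\<delta> / (8 * real CARD('d))))"
        using h by (intro mult_left_mono) (auto simp: h0_def)
      also have "\<dots> < \<delta>" using \<delta>(1) by simp
      finally have "\<bar>f y - f x\<bar> < e" using \<delta>(2)[OF x y] by (simp add: dist_norm)
      then show ?thesis using mollifier_nonneg[OF h(1), of x y] by (intro mult_right_mono) auto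
    qed simp
    have i1: "integrable lborel (\<lambda>y. indicator unit_cube y *\<^sub>R (f y * mollifier h x y))"
      and i2: "integrable lborel (\<lambda>y. indicator unit_cube y *\<^sub>R (f x * mollifier h x y))"
      by (intro borel_integrable_compact compact_cbox continuous_intros f mc)+
    have one: "f x = (\<integral>y. indicator unit_cube y *\<^sub>R (f x * mollifier h x y) \<partial>lborel)"
    proof -
      have "(\<lambda>y. indicator unit_cube y *\<^sub>R (f x * mollifier h x y)) = (\<lambda>y. f x * mollifier h x y)"
        using mollifier_outside[OF h(1) h4 x] by (auto split: split_indicator)
      then show ?thesis by (simp add: mollifier_integrable[OF h(1)])
    qed
    have diff: "mollify h f (\<lambda>_. 0) x - f x = (\<integral>y. indicator unit_cube y *\<^sub>R (f y * mollifier h x y) - indicator unit_cube y *\<^sub>R (f x * mollifier h x y) \<partial>lborel)"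
      by (subst Bochner_Integration.integral_diff[OF i1 i2], subst one)
        (simp add: mollify_def mollifier_deriv_0 set_lebesgue_integral_def)
    have "\<bar>mollify h f (\<lambda>_. 0) x - f x\<bar> \<le> (\<integral>y. \<bar>indicator unit_cube y *\<^sub>R (f y * mollifier h x y) - indicator unit_cube y *\<^sub>R (f x * mollifier h x y)\<bar> \<partial>lborel)"
      unfolding diff by (rule integral_abs_bound)
    also have "\<dots> \<le> (\<integral>y. e * mollifier h x y \<partial>lborel)"
    proof (rule integral_mono)
      show "integrable lborel (\<lambda>y. \<bar>indicator unit_cube y *\<^sub>R (f y * mollifier h x y) - indicator unit_cube y *\<^sub>R (f x * mollifier h x y)\<bar>)"
        by (rule integrable_abs[OF Bochner_Integration.integrable_diff[OF i1 i2]])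
      show "integrable lborel (\<lambda>y. e * mollifier h x y)"
        by (rule Bochner_Integration.integrable_mult_right[OF mollifier_integrable(1)[OF h(1)]])
      fix y :: "real^'d"
      show "\<bar>indicator unit_cube y *\<^sub>R (f y * mollifier h x y) - indicator unit_cube y *\<^sub>R (f x * mollifier h x y)\<bar> \<le> e * mollifier h x y"
      proof (cases "y \<in> unit_cube")
        case True
        have "\<bar>f y * mollifier h x y - f x * mollifier h x y\<bar> = \<bar>f y - f x\<bar> * mollifier h x y"
          using mollifier_nonneg[OF h(1), of x y] by (simp add: abs_mult flip: left_diff_distrib)
        then show ?thesis using near[OF True] True by simp
      next
        case False
        then show ?thesis using mollifier_outside[OF h(1) h4 x] by simp
      qed
    qed
    also have "\<dots> = e" by (simp add: mollifier_integrable[OF h(1)])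
    finally show ?thesis .
  qed
  with h0 show ?thesis by blast
qed

lemma weak_deriv_props:
  assumes "f \<in> sobolev_space A" "\<beta> \<in> A"
  shows "weak_deriv \<beta> f \<in> L2_cube" "is_weak_deriv \<beta> f (weak_deriv \<beta> f)"
proof -
  have "\<exists>g. g \<in> L2_cube \<and> is_weak_deriv \<beta> f g" using assms by (auto simp: sobolev_space_def)
  from someI_ex[OF this] show "weak_deriv \<beta> f \<in> L2_cube" "is_weak_deriv \<beta> f (weak_deriv \<beta> f)"
    unfolding weak_deriv_def by auto
qed

text \<open>Passing the derivatives of the kernel from \<open>x\<close> to \<open>y\<close> gives a
  sign, and the definition of the weak derivative gives the same sign once more; they cancel,
  leaving the power of \<open>1 - 2 * h\<close>.\<close>

lemma mollify_weak:
  fixes f :: "real^'d::finite \<Rightarrow> real"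
  assumes h: "0 < h" "h \<le> 1 / 4" and x: "x \<in> unit_cube"
    and f: "continuous_on unit_cube f" and g: "g \<in> borel_measurable (lebesgue_on unit_cube)"
    and weak: "is_weak_deriv \<beta> f g"
    and g0: "g0 \<in> borel_measurable borel" "\<And>x. x \<notin> unit_cube \<Longrightarrow> g0 x = 0"
      "AE x in lborel. x \<in> unit_cube \<longrightarrow> g0 x = g x"
  shows "mollify h f \<beta> x = (1 - 2 * h) ^ (\<Sum>i\<in>UNIV. \<beta> i) * (\<integral>y. g0 y * mollifier h x y \<partial>lborel)"
proof -
  let ?n = "\<Sum>i\<in>UNIV. \<beta> i"
  obtain js where js: "\<And>i. count_list js i = \<beta> i" using exists_multiindex_list[of \<beta>] by blast
  define ip where "ip = iter_partial js (mollifier h x)"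
  have ipc: "continuous_on A ip" for A
    using mollifier_test_function(1)[OF h x] unfolding test_function_def ip_def
    by (intro continuous_at_imp_continuous_on ballI differentiable_imp_continuous_within) auto
  have mc: "continuous_on A (mollifier h x)" for A by (intro mollifier_cont continuous_intros)
  have [measurable]: "mollifier h x \<in> borel_measurable borel" by (intro borel_measurable_continuous_onI mc)
  have fip: "integrable lborel (\<lambda>y. indicator unit_cube y *\<^sub>R (f y * ip y))"
    by (intro borel_integrable_compact compact_cbox continuous_intros f ipc)
  have e1: "(LINT y|lebesgue_on unit_cube. f y * ip y) = (LINT y:unit_cube|lborel. f y * ip y)"
    unfolding set_lebesgue_integral_def
  proof (rule lebesgue_on_cube_transfer(1))
    show "(\<lambda>y. f y * ip y) \<in> borel_measurable (lebesgue_on unit_cube)"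
      by (intro continuous_imp_measurable_on_sets_lebesgue continuous_intros f ipc) auto
  qed (use fip in auto)
  have e2: "(LINT y|lebesgue_on unit_cube. g y * mollifier h x y) = (\<integral>y. g0 y * mollifier h x y \<partial>lborel)"
  proof (rule lebesgue_on_cube_transfer(1))
    show "(\<lambda>y. g y * mollifier h x y) \<in> borel_measurable (lebesgue_on unit_cube)"
      by (intro borel_measurable_times g continuous_imp_measurable_on_sets_lebesgue mc) auto
    show "(\<lambda>y. g0 y * mollifier h x y) \<in> borel_measurable borel" using g0(1) by measurable
    show "AE y in lborel. y \<in> unit_cube \<longrightarrow> g0 y * mollifier h x y = g y * mollifier h x y"
      using g0(3) by eventually_elim auto
  qed (use g0 in auto)
  have "mollify h f \<beta> x = (LINT y:unit_cube|lborel. ((1 - 2 * h) ^ ?n * (-1) ^ ?n) * (f y * ip y))"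
    unfolding mollify_def ip_def using mollifier_test_function(2)[OF h x, of js \<beta>, OF js, symmetric] by (simp add: mult_ac)
  also have "\<dots> = ((1 - 2 * h) ^ ?n * (-1) ^ ?n) * (LINT y|lebesgue_on unit_cube. f y * ip y)"
    unfolding e1 by (rule set_integral_mult_right)
  also have "(LINT y|lebesgue_on unit_cube. f y * ip y) = (-1) ^ ?n * (LINT y|lebesgue_on unit_cube. g y * mollifier h x y)"
    using weak mollifier_test_function(1)[OF h x] js unfolding is_weak_deriv_def ip_def by blast
  finally show ?thesis unfolding e2 by (simp add: mult.assoc[symmetric] power_mult_distrib[symmetric])
qed

text \<open>The kernel is a probability density in \<open>y\<close>, so the square of an average is
  at most the average of the square. Integration over \<open>x\<close> then costs the factor
  \<open>2 ^ d\<close>, the bound for the mass of the kernel in \<open>x\<close>, and powers of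
  \<open>1 - 2 * h\<close> are at most one.\<close>

lemma mollify_L2:
  fixes f :: "real^'d::finite \<Rightarrow> real"
  assumes h: "0 < h" "h \<le> 1 / 4" and f: "continuous_on unit_cube f"
    and g: "g \<in> L2_cube" and weak: "is_weak_deriv \<beta> f g"
  shows "(LINT x:unit_cube|lborel. (mollify h f \<beta> x)\<^sup>2) \<le> 2 ^ CARD('d) * (L2_norm_cube g)\<^sup>2"
proof -
  have gm: "g \<in> borel_measurable (lebesgue_on unit_cube)" and gi: "integrable (lebesgue_on unit_cube) (\<lambda>x. (g x)\<^sup>2)"
    using g by (auto simp: L2_cube_def)
  obtain g0 where g0 [measurable]: "g0 \<in> borel_measurable borel" and g0': "\<And>x. x \<notin> unit_cube \<Longrightarrow> g0 x = 0"
    "AE x in lborel. x \<in> unit_cube \<longrightarrow> g0 x = g x"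
  proof (rule lebesgue_on_cube_borel[OF gm])
    fix g1 :: "real^'d \<Rightarrow> real"
    assume "g1 \<in> borel_measurable borel" "\<And>x. x \<notin> unit_cube \<Longrightarrow> g1 x = 0" "AE x in lborel. x \<in> unit_cube \<longrightarrow> g1 x = g x"
    then show thesis by (rule that)
  qed
  have gm2: "(\<lambda>x. (g x)\<^sup>2) \<in> borel_measurable (lebesgue_on unit_cube)"
    using gm by measurable
  have g0m2: "(\<lambda>x. (g0 x)\<^sup>2) \<in> borel_measurable borel" by measurable
  have ae2: "AE x in lborel. x \<in> unit_cube \<longrightarrow> (g0 x)\<^sup>2 = (g x)\<^sup>2" using g0'(2) by eventually_elim auto
  have sq: "(LINT x|lebesgue_on unit_cube. (g x)\<^sup>2) = (\<integral>x. (g0 x)\<^sup>2 \<partial>lborel)" and sqi: "integrable lborel (\<lambda>x. (g0 x)\<^sup>2)"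
    using lebesgue_on_cube_transfer[OF gm2 g0m2 _ ae2] g0'(1) gi by simp_all
  have norm: "(L2_norm_cube g)\<^sup>2 = (\<integral>x. (g0 x)\<^sup>2 \<partial>lborel)"
    unfolding L2_norm_cube_def sq by (rule real_sqrt_pow2) (rule Bochner_Integration.integral_nonneg, simp)
  have ci: "integrable lborel (indicator (unit_cube :: (real^'d) set) :: _ \<Rightarrow> real)"
    by (rule integrable_real_indicator) (use emeasure_lborel_cbox_finite[of 0 "1 :: real^'d"] in auto)
  have g0i: "integrable lborel g0"
  proof (rule Bochner_Integration.integrable_bound[OF Bochner_Integration.integrable_add[OF ci sqi]])
    show "AE x in lborel. norm (g0 x) \<le> norm (indicator unit_cube x + (g0 x)\<^sup>2)"
    proof (rule AE_I2)
      fix x :: "real^'d"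
      have "\<bar>g0 x\<bar> \<le> 1 + (g0 x)\<^sup>2"
        using sum_squares_bound[of "\<bar>g0 x\<bar>" 1] by (simp add: power2_eq_square)
      then show "norm (g0 x) \<le> norm (indicator unit_cube x + (g0 x)\<^sup>2)"
        using g0'(1)[of x] by (cases "x \<in> unit_cube") auto
    qed
  qed simp
  have mm: "(\<lambda>(x, y). mollifier h (x :: real^'d) y) \<in> borel_measurable borel"
    by (intro borel_measurable_continuous_onI) (auto simp: case_prod_beta intro!: mollifier_cont continuous_intros)
  have [measurable]: "(\<lambda>z. mollifier h (u z) (v z)) \<in> borel_measurable M"
    if "u \<in> borel_measurable M" "v \<in> borel_measurable M" for M :: "'z measure" and u v :: "'z \<Rightarrow> real^'d"
    using measurable_compose[OF borel_measurable_Pair[OF that] mm] by simp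
  have bound: "(mollify h f \<beta> x)\<^sup>2 \<le> (\<integral>y. (g0 y)\<^sup>2 * mollifier h x y \<partial>lborel)" if x: "x \<in> unit_cube" for x
  proof -
    define c where "c = (\<integral>y. g0 y * mollifier h x y \<partial>lborel)"
    have mc: "continuous_on A (mollifier h x)" for A by (intro mollifier_cont continuous_intros)
    obtain b where b: "\<And>y. y \<in> unit_cube \<Longrightarrow> \<bar>mollifier h x y\<bar> \<le> b"
      using compact_imp_bounded[OF compact_continuous_image[OF mc compact_cbox[of 0 1]]] unfolding bounded_iff
      by (metis imageI real_norm_def)
    have bb: "\<bar>mollifier h x y\<bar> \<le> \<bar>b\<bar>" for y
      using b[of y] mollifier_outside[OF h x, of y] by (cases "y \<in> unit_cube") auto
    have dom: "norm (g0 y * mollifier h x y) \<le> norm (\<bar>b\<bar> * norm (g0 y))" for y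
      using mult_left_mono[OF bb[of y], of "\<bar>g0 y\<bar>"] by (simp add: abs_mult mult.commute)
    have dom2: "norm ((g0 y)\<^sup>2 * mollifier h x y) \<le> norm (\<bar>b\<bar> * (g0 y)\<^sup>2)" for y
      using mult_left_mono[OF bb[of y], of "(g0 y)\<^sup>2"] by (simp add: abs_mult mult.commute)
    have i1: "integrable lborel (\<lambda>y. g0 y * mollifier h x y)"
      by (rule Bochner_Integration.integrable_bound[OF Bochner_Integration.integrable_mult_right[OF integrable_norm[OF g0i], of "\<bar>b\<bar>"]])
        (measurable, intro AE_I2, rule dom)
    have i2: "integrable lborel (\<lambda>y. (g0 y)\<^sup>2 * mollifier h x y)"
      by (rule Bochner_Integration.integrable_bound[OF Bochner_Integration.integrable_mult_right[OF sqi, of "\<bar>b\<bar>"]])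
        (measurable, intro AE_I2, rule dom2)
    note i3 = mollifier_integrable[OF h(1), of x]
    \<comment> \<open>Jensen's inequality for the square, in the form that a variance is
      nonnegative.\<close>
    have "0 \<le> (\<integral>y. (g0 y - c)\<^sup>2 * mollifier h x y \<partial>lborel)"
      by (intro Bochner_Integration.integral_nonneg mult_nonneg_nonneg mollifier_nonneg[OF h(1)]) simp
    also have "\<dots> = (\<integral>y. ((g0 y)\<^sup>2 * mollifier h x y - 2 * c * (g0 y * mollifier h x y)) + c\<^sup>2 * mollifier h x y \<partial>lborel)"
      by (intro Bochner_Integration.integral_cong refl) (simp add: power2_eq_square algebra_simps)
    also have "\<dots> = ((\<integral>y. (g0 y)\<^sup>2 * mollifier h x y \<partial>lborel) - (\<integral>y. 2 * c * (g0 y * mollifier h x y) \<partial>lborel)) + (\<integral>y. c\<^sup>2 * mollifier h x y \<partial>lborel)"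
      by (subst Bochner_Integration.integral_add, (intro Bochner_Integration.integrable_diff Bochner_Integration.integrable_mult_right i1 i2 i3)+)
        (subst Bochner_Integration.integral_diff, (intro Bochner_Integration.integrable_mult_right i1 i2)+, rule refl)
    also have "\<dots> = (\<integral>y. (g0 y)\<^sup>2 * mollifier h x y \<partial>lborel) - 2 * c * c + c\<^sup>2 * 1"
      by (simp only: Bochner_Integration.integral_mult_right_zero i3(2) c_def)
    finally have cc: "c\<^sup>2 \<le> (\<integral>y. (g0 y)\<^sup>2 * mollifier h x y \<partial>lborel)" by (simp add: power2_eq_square)
    have "mollify h f \<beta> x = (1 - 2 * h) ^ (\<Sum>i\<in>UNIV. \<beta> i) * c"
      unfolding c_def by (rule mollify_weak[OF h x f gm weak g0 g0'])
    then have "(mollify h f \<beta> x)\<^sup>2 = ((1 - 2 * h) ^ (\<Sum>i\<in>UNIV. \<beta> i))\<^sup>2 * c\<^sup>2" by (simp add: power_mult_distrib)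
    also have "\<dots> \<le> 1 * c\<^sup>2" using h by (intro mult_right_mono power_le_one) auto
    finally show ?thesis using cc by simp
  qed
  have mfc: "continuous_on A (mollify h f \<beta>)" for A
    using deriv_familyD(1)[OF mollify_family[OF f]] h by auto
  have mfi: "integrable lborel (\<lambda>x. indicator unit_cube x *\<^sub>R (mollify h f \<beta> x)\<^sup>2)"
    by (intro borel_integrable_compact compact_cbox continuous_intros mfc)
  have "ennreal (LINT x:unit_cube|lborel. (mollify h f \<beta> x)\<^sup>2) = (\<integral>\<^sup>+x. ennreal (indicator unit_cube x *\<^sub>R (mollify h f \<beta> x)\<^sup>2) \<partial>lborel)"
    unfolding set_lebesgue_integral_def by (rule nn_integral_eq_integral[OF mfi, symmetric]) auto
  also have "\<dots> \<le> (\<integral>\<^sup>+x. (\<integral>\<^sup>+y. ennreal ((g0 y)\<^sup>2) * ennreal (mollifier h x y) \<partial>lborel) \<partial>lborel)"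
  proof (rule nn_integral_mono)
    fix x :: "real^'d"
    show "ennreal (indicator unit_cube x *\<^sub>R (mollify h f \<beta> x)\<^sup>2) \<le> (\<integral>\<^sup>+y. ennreal ((g0 y)\<^sup>2) * ennreal (mollifier h x y) \<partial>lborel)"
    proof (cases "x \<in> unit_cube")
      case True
      have "ennreal ((mollify h f \<beta> x)\<^sup>2) \<le> ennreal (\<integral>y. (g0 y)\<^sup>2 * mollifier h x y \<partial>lborel)"
        by (rule ennreal_leI[OF bound[OF True]])
      also have "\<dots> \<le> (\<integral>\<^sup>+y. ennreal ((g0 y)\<^sup>2 * mollifier h x y) \<partial>lborel)"
      proof (cases "integrable lborel (\<lambda>y. (g0 y)\<^sup>2 * mollifier h x y)")
        case i: True
        have "AE y in lborel. 0 \<le> (g0 y)\<^sup>2 * mollifier h x y"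
          by (intro AE_I2 mult_nonneg_nonneg mollifier_nonneg[OF h(1)]) simp
        from nn_integral_eq_integral[OF i this] show ?thesis by (simp only: order_refl)
      qed (simp add: not_integrable_integral_eq)
      also have "\<dots> = (\<integral>\<^sup>+y. ennreal ((g0 y)\<^sup>2) * ennreal (mollifier h x y) \<partial>lborel)"
        by (intro nn_integral_cong ennreal_mult mollifier_nonneg[OF h(1)]) simp
      finally show ?thesis using True by simp
    qed simp
  qed
  also have "\<dots> = (\<integral>\<^sup>+y. (\<integral>\<^sup>+x. ennreal ((g0 y)\<^sup>2) * ennreal (mollifier h x y) \<partial>lborel) \<partial>lborel)"
    by (rule pair_sigma_finite.Fubini'[OF pair_sigma_finite_lborel, symmetric]) measurable
  also have "\<dots> \<le> (\<integral>\<^sup>+y. ennreal ((g0 y)\<^sup>2) * ennreal (2 ^ CARD('d)) \<partial>lborel)"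
  proof (rule nn_integral_mono)
    fix y :: "real^'d"
    have "(\<integral>\<^sup>+x. ennreal ((g0 y)\<^sup>2) * ennreal (mollifier h x y) \<partial>lborel) = ennreal ((g0 y)\<^sup>2) * (\<integral>\<^sup>+x. ennreal (mollifier h x y) \<partial>lborel)"
      by (rule nn_integral_cmult) measurable
    also have "\<dots> \<le> ennreal ((g0 y)\<^sup>2) * ennreal (2 ^ CARD('d))"
      by (intro mult_left_mono nn_integral_mollifier_x h) simp
    finally show "(\<integral>\<^sup>+x. ennreal ((g0 y)\<^sup>2) * ennreal (mollifier h x y) \<partial>lborel) \<le> ennreal ((g0 y)\<^sup>2) * ennreal (2 ^ CARD('d))" .
  qed
  also have "\<dots> = (\<integral>\<^sup>+y. ennreal ((g0 y)\<^sup>2) \<partial>lborel) * ennreal (2 ^ CARD('d))"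
    by (rule nn_integral_multc) measurable
  also have "(\<integral>\<^sup>+y. ennreal ((g0 y)\<^sup>2) \<partial>lborel) = ennreal ((L2_norm_cube g)\<^sup>2)"
    unfolding norm by (rule nn_integral_eq_integral[OF sqi]) auto
  also have "ennreal ((L2_norm_cube g)\<^sup>2) * ennreal (2 ^ CARD('d)) = ennreal (2 ^ CARD('d) * (L2_norm_cube g)\<^sup>2)"
    by (subst ennreal_mult) (auto simp: mult.commute)
  finally show ?thesis by (subst (asm) ennreal_le_iff) auto
qed

text \<open>Uniform closeness and bounded derivative norms are enough, and convergence of the
  derivatives is not claimed: a fixed rule and the integral are continuous in the sup norm, and the
  norm is needed only up to the constant \<open>2 ^ d\<close>, which does not depend on
  \<open>e\<close>.\<close>

lemma sobolev_approx:
  fixes f :: "real^'d::finite \<Rightarrow> real"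
  assumes f: "f \<in> sobolev_space A" "continuous_on unit_cube f" and "e > 0"
  obtains F where "deriv_family F" "\<And>x. x \<in> unit_cube \<Longrightarrow> \<bar>F (\<lambda>_. 0) x - f x\<bar> \<le> e"
    "\<And>\<beta>. \<beta> \<in> A \<Longrightarrow> (LINT x:unit_cube|lborel. (F \<beta> x)\<^sup>2) \<le> 2 ^ CARD('d) * (L2_norm_cube (weak_deriv \<beta> f))\<^sup>2"
proof -
  obtain h0 where h0: "h0 > 0" "\<And>h x. 0 < h \<Longrightarrow> h \<le> h0 \<Longrightarrow> x \<in> unit_cube \<Longrightarrow> \<bar>mollify h f (\<lambda>_. 0) x - f x\<bar> \<le> e"
    using mollify_sup[OF f(2) \<open>e > 0\<close>] by blast
  define h where "h = min h0 (1 / 4)"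
  have h: "0 < h" "h \<le> h0" "h \<le> 1 / 4" using h0 by (auto simp: h_def)
  show thesis
  proof (rule that[of "mollify h f"])
    show "deriv_family (mollify h f)" using h by (intro mollify_family f(2)) auto
    show "\<bar>mollify h f (\<lambda>_. 0) x - f x\<bar> \<le> e" if "x \<in> unit_cube" for x
      by (rule h0(2)[OF h(1,2) that])
    show "(LINT x:unit_cube|lborel. (mollify h f \<beta> x)\<^sup>2) \<le> 2 ^ CARD('d) * (L2_norm_cube (weak_deriv \<beta> f))\<^sup>2" if "\<beta> \<in> A" for \<beta>
      using weak_deriv_props[OF f(1) that] by (intro mollify_L2 h f(2))
  qed
qed

end

subsection \<open>Dilated Frolov lattices\<close>

lemma dilation_nth: "dilation a B u $ i $ j = a * (u $ i) * (B $ i $ j)"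
proof -
  have "(\<Sum>k\<in>UNIV. (if i = k then u $ i else 0) * B $ k $ j) = (\<Sum>k\<in>UNIV. if i = k then u $ i * B $ k $ j else 0)"
    by (intro sum.cong) auto
  then show ?thesis by (simp add: dilation_def diag_matrix_def matrix_matrix_mult_def)
qed

lemma dilation_mult: "(dilation a B u *v k) $ i = a * u $ i * (B *v k) $ i"
  by (simp add: matrix_vector_mult_def dilation_nth sum_distrib_left mult.assoc)

lemma det_dilation: "det (dilation a B u) = a ^ CARD('d) * (\<Prod>i\<in>UNIV. u $ i) * det (B :: real^'d^'d::finite)"
proof -
  have "dilation a B u = (\<chi> i. (a * u $ i) *s (B $ i))"
    by (simp add: vec_eq_iff dilation_nth)
  then show ?thesis
    using det_rows_mul[of "\<lambda>i. a * u $ i" "\<lambda>i. B $ i"] by (simp add: prod.distrib vec_lambda_eta)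
qed

lemma u_box_iff: "u \<in> u_box \<longleftrightarrow> (\<forall>i. 1 \<le> u $ i \<and> u $ i \<le> 2 powr (1 / real CARD('d)))"
  for u :: "real^'d::finite"
  by (auto simp: u_box_def mem_box_cart)

lemma two_root_power: "(2 powr (1 / real CARD('d::finite))) ^ CARD('d) = 2"
  by (simp add: powr_realpow[symmetric] powr_powr)

lemma two_root_le: "2 powr (1 / real CARD('d::finite)) \<le> 2"
  using powr_mono[of "1 / real CARD('d)" 1 2] by (simp add: Suc_le_eq)

lemma u_box_le2: "u \<in> u_box \<Longrightarrow> \<bar>u $ i\<bar> \<le> 2" for u :: "real^'d::finite"
  using two_root_le[where 'd = 'd] unfolding u_box_iff by (smt (verit))

lemma u_box_prod: "u \<in> u_box \<Longrightarrow> 1 \<le> (\<Prod>i\<in>UNIV. u $ i)" for u :: "real^'d::finite"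
  unfolding u_box_iff by (intro prod_ge_1) auto

lemma det_dilation_ge:
  assumes "u \<in> u_box" "a > 0"
  shows "a ^ CARD('d) * \<bar>det B\<bar> \<le> \<bar>det (dilation a (B :: real^'d^'d::finite) u)\<bar>"
proof -
  have "a ^ CARD('d) * 1 * \<bar>det B\<bar> \<le> a ^ CARD('d) * (\<Prod>i\<in>UNIV. u $ i) * \<bar>det B\<bar>"
    using assms u_box_prod[OF assms(1)] by (intro mult_right_mono mult_left_mono) auto
  also have "\<dots> = \<bar>det (dilation a B u)\<bar>"
    using assms u_box_prod[OF assms(1)] by (simp add: det_dilation abs_mult)
  finally show ?thesis by simp
qed

lemma invertible_dilation:
  assumes "invertible (B :: real^'d^'d::finite)" "u \<in> u_box" "a > 0"
  shows "invertible (dilation a B u)"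
proof -
  have "0 < a ^ CARD('d) * \<bar>det B\<bar>" using assms by (simp add: invertible_det_nz)
  with det_dilation_ge[OF assms(2,3), of B] show ?thesis by (auto simp: invertible_det_nz)
qed

text \<open>The 2 is a crude bound for the entries of \<open>u\<close>, valid in every dimension
  since \<open>2 powr (1 / d) \<le> 2\<close>.\<close>

lemma transpose_dilation_bound:
  fixes B :: "real^'d^'d::finite"
  assumes b: "\<And>i j. \<bar>B $ i $ j\<bar> \<le> b" and u: "u \<in> u_box" and "a > 0" and w: "\<And>i. \<bar>w $ i\<bar> \<le> r"
  shows "\<bar>(transpose (dilation a B u) *v w) $ j\<bar> \<le> real CARD('d) * (2 * a * b * r)"
proof -
  have b0: "0 \<le> b" using b[of undefined undefined] by linarith
  have r0: "0 \<le> r" using w[of undefined] by linarith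
  have "\<bar>(transpose (dilation a B u) *v w) $ j\<bar> = \<bar>\<Sum>i\<in>UNIV. dilation a B u $ i $ j * w $ i\<bar>"
    by (simp add: matrix_vector_mult_def transpose_def del: transpose_matrix_vector)
  also have "\<dots> \<le> (\<Sum>i\<in>UNIV. \<bar>dilation a B u $ i $ j * w $ i\<bar>)" by (rule sum_abs)
  also have "\<dots> \<le> real CARD('d) * (2 * a * b * r)"
  proof (rule order_trans[OF sum_bounded_above])
    fix i :: 'd
    have "\<bar>dilation a B u $ i $ j * w $ i\<bar> = a * \<bar>u $ i\<bar> * \<bar>B $ i $ j\<bar> * \<bar>w $ i\<bar>"
      using \<open>a > 0\<close> by (simp add: dilation_nth abs_mult)
    also have "\<dots> \<le> a * 2 * b * r"
      using u_box_le2[OF u, of i] b[of i j] w[of i] \<open>a > 0\<close> b0 r0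
      by (intro mult_mono mult_nonneg_nonneg) auto
    finally show "\<bar>dilation a B u $ i $ j * w $ i\<bar> \<le> 2 * a * b * r" by (simp add: mult_ac)
  qed simp
  finally show ?thesis .
qed

lemma node_transpose:
  assumes "invertible (S :: real^'d^'d::finite)"
  shows "transpose S *v node S v m = m + v"
  unfolding node_eq by (rule node_matrix_props(3)[OF assms])

lemma matrix_entry_bound:
  obtains b where "b > 0" "\<And>i j. \<bar>(B :: real^'d^'d::finite) $ i $ j\<bar> \<le> b"
proof
  show "0 < (\<Sum>i\<in>UNIV. \<Sum>j\<in>UNIV. \<bar>B $ i $ j\<bar>) + 1"
    using sum_nonneg[of UNIV "\<lambda>i. \<Sum>j\<in>UNIV. \<bar>B $ i $ j\<bar>"] by (simp add: sum_nonneg add_nonneg_pos)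
  fix i j
  have "\<bar>B $ i $ j\<bar> \<le> (\<Sum>j\<in>UNIV. \<bar>B $ i $ j\<bar>)" by (intro member_le_sum) auto
  also have "\<dots> \<le> (\<Sum>i\<in>UNIV. \<Sum>j\<in>UNIV. \<bar>B $ i $ j\<bar>)" by (intro member_le_sum[of i UNIV "\<lambda>i. \<Sum>j\<in>UNIV. \<bar>B $ i $ j\<bar>"]) (auto intro: sum_nonneg)
  finally show "\<bar>B $ i $ j\<bar> \<le> (\<Sum>i\<in>UNIV. \<Sum>j\<in>UNIV. \<bar>B $ i $ j\<bar>) + 1" by simp
qed

text \<open>\<open>m\<close> is recovered as \<open>transpose S *v x - v\<close> from a node
  \<open>x\<close> in the cube, and this is bounded uniformly in \<open>(u, v)\<close>.\<close>

lemma finite_nodes: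
  fixes B :: "real^'d^'d::finite"
  assumes B: "invertible B" and a: "a > 0"
  shows "finite {m \<in> int_lattice. \<exists>(u, v)\<in>realizations. node (dilation a B u) v m \<in> unit_cube}"
proof -
  obtain b where b: "b > 0" "\<And>i j. \<bar>B $ i $ j\<bar> \<le> b" using matrix_entry_bound[of B] by blast
  let ?r = "real CARD('d) * (2 * a * b * 1) + 1"
  let ?K = "cbox (\<chi> i. - ?r) (\<chi> i. ?r) :: (real^'d) set"
  have "{m \<in> int_lattice. \<exists>(u, v)\<in>realizations. node (dilation a B u) v m \<in> unit_cube} \<subseteq> int_lattice \<inter> ?K"
  proof safe
    fix m u v :: "real^'d"
    assume uv: "(u, v) \<in> realizations" and n: "node (dilation a B u) v m \<in> unit_cube"
    from uv have u: "u \<in> u_box" and v: "v \<in> unit_cube" by (auto simp: realizations_def)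
    have "\<bar>m $ j\<bar> \<le> ?r" for j
    proof -
      have "\<bar>node (dilation a B u) v m $ i\<bar> \<le> 1" for i using n by (auto simp: mem_unit_cube)
      from transpose_dilation_bound[OF b(2) u a this, of j]
      have "\<bar>m $ j + v $ j\<bar> \<le> real CARD('d) * (2 * a * b * 1)"
        unfolding node_transpose[OF invertible_dilation[OF B u a]] by simp
      moreover have "0 \<le> v $ j" "v $ j \<le> 1" using v by (auto simp: mem_unit_cube)
      ultimately show ?thesis by linarith
    qed
    then have "- ?r \<le> m $ j" "m $ j \<le> ?r" for j using abs_le_iff[of "m $ j" ?r] by (metis minus_le_iff)+
    then show "m \<in> ?K" by (simp only: mem_box_cart vec_lambda_beta simp_thms)
  qed
  moreover have "finite (int_lattice \<inter> ?K)" by (rule finite_int_lattice_bounded) simp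
  ultimately show ?thesis by (rule finite_subset)
qed

text \<open>Split the cube into \<open>k ^ d\<close> cells; two nodes in one cell would come from two lattice points
  at distance less than one.\<close>

lemma uses_at_most_power:
  fixes B :: "real^'d^'d::finite"
  assumes B: "invertible B"
  obtains a0 where "0 < a0" "a0 \<le> 1" "\<And>k. k \<ge> 1 \<Longrightarrow> uses_at_most (k ^ CARD('d)) (a0 * real k) B"
proof -
  obtain b where b: "b > 0" "\<And>i j. \<bar>B $ i $ j\<bar> \<le> b" using matrix_entry_bound[of B] by blast
  \<comment> \<open>The coordinates of \<open>m - m'\<close> for two nodes in one cell are at most
    \<open>d * (2 * a0 * b)\<close> in absolute value, and \<open>a0\<close> makes this less than
    one; the summand 1 in the denominator also gives \<open>a0 \<le> 1\<close>.\<close>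
  define a0 where "a0 = 1 / (2 * b * real CARD('d) + 1)"
  have pos: "0 < 2 * b * real CARD('d)" using b by simp
  have a0: "0 < a0" "a0 \<le> 1" using pos by (auto simp: a0_def)
  have a0b: "real CARD('d) * (2 * a0 * b) < 1" using pos by (simp add: a0_def field_simps)
  show thesis
  proof (rule that[OF a0])
    fix k :: nat assume k: "k \<ge> 1"
    define a where "a = a0 * real k"
    have a: "a > 0" using a0 k by (simp add: a_def)
    have "finite T \<and> card T \<le> k ^ CARD('d)"
      if u: "u \<in> u_box" and T: "T = {m \<in> int_lattice. node (dilation a B u) v m \<in> unit_cube}" for u v T
    proof -
      let ?S = "dilation a B u"
      note inv = invertible_dilation[OF B u a]
      \<comment> \<open>The \<open>min\<close> puts a coordinate equal to one into the last cell, so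
        that \<open>k\<close> cells per coordinate cover the closed interval.\<close>
      define cell where "cell m = (\<lambda>i. min (nat \<lfloor>real k * node ?S v m $ i\<rfloor>) (k - 1))" for m
      have "inj_on cell T"
      proof (rule inj_onI)
        fix m m' assume m: "m \<in> T" "m' \<in> T" and eq: "cell m = cell m'"
        let ?w = "node ?S v m - node ?S v m'"
        have close: "\<bar>?w $ i\<bar> \<le> 1 / real k" for i
        proof -
          have *: "real (min (nat \<lfloor>real k * x\<rfloor>) (k - 1)) \<le> real k * x \<and> real k * x \<le> real (min (nat \<lfloor>real k * x\<rfloor>) (k - 1)) + 1"
            if "0 \<le> x" "x \<le> 1" for x :: real
          proof -
            have "0 \<le> real k * x" "real k * x \<le> real k" using that k by (auto intro: mult_left_le)
            then have "real (nat \<lfloor>real k * x\<rfloor>) \<le> real k * x" "real k * x < real (nat \<lfloor>real k * x\<rfloor>) + 1" "real (k - 1) = real k - 1"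
              using k by (auto simp: of_nat_diff)
            then show ?thesis using \<open>real k * x \<le> real k\<close> by (auto simp: min_def)
          qed
          have x: "0 \<le> node ?S v m $ i" "node ?S v m $ i \<le> 1" "0 \<le> node ?S v m' $ i" "node ?S v m' $ i \<le> 1"
            using m unfolding T by (auto simp: mem_unit_cube)
          have "\<bar>real k * node ?S v m $ i - real k * node ?S v m' $ i\<bar> \<le> 1"
            using *[OF x(1,2)] *[OF x(3,4)] fun_cong[OF eq, of i] unfolding cell_def by linarith
          then have "real k * \<bar>?w $ i\<bar> \<le> 1" by (simp add: abs_mult flip: right_diff_distrib)
          then show ?thesis using k by (simp add: field_simps)
        qed
        have "transpose ?S *v ?w = m - m'"
          by (simp only: matrix_vector_mult_diff_distrib node_transpose[OF inv]) simp
        then have lt: "\<bar>(m - m') $ j\<bar> < 1" for j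
          using transpose_dilation_bound[OF b(2) u a close, of j] a0b k by (simp add: a_def)
        have "(m - m') $ j = 0" for j
        proof -
          have "m - m' \<in> int_lattice" using m by (intro int_lattice_closed) (auto simp: T)
          then obtain z where "(m - m') $ j = of_int z" by (auto simp: int_lattice_def Ints_def)
          with lt[of j] show ?thesis by simp
        qed
        then show "m = m'" by (simp add: vec_eq_iff)
      qed
      moreover have "cell ` T \<subseteq> PiE UNIV (\<lambda>_. {..<k})"
        using k by (auto simp: cell_def)
      moreover have "finite (PiE (UNIV :: 'd set) (\<lambda>_. {..<k}))" by (intro finite_PiE) auto
      moreover have "card (PiE (UNIV :: 'd set) (\<lambda>_. {..<k})) = k ^ CARD('d)" by (simp add: card_PiE)
      ultimately show ?thesis by (metis inj_on_finite card_inj_on_le)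
    qed
    then show "uses_at_most (k ^ CARD('d)) (a0 * real k) B"
      unfolding uses_at_most_def Let_def a_def[symmetric] by (auto simp: realizations_def)
  qed
qed

lemma uses_at_most_mono: "uses_at_most n a B \<Longrightarrow> n \<le> n' \<Longrightarrow> uses_at_most n' a B"
  unfolding uses_at_most_def Let_def by fastforce

text \<open>One finite index set for all \<open>u\<close> and \<open>v\<close>, so that the random
  rule is a fixed finite sum of functions of \<open>(u, v)\<close>.\<close>

definition node_set :: "real \<Rightarrow> real^'d^'d::finite \<Rightarrow> (real^'d) set" where
  "node_set a B = {m \<in> int_lattice. \<exists>(u, v)\<in>realizations. node (dilation a B u) v m \<in> unit_cube}"

lemma cubature_dilation:
  fixes B :: "real^'d^'d::finite"
  assumes B: "invertible B" and a: "a > 0" and uses: "uses_at_most N a B" and u: "u \<in> u_box"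
  shows "cubature (dilation a B u) (node_set a B) N"
proof
  show "invertible (dilation a B u)" by (rule invertible_dilation[OF B u a])
  show "finite (node_set a B)" unfolding node_set_def by (rule finite_nodes[OF B a])
  show "node_set a B \<subseteq> int_lattice" by (auto simp: node_set_def)
  fix v :: "real^'d" assume v: "v \<in> unit_cube"
  have uv: "(u, v) \<in> realizations" using u v by (simp add: realizations_def)
  show "node (dilation a B u) v m \<notin> unit_cube" if "m \<in> int_lattice - node_set a B" for m
    using that uv by (auto simp: node_set_def)
  have fc: "finite {m \<in> int_lattice. node (dilation a B u) v m \<in> unit_cube}"
    "card {m \<in> int_lattice. node (dilation a B u) v m \<in> unit_cube} \<le> N"
    using uses uv unfolding uses_at_most_def Let_def by auto
  have "card {m \<in> node_set a B. node (dilation a B u) v m \<in> unit_cube} \<le> card {m \<in> int_lattice. node (dilation a B u) v m \<in> unit_cube}"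
    by (rule card_mono[OF fc(1)]) (auto simp: node_set_def)
  then show "card {m \<in> node_set a B. node (dilation a B u) v m \<in> unit_cube} \<le> N" using fc(2) by simp
qed

context
  fixes \<psi> :: "real \<Rightarrow> real"
  assumes adm: "admissible_psi \<psi>"
begin

lemma Q_rule_eq_sum:
  assumes "cubature S F N" "v \<in> unit_cube"
  shows "Q_rule \<psi> S v f = 1 / \<bar>det S\<bar> * (\<Sum>m\<in>F. f (Psi \<psi> (node S v m)) * DPsi \<psi> (node S v m))"
proof -
  interpret cubature S F N by fact
  have "(\<Sum>\<^sub>\<infinity>m\<in>int_lattice. f (Psi \<psi> (node S v m)) * DPsi \<psi> (node S v m))
    = (\<Sum>\<^sub>\<infinity>m\<in>F. f (Psi \<psi> (node S v m)) * DPsi \<psi> (node S v m))"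
    using F cover[OF assms(2)] DPsi_outside[OF adm] by (intro infsum_cong_neutral) auto
  then show ?thesis using F by (simp add: Q_rule_def)
qed

end

subsection \<open>Weighted sums of Fourier coefficients\<close>

text \<open>The Fourier symbol of the squared Sobolev norm with index set \<open>A\<close>: each
  derivative in direction \<open>j\<close> multiplies the transform by
  \<open>2 * pi * \<xi> $ j\<close> up to a unit.\<close>

definition freq_weight :: "('d::finite \<Rightarrow> nat) set \<Rightarrow> real^'d \<Rightarrow> real" where
  "freq_weight A \<xi> = (\<Sum>\<alpha>\<in>A. ((\<Prod>j\<in>UNIV. (2 * pi * \<bar>\<xi> $ j\<bar>) ^ \<alpha> j))\<^sup>2)"

definition family_energy :: "('d::finite \<Rightarrow> nat) set \<Rightarrow> (('d \<Rightarrow> nat) \<Rightarrow> real^'d \<Rightarrow> real) \<Rightarrow> real" where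
  "family_energy A G = (\<Sum>\<alpha>\<in>A. \<integral>x. (G \<alpha> x)\<^sup>2 \<partial>lborel)"

lemma freq_weight_nonneg: "0 \<le> freq_weight A \<xi>"
  unfolding freq_weight_def by (intro sum_nonneg) auto

lemma family_energy_nonneg: "0 \<le> family_energy A G"
  unfolding family_energy_def by (intro sum_nonneg Bochner_Integration.integral_nonneg) auto

lemma freq_weight_ge_1:
  assumes "finite A" "(\<lambda>_. 0) \<in> A"
  shows "1 \<le> freq_weight A \<xi>"
proof -
  have "((\<Prod>j\<in>UNIV. (2 * pi * \<bar>\<xi> $ j\<bar>) ^ 0))\<^sup>2 \<le> freq_weight A \<xi>"
    unfolding freq_weight_def by (rule member_le_sum[OF assms(2) _ assms(1), of "\<lambda>\<alpha>. ((\<Prod>j\<in>UNIV. (2 * pi * \<bar>\<xi> $ j\<bar>) ^ \<alpha> j))\<^sup>2"]) simp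
  then show ?thesis by simp
qed

lemma freq_weight_coeff:
  assumes G: "deriv_family G" and supp: "\<And>\<beta> x. x \<notin> unit_cube \<Longrightarrow> G \<beta> x = 0"
  shows "freq_weight A \<xi> * (norm (fourier_coeff (\<lambda>x. complex_of_real (G (\<lambda>_. 0) x)) \<xi>))\<^sup>2
    = (\<Sum>\<alpha>\<in>A. (norm (fourier_coeff (\<lambda>x. complex_of_real (G \<alpha> x)) \<xi>))\<^sup>2)"
  unfolding freq_weight_def sum_distrib_right
proof (rule sum.cong[OF refl])
  fix \<alpha>
  have "norm (fourier_coeff (\<lambda>x. complex_of_real (G \<alpha> x)) \<xi>)
    = (\<Prod>j\<in>UNIV. (2 * pi * \<bar>\<xi> $ j\<bar>) ^ \<alpha> j) * norm (fourier_coeff (\<lambda>x. complex_of_real (G (\<lambda>_. 0) x)) \<xi>)"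
    using supp by (rule norm_fourier_coeff_deriv_family[OF G])
  then show "((\<Prod>j\<in>UNIV. (2 * pi * \<bar>\<xi> $ j\<bar>) ^ \<alpha> j))\<^sup>2 * (norm (fourier_coeff (\<lambda>x. complex_of_real (G (\<lambda>_. 0) x)) \<xi>))\<^sup>2
    = (norm (fourier_coeff (\<lambda>x. complex_of_real (G \<alpha> x)) \<xi>))\<^sup>2"
    by (simp only: power_mult_distrib)
qed

text \<open>Cauchy-Schwarz with \<open>1 / sqrt W\<close> and \<open>sqrt W\<close>. The weight in
  the second factor turns the coefficients of \<open>G\<close> at zero into those of all derivatives
  \<open>G \<alpha>\<close>, and the Bessel inequality along the nodes applies to each of
  them.\<close>

lemma (in cubature) coeff_sum_bound:
  fixes G :: "('d \<Rightarrow> nat) \<Rightarrow> real^'d \<Rightarrow> real"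
  assumes G: "deriv_family G" and supp: "\<And>\<beta> x. x \<notin> unit_cube \<Longrightarrow> G \<beta> x = 0"
    and A: "finite A" "(\<lambda>_. 0) \<in> A" and K: "finite K" "K \<subseteq> int_lattice"
    and Z: "(\<Sum>k\<in>K. 1 / freq_weight A (S *v k)) \<le> Z"
  shows "(\<Sum>k\<in>K. norm (fourier_coeff (\<lambda>x. complex_of_real (G (\<lambda>_. 0) x)) (S *v k)))
    \<le> sqrt (Z * (real N / \<bar>det S\<bar> * family_energy A G))"
proof -
  let ?c = "\<lambda>\<alpha> k. norm (fourier_coeff (\<lambda>x. complex_of_real (G \<alpha> x)) (S *v k))"
  let ?W = "\<lambda>k. freq_weight A (S *v k)"
  have W: "0 < ?W k" for k using freq_weight_ge_1[OF A, of "S *v k"] by linarith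
  have "(\<Sum>k\<in>K. ?c (\<lambda>_. 0) k)\<^sup>2 = (\<Sum>k\<in>K. (1 / sqrt (?W k)) * (sqrt (?W k) * ?c (\<lambda>_. 0) k))\<^sup>2"
    using W by (intro arg_cong[of _ _ "\<lambda>x. x\<^sup>2"] sum.cong refl) (simp add: less_imp_neq[THEN not_sym])
  also have "\<dots> \<le> (\<Sum>k\<in>K. (1 / sqrt (?W k))\<^sup>2) * (\<Sum>k\<in>K. (sqrt (?W k) * ?c (\<lambda>_. 0) k)\<^sup>2)"
    by (rule Cauchy_Schwarz_ineq_sum)
  also have "(\<Sum>k\<in>K. (1 / sqrt (?W k))\<^sup>2) = (\<Sum>k\<in>K. 1 / ?W k)"
    using W by (intro sum.cong refl) (simp add: power_divide less_imp_le)
  also have "(\<Sum>k\<in>K. (sqrt (?W k) * ?c (\<lambda>_. 0) k)\<^sup>2) = (\<Sum>k\<in>K. \<Sum>\<alpha>\<in>A. (?c \<alpha> k)\<^sup>2)"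
    using W freq_weight_coeff[OF G supp, where A = A]
    by (intro sum.cong refl) (simp add: power_mult_distrib less_imp_le)
  also have "\<dots> = (\<Sum>\<alpha>\<in>A. \<Sum>k\<in>K. (?c \<alpha> k)\<^sup>2)" by (rule sum.swap)
  also have "(\<Sum>k\<in>K. 1 / ?W k) * \<dots> \<le> Z * (real N / \<bar>det S\<bar> * family_energy A G)"
  proof (rule mult_mono[OF Z])
    have "(\<Sum>\<alpha>\<in>A. \<Sum>k\<in>K. (?c \<alpha> k)\<^sup>2) \<le> (\<Sum>\<alpha>\<in>A. real N / \<bar>det S\<bar> * (\<integral>x. (norm (complex_of_real (G \<alpha> x)))\<^sup>2 \<partial>lborel))"
      using supp by (intro sum_mono periodize_bessel K continuous_intros deriv_familyD(1)[OF G]) auto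
    then show "(\<Sum>\<alpha>\<in>A. \<Sum>k\<in>K. (?c \<alpha> k)\<^sup>2) \<le> real N / \<bar>det S\<bar> * family_energy A G"
      by (simp add: family_energy_def sum_distrib_left)
    show "0 \<le> Z" by (rule order_trans[OF sum_nonneg Z]) (simp add: freq_weight_nonneg)
  qed (simp add: sum_nonneg)
  finally show ?thesis by (rule real_le_rsqrt)
qed

subsection \<open>Lattice sums\<close>

lemma sum_group_bound:
  fixes f \<phi> b :: "_ \<Rightarrow> real"
  assumes K: "finite K" and f: "\<And>k. k \<in> K \<Longrightarrow> f k \<le> \<phi> (g k)"
    and b: "\<And>l. l \<in> g ` K \<Longrightarrow> real (card {k \<in> K. g k = l}) * \<phi> l \<le> b l"
  shows "(\<Sum>k\<in>K. f k) \<le> (\<Sum>l\<in>g ` K. b l)"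
proof -
  have "(\<Sum>k\<in>K. f k) \<le> (\<Sum>k\<in>K. \<phi> (g k))" by (rule sum_mono) (rule f)
  also have "\<dots> = (\<Sum>l\<in>g ` K. \<Sum>k\<in>{k \<in> K. g k = l}. \<phi> (g k))"
    using sum.image_gen[OF K, of "\<lambda>k. \<phi> (g k)" g] by simp
  also have "\<dots> = (\<Sum>l\<in>g ` K. real (card {k \<in> K. g k = l}) * \<phi> l)"
    by (intro sum.cong refl) simp
  also have "\<dots> \<le> (\<Sum>l\<in>g ` K. b l)" by (rule sum_mono) (rule b)
  finally show ?thesis .
qed

text \<open>Level zero collects all \<open>x \<le> 1\<close>; this matches the truncation
  \<open>max 1 x\<close> in the mixed weight.\<close>

definition dyadic_level :: "real \<Rightarrow> nat" where
  "dyadic_level x = (LEAST l. x \<le> 2 ^ l)"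

lemma dyadic_level_ge: "x \<le> 2 ^ dyadic_level x"
proof -
  obtain n where "x < 2 ^ n" using real_arch_pow[of 2 x] by auto
  then have "x \<le> 2 ^ n" by simp
  then show ?thesis unfolding dyadic_level_def by (rule LeastI)
qed

lemma dyadic_level_le: "2 ^ dyadic_level x \<le> 2 * max 1 x"
proof (cases "dyadic_level x")
  case (Suc l)
  then have "\<not> x \<le> 2 ^ l"
    using not_less_Least[of l "\<lambda>l. x \<le> 2 ^ l"] by (simp add: dyadic_level_def)
  then show ?thesis using Suc by simp
qed simp

lemma dyadic_level_least: "x \<le> 2 ^ l \<Longrightarrow> dyadic_level x \<le> l"
  unfolding dyadic_level_def by (rule Least_le)

lemma abs_dilation_mult:
  fixes B :: "real^'d^'d::finite"
  assumes "a > 0" "u \<in> u_box"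
  shows "\<bar>(dilation a B u *v k) $ j\<bar> = a * u $ j * \<bar>(B *v k) $ j\<bar>"
proof -
  have "1 \<le> u $ j" using assms(2) by (auto simp: u_box_iff)
  then have "\<bar>u $ j\<bar> = u $ j" by simp
  then show ?thesis using assms(1) by (simp add: dilation_mult abs_mult)
qed

lemma frolov_prod_ge:
  assumes "frolov_matrix B" "k \<in> int_lattice - {0}"
  shows "1 \<le> (\<Prod>j\<in>UNIV. \<bar>(B *v k) $ j\<bar>)"
  using assms by (auto simp: frolov_matrix_def abs_prod)

text \<open>Condition (c) counts points \<open>B *v k\<close>; injectivity of \<open>B\<close> turns
  this into a count of indices \<open>k\<close>.\<close>

lemma frolov_card:
  fixes B :: "real^'d^'d::finite"
  assumes B: "frolov_matrix B" and K: "K \<subseteq> int_lattice" and b: "\<And>j. x $ j \<le> y $ j"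
    and in_box: "\<And>k j. k \<in> K \<Longrightarrow> x $ j \<le> (B *v k) $ j \<and> (B *v k) $ j \<le> y $ j"
  shows "finite K" "real (card K) \<le> (\<Prod>j\<in>UNIV. y $ j - x $ j) + 1"
proof -
  let ?P = "(\<lambda>m. B *v m) ` int_lattice \<inter> box_between x y"
  have P: "finite ?P" "real (card ?P) \<le> (\<Prod>j\<in>UNIV. \<bar>x $ j - y $ j\<bar>) + 1"
    using B unfolding frolov_matrix_def Let_def by blast+
  have sub: "(\<lambda>m. B *v m) ` K \<subseteq> ?P"
    using K in_box b by (auto simp: box_between_def min_def max_def)
  have "invertible B" using B by (simp add: frolov_matrix_def)
  then have inj: "inj_on (\<lambda>m. B *v m) K"
    using matrix_inv_mult(1)[of B] by (intro inj_on_inverseI[of _ "\<lambda>m. matrix_inv B *v m"]) (simp add: matrix_vector_mul_assoc)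
  show "finite K" using finite_imageD[OF finite_subset[OF sub P(1)] inj] .
  have "card K = card ((\<lambda>m. B *v m) ` K)" by (rule card_image[OF inj, symmetric])
  also have "\<dots> \<le> card ?P" by (rule card_mono[OF P(1) sub])
  finally have "real (card K) \<le> (\<Prod>j\<in>UNIV. \<bar>x $ j - y $ j\<bar>) + 1" using P(2) by linarith
  moreover have "(\<Prod>j\<in>UNIV. \<bar>x $ j - y $ j\<bar>) = (\<Prod>j\<in>UNIV. y $ j - x $ j)"
    by (intro prod.cong refl) (simp add: abs_of_nonpos b)
  ultimately show "real (card K) \<le> (\<Prod>j\<in>UNIV. y $ j - x $ j) + 1" by simp
qed

lemma finite_mix_indices: "finite (mix_indices r :: ('d::finite \<Rightarrow> nat) set)"
proof -
  have "mix_indices r = PiE (UNIV :: 'd set) (\<lambda>_. {..r})" by (auto simp: mix_indices_def PiE_def Pi_iff)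
  then show ?thesis by (simp add: finite_PiE)
qed

lemma iso_subset_mix: "iso_indices s \<subseteq> (mix_indices s :: ('d::finite \<Rightarrow> nat) set)"
proof
  fix \<alpha> :: "'d \<Rightarrow> nat" assume "\<alpha> \<in> iso_indices s"
  then have s: "(\<Sum>i\<in>UNIV. \<alpha> i) \<le> s" by (simp add: iso_indices_def)
  have "\<alpha> i \<le> (\<Sum>i\<in>UNIV. \<alpha> i)" for i by (intro member_le_sum) auto
  then show "\<alpha> \<in> mix_indices s" using s unfolding mix_indices_def by (auto intro: order_trans)
qed

lemma finite_iso_indices: "finite (iso_indices s :: ('d::finite \<Rightarrow> nat) set)"
  by (rule finite_subset[OF iso_subset_mix finite_mix_indices])

text \<open>A single term suffices, the one that differentiates \<open>s\<close> times in direction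
  \<open>j\<close>.\<close>

lemma freq_weight_iso_ge:
  fixes \<xi> :: "real^'d::finite"
  shows "\<bar>\<xi> $ j\<bar> ^ (2 * s) \<le> freq_weight (iso_indices s) \<xi>"
proof -
  define \<alpha> where "\<alpha> i = (if i = j then s else 0)" for i
  have "\<alpha> \<in> iso_indices s" by (simp add: \<alpha>_def iso_indices_def)
  then have "((\<Prod>i\<in>UNIV. (2 * pi * \<bar>\<xi> $ i\<bar>) ^ \<alpha> i))\<^sup>2 \<le> freq_weight (iso_indices s) \<xi>"
    unfolding freq_weight_def
    by (intro member_le_sum[of \<alpha> _ "\<lambda>\<alpha>. ((\<Prod>i\<in>UNIV. (2 * pi * \<bar>\<xi> $ i\<bar>) ^ \<alpha> i))\<^sup>2"] finite_iso_indices) auto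
  also have "(\<Prod>i\<in>UNIV. (2 * pi * \<bar>\<xi> $ i\<bar>) ^ \<alpha> i) = (2 * pi * \<bar>\<xi> $ j\<bar>) ^ s"
    by (subst prod.remove[of _ j]) (auto simp: \<alpha>_def)
  finally have "(2 * pi * \<bar>\<xi> $ j\<bar>) ^ (2 * s) \<le> freq_weight (iso_indices s) \<xi>" by (simp add: power_mult mult.commute)
  moreover have "\<bar>\<xi> $ j\<bar> ^ (2 * s) \<le> (2 * pi * \<bar>\<xi> $ j\<bar>) ^ (2 * s)"
  proof (rule power_mono)
    have "1 * \<bar>\<xi> $ j\<bar> \<le> 2 * pi * \<bar>\<xi> $ j\<bar>" using pi_ge_two by (intro mult_right_mono) auto
    then show "\<bar>\<xi> $ j\<bar> \<le> 2 * pi * \<bar>\<xi> $ j\<bar>" by simp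
  qed simp
  ultimately show ?thesis by linarith
qed

text \<open>A single term suffices, the one that differentiates \<open>r\<close> times in exactly
  those directions where \<open>|\<xi> $ i|\<close> is at least one.\<close>

lemma freq_weight_mix_ge:
  fixes \<xi> :: "real^'d::finite"
  shows "(\<Prod>j\<in>UNIV. max 1 \<bar>\<xi> $ j\<bar>) ^ (2 * r) \<le> freq_weight (mix_indices r) \<xi>"
proof -
  define \<alpha> where "\<alpha> i = (if 1 \<le> \<bar>\<xi> $ i\<bar> then r else 0)" for i
  have "\<alpha> \<in> mix_indices r" by (simp add: \<alpha>_def mix_indices_def)
  then have le: "((\<Prod>i\<in>UNIV. (2 * pi * \<bar>\<xi> $ i\<bar>) ^ \<alpha> i))\<^sup>2 \<le> freq_weight (mix_indices r) \<xi>"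
    unfolding freq_weight_def
    by (intro member_le_sum[of \<alpha> _ "\<lambda>\<alpha>. ((\<Prod>i\<in>UNIV. (2 * pi * \<bar>\<xi> $ i\<bar>) ^ \<alpha> i))\<^sup>2"] finite_mix_indices) auto
  have "(\<Prod>j\<in>UNIV. max 1 \<bar>\<xi> $ j\<bar>) ^ r = (\<Prod>j\<in>UNIV. max 1 \<bar>\<xi> $ j\<bar> ^ r)"
    by (simp add: prod_power_distrib)
  also have "\<dots> \<le> (\<Prod>i\<in>UNIV. (2 * pi * \<bar>\<xi> $ i\<bar>) ^ \<alpha> i)"
  proof (intro prod_mono conjI)
    fix i
    show "max 1 \<bar>\<xi> $ i\<bar> ^ r \<le> (2 * pi * \<bar>\<xi> $ i\<bar>) ^ \<alpha> i"
    proof (cases "1 \<le> \<bar>\<xi> $ i\<bar>")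
      case True
      have "1 * \<bar>\<xi> $ i\<bar> \<le> 2 * pi * \<bar>\<xi> $ i\<bar>" using pi_ge_two by (intro mult_right_mono) auto
      then have "\<bar>\<xi> $ i\<bar> ^ r \<le> (2 * pi * \<bar>\<xi> $ i\<bar>) ^ r" by (intro power_mono) auto
      then show ?thesis using True by (simp add: \<alpha>_def max_def)
    next
      case False
      then show ?thesis by (simp add: \<alpha>_def max_def)
    qed
  qed auto
  finally have "((\<Prod>j\<in>UNIV. max 1 \<bar>\<xi> $ j\<bar>) ^ r)\<^sup>2 \<le> ((\<Prod>i\<in>UNIV. (2 * pi * \<bar>\<xi> $ i\<bar>) ^ \<alpha> i))\<^sup>2"
    by (intro power_mono zero_le_power prod_nonneg) auto
  then show ?thesis using le by (simp add: power_mult[symmetric] mult.commute)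
qed

lemma sum_half_power_le: "finite I \<Longrightarrow> (\<Sum>l\<in>I. (1 / 2 :: real) ^ l) \<le> 2"
  using sum_le_suminf[of "\<lambda>l. (1 / 2 :: real) ^ l" I] by (simp add: suminf_geometric)

text \<open>Sort the lattice points by the dyadic level \<open>l\<close> of the largest coordinate
  of \<open>B *v k\<close>, which is at least one because the product of the coordinates is. Level
  \<open>l\<close> has at most a multiple of \<open>2 ^ (l * d)\<close> points, each with inverse
  weight of order \<open>(a * 2 ^ l) ^ (- 2 * s)\<close>, so that the levels decay
  geometrically.\<close>

lemma lattice_sum_iso:
  fixes B :: "real^'d^'d::finite"
  assumes B: "frolov_matrix B" and s: "real s > real CARD('d) / 2"
    and a: "a > 0" and u: "u \<in> u_box" and K: "finite K" "K \<subseteq> int_lattice - {0}"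
  shows "(\<Sum>k\<in>K. 1 / freq_weight (iso_indices s) (dilation a B u *v k)) \<le> 2 * 2 ^ (1 + CARD('d) + 2 * s) * (1 / a) ^ (2 * s)"
proof -
  let ?D = "CARD('d)"
  define M where "M k = Max (range (\<lambda>j. \<bar>(B *v k) $ j\<bar>))" for k
  have M_ge: "\<bar>(B *v k) $ j\<bar> \<le> M k" for k j unfolding M_def by (intro Max_ge) auto
  have M_mem: "\<exists>j. M k = \<bar>(B *v k) $ j\<bar>" for k
  proof -
    have "M k \<in> range (\<lambda>j. \<bar>(B *v k) $ j\<bar>)" unfolding M_def by (intro Max_in) auto
    then show ?thesis by auto
  qed
  have M1: "1 \<le> M k" if "k \<in> K" for k
  proof (rule ccontr)
    assume neg: "\<not> 1 \<le> M k"
    have "(\<Prod>j\<in>UNIV. \<bar>(B *v k) $ j\<bar>) \<le> (\<Prod>j\<in>(UNIV :: 'd set). M k)"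
      by (intro prod_mono) (auto intro: M_ge)
    also have "\<dots> = M k ^ ?D" by simp
    also have "\<dots> \<le> M k ^ 1"
      using neg M_ge[of k undefined] by (intro power_decreasing) (auto simp: Suc_le_eq intro: order_trans[OF abs_ge_zero])
    also have "\<dots> < 1" using neg by simp
    finally show False using frolov_prod_ge[OF B, of k] K that by auto
  qed
  define lv where "lv k = dyadic_level (M k)" for k
  let ?\<phi> = "\<lambda>l::nat. (2 / (a * 2 ^ l)) ^ (2 * s)"
  let ?b = "\<lambda>l::nat. 2 ^ (1 + ?D + 2 * s) * (1 / a) ^ (2 * s) * (1 / 2) ^ l"
  have "(\<Sum>k\<in>K. 1 / freq_weight (iso_indices s) (dilation a B u *v k)) \<le> (\<Sum>l\<in>lv ` K. ?b l)"
  proof (rule sum_group_bound[OF K(1), where \<phi> = ?\<phi>])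
    fix k assume k: "k \<in> K"
    obtain j where j: "M k = \<bar>(B *v k) $ j\<bar>" using M_mem by blast
    have "2 ^ lv k \<le> 2 * M k" using dyadic_level_le[of "M k"] M1[OF k] by (simp add: lv_def max_def)
    then have "a * 2 ^ lv k / 2 \<le> a * M k" using a by simp
    also have "\<dots> \<le> a * u $ j * M k"
      using a u M1[OF k] unfolding u_box_iff by (intro mult_right_mono) auto
    also have "\<dots> = \<bar>(dilation a B u *v k) $ j\<bar>"
      unfolding j by (rule abs_dilation_mult[OF a u, symmetric])
    finally have "(a * 2 ^ lv k / 2) ^ (2 * s) \<le> \<bar>(dilation a B u *v k) $ j\<bar> ^ (2 * s)"
      using a by (intro power_mono) auto
    also have "\<dots> \<le> freq_weight (iso_indices s) (dilation a B u *v k)" by (rule freq_weight_iso_ge)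
    finally have "1 / freq_weight (iso_indices s) (dilation a B u *v k) \<le> 1 / (a * 2 ^ lv k / 2) ^ (2 * s)"
      using a by (intro frac_le) auto
    also have "\<dots> = ?\<phi> (lv k)" by (simp add: power_divide)
    finally show "1 / freq_weight (iso_indices s) (dilation a B u *v k) \<le> ?\<phi> (lv k)" .
  next
    fix l
    let ?Kl = "{k \<in> K. lv k = l}"
    have "real (card ?Kl) \<le> (\<Prod>j\<in>UNIV. (\<chi> j. 2 ^ l :: real^'d) $ j - (\<chi> j. - (2 ^ l)) $ j) + 1"
    proof (rule frolov_card(2)[OF B])
      fix k j assume "k \<in> ?Kl"
      then have "\<bar>(B *v k) $ j\<bar> \<le> 2 ^ l" using M_ge[of k j] dyadic_level_ge[of "M k"] by (auto simp: lv_def)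
      then show "(\<chi> j. - (2 ^ l)) $ j \<le> (B *v k) $ j \<and> (B *v k) $ j \<le> (\<chi> j. 2 ^ l :: real^'d) $ j"
        by (simp add: abs_le_iff)
    qed (use K in auto)
    also have "\<dots> = (2 * 2 ^ l) ^ ?D + 1" by simp
    also have "\<dots> \<le> 2 * (2 * 2 ^ l) ^ ?D"
      using one_le_power[of "2 * 2 ^ l :: real" ?D] by (simp add: mult_ge1_I)
    finally have card: "real (card ?Kl) \<le> 2 * (2 * 2 ^ l) ^ ?D" .
    \<comment> \<open>Between integers \<open>2 * s > d\<close> means at least \<open>d + 1\<close>,
      which yields a full factor \<open>1 / 2\<close> per level.\<close>
    have "?D + 1 \<le> 2 * s" using s by linarith
    then have "l * (?D + 1) \<le> l * (2 * s)" by (rule mult_le_mono2)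
    then have p: "(2 :: real) ^ (l * ?D) * 2 ^ l \<le> 2 ^ (l * (2 * s))"
      unfolding power_add[symmetric] by (intro power_increasing) (auto simp: algebra_simps)
    have "real (card ?Kl) * ?\<phi> l \<le> 2 * (2 * 2 ^ l) ^ ?D * ?\<phi> l"
      using card by (rule mult_right_mono) (use a in simp)
    also have "\<dots> = 2 ^ (1 + ?D + 2 * s) * (1 / a) ^ (2 * s) * (2 ^ (l * ?D) / 2 ^ (l * (2 * s)))"
      by (simp add: power_divide power_mult_distrib power_mult power_add)
    also have "\<dots> \<le> ?b l"
    proof (rule mult_left_mono)
      show "2 ^ (l * ?D) / 2 ^ (l * (2 * s)) \<le> (1 / 2 :: real) ^ l"
        using p by (simp add: power_one_over field_simps)
    qed (use a in simp)
    finally show "real (card ?Kl) * ?\<phi> l \<le> ?b l" .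
  qed
  also have "\<dots> = 2 ^ (1 + ?D + 2 * s) * (1 / a) ^ (2 * s) * (\<Sum>l\<in>lv ` K. (1 / 2) ^ l)"
    by (simp add: sum_distrib_left)
  also have "\<dots> \<le> 2 ^ (1 + ?D + 2 * s) * (1 / a) ^ (2 * s) * 2"
    using a K(1) by (intro mult_left_mono sum_half_power_le) auto
  finally show ?thesis by (simp only: mult_ac)
qed

lemma summable_poly_half: "summable (\<lambda>i. real (i + 1) ^ m * (1 / 2) ^ i)"
proof -
  have "(\<lambda>i. (1 + 1 / real (Suc i)) ^ m) \<longlonglongrightarrow> (1 + 0) ^ m"
    by (intro tendsto_intros) (rule LIMSEQ_Suc[OF lim_1_over_n])
  then have "eventually (\<lambda>i. (1 + 1 / real (Suc i)) ^ m < 3 / 2) sequentially"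
    by (intro order_tendstoD) auto
  then obtain N where N: "\<And>i. i \<ge> N \<Longrightarrow> (1 + 1 / real (Suc i)) ^ m < 3 / 2"
    unfolding eventually_sequentially by blast
  show ?thesis
  proof (rule summable_ratio_test[of "3 / 4" N])
    fix i assume i: "i \<ge> N"
    have "real (Suc i + 1) = (1 + 1 / real (Suc i)) * real (i + 1)" by (simp add: field_simps)
    then have "real (Suc i + 1) ^ m = (1 + 1 / real (Suc i)) ^ m * real (i + 1) ^ m"
      by (simp only: power_mult_distrib)
    also have "\<dots> \<le> 3 / 2 * real (i + 1) ^ m" using N[OF i] by (intro mult_right_mono) auto
    finally have "real (Suc i + 1) ^ m * (1 / 2) ^ Suc i \<le> 3 / 2 * real (i + 1) ^ m * (1 / 2) ^ Suc i"
      by (rule mult_right_mono) simp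
    then show "norm (real (Suc i + 1) ^ m * (1 / 2) ^ Suc i) \<le> 3 / 4 * norm (real (i + 1) ^ m * (1 / 2) ^ i)"
      by simp
  qed simp
qed

text \<open>The prescribed sum determines one entry from the others, hence the exponent
  \<open>CARD('d) - 1\<close>. This count is the origin of the power of the logarithm.\<close>

lemma card_multiindices_of_sum:
  fixes X :: "('d::finite \<Rightarrow> nat) set"
  assumes "finite X" "\<And>l. l \<in> X \<Longrightarrow> (\<Sum>j\<in>UNIV. l j) = n"
  shows "card X \<le> (n + 1) ^ (CARD('d) - 1)"
proof -
  obtain j0 :: 'd where True by blast
  let ?J = "UNIV - {j0}"
  let ?r = "\<lambda>l :: 'd \<Rightarrow> nat. restrict l ?J"
  have "inj_on ?r X"
  proof (rule inj_onI)
    fix l l' assume l: "l \<in> X" "l' \<in> X" and eq: "?r l = ?r l'"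
    have same: "l j = l' j" if "j \<noteq> j0" for j using fun_cong[OF eq, of j] that by simp
    have "(\<Sum>j\<in>UNIV. l j) = l j0 + (\<Sum>j\<in>?J. l j)" "(\<Sum>j\<in>UNIV. l' j) = l' j0 + (\<Sum>j\<in>?J. l' j)"
      by (simp_all add: sum.remove[of UNIV j0])
    moreover have "(\<Sum>j\<in>?J. l j) = (\<Sum>j\<in>?J. l' j)" using same by (intro sum.cong) auto
    ultimately have "l j0 = l' j0" using assms(2)[OF l(1)] assms(2)[OF l(2)] by linarith
    then show "l = l'" using same by (intro ext) metis
  qed
  moreover have "?r ` X \<subseteq> PiE ?J (\<lambda>_. {..n})"
  proof (rule image_subsetI)
    fix l assume "l \<in> X"
    have "l j \<le> n" for j
      using member_le_sum[of j UNIV l] assms(2)[OF \<open>l \<in> X\<close>] by simp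
    then show "?r l \<in> PiE ?J (\<lambda>_. {..n})" by auto
  qed
  moreover have "finite (PiE ?J (\<lambda>_. {..n}))" by (intro finite_PiE) auto
  moreover have "card (PiE ?J (\<lambda>_. {..n})) = (n + 1) ^ (CARD('d) - 1)" by (simp add: card_PiE)
  ultimately show ?thesis by (metis card_inj_on_le)
qed

text \<open>Sort the lattice points by the vector \<open>l\<close> of dyadic levels of the
  coordinates of \<open>dilation a B u *v k\<close>. The corresponding box has volume of order
  \<open>2 ^ tot l / a ^ d\<close> and can be occupied only if \<open>2 ^ tot l\<close> reaches
  \<open>a ^ d\<close>; its points have inverse weight of order
  \<open>2 ^ (- 2 * r * tot l)\<close>. Level vectors of a given total are polynomially many, so the
  sum is governed by the smallest admissible total, the dyadic level of
  \<open>a ^ d\<close>.\<close>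

lemma lattice_sum_mix:
  fixes B :: "real^'d^'d::finite" and r :: nat
  assumes B: "frolov_matrix B" and r: "r \<ge> 1"
  shows "\<exists>C\<ge>0. \<forall>a u K. a > 0 \<longrightarrow> u \<in> u_box \<longrightarrow> finite K \<longrightarrow> K \<subseteq> int_lattice - {0} \<longrightarrow>
    (\<Sum>k\<in>K. 1 / freq_weight (mix_indices r) (dilation a B u *v k))
    \<le> C * real (dyadic_level (a ^ CARD('d)) + 1) ^ (CARD('d) - 1) * (1 / a ^ CARD('d)) ^ (2 * r)"
proof -
  let ?D = "CARD('d)"
  define Y where "Y = (\<Sum>i. real (i + 1) ^ (?D - 1) * (1 / 2) ^ i)"
  have Y: "(\<Sum>i\<in>I. real (i + 1) ^ (?D - 1) * (1 / 2) ^ i) \<le> Y" if "finite I" for I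
    unfolding Y_def using that by (intro sum_le_suminf summable_poly_half) auto
  have Y0: "0 \<le> Y" using Y[of "{}"] by simp
  define C1 :: real where "C1 = (2 ^ ?D + 1) * (2 ^ ?D) ^ (2 * r)"
  have C1: "0 \<le> C1" by (simp add: C1_def)
  show ?thesis
  proof (intro exI[of _ "C1 * Y"] conjI allI impI)
    show "0 \<le> C1 * Y" using C1 Y0 by simp
    fix a :: real and u :: "real^'d" and K :: "(real^'d) set"
    assume a: "a > 0" and u: "u \<in> u_box" and K: "finite K" "K \<subseteq> int_lattice - {0}"
    let ?\<xi> = "\<lambda>k. dilation a B u *v k"
    define T where "T = a ^ ?D"
    have T: "T > 0" using a by (simp add: T_def)
    define lv where "lv k = (\<lambda>j. dyadic_level \<bar>?\<xi> k $ j\<bar>)" for k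
    define tot where "tot l = (\<Sum>j\<in>UNIV. l j)" for l :: "'d \<Rightarrow> nat"
    have prod2: "(\<Prod>j\<in>UNIV. (2::real) ^ l j) = 2 ^ tot l" for l :: "'d \<Rightarrow> nat"
      by (simp add: tot_def power_sum)
    have B_le: "\<bar>(B *v k) $ j\<bar> \<le> 2 ^ lv k j / a" for k j
    proof -
      have "a * \<bar>(B *v k) $ j\<bar> * 1 \<le> a * \<bar>(B *v k) $ j\<bar> * u $ j"
        using a u unfolding u_box_iff by (intro mult_left_mono) auto
      also have "\<dots> = a * u $ j * \<bar>(B *v k) $ j\<bar>" by (simp only: mult_ac)
      also have "\<dots> = \<bar>?\<xi> k $ j\<bar>"
        by (rule abs_dilation_mult[OF a u, symmetric])
      also have "\<dots> \<le> 2 ^ lv k j" unfolding lv_def by (rule dyadic_level_ge)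
      finally show ?thesis using a by (simp add: field_simps)
    qed
    have T_le: "T \<le> 2 ^ tot (lv k)" if "k \<in> K" for k
    proof -
      have "1 \<le> (\<Prod>j\<in>UNIV. \<bar>(B *v k) $ j\<bar>)" using frolov_prod_ge[OF B] K that by auto
      also have "\<dots> \<le> (\<Prod>j\<in>UNIV. 2 ^ lv k j / a)" by (intro prod_mono) (auto intro: B_le)
      also have "\<dots> = 2 ^ tot (lv k) / T" by (simp add: prod_dividef prod2 T_def)
      finally show ?thesis using T by (simp add: field_simps)
    qed
    let ?\<phi> = "\<lambda>l. (2 ^ ?D / 2 ^ tot l) ^ (2 * r) :: real"
    let ?c = "\<lambda>n :: nat. C1 / T * (2 ^ n / (2 ^ n) ^ (2 * r)) :: real"
    have "(\<Sum>k\<in>K. 1 / freq_weight (mix_indices r) (?\<xi> k)) \<le> (\<Sum>l\<in>lv ` K. ?c (tot l))"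
    proof (rule sum_group_bound[OF K(1), where \<phi> = ?\<phi>])
      fix k assume k: "k \<in> K"
      have "2 ^ tot (lv k) = (\<Prod>j\<in>UNIV. (2::real) ^ lv k j)" by (simp add: prod2)
      also have "\<dots> \<le> (\<Prod>j\<in>UNIV. 2 * max 1 \<bar>?\<xi> k $ j\<bar>)"
        unfolding lv_def by (intro prod_mono conjI dyadic_level_le) auto
      also have "\<dots> = 2 ^ ?D * (\<Prod>j\<in>UNIV. max 1 \<bar>?\<xi> k $ j\<bar>)" by (simp add: prod.distrib)
      finally have "2 ^ tot (lv k) / 2 ^ ?D \<le> (\<Prod>j\<in>UNIV. max 1 \<bar>?\<xi> k $ j\<bar>)" by (simp add: field_simps)
      then have "(2 ^ tot (lv k) / 2 ^ ?D) ^ (2 * r) \<le> (\<Prod>j\<in>UNIV. max 1 \<bar>?\<xi> k $ j\<bar>) ^ (2 * r)"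
        by (intro power_mono) auto
      also have "\<dots> \<le> freq_weight (mix_indices r) (?\<xi> k)" by (rule freq_weight_mix_ge)
      finally have le: "(2 ^ tot (lv k) / 2 ^ ?D) ^ (2 * r) \<le> freq_weight (mix_indices r) (?\<xi> k)" .
      have pos: "0 < (2 ^ tot (lv k) / 2 ^ ?D :: real) ^ (2 * r)" by simp
      have "1 / freq_weight (mix_indices r) (?\<xi> k) \<le> 1 / (2 ^ tot (lv k) / 2 ^ ?D) ^ (2 * r)"
        by (rule frac_le[OF _ _ pos le]) auto
      also have "\<dots> = ?\<phi> (lv k)" by (simp add: power_divide)
      finally show "1 / freq_weight (mix_indices r) (?\<xi> k) \<le> ?\<phi> (lv k)" .
    next
      fix l assume "l \<in> lv ` K"
      then obtain k0 where k0: "k0 \<in> K" "l = lv k0" by blast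
      let ?Kl = "{k \<in> K. lv k = l}"
      have "real (card ?Kl) \<le> (\<Prod>j\<in>UNIV. (\<chi> j. 2 ^ l j / a :: real^'d) $ j - (\<chi> j. - (2 ^ l j / a)) $ j) + 1"
      proof (rule frolov_card(2)[OF B])
        fix k j assume "k \<in> ?Kl"
        then have "\<bar>(B *v k) $ j\<bar> \<le> 2 ^ l j / a" using B_le[of k j] by auto
        then show "(\<chi> j. - (2 ^ l j / a)) $ j \<le> (B *v k) $ j \<and> (B *v k) $ j \<le> (\<chi> j. 2 ^ l j / a :: real^'d) $ j"
          unfolding vec_lambda_beta abs_le_iff by linarith
      qed (use K a in auto)
      also have "\<dots> = (\<Prod>j\<in>UNIV. 2 * (2 ^ l j / a)) + 1" by simp
      also have "\<dots> = 2 ^ ?D * (2 ^ tot l / T) + 1"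
        by (simp only: prod.distrib prod_dividef prod2 T_def prod_constant)
      \<comment> \<open>The additional 1 of the count is absorbed, since an occupied box satisfies
        \<open>T \<le> 2 ^ tot l\<close>.\<close>
      also have "\<dots> \<le> (2 ^ ?D + 1) * (2 ^ tot l / T)"
        using T_le[OF k0(1)] T k0(2) by (simp add: field_simps)
      finally have "real (card ?Kl) * ?\<phi> l \<le> (2 ^ ?D + 1) * (2 ^ tot l / T) * ?\<phi> l"
        by (rule mult_right_mono) simp
      also have "\<dots> = ?c (tot l)" by (simp add: C1_def power_divide)
      finally show "real (card ?Kl) * ?\<phi> l \<le> ?c (tot l)" .
    qed
    also have "\<dots> \<le> (\<Sum>n\<in>tot ` lv ` K. real (n + 1) ^ (?D - 1) * ?c n)"
    proof (rule sum_group_bound[where \<phi> = ?c])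
      fix n
      have "card {l \<in> lv ` K. tot l = n} \<le> (n + 1) ^ (?D - 1)"
        using K(1) by (intro card_multiindices_of_sum) (auto simp: tot_def)
      then have "real (card {l \<in> lv ` K. tot l = n}) \<le> real (n + 1) ^ (?D - 1)"
        by (simp only: of_nat_power[symmetric] of_nat_le_iff)
      then show "real (card {l \<in> lv ` K. tot l = n}) * ?c n \<le> real (n + 1) ^ (?D - 1) * ?c n"
        using C1 T by (intro mult_right_mono) auto
    qed (use K in auto)
    also have "\<dots> \<le> (\<Sum>n\<in>tot ` lv ` K. C1 * real (dyadic_level T + 1) ^ (?D - 1) * (1 / T) ^ (2 * r) *
        (real (n - dyadic_level T + 1) ^ (?D - 1) * (1 / 2) ^ (n - dyadic_level T)))"
    proof (rule sum_mono)
      fix n assume "n \<in> tot ` lv ` K"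
      then obtain k where k: "k \<in> K" "n = tot (lv k)" by auto
      define L where "L = dyadic_level T"
      have L: "L \<le> n" unfolding L_def k(2) by (rule dyadic_level_least[OF T_le[OF k(1)]])
      define i where "i = n - L"
      have n: "n = L + i" using L by (simp add: i_def)
      \<comment> \<open>With \<open>n = L + i\<close>, the factor \<open>L + 1\<close> survives as
        the logarithm, while \<open>i + 1\<close> is summed against
        \<open>(1 / 2) ^ i\<close>.\<close>
      have p1: "real (n + 1) ^ (?D - 1) \<le> real (L + 1) ^ (?D - 1) * real (i + 1) ^ (?D - 1)"
        unfolding power_mult_distrib[symmetric] n by (intro power_mono) (auto simp: algebra_simps)
      \<comment> \<open>\<open>r = Suc r'\<close> leaves the exponent \<open>2 * r' + 1\<close> for
        \<open>1 / 2 ^ n\<close>: the part in \<open>L\<close> becomes a power of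
        \<open>1 / T\<close>, and of the part in \<open>i\<close> one factor is kept for
        convergence.\<close>
      obtain r' where r': "r = Suc r'" using r by (cases r) auto
      have "2 ^ n / (2 ^ n) ^ (2 * r) = (1 / 2 ^ n :: real) ^ (2 * r' + 1)"
        by (simp add: r' power_one_over field_simps)
      also have "\<dots> = (1 / 2 ^ L) ^ (2 * r' + 1) * (1 / 2 ^ i) ^ (2 * r' + 1)"
        by (simp add: n power_add power_mult_distrib power_one_over)
      also have "\<dots> \<le> (1 / T) ^ (2 * r' + 1) * (1 / 2) ^ i"
      proof (intro mult_mono power_mono)
        show "1 / 2 ^ L \<le> 1 / T" using dyadic_level_ge[of T] T by (simp add: L_def frac_le)
        have "(1 / 2 ^ i :: real) ^ (2 * r' + 1) \<le> (1 / 2 ^ i) ^ 1" by (intro power_decreasing) auto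
        then show "(1 / 2 ^ i :: real) ^ (2 * r' + 1) \<le> (1 / 2) ^ i" by (simp add: power_one_over)
      qed (use T in auto)
      finally have p2: "?c n \<le> C1 / T * ((1 / T) ^ (2 * r' + 1) * (1 / 2) ^ i)"
        using C1 T by (intro mult_left_mono) auto
      have "real (n + 1) ^ (?D - 1) * ?c n \<le> (real (L + 1) ^ (?D - 1) * real (i + 1) ^ (?D - 1)) * (C1 / T * ((1 / T) ^ (2 * r' + 1) * (1 / 2) ^ i))"
        by (intro mult_mono p1 p2) (use C1 T in auto)
      also have "\<dots> = C1 * real (L + 1) ^ (?D - 1) * (1 / T) ^ (2 * r) * (real (i + 1) ^ (?D - 1) * (1 / 2) ^ i)"
        by (simp add: r' power_one_over field_simps)
      finally show "real (n + 1) ^ (?D - 1) * ?c n \<le> C1 * real (dyadic_level T + 1) ^ (?D - 1) * (1 / T) ^ (2 * r) *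
        (real (n - dyadic_level T + 1) ^ (?D - 1) * (1 / 2) ^ (n - dyadic_level T))"
        by (simp only: i_def L_def)
    qed
    also have "\<dots> = C1 * real (dyadic_level T + 1) ^ (?D - 1) * (1 / T) ^ (2 * r) *
        (\<Sum>n\<in>tot ` lv ` K. real (n - dyadic_level T + 1) ^ (?D - 1) * (1 / 2) ^ (n - dyadic_level T))"
      by (rule sum_distrib_left[symmetric])
    also have "\<dots> \<le> C1 * real (dyadic_level T + 1) ^ (?D - 1) * (1 / T) ^ (2 * r) * Y"
    proof (rule mult_left_mono)
      have inj: "inj_on (\<lambda>n. n - dyadic_level T) (tot ` lv ` K)"
      proof (rule inj_onI)
        fix n n' assume nn: "n \<in> tot ` lv ` K" "n' \<in> tot ` lv ` K" "n - dyadic_level T = n' - dyadic_level T"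
        have "dyadic_level T \<le> n" "dyadic_level T \<le> n'" using nn(1,2) dyadic_level_least[OF T_le] by auto
        then show "n = n'" using nn(3) by linarith
      qed
      have "(\<Sum>n\<in>tot ` lv ` K. real (n - dyadic_level T + 1) ^ (?D - 1) * (1 / 2) ^ (n - dyadic_level T))
        = (\<Sum>i\<in>(\<lambda>n. n - dyadic_level T) ` tot ` lv ` K. real (i + 1) ^ (?D - 1) * (1 / 2) ^ i)"
        by (simp only: sum.reindex[OF inj] o_def)
      also have "\<dots> \<le> Y" using K(1) by (intro Y) auto
      finally show "(\<Sum>n\<in>tot ` lv ` K. real (n - dyadic_level T + 1) ^ (?D - 1) * (1 / 2) ^ (n - dyadic_level T)) \<le> Y" .
    qed (use C1 T in simp)
    finally show "(\<Sum>k\<in>K. 1 / freq_weight (mix_indices r) (?\<xi> k))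
      \<le> C1 * Y * real (dyadic_level (a ^ ?D) + 1) ^ (?D - 1) * (1 / a ^ ?D) ^ (2 * r)"
      by (simp add: T_def mult_ac)
  qed
qed

subsection \<open>Random dilations\<close>

lemma two_root_gt_1: "1 < 2 powr (1 / real CARD('d::finite))"
  using powr_less_mono[of 0 "1 / real CARD('d)" 2] by simp

lemma emeasure_u_box:
  "emeasure lborel (u_box :: (real^'d::finite) set) = ennreal ((2 powr (1 / real CARD('d)) - 1) ^ CARD('d))"
proof -
  let ?c = "2 powr (1 / real CARD('d))"
  have "(1 :: real^'d) \<in> cbox 1 (\<chi> i. ?c)"
    using two_root_gt_1[where 'd = 'd] by (simp add: mem_box_cart less_imp_le)
  then have ne: "cbox (1 :: real^'d) (\<chi> i. ?c) \<noteq> {}" by blast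
  have "emeasure lborel (u_box :: (real^'d) set) = ennreal (measure lborel (u_box :: (real^'d) set))"
    using emeasure_lborel_cbox_finite[of "1 :: real^'d" "\<chi> i. ?c"] unfolding u_box_def
    by (intro emeasure_eq_ennreal_measure) (simp add: less_top)
  also have "measure lborel (u_box :: (real^'d) set) = (?c - 1) ^ CARD('d)"
    unfolding u_box_def content_cbox_cart[OF ne] by simp
  finally show ?thesis .
qed

lemma u_box_sets [measurable]: "u_box \<in> sets borel" by (simp add: u_box_def)

abbreviation u_dist :: "(real^'d::finite) measure" where "u_dist \<equiv> uniform_measure lborel u_box"
abbreviation v_dist :: "(real^'d::finite) measure" where "v_dist \<equiv> uniform_measure lborel unit_cube"

lemma prob_space_u_dist: "prob_space (u_dist :: (real^'d::finite) measure)"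
proof -
  have "0 < (2 powr (1 / real CARD('d)) - 1) ^ CARD('d)" using two_root_gt_1[where 'd = 'd] by simp
  then show ?thesis
    by (intro prob_space_uniform_measure) (simp_all add: emeasure_u_box ennreal_eq_0_iff not_le)
qed

lemma prob_space_v_dist: "prob_space (v_dist :: (real^'d::finite) measure)"
  by (intro prob_space_uniform_measure) (simp_all add: emeasure_unit_cube)

lemma sets_uv: "sets (u_dist \<Otimes>\<^sub>M v_dist) = sets (borel \<Otimes>\<^sub>M (borel :: (real^'d::finite) measure))"
  by (intro sets_pair_measure_cong) simp_all

lemma pair_sigma_finite_uv: "pair_sigma_finite (u_dist :: (real^'d::finite) measure) (v_dist :: (real^'d) measure)"
  by (intro pair_sigma_finite.intro prob_space_imp_sigma_finite prob_space_u_dist prob_space_v_dist)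

lemma AE_u_dist: "AE u in u_dist. u \<in> u_box"
  by (rule AE_uniform_measureI) auto

lemma AE_v_dist: "AE v in v_dist. v \<in> unit_cube"
  by (rule AE_uniform_measureI) auto

lemma AE_realizations: "AE \<omega> in (u_dist \<Otimes>\<^sub>M v_dist). \<omega> \<in> (realizations :: ((real^'d::finite) \<times> (real^'d)) set)"
proof (rule pair_sigma_finite.AE_pair_measure[OF pair_sigma_finite_uv])
  have "realizations \<in> sets (borel \<Otimes>\<^sub>M (borel :: (real^'d) measure))"
    unfolding realizations_def by (intro pair_measureI) auto
  then have "realizations \<in> sets (u_dist \<Otimes>\<^sub>M (v_dist :: (real^'d) measure))" by (simp only: sets_uv)
  then show "{\<omega> \<in> space (u_dist \<Otimes>\<^sub>M (v_dist :: (real^'d) measure)). \<omega> \<in> realizations} \<in> sets (u_dist \<Otimes>\<^sub>M v_dist)"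
    using sets.sets_into_space by (auto simp: Collect_conj_eq Int_absorb1)
  show "AE u in u_dist. AE v in v_dist. (u, v) \<in> (realizations :: ((real^'d) \<times> (real^'d)) set)"
    using AE_u_dist
  proof eventually_elim
    case (elim u)
    show ?case using AE_v_dist by eventually_elim (use elim in \<open>simp add: realizations_def\<close>)
  qed
qed

text \<open>The node written with the inverse of the fixed matrix \<open>transpose B\<close> only;
  \<open>u\<close> enters by division, which makes joint measurability in \<open>(u, v)\<close>
  immediate.\<close>

definition explicit_node :: "real \<Rightarrow> real^'d^'d::finite \<Rightarrow> real^'d \<Rightarrow> real^'d \<Rightarrow> real^'d \<Rightarrow> real^'d" where
  "explicit_node a B u v m = (\<chi> i. (matrix_inv (transpose B) *v (m + v)) $ i / (a * u $ i))"

lemma node_dilation: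
  fixes B :: "real^'d^'d::finite"
  assumes B: "invertible B" and u: "u \<in> u_box" and a: "a > 0"
  shows "node (dilation a B u) v m = explicit_node a B u v m"
proof -
  let ?S = "dilation a B u"
  define y where "y = matrix_inv (transpose B) *v (m + v)"
  note S = invertible_dilation[OF B u a]
  have u1: "1 \<le> u $ i" for i using u by (auto simp: u_box_iff)
  have By: "transpose B *v y = m + v"
    unfolding y_def using matrix_inv_mult(2)[of "transpose B"] B by (simp add: invertible_transpose_iff matrix_vector_mul_assoc del: transpose_matrix_vector)
  have tr: "(transpose A *v w) $ j = (\<Sum>i\<in>UNIV. A $ i $ j * w $ i)" for A :: "real^'d^'d" and w j
    by (simp add: matrix_vector_mult_def transpose_def del: transpose_matrix_vector)
  have "(transpose ?S *v explicit_node a B u v m) $ j = (transpose B *v y) $ j" for j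
    unfolding tr
  proof (rule sum.cong[OF refl])
    fix i
    show "?S $ i $ j * explicit_node a B u v m $ i = B $ i $ j * y $ i"
      using a u1[of i] by (simp add: dilation_nth explicit_node_def y_def[symmetric])
  qed
  then have "transpose ?S *v explicit_node a B u v m = m + v" by (simp add: By vec_eq_iff del: transpose_matrix_vector)
  then have "node_matrix ?S *v (transpose ?S *v explicit_node a B u v m) = node ?S v m" by (simp only: node_eq)
  then show ?thesis by (simp only: node_matrix_props(4)[OF S])
qed

lemma explicit_node_measurable [measurable (raw)]:
  assumes [measurable]: "f \<in> borel_measurable M" "g \<in> borel_measurable M"
  shows "(\<lambda>\<omega>. explicit_node a B (f \<omega>) (g \<omega>) m) \<in> borel_measurable M"
  unfolding explicit_node_def by measurable

text \<open>A Borel function of \<open>(u, v)\<close> on the whole space whenever \<open>g\<close>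
  is Borel. On the realizations it coincides with \<open>M_method\<close> if \<open>g\<close> is the
  transformed integrand.\<close>

definition explicit_rule :: "real \<Rightarrow> real^'d^'d::finite \<Rightarrow> (real^'d \<Rightarrow> real) \<Rightarrow> (real^'d) \<times> (real^'d) \<Rightarrow> real" where
  "explicit_rule a B g \<omega> = 1 / \<bar>det (dilation a B (fst \<omega>))\<bar> * (\<Sum>m\<in>node_set a B. g (explicit_node a B (fst \<omega>) (snd \<omega>) m))"

lemma explicit_rule_measurable [measurable]:
  assumes [measurable]: "g \<in> borel_measurable borel"
  shows "explicit_rule a B g \<in> borel_measurable (borel \<Otimes>\<^sub>M borel)"
  unfolding explicit_rule_def det_dilation by measurable

lemma explicit_rule_periodize:
  assumes B: "invertible B" and a: "a > 0" and uses: "uses_at_most N a B" and u: "u \<in> u_box"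
  shows "explicit_rule a B g (u, v) = cubature.periodize (dilation a B u) (node_set a B) g v"
proof -
  interpret cubature "dilation a B u" "node_set a B" N by (rule cubature_dilation[OF B a uses u])
  show ?thesis
    by (simp add: explicit_rule_def periodize_def node_dilation[OF B u a])
qed

lemma M_method_explicit:
  assumes adm: "admissible_psi \<psi>" and B: "invertible B" and a: "a > 0" and uses: "uses_at_most N a B"
    and \<omega>: "\<omega> \<in> realizations"
  shows "M_method \<psi> a B \<omega> f = explicit_rule a B (\<lambda>x. f (Psi \<psi> x) * DPsi \<psi> x) \<omega>"
proof -
  obtain u v where uv: "\<omega> = (u, v)" by (cases \<omega>)
  have u: "u \<in> u_box" and v: "v \<in> unit_cube" using \<omega> by (auto simp: uv realizations_def)
  show ?thesis
    using Q_rule_eq_sum[OF adm cubature_dilation[OF B a uses u] v, of f]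
    by (simp add: M_method_def uv explicit_rule_def node_dilation[OF B u a])
qed

lemma nn_integral_diag:
  fixes z :: "real^'d::finite" and H :: "real^'d \<Rightarrow> ennreal"
  assumes [measurable]: "H \<in> borel_measurable borel" and z: "\<And>j. z $ j \<noteq> 0"
  shows "(\<integral>\<^sup>+u. H (\<chi> j. z $ j * u $ j) \<partial>lborel) = (\<integral>\<^sup>+x. ennreal (1 / (\<Prod>j\<in>UNIV. \<bar>z $ j\<bar>)) * H x \<partial>lborel)"
proof -
  let ?A = "diag_matrix z"
  have det: "det ?A = (\<Prod>j\<in>UNIV. z $ j)"
    by (subst det_diagonal) (simp_all add: diag_matrix_def)
  have inv: "invertible ?A" using z by (simp add: invertible_det_nz det)
  have mul: "?A *v u = (\<chi> j. z $ j * u $ j)" for u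
    by (simp add: vec_eq_iff matrix_vector_mult_def diag_matrix_def if_distrib[of "\<lambda>x. x * _"] cong: if_cong)
  let ?p = "\<Prod>j\<in>UNIV. \<bar>z $ j\<bar>"
  have p: "?p > 0" using z by (intro prod_pos) simp
  have "ennreal ?p * (\<integral>\<^sup>+u. H (\<chi> j. z $ j * u $ j) \<partial>lborel) = (\<integral>\<^sup>+x. H x \<partial>lborel)"
    using nn_integral_linear_change[OF inv assms(1)] by (simp add: det mul abs_prod)
  then have "ennreal (1 / ?p) * (\<integral>\<^sup>+x. H x \<partial>lborel) = ennreal (1 / ?p) * (ennreal ?p * (\<integral>\<^sup>+u. H (\<chi> j. z $ j * u $ j) \<partial>lborel))"
    by simp
  also have "\<dots> = (\<integral>\<^sup>+u. H (\<chi> j. z $ j * u $ j) \<partial>lborel)"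
  proof -
    have "ennreal (1 / p) * (ennreal p * X) = X" if "p > 0" for p X
      using that by (simp add: mult.assoc[symmetric] ennreal_mult[symmetric])
    from this[OF p] show ?thesis .
  qed
  finally show ?thesis by (simp add: nn_integral_cmult)
qed

text \<open>Averaging over the dilation turns the sum over the lattice into an integral over the region
  \<open>\<Prod>|x\<^sub>j| \<ge> a ^ d\<close>: for fixed \<open>x\<close> only lattice points in a box of volume
  \<open>\<Prod>|x\<^sub>j| / a ^ d\<close> contribute.\<close>

lemma frolov_average:
  fixes B :: "real^'d^'d::finite" and h :: "real^'d \<Rightarrow> ennreal"
  assumes B: "frolov_matrix B" and a: "a > 0" and h [measurable]: "h \<in> borel_measurable borel"
    and K: "finite K" "K \<subseteq> int_lattice - {0}"
  shows "(\<Sum>k\<in>K. \<integral>\<^sup>+u. h (dilation a B u *v k) * indicator u_box u \<partial>lborel)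
    \<le> ennreal (4 / a ^ CARD('d)) * (\<integral>\<^sup>+x. h x * indicator {x. a ^ CARD('d) \<le> (\<Prod>j\<in>UNIV. \<bar>x $ j\<bar>)} x \<partial>lborel)"
proof -
  define T where "T = a ^ CARD('d)"
  have T: "T > 0" using a by (simp add: T_def)
  define z where "z k = (\<chi> j. a * (B *v k) $ j)" for k :: "real^'d"
  define q where "q k = (\<Prod>j\<in>UNIV. \<bar>z k $ j\<bar>)" for k
  \<comment> \<open>The box over which the lattice point \<open>k\<close> is spread when
    \<open>u\<close> ranges over \<open>u_box\<close>.\<close>
  let ?E = "\<lambda>k. {x :: real^'d. (\<chi> j. x $ j / z k $ j) \<in> u_box}"
  have E [measurable]: "?E k \<in> sets borel" for k
  proof -
    have "?E k = (\<lambda>x. \<chi> j. x $ j / z k $ j) -` u_box \<inter> space borel" by auto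
    also have "\<dots> \<in> sets borel" by (rule measurable_sets[where A = borel]) measurable
    finally show ?thesis .
  qed
  have q_T: "T \<le> q k" and z_nz: "z k $ j \<noteq> 0" if "k \<in> K" for k j
  proof -
    have p: "1 \<le> (\<Prod>j\<in>UNIV. \<bar>(B *v k) $ j\<bar>)" using frolov_prod_ge[OF B] K that by auto
    have "q k = T * (\<Prod>j\<in>UNIV. \<bar>(B *v k) $ j\<bar>)"
      using a by (simp add: q_def z_def T_def abs_mult prod.distrib)
    moreover have "T * 1 \<le> T * (\<Prod>j\<in>UNIV. \<bar>(B *v k) $ j\<bar>)" using p T by (intro mult_left_mono) auto
    ultimately show q: "T \<le> q k" by simp
    show "z k $ j \<noteq> 0"
    proof
      assume "z k $ j = 0"
      then have "q k = 0" unfolding q_def by (intro prod_zero bexI[of _ j]) auto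
      with q T show False by simp
    qed
  qed
  have avg: "(\<integral>\<^sup>+u. h (dilation a B u *v k) * indicator u_box u \<partial>lborel)
    = (\<integral>\<^sup>+x. ennreal (1 / q k) * (h x * indicator (?E k) x) \<partial>lborel)" if k: "k \<in> K" for k
  proof -
    have "(\<integral>\<^sup>+u. h (dilation a B u *v k) * indicator u_box u \<partial>lborel)
      = (\<integral>\<^sup>+u. h (\<chi> j. z k $ j * u $ j) * indicator (?E k) (\<chi> j. z k $ j * u $ j) \<partial>lborel)"
    proof (rule nn_integral_cong)
      fix u :: "real^'d"
      have "dilation a B u *v k = (\<chi> j. z k $ j * u $ j)"
        by (simp add: vec_eq_iff dilation_mult z_def)
      moreover have "(\<chi> j. (\<chi> j. z k $ j * u $ j) $ j / z k $ j) = u"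
        using z_nz[OF k] by (simp add: vec_eq_iff)
      ultimately show "h (dilation a B u *v k) * indicator u_box u
        = h (\<chi> j. z k $ j * u $ j) * indicator (?E k) (\<chi> j. z k $ j * u $ j)"
        by (simp only: indicator_def mem_Collect_eq)
    qed
    also have "\<dots> = (\<integral>\<^sup>+x. ennreal (1 / (\<Prod>j\<in>UNIV. \<bar>z k $ j\<bar>)) * (h x * indicator (?E k) x) \<partial>lborel)"
      by (rule nn_integral_diag[where H = "\<lambda>x. h x * indicator (?E k) x", OF _ z_nz[OF k]]) measurable
    finally show ?thesis by (simp only: q_def)
  qed
  have pt: "(\<Sum>k\<in>K. ennreal (1 / q k) * (h x * indicator (?E k) x))
    \<le> ennreal (4 / T) * (h x * indicator {x. T \<le> (\<Prod>j\<in>UNIV. \<bar>x $ j\<bar>)} x)" for x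
  proof -
    define X where "X = (\<Prod>j\<in>UNIV. \<bar>x $ j\<bar>)"
    let ?Kx = "{k \<in> K. x \<in> ?E k}"
    have fin: "finite ?Kx" using K by simp
    have ratio: "\<exists>t\<in>u_box. \<forall>j. x $ j = z k $ j * t $ j" if "k \<in> ?Kx" for k
      using that z_nz[of k] by (intro bexI[of _ "\<chi> j. x $ j / z k $ j"]) auto
    \<comment> \<open>The coordinates of \<open>x\<close> are those of \<open>z k\<close> times
      factors between 1 and \<open>2 powr (1 / d)\<close>, whose product lies between 1 and 2; the
      side length of \<open>u_box\<close> is made for this.\<close>
    have qX: "q k \<le> X" "X \<le> 2 * q k" if k: "k \<in> ?Kx" for k
    proof -
      obtain t where t: "t \<in> u_box" "\<And>j. x $ j = z k $ j * t $ j" using ratio[OF k] by blast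
      have t1: "1 \<le> t $ j" "t $ j \<le> 2 powr (1 / real CARD('d))" for j using t(1) by (auto simp: u_box_iff)
      have "X = (\<Prod>j\<in>UNIV. \<bar>z k $ j\<bar> * \<bar>t $ j\<bar>)" unfolding X_def t(2) abs_mult ..
      also have "\<dots> = q k * (\<Prod>j\<in>UNIV. \<bar>t $ j\<bar>)" by (simp add: prod.distrib q_def)
      also have "(\<Prod>j\<in>UNIV. \<bar>t $ j\<bar>) = (\<Prod>j\<in>UNIV. t $ j)"
      proof (rule prod.cong[OF refl])
        fix j show "\<bar>t $ j\<bar> = t $ j" using t1(1)[of j] by simp
      qed
      finally have X: "X = q k * (\<Prod>j\<in>UNIV. t $ j)" .
      have q0: "0 \<le> q k" unfolding q_def by (intro prod_nonneg) auto
      have "(\<Prod>j\<in>UNIV. t $ j) \<le> (\<Prod>j\<in>(UNIV :: 'd set). 2 powr (1 / real CARD('d)))"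
      proof (intro prod_mono conjI)
        fix j show "0 \<le> t $ j" using t1(1)[of j] by linarith
        show "t $ j \<le> 2 powr (1 / real CARD('d))" by (rule t1(2))
      qed
      also have "\<dots> = 2" using two_root_power[where 'd = 'd] by simp
      finally have "q k * (\<Prod>j\<in>UNIV. t $ j) \<le> q k * 2" using q0 by (rule mult_left_mono)
      then show "X \<le> 2 * q k" by (simp add: X mult.commute)
      have "q k * 1 \<le> q k * (\<Prod>j\<in>UNIV. t $ j)" using q0 u_box_prod[OF t(1)] by (intro mult_left_mono)
      then show "q k \<le> X" by (simp add: X)
    qed
    have "(\<Sum>k\<in>K. ennreal (1 / q k) * (h x * indicator (?E k) x)) = (\<Sum>k\<in>?Kx. ennreal (1 / q k) * h x)"
      using K by (intro sum.mono_neutral_cong_right) auto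
    also have "\<dots> \<le> ennreal (4 / T) * (h x * indicator {x. T \<le> (\<Prod>j\<in>UNIV. \<bar>x $ j\<bar>)} x)"
    proof (cases "?Kx = {}")
      case True
      then show ?thesis by (simp only: sum.empty zero_le)
    next
      case False
      then obtain k0 where k0: "k0 \<in> ?Kx" by blast
      have XT: "T \<le> X" using qX(1)[OF k0] q_T[of k0] k0 by auto
      then have X0: "X > 0" using T by linarith
      \<comment> \<open>As the factors \<open>t $ j\<close> are at least one, all contributing
        points \<open>B *v k\<close> lie in the box spanned by the origin and
        \<open>x / a\<close>.\<close>
      have "real (card ?Kx) \<le> (\<Prod>j\<in>UNIV. (\<chi> j. max 0 (x $ j / a) :: real^'d) $ j - (\<chi> j. min 0 (x $ j / a)) $ j) + 1"
      proof (rule frolov_card(2)[OF B])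
        fix k j assume "k \<in> ?Kx"
        from ratio[OF this] obtain t where t: "t \<in> u_box" "\<And>j. x $ j = z k $ j * t $ j" by blast
        have t1: "1 \<le> t $ j" using t(1) by (auto simp: u_box_iff)
        have x: "x $ j / a = (B *v k) $ j * t $ j" using a t(2)[of j] by (simp add: z_def)
        show "(\<chi> j. min 0 (x $ j / a)) $ j \<le> (B *v k) $ j \<and> (B *v k) $ j \<le> (\<chi> j. max 0 (x $ j / a) :: real^'d) $ j"
        proof (cases "0 \<le> (B *v k) $ j")
          case True
          have "(B *v k) $ j * 1 \<le> (B *v k) $ j * t $ j" using True t1 by (rule mult_left_mono[rotated])
          then show ?thesis using True by (simp add: x)
        next
          case False
          have le: "(B *v k) $ j * t $ j \<le> (B *v k) $ j"
            using mult_left_mono_neg[OF t1, of "(B *v k) $ j"] False by simp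
          show ?thesis
            unfolding x vec_lambda_beta
            by (intro conjI min.coboundedI2[OF le] max.coboundedI1) (use False in simp)
        qed
      qed (use K in auto)
      also have "(\<Prod>j\<in>UNIV. (\<chi> j. max 0 (x $ j / a) :: real^'d) $ j - (\<chi> j. min 0 (x $ j / a)) $ j) = (\<Prod>j\<in>UNIV. \<bar>x $ j\<bar> / a)"
        using a by (intro prod.cong refl) (auto simp: max_def min_def abs_if field_simps)
      also have "\<dots> = X / T" by (simp add: prod_dividef X_def T_def)
      finally have "real (card ?Kx) \<le> X / T + 1" .
      \<comment> \<open>The additional 1 is absorbed because \<open>T \<le> X\<close>, which holds
        as soon as one lattice point contributes.\<close>
      also have "\<dots> \<le> 2 * X / T" using XT T by (simp add: field_simps)
      finally have card: "real (card ?Kx) \<le> 2 * X / T" .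
      \<comment> \<open>The 4 of the claim: one factor 2 from the count, one from
        \<open>X \<le> 2 * q k\<close>, while \<open>X\<close> itself cancels.\<close>
      have "(\<Sum>k\<in>?Kx. 1 / q k) \<le> real (card ?Kx) * (2 / X)"
      proof (rule sum_bounded_above)
        fix k assume k: "k \<in> ?Kx"
        have "q k > 0" using q_T[of k] k T by auto
        then show "1 / q k \<le> 2 / X" using qX(2)[OF k] X0 by (simp add: field_simps)
      qed
      also have "\<dots> \<le> (2 * X / T) * (2 / X)" using card X0 by (intro mult_right_mono) auto
      also have "\<dots> = 4 / T" using X0 by simp
      finally have "(\<Sum>k\<in>?Kx. 1 / q k) \<le> 4 / T" .
      then have "ennreal (\<Sum>k\<in>?Kx. 1 / q k) * h x \<le> ennreal (4 / T) * h x" by (intro mult_right_mono ennreal_leI) auto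
      moreover have "(\<Sum>k\<in>?Kx. ennreal (1 / q k) * h x) = ennreal (\<Sum>k\<in>?Kx. 1 / q k) * h x"
      proof -
        have "0 \<le> 1 / q k" for k unfolding q_def by (intro divide_nonneg_nonneg prod_nonneg) auto
        then have "ennreal (\<Sum>k\<in>?Kx. 1 / q k) = (\<Sum>k\<in>?Kx. ennreal (1 / q k))" by (intro sum_ennreal[symmetric])
        then show ?thesis by (simp only: sum_distrib_right)
      qed
      ultimately show ?thesis using XT by (simp add: X_def)
    qed
    finally show ?thesis .
  qed
  have "(\<Sum>k\<in>K. \<integral>\<^sup>+u. h (dilation a B u *v k) * indicator u_box u \<partial>lborel)
    = (\<Sum>k\<in>K. \<integral>\<^sup>+x. ennreal (1 / q k) * (h x * indicator (?E k) x) \<partial>lborel)"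
    by (rule sum.cong[OF refl avg])
  also have "\<dots> = (\<integral>\<^sup>+x. (\<Sum>k\<in>K. ennreal (1 / q k) * (h x * indicator (?E k) x)) \<partial>lborel)"
    by (rule nn_integral_sum[symmetric]) measurable
  also have "\<dots> \<le> (\<integral>\<^sup>+x. ennreal (4 / T) * (h x * indicator {x. T \<le> (\<Prod>j\<in>UNIV. \<bar>x $ j\<bar>)} x) \<partial>lborel)"
    by (rule nn_integral_mono) (rule pt)
  also have "\<dots> = ennreal (4 / T) * (\<integral>\<^sup>+x. h x * indicator {x. T \<le> (\<Prod>j\<in>UNIV. \<bar>x $ j\<bar>)} x \<partial>lborel)"
    by (rule nn_integral_cmult) measurable
  finally show ?thesis by (simp only: T_def)
qed

subsection \<open>Unbiasedness\<close>

lemma integral_v_dist: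
  fixes h :: "real^'d::finite \<Rightarrow> 'b::{banach, second_countable_topology}"
  assumes "h \<in> borel_measurable borel"
  shows "(\<integral>v. h v \<partial>v_dist) = (LINT v:unit_cube|lborel. h v)"
proof -
  have "(v_dist :: (real^'d) measure) = density lborel (\<lambda>x. ennreal (indicator unit_cube x))"
    unfolding uniform_measure_def by (simp add: emeasure_unit_cube ennreal_indicator divide_ennreal_def)
  then show ?thesis
    using assms by (simp add: integral_density set_lebesgue_integral_def)
qed

lemma nn_integral_v_dist:
  fixes h :: "real^'d::finite \<Rightarrow> ennreal"
  assumes "h \<in> borel_measurable borel"
  shows "(\<integral>\<^sup>+v. h v \<partial>v_dist) = (\<integral>\<^sup>+v. indicator unit_cube v * h v \<partial>lborel)"
  using assms by (subst nn_integral_uniform_measure) (simp_all add: emeasure_unit_cube mult.commute divide_ennreal_def)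

text \<open>The nodes in use are part of the full lattice sum, which tiles the space after the
  linear change of variables. With the absolute value of an integrand as \<open>G\<close> this gives
  integrability of the rule; with a \<open>G\<close> of integral zero it shows that the nodes avoid
  null sets almost surely.\<close>

lemma nn_integral_explicit_nodes:
  fixes B :: "real^'d^'d::finite" and G :: "real^'d \<Rightarrow> ennreal"
  assumes B: "invertible B" and a: "a > 0" and u: "u \<in> u_box" and G [measurable]: "G \<in> borel_measurable borel"
  shows "(\<integral>\<^sup>+v. (\<Sum>m\<in>node_set a B. G (explicit_node a B u v m)) \<partial>v_dist)
    \<le> ennreal \<bar>det (dilation a B u)\<bar> * (\<integral>\<^sup>+x. G x \<partial>lborel)"
proof -
  let ?S = "dilation a B u"
  let ?A = "node_matrix ?S"
  note S = invertible_dilation[OF B u a]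
  have A: "invertible ?A" by (rule node_matrix_props[OF S])
  have fin: "finite (node_set a B)" "node_set a B \<subseteq> int_lattice"
    unfolding node_set_def using finite_nodes[OF B a] by auto
  have "(\<integral>\<^sup>+v. (\<Sum>m\<in>node_set a B. G (explicit_node a B u v m)) \<partial>v_dist)
    = (\<integral>\<^sup>+v. indicator unit_cube v * (\<Sum>m\<in>node_set a B. G (explicit_node a B u v m)) \<partial>lborel)"
    by (rule nn_integral_v_dist) measurable
  also have "\<dots> \<le> (\<integral>\<^sup>+v. indicator unit_cube v * (\<integral>\<^sup>+m. G (?A *v (v + m)) \<partial>count_space int_lattice) \<partial>lborel)"
  proof (rule nn_integral_mono, rule mult_left_mono)
    fix v :: "real^'d"
    have "(\<Sum>m\<in>node_set a B. G (explicit_node a B u v m)) = (\<Sum>m\<in>node_set a B. G (?A *v (v + m)) * indicator (node_set a B) m)"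
      by (intro sum.cong refl) (simp add: node_dilation[OF B u a, symmetric] node_eq add.commute)
    also have "\<dots> = (\<integral>\<^sup>+m. G (?A *v (v + m)) * indicator (node_set a B) m \<partial>count_space int_lattice)"
      using fin by (intro nn_integral_count_space'[symmetric]) auto
    also have "\<dots> \<le> (\<integral>\<^sup>+m. G (?A *v (v + m)) \<partial>count_space int_lattice)"
      by (intro nn_integral_mono) (auto split: split_indicator)
    finally show "(\<Sum>m\<in>node_set a B. G (explicit_node a B u v m)) \<le> (\<integral>\<^sup>+m. G (?A *v (v + m)) \<partial>count_space int_lattice)" .
  qed simp
  also have "\<dots> = (\<integral>\<^sup>+x. G (?A *v x) \<partial>lborel)"
    by (rule nn_integral_tiling[symmetric]) measurable
  also have "\<dots> = ennreal (\<bar>det ?S\<bar> * \<bar>det ?A\<bar>) * (\<integral>\<^sup>+x. G (?A *v x) \<partial>lborel)"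
    by (simp only: node_matrix_props(2)[OF S] ennreal_1 mult_1)
  also have "\<dots> = ennreal \<bar>det ?S\<bar> * (\<integral>\<^sup>+x. G x \<partial>lborel)"
    by (simp only: ennreal_mult abs_ge_zero mult.assoc nn_integral_linear_change[OF A G])
  finally show ?thesis .
qed

text \<open>Serves \<open>M_method\<close> on an integrand that is merely Lebesgue measurable, where
  only agreement almost everywhere with a Borel function is known.\<close>

lemma measurable_completion_AE:
  assumes g: "g \<in> borel_measurable M" and eq: "AE x in M. f x = g x"
  shows "f \<in> borel_measurable (completion M)"
proof (rule measurableI)
  fix X :: "'b set" assume X: "X \<in> sets borel"
  have A: "g -` X \<inter> space M \<in> sets (completion M)" using g X by (intro sets_completionI_sets) (rule measurable_sets)
  have E: "AE x in completion M. x \<in> g -` X \<inter> space M \<longleftrightarrow> x \<in> f -` X \<inter> space (completion M)"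
    using AE_completion[OF eq] by eventually_elim simp
  show "f -` X \<inter> space (completion M) \<in> sets (completion M)"
    by (rule completion.in_sets_AE[OF E A Int_lower2])
qed simp

context
  fixes \<psi> :: "real \<Rightarrow> real"
  assumes adm: "admissible_psi \<psi>"
begin

text \<open>\<open>Psi\<close> maps the measure with density \<open>DPsi\<close> to Lebesgue measure
  on the cube. Transport along this map covers signed integrands and integrability at once.\<close>

lemma integral_Psi:
  fixes f0 :: "real^'d::finite \<Rightarrow> real"
  assumes f0: "integrable lborel f0" and out: "\<And>x. x \<notin> unit_cube \<Longrightarrow> f0 x = 0"
  shows "integrable lborel (\<lambda>x. f0 (Psi \<psi> x) * DPsi \<psi> x)"
    and "(\<integral>x. f0 (Psi \<psi> x) * DPsi \<psi> x \<partial>lborel) = (\<integral>x. f0 x \<partial>lborel)"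
proof -
  note [measurable] = Psi_measurable[OF adm] DPsi_measurable[OF adm]
  have f0m [measurable]: "f0 \<in> borel_measurable borel" using f0 by auto
  let ?M = "density lborel (\<lambda>x :: real^'d. ennreal (DPsi \<psi> x))"
  have Pm: "Psi \<psi> \<in> measurable ?M (borel :: (real^'d) measure)" by measurable
  have eq: "density lborel (\<lambda>x :: real^'d. ennreal (indicator unit_cube x)) = distr ?M borel (Psi \<psi>)" (is "?C = _")
  proof (rule measure_eqI)
    fix X :: "(real^'d) set" assume "X \<in> sets ?C"
    then have [measurable]: "X \<in> sets borel" by simp
    have "emeasure (distr ?M borel (Psi \<psi>)) X = (\<integral>\<^sup>+x. indicator X x \<partial>distr ?M borel (Psi \<psi>))" by simp
    also have "\<dots> = (\<integral>\<^sup>+x. indicator X (Psi \<psi> x) \<partial>?M)" by (rule nn_integral_distr[OF Pm]) measurable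
    also have "\<dots> = (\<integral>\<^sup>+x. ennreal (DPsi \<psi> x) * indicator X (Psi \<psi> x) \<partial>lborel)"
      by (rule nn_integral_density) measurable
    also have "\<dots> = (\<integral>\<^sup>+x. indicator X x * indicator unit_cube x \<partial>lborel)"
      using nn_integral_Psi[OF adm, of "indicator X"] by (simp only: mult.commute) measurable
    also have "\<dots> = (\<integral>\<^sup>+x. ennreal (indicator unit_cube x) * indicator X x \<partial>lborel)"
      by (simp only: ennreal_indicator mult.commute)
    also have "\<dots> = emeasure ?C X" by (rule emeasure_density[symmetric]) measurable
    finally show "emeasure ?C X = emeasure (distr ?M borel (Psi \<psi>)) X" ..
  qed simp
  have ind: "(\<lambda>x. indicator unit_cube x *\<^sub>R f0 x) = f0" using out by (auto split: split_indicator)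
  have "integrable ?C f0" using f0 by (subst integrable_density) (auto simp: ind[simplified])
  then have "integrable ?M (\<lambda>x. f0 (Psi \<psi> x))" unfolding eq by (subst (asm) integrable_distr_eq[OF Pm]) auto
  then have "integrable lborel (\<lambda>x. DPsi \<psi> x *\<^sub>R f0 (Psi \<psi> x))"
    by (subst (asm) integrable_density) (auto simp: DPsi_nonneg[OF adm])
  then show "integrable lborel (\<lambda>x. f0 (Psi \<psi> x) * DPsi \<psi> x)" by (simp add: mult.commute)
  have "(\<integral>x. f0 x \<partial>lborel) = (\<integral>x. f0 x \<partial>?C)" by (subst integral_density) (auto simp: ind[simplified])
  also have "\<dots> = (\<integral>x. f0 (Psi \<psi> x) \<partial>?M)" unfolding eq by (rule integral_distr[OF Pm]) simp
  also have "\<dots> = (\<integral>x. DPsi \<psi> x *\<^sub>R f0 (Psi \<psi> x) \<partial>lborel)"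
    by (subst integral_density) (auto simp: DPsi_nonneg[OF adm])
  finally show "(\<integral>x. f0 (Psi \<psi> x) * DPsi \<psi> x \<partial>lborel) = (\<integral>x. f0 x \<partial>lborel)" by (simp add: mult.commute)
qed

text \<open>For each fixed \<open>u\<close> the average over the shift unfolds to the integral of
  the transformed integrand, which is already the exact value; averaging over \<open>u\<close> then
  changes nothing. The computation is run for a Borel version \<open>f0\<close> of \<open>f\<close>,
  and the two rules are shown to agree almost surely.\<close>

lemma M_method_unbiased:
  fixes B :: "real^'d^'d::finite"
  assumes B: "invertible B" and a: "a > 0" and uses: "uses_at_most N a B" and f: "f \<in> L1_cube"
  shows "has_bochner_integral uv_measure (\<lambda>\<omega>. M_method \<psi> a B \<omega> f) (cube_integral f)"
proof -
  note [measurable] = Psi_measurable[OF adm] DPsi_measurable[OF adm]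
  let ?UV = "u_dist \<Otimes>\<^sub>M (v_dist :: (real^'d) measure)"
  have fi: "integrable (lebesgue_on unit_cube) f" using f by (simp add: L1_cube_def)
  then have fm: "f \<in> borel_measurable (lebesgue_on unit_cube)" by auto
  obtain f0 where f0 [measurable]: "f0 \<in> borel_measurable borel" and out: "\<And>x. x \<notin> unit_cube \<Longrightarrow> f0 x = 0"
    and ae: "AE x in lborel. x \<in> unit_cube \<longrightarrow> f0 x = f x"
  proof (rule lebesgue_on_cube_borel[OF fm])
    fix g1 :: "real^'d \<Rightarrow> real"
    assume "g1 \<in> borel_measurable borel" "\<And>x. x \<notin> unit_cube \<Longrightarrow> g1 x = 0" "AE x in lborel. x \<in> unit_cube \<longrightarrow> g1 x = f x"
    then show thesis by (rule that)
  qed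
  have f0i: "integrable lborel f0" and If: "cube_integral f = (\<integral>x. f0 x \<partial>lborel)"
    using lebesgue_on_cube_transfer[OF fm f0 out ae] fi by (simp_all add: cube_integral_def)
  define g where "g x = f0 (Psi \<psi> x) * DPsi \<psi> x" for x
  have gi: "integrable lborel g" and Ig: "(\<integral>x. g x \<partial>lborel) = cube_integral f"
    unfolding g_def If using integral_Psi[OF f0i out] by simp_all
  have gm [measurable]: "g \<in> borel_measurable borel" using gi by auto
  have gout: "g x = 0" if "x \<notin> unit_cube" for x using DPsi_outside[OF adm that] by (simp add: g_def)
  have det: "\<bar>det (dilation a B u)\<bar> > 0" if "u \<in> u_box" for u
    using invertible_dilation[OF B that a] by (simp add: invertible_det_nz)
  have Em: "explicit_rule a B g \<in> borel_measurable ?UV"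
    by (simp only: measurable_cong_sets[OF sets_uv refl]) measurable
  have "(\<integral>\<^sup>+\<omega>. ennreal (norm (explicit_rule a B g \<omega>)) \<partial>?UV) < \<infinity>"
  proof -
    have "(\<integral>\<^sup>+\<omega>. ennreal (norm (explicit_rule a B g \<omega>)) \<partial>?UV)
      = (\<integral>\<^sup>+u. (\<integral>\<^sup>+v. ennreal (norm (explicit_rule a B g (u, v))) \<partial>v_dist) \<partial>u_dist)"
      using Em by (intro sigma_finite_measure.nn_integral_fst[symmetric] prob_space_imp_sigma_finite prob_space_v_dist) measurable
    also have "\<dots> \<le> (\<integral>\<^sup>+u. (\<integral>\<^sup>+x. ennreal (norm (g x)) \<partial>lborel) \<partial>(u_dist :: (real^'d) measure))"
    proof (rule nn_integral_mono_AE, rule AE_mp[OF AE_u_dist], rule AE_I2, rule impI)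
      fix u :: "real^'d" assume u: "u \<in> u_box"
      let ?d = "\<bar>det (dilation a B u)\<bar>"
      have "(\<integral>\<^sup>+v. ennreal (norm (explicit_rule a B g (u, v))) \<partial>v_dist)
        \<le> (\<integral>\<^sup>+v. ennreal (1 / ?d) * (\<Sum>m\<in>node_set a B. ennreal (norm (g (explicit_node a B u v m)))) \<partial>v_dist)"
      proof (rule nn_integral_mono)
        fix v :: "real^'d"
        have "norm (explicit_rule a B g (u, v)) \<le> 1 / ?d * (\<Sum>m\<in>node_set a B. norm (g (explicit_node a B u v m)))"
          unfolding explicit_rule_def fst_conv snd_conv norm_mult by (intro mult_mono norm_sum) auto
        then have "ennreal (norm (explicit_rule a B g (u, v))) \<le> ennreal (1 / ?d * (\<Sum>m\<in>node_set a B. norm (g (explicit_node a B u v m))))"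
          by (rule ennreal_leI)
        also have "\<dots> = ennreal (1 / ?d) * (\<Sum>m\<in>node_set a B. ennreal (norm (g (explicit_node a B u v m))))"
          by (subst ennreal_mult) (auto intro: sum_nonneg simp: sum_ennreal)
        finally show "ennreal (norm (explicit_rule a B g (u, v))) \<le> ennreal (1 / ?d) * (\<Sum>m\<in>node_set a B. ennreal (norm (g (explicit_node a B u v m))))" .
      qed
      also have "\<dots> = ennreal (1 / ?d) * (\<integral>\<^sup>+v. (\<Sum>m\<in>node_set a B. ennreal (norm (g (explicit_node a B u v m)))) \<partial>v_dist)"
        by (rule nn_integral_cmult) measurable
      also have "\<dots> \<le> ennreal (1 / ?d) * (ennreal ?d * (\<integral>\<^sup>+x. ennreal (norm (g x)) \<partial>lborel))"
        by (intro mult_left_mono nn_integral_explicit_nodes[OF B a u, of "\<lambda>x. ennreal (norm (g x))"]) auto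
      also have "\<dots> = (\<integral>\<^sup>+x. ennreal (norm (g x)) \<partial>lborel)"
      proof -
        have "ennreal (1 / p) * (ennreal p * X) = X" if "p > 0" for p X
          using that by (simp add: mult.assoc[symmetric] ennreal_mult[symmetric])
        from this[OF det[OF u]] show ?thesis .
      qed
      finally show "(\<integral>\<^sup>+v. ennreal (norm (explicit_rule a B g (u, v))) \<partial>v_dist) \<le> (\<integral>\<^sup>+x. ennreal (norm (g x)) \<partial>lborel)" .
    qed
    also have "\<dots> = (\<integral>\<^sup>+x. ennreal (norm (g x)) \<partial>lborel)"
      using prob_space.emeasure_space_1[OF prob_space_u_dist[where 'd = 'd]] by simp
    also have "\<dots> < \<infinity>" using gi by (simp add: integrable_iff_bounded)
    finally show ?thesis .
  qed
  with Em have Ei: "integrable ?UV (explicit_rule a B g)" by (simp add: integrable_iff_bounded)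
  have "(\<integral>\<omega>. explicit_rule a B g \<omega> \<partial>?UV) = (\<integral>u. (\<integral>v. explicit_rule a B g (u, v) \<partial>v_dist) \<partial>u_dist)"
    by (rule pair_sigma_finite.integral_fst'[OF pair_sigma_finite_uv Ei, symmetric])
  also have "\<dots> = (\<integral>u. cube_integral f \<partial>(u_dist :: (real^'d) measure))"
  proof (rule integral_cong_AE)
    have Em': "explicit_rule a B g \<in> borel_measurable ?UV" by (rule Em)
    show "(\<lambda>u. \<integral>v. explicit_rule a B g (u, v) \<partial>v_dist) \<in> borel_measurable u_dist"
      using Em by (intro sigma_finite_measure.borel_measurable_lebesgue_integral prob_space_imp_sigma_finite prob_space_v_dist) (simp add: case_prod_eta)
    show "AE u in u_dist. (\<integral>v. explicit_rule a B g (u, v) \<partial>v_dist) = cube_integral f"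
    proof (rule AE_mp[OF AE_u_dist], rule AE_I2, rule impI)
      fix u :: "real^'d" assume u: "u \<in> u_box"
      interpret cubature "dilation a B u" "node_set a B" N by (rule cubature_dilation[OF B a uses u])
      have m: "(\<lambda>v. explicit_rule a B g (u, v)) \<in> borel_measurable borel"
        unfolding explicit_rule_def fst_conv snd_conv by measurable
      have "(\<integral>v. explicit_rule a B g (u, v) \<partial>v_dist) = (LINT v:unit_cube|lborel. periodize g v)"
        unfolding integral_v_dist[OF m] by (simp only: explicit_rule_periodize[OF B a uses u])
      also have "\<dots> = cube_integral f"
        using integral_periodize[OF gi gout] det[OF u] by (simp add: periodize_def Ig)
      finally show "(\<integral>v. explicit_rule a B g (u, v) \<partial>v_dist) = cube_integral f" .
    qed
  qed simp
  also have "\<dots> = cube_integral f"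
    using prob_space.prob_space[OF prob_space_u_dist[where 'd = 'd]] by simp
  finally have "has_bochner_integral ?UV (explicit_rule a B g) (cube_integral f)"
    using Ei by (simp add: has_bochner_integral_iff)
  then have E: "has_bochner_integral uv_measure (explicit_rule a B g) (cube_integral f)"
    unfolding uv_measure_def has_bochner_integral_iff using Em by (simp add: integrable_completion integral_completion)
  have eq: "AE \<omega> in ?UV. M_method \<psi> a B \<omega> f = explicit_rule a B g \<omega>"
  proof -
    from ae obtain X where X: "{x \<in> space lborel. \<not> (x \<in> unit_cube \<longrightarrow> f0 x = f x)} \<subseteq> X" "emeasure lborel X = 0" "X \<in> sets lborel"
      by (rule AE_E)
    have [measurable]: "X \<in> sets borel" using X(3) by simp
    \<comment> \<open>The Jacobian restricted to the points that \<open>Psi\<close> sends into the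
      exceptional set \<open>X\<close>. Its integral is the measure of \<open>X\<close> in the cube,
      hence zero, so almost surely no node of nonzero weight is sent into \<open>X\<close>.\<close>
    define h where "h x = indicator X (Psi \<psi> x) * ennreal (DPsi \<psi> x)" for x :: "real^'d"
    have hm [measurable]: "h \<in> borel_measurable borel" unfolding h_def by measurable
    have "(\<integral>\<^sup>+x. h x \<partial>lborel) = (\<integral>\<^sup>+x. indicator X x * indicator unit_cube x \<partial>lborel)"
      unfolding h_def by (rule nn_integral_Psi[OF adm]) measurable
    also have "\<dots> \<le> (\<integral>\<^sup>+x. indicator X x \<partial>lborel)" by (intro nn_integral_mono) (auto split: split_indicator)
    also have "\<dots> = 0" using X(2,3) by simp
    finally have h0: "(\<integral>\<^sup>+x. h x \<partial>lborel) = 0" by simp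
    let ?H = "\<lambda>\<omega>. \<Sum>m\<in>node_set a B. h (explicit_node a B (fst \<omega>) (snd \<omega>) m)"
    have Hm0: "?H \<in> borel_measurable (borel \<Otimes>\<^sub>M borel)" by measurable
    then have Hm: "?H \<in> borel_measurable ?UV" by (simp only: measurable_cong_sets[OF sets_uv refl])
    have "(\<integral>\<^sup>+\<omega>. ?H \<omega> \<partial>?UV) = (\<integral>\<^sup>+u. (\<integral>\<^sup>+v. ?H (u, v) \<partial>v_dist) \<partial>u_dist)"
      using Hm by (intro sigma_finite_measure.nn_integral_fst[symmetric] prob_space_imp_sigma_finite prob_space_v_dist)
    also have "\<dots> = (\<integral>\<^sup>+u. 0 \<partial>(u_dist :: (real^'d) measure))"
    proof (rule nn_integral_cong_AE, rule AE_mp[OF AE_u_dist], rule AE_I2, rule impI)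
      fix u :: "real^'d" assume u: "u \<in> u_box"
      show "(\<integral>\<^sup>+v. ?H (u, v) \<partial>v_dist) = 0"
        using nn_integral_explicit_nodes[OF B a u hm] unfolding h0 by simp
    qed
    finally have "AE \<omega> in ?UV. ?H \<omega> = 0" using nn_integral_0_iff_AE[OF Hm] by simp
    with AE_realizations show ?thesis
    proof eventually_elim
      case (elim \<omega>)
      have fin: "finite (node_set a B)" unfolding node_set_def by (rule finite_nodes[OF B a])
      have "f (Psi \<psi> y) * DPsi \<psi> y = g y" if "y = explicit_node a B (fst \<omega>) (snd \<omega>) m" "m \<in> node_set a B" for y m
      proof -
        have "h y = 0" using elim(2) fin that by (simp add: sum_eq_0_iff)
        then have "Psi \<psi> y \<notin> X \<or> DPsi \<psi> y = 0"
          using DPsi_nonneg[OF adm, of y] by (auto simp: h_def ennreal_eq_0_iff split: split_indicator_asm)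
        moreover have "f0 (Psi \<psi> y) = f (Psi \<psi> y)" if "Psi \<psi> y \<notin> X" using X(1) that Psi_in_cube[OF adm, of y] by auto
        ultimately show ?thesis by (auto simp: g_def)
      qed
      then have "explicit_rule a B (\<lambda>x. f (Psi \<psi> x) * DPsi \<psi> x) \<omega> = explicit_rule a B g \<omega>"
        unfolding explicit_rule_def by (auto intro!: arg_cong2[of _ _ _ _ "(*)"] sum.cong)
      then show ?case unfolding M_method_explicit[OF adm B a uses elim(1)] .
    qed
  qed
  have Mm: "(\<lambda>\<omega>. M_method \<psi> a B \<omega> f) \<in> borel_measurable uv_measure"
    unfolding uv_measure_def by (rule measurable_completion_AE[OF Em eq])
  have Em2: "explicit_rule a B g \<in> borel_measurable uv_measure"
    unfolding uv_measure_def by (rule measurable_completion[OF Em])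
  have eq2: "AE \<omega> in uv_measure. M_method \<psi> a B \<omega> f = explicit_rule a B g \<omega>"
    unfolding uv_measure_def by (rule AE_completion[OF eq])
  show ?thesis using has_bochner_integral_cong_AE[OF Mm Em2 eq2] E by simp
qed

end

subsection \<open>Error bounds for smooth integrands\<close>

lemma cube_integral_continuous:
  fixes f :: "real^'d::finite \<Rightarrow> real"
  assumes "continuous_on unit_cube f"
  shows "cube_integral f = (LINT x:unit_cube|lborel. f x)"
  unfolding cube_integral_def set_lebesgue_integral_def
proof (rule lebesgue_on_cube_transfer(1))
  show "f \<in> borel_measurable (lebesgue_on unit_cube)"
    by (intro continuous_imp_measurable_on_sets_lebesgue assms) auto
  show "(\<lambda>x. indicator unit_cube x *\<^sub>R f x) \<in> borel_measurable borel"
    using borel_integrable_compact[OF compact_cbox assms] by auto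
qed auto

text \<open>Integrate \<open>|X| \<le> X\<^sup>2 / (2 * t) + t / 2\<close> over the probability
  space; each of the two terms contributes at most \<open>t / 2\<close>.\<close>

lemma nn_integral_le_of_square:
  fixes X :: "'a \<Rightarrow> real"
  assumes M: "prob_space M" and t: "t > 0"
    and sq: "(\<integral>\<^sup>+\<omega>. ennreal ((X \<omega>)\<^sup>2) \<partial>M) \<le> ennreal (t\<^sup>2)" and m: "X \<in> borel_measurable M"
  shows "(\<integral>\<^sup>+\<omega>. ennreal \<bar>X \<omega>\<bar> \<partial>M) \<le> ennreal t"
proof -
  note [measurable] = m
  have em: "ennreal (1 / (2 * t)) * ennreal s = ennreal (1 / (2 * t) * s)" if "0 \<le> s" for s
    using t that by (intro ennreal_mult[symmetric]) auto
  have "(\<integral>\<^sup>+\<omega>. ennreal \<bar>X \<omega>\<bar> \<partial>M) \<le> (\<integral>\<^sup>+\<omega>. ennreal (1 / (2 * t)) * ennreal ((X \<omega>)\<^sup>2) + ennreal (t / 2) \<partial>M)"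
  proof (rule nn_integral_mono)
    fix \<omega>
    have "2 * \<bar>X \<omega>\<bar> * t \<le> (X \<omega>)\<^sup>2 + t\<^sup>2" using sum_squares_bound[of "\<bar>X \<omega>\<bar>" t] by simp
    then have "\<bar>X \<omega>\<bar> \<le> 1 / (2 * t) * (X \<omega>)\<^sup>2 + t / 2" using t by (simp add: field_simps power2_eq_square)
    then have "ennreal \<bar>X \<omega>\<bar> \<le> ennreal (1 / (2 * t) * (X \<omega>)\<^sup>2 + t / 2)" by (rule ennreal_leI)
    also have "\<dots> = ennreal (1 / (2 * t)) * ennreal ((X \<omega>)\<^sup>2) + ennreal (t / 2)"
      using t by (subst ennreal_plus) (auto simp: em)
    finally show "ennreal \<bar>X \<omega>\<bar> \<le> ennreal (1 / (2 * t)) * ennreal ((X \<omega>)\<^sup>2) + ennreal (t / 2)" .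
  qed
  also have "\<dots> = ennreal (1 / (2 * t)) * (\<integral>\<^sup>+\<omega>. ennreal ((X \<omega>)\<^sup>2) \<partial>M) + ennreal (t / 2)"
    using prob_space.emeasure_space_1[OF M] by (subst nn_integral_add) (auto simp: nn_integral_cmult)
  also have "\<dots> \<le> ennreal (1 / (2 * t)) * ennreal (t\<^sup>2) + ennreal (t / 2)"
    by (intro add_mono mult_left_mono sq) auto
  also have "\<dots> = ennreal (1 / (2 * t) * t\<^sup>2 + t / 2)"
    using t by (subst ennreal_plus) (auto simp: em)
  also have "1 / (2 * t) * t\<^sup>2 + t / 2 = t" using t by (simp add: power2_eq_square)
  finally show ?thesis .
qed

lemma prob_space_uv: "prob_space (u_dist \<Otimes>\<^sub>M (v_dist :: (real^'d::finite) measure))"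
  by (intro prob_space_pair prob_space_u_dist prob_space_v_dist)

definition weight_sums_le :: "('d::finite \<Rightarrow> nat) set \<Rightarrow> real \<Rightarrow> real^'d^'d \<Rightarrow> real \<Rightarrow> bool" where
  "weight_sums_le A a B Z \<longleftrightarrow> (\<forall>u\<in>u_box. \<forall>K. finite K \<longrightarrow> K \<subseteq> int_lattice - {0} \<longrightarrow>
    (\<Sum>k\<in>K. 1 / freq_weight A (dilation a B u *v k)) \<le> Z)"

text \<open>The lattice enters through two numbers: \<open>Z\<close> bounds the sums of inverse
  weights, and \<open>\<nu>\<close> bounds the inverse weight on the region reached by averaging. As
  \<open>C\<close> depends on neither lattice, scaling nor integrand, one proof serves both
  \<open>mix_indices r\<close> and \<open>iso_indices s\<close>.\<close>

definition error_constant :: "(real \<Rightarrow> real) \<Rightarrow> ('d::finite \<Rightarrow> nat) set \<Rightarrow> real \<Rightarrow> bool" where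
  "error_constant \<psi> A C \<longleftrightarrow> C > 0 \<and> (\<forall>(B :: real^'d^'d) a N Z f.
    frolov_matrix B \<longrightarrow> a > 0 \<longrightarrow> uses_at_most N a B \<longrightarrow> f \<in> sobolev_space A \<longrightarrow>
    continuous_on unit_cube f \<longrightarrow> weight_sums_le A a B Z \<longrightarrow>
      worst_error \<psi> a B f \<le> ennreal (C * sqrt (Z * (real N / (a ^ CARD('d) * \<bar>det B\<bar>))) * sobolev_norm A f) \<and>
      (\<forall>\<nu>\<ge>0. (\<forall>\<xi>. a ^ CARD('d) \<le> (\<Prod>j\<in>UNIV. \<bar>\<xi> $ j\<bar>) \<longrightarrow> 1 \<le> \<nu> * freq_weight A \<xi>) \<longrightarrow>
        mean_error \<psi> a B f \<le> ennreal (C * sqrt (\<nu> / a ^ CARD('d)) * sobolev_norm A f)))"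

context
  fixes \<psi> :: "real \<Rightarrow> real"
  assumes adm: "admissible_psi \<psi>"
begin

lemma pullback_cube_integral:
  fixes F :: "('d::finite \<Rightarrow> nat) \<Rightarrow> real^'d \<Rightarrow> real"
  assumes F: "deriv_family F"
  shows "(\<integral>x. pullback \<psi> F (\<lambda>_. 0) x \<partial>lborel) = cube_integral (F (\<lambda>_. 0))"
proof -
  define f0 where "f0 x = indicator unit_cube x *\<^sub>R F (\<lambda>_. 0) x" for x
  have f0: "integrable lborel f0"
    unfolding f0_def by (rule borel_integrable_compact[OF compact_cbox deriv_familyD(1)[OF F]])
  have "pullback \<psi> F (\<lambda>_. 0) x = f0 (Psi \<psi> x) * DPsi \<psi> x" for x
    using Psi_in_cube[OF adm, of x] by (simp add: pullback_zero[OF adm] f0_def)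
  then have "(\<integral>x. pullback \<psi> F (\<lambda>_. 0) x \<partial>lborel) = (\<integral>x. f0 x \<partial>lborel)"
    using integral_Psi(2)[OF adm f0] by (simp add: f0_def)
  also have "\<dots> = cube_integral (F (\<lambda>_. 0))"
    by (simp add: cube_integral_continuous deriv_familyD(1)[OF F] set_lebesgue_integral_def f0_def)
  finally show ?thesis .
qed

context
  fixes B :: "real^'d^'d::finite" and a Z :: real and N :: nat
    and F :: "('d \<Rightarrow> nat) \<Rightarrow> real^'d \<Rightarrow> real" and A :: "('d \<Rightarrow> nat) set"
  assumes B: "frolov_matrix B" and a: "a > 0" and uses: "uses_at_most N a B"
    and fam: "deriv_family F" and A: "finite A" "(\<lambda>_. 0) \<in> A"
    and Z: "\<And>u K. u \<in> u_box \<Longrightarrow> finite K \<Longrightarrow> K \<subseteq> int_lattice - {0} \<Longrightarrow>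
      (\<Sum>k\<in>K. 1 / freq_weight A (dilation a B u *v k)) \<le> Z"
begin

abbreviation "gg \<equiv> \<lambda>x. complex_of_real (pullback \<psi> F (\<lambda>_. 0) x)"
abbreviation "\<Gamma> \<equiv> family_energy A (pullback \<psi> F)"
abbreviation "R \<equiv> real N / (a ^ CARD('d) * \<bar>det B\<bar>)"

lemma B_inv: "invertible B" using B by (simp add: frolov_matrix_def)

lemma gg_cont: "continuous_on X gg"
  by (intro continuous_intros deriv_familyD(1)[OF pullback_family[OF adm fam]])

lemma gg_out: "x \<notin> unit_cube \<Longrightarrow> gg x = 0"
  by (simp add: pullback_outside[OF adm])

text \<open>Uniform in \<open>u\<close>, since the determinant of the dilation is bounded below.
  Both Fourier estimates start from it: it is the value of the sup bound and, in mean square, the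
  guarantee of convergence.\<close>

lemma coeff_sum:
  assumes u: "u \<in> u_box" and K: "finite K" "K \<subseteq> int_lattice - {0}"
  shows "(\<Sum>k\<in>K. norm (fourier_coeff gg (dilation a B u *v k))) \<le> sqrt (Z * (R * \<Gamma>))"
proof -
  interpret cubature "dilation a B u" "node_set a B" N by (rule cubature_dilation[OF B_inv a uses u])
  have "(\<Sum>k\<in>K. norm (fourier_coeff gg (dilation a B u *v k)))
    \<le> sqrt (Z * (real N / \<bar>det (dilation a B u)\<bar> * \<Gamma>))"
    using K by (intro coeff_sum_bound[OF pullback_family[OF adm fam] _ A K(1) _ Z[OF u K]] pullback_outside[OF adm]) auto
  also have "\<dots> \<le> sqrt (Z * (R * \<Gamma>))"
  proof (intro real_sqrt_le_mono mult_left_mono mult_right_mono family_energy_nonneg)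
    have "0 < a ^ CARD('d) * \<bar>det B\<bar>" using B_inv a by (simp add: invertible_det_nz)
    then show "real N / \<bar>det (dilation a B u)\<bar> \<le> R"
      using det_dilation_ge[OF u a, of B] by (intro frac_le) auto
    show "0 \<le> Z" using Z[OF u, of "{}"] by simp
  qed
  finally show ?thesis .
qed

lemma periodize_complex:
  assumes u: "u \<in> u_box"
  shows "complex_of_real (explicit_rule a B (pullback \<psi> F (\<lambda>_. 0)) (u, v)) = cubature.periodize (dilation a B u) (node_set a B) gg v"
proof -
  interpret cubature "dilation a B u" "node_set a B" N by (rule cubature_dilation[OF B_inv a uses u])
  show ?thesis
    unfolding explicit_rule_periodize[OF B_inv a uses u] periodize_def by simp
qed

lemma M_method_pullback:
  "\<omega> \<in> realizations \<Longrightarrow> M_method \<psi> a B \<omega> (F (\<lambda>_. 0)) = explicit_rule a B (pullback \<psi> F (\<lambda>_. 0)) \<omega>"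
  using M_method_explicit[OF adm B_inv a uses] by (simp add: pullback_zero[OF adm, abs_def])

lemma coeff_zero:
  "fourier_coeff (cubature.periodize (dilation a B u) (node_set a B) gg) 0 = complex_of_real (cube_integral (F (\<lambda>_. 0)))"
  if u: "u \<in> u_box"
proof -
  interpret cubature "dilation a B u" "node_set a B" N by (rule cubature_dilation[OF B_inv a uses u])
  have "fourier_coeff (periodize gg) 0 = fourier_coeff gg (dilation a B u *v 0)"
    by (rule fourier_coeff_periodize[OF gg_cont gg_out int_lattice_closed(1)])
  then show ?thesis
    using fourier_coeff_zero_freq[of "pullback \<psi> F (\<lambda>_. 0)", OF pullback_outside[OF adm]] pullback_cube_integral[OF fam] by simp
qed

lemma worst_error_smooth:
  assumes \<omega>: "\<omega> \<in> realizations"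
  shows "\<bar>M_method \<psi> a B \<omega> (F (\<lambda>_. 0)) - cube_integral (F (\<lambda>_. 0))\<bar> \<le> sqrt (Z * (R * \<Gamma>))"
proof -
  obtain u v where uv: "\<omega> = (u, v)" by (cases \<omega>)
  have u: "u \<in> u_box" and v: "v \<in> unit_cube" using \<omega> by (auto simp: uv realizations_def)
  interpret cubature "dilation a B u" "node_set a B" N by (rule cubature_dilation[OF B_inv a uses u])
  have "norm (periodize gg v - fourier_coeff (periodize gg) 0) \<le> sqrt (Z * (R * \<Gamma>))"
  proof (rule fourier_sup_bound[OF periodize_cont[OF gg_cont] _ v])
    fix K :: "(real^'d) set" assume K: "finite K" "K \<subseteq> int_lattice - {0}"
    have "(\<Sum>k\<in>K. norm (fourier_coeff (periodize gg) k)) = (\<Sum>k\<in>K. norm (fourier_coeff gg (dilation a B u *v k)))"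
      using K by (intro sum.cong refl arg_cong[of _ _ norm] fourier_coeff_periodize[OF gg_cont gg_out]) auto
    then show "(\<Sum>k\<in>K. norm (fourier_coeff (periodize gg) k)) \<le> sqrt (Z * (R * \<Gamma>))"
      using coeff_sum[OF u K] by simp
  qed
  then have "norm (complex_of_real (M_method \<psi> a B \<omega> (F (\<lambda>_. 0)) - cube_integral (F (\<lambda>_. 0)))) \<le> sqrt (Z * (R * \<Gamma>))"
    unfolding coeff_zero[OF u] periodize_complex[OF u, symmetric] M_method_pullback[OF \<omega>] unfolding uv by simp
  then show ?thesis by (simp only: norm_of_real)
qed

text \<open>\<open>\<nu>\<close> trades the region for the energy: where
  \<open>1 \<le> \<nu> * freq_weight A \<xi>\<close>, the squared transform is at most
  \<open>\<nu>\<close> times the sum of those of the derivatives, and Plancherel bounds their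
  integrals by \<open>\<Gamma>\<close>. The 4 belongs to the averaging over lattice points, and
  \<open>\<rho>\<close> is the volume of \<open>u_box\<close>, which normalizes the distribution of
  \<open>u\<close>.\<close>

lemma second_moment_smooth:
  assumes \<nu>: "\<nu> \<ge> 0" "\<And>\<xi>. a ^ CARD('d) \<le> (\<Prod>j\<in>UNIV. \<bar>\<xi> $ j\<bar>) \<Longrightarrow> 1 \<le> \<nu> * freq_weight A \<xi>"
    and \<rho>: "\<rho> = (2 powr (1 / real CARD('d)) - 1) ^ CARD('d)"
  shows "(\<integral>\<^sup>+\<omega>. ennreal ((explicit_rule a B (pullback \<psi> F (\<lambda>_. 0)) \<omega> - cube_integral (F (\<lambda>_. 0)))\<^sup>2) \<partial>(u_dist \<Otimes>\<^sub>M v_dist))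
    \<le> ennreal (4 / a ^ CARD('d) * (\<nu> * \<Gamma>) / \<rho>)"
proof -
  let ?E = "explicit_rule a B (pullback \<psi> F (\<lambda>_. 0))"
  let ?I = "cube_integral (F (\<lambda>_. 0))"
  let ?L = "int_lattice - {0} :: (real^'d) set"
  define T where "T = a ^ CARD('d)"
  have T: "T > 0" using a by (simp add: T_def)
  have \<rho>0: "\<rho> > 0" unfolding \<rho> using two_root_gt_1[where 'd = 'd] by simp
  define c2 where "c2 \<xi> = ennreal ((norm (fourier_coeff gg \<xi>))\<^sup>2)" for \<xi>
  have c2m [measurable]: "c2 \<in> borel_measurable borel"
    unfolding c2_def using fourier_coeff_measurable[OF gg_cont] by measurable
  have pm [measurable]: "pullback \<psi> F (\<lambda>_. 0) \<in> borel_measurable borel"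
    by (intro borel_measurable_continuous_onI deriv_familyD(1)[OF pullback_family[OF adm fam]])
  have Sm: "(\<lambda>u. dilation a B u *v k) \<in> borel_measurable borel" for k :: "real^'d"
  proof -
    have "(\<lambda>u. dilation a B u *v k) = (\<lambda>u. \<chi> i. a * u $ i * (B *v k) $ i)"
      by (auto simp: vec_eq_iff dilation_mult)
    also have "\<dots> \<in> borel_measurable borel" by measurable
    finally show ?thesis .
  qed
  have cSm [measurable]: "(\<lambda>u. c2 (dilation a B u *v k)) \<in> borel_measurable borel" for k :: "real^'d"
    using measurable_compose[OF Sm c2m] .
  have Hm0: "(\<lambda>\<omega>. ennreal ((?E \<omega> - ?I)\<^sup>2)) \<in> borel_measurable (borel \<Otimes>\<^sub>M borel)" by measurable
  then have Hm: "(\<lambda>\<omega>. ennreal ((?E \<omega> - ?I)\<^sup>2)) \<in> borel_measurable (u_dist \<Otimes>\<^sub>M (v_dist :: (real^'d) measure))"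
    by (simp only: measurable_cong_sets[OF sets_uv refl])
  have cntL: "countable ?L" using countable_int_lattice by (rule countable_subset[rotated]) auto
  have inner: "(\<integral>\<^sup>+v. ennreal ((?E (u, v) - ?I)\<^sup>2) \<partial>v_dist) \<le> (\<integral>\<^sup>+k. c2 (dilation a B u *v k) \<partial>count_space ?L)"
    if u: "u \<in> u_box" for u
  proof -
    interpret cubature "dilation a B u" "node_set a B" N by (rule cubature_dilation[OF B_inv a uses u])
    let ?\<sigma> = "\<integral>\<^sup>+k. c2 (dilation a B u *v k) \<partial>count_space ?L"
    have ck: "fourier_coeff (periodize gg) k = fourier_coeff gg (dilation a B u *v k)" if "k \<in> ?L" for k
      using that by (intro fourier_coeff_periodize[OF gg_cont gg_out]) auto
    have fin_le: "ennreal (\<Sum>k\<in>K. (norm (fourier_coeff (periodize gg) k))\<^sup>2) \<le> ?\<sigma>" if K: "finite K" "K \<subseteq> ?L" for K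
    proof -
      have "ennreal (\<Sum>k\<in>K. (norm (fourier_coeff (periodize gg) k))\<^sup>2) = (\<Sum>k\<in>K. c2 (dilation a B u *v k) * indicator K k)"
        using K ck by (subst sum_ennreal[symmetric]) (auto intro!: sum.cong simp: c2_def subset_iff)
      also have "\<dots> = (\<integral>\<^sup>+k. c2 (dilation a B u *v k) * indicator K k \<partial>count_space ?L)"
        using K by (intro nn_integral_count_space'[symmetric]) auto
      also have "\<dots> \<le> ?\<sigma>" by (intro nn_integral_mono) (auto split: split_indicator)
      finally show ?thesis .
    qed
    show ?thesis
    \<comment> \<open>The mean square estimate takes a real number as its bound; for an infinite sum
      the claim is trivial.\<close>
    proof (cases "?\<sigma> = \<infinity>")
      case True
      then show ?thesis by (simp only: infinity_ennreal_def top_greatest)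
    next
      case False
      then obtain W where W: "?\<sigma> = ennreal W" "W \<ge> 0" by (cases ?\<sigma>) auto
      have "(LINT v:unit_cube|lborel. (norm (periodize gg v - fourier_coeff (periodize gg) 0))\<^sup>2) \<le> W"
      proof (rule fourier_L2_bound[OF periodize_cont[OF gg_cont]])
        fix K :: "(real^'d) set" assume K: "finite K" "K \<subseteq> ?L"
        have "(\<Sum>k\<in>K. norm (fourier_coeff (periodize gg) k)) = (\<Sum>k\<in>K. norm (fourier_coeff gg (dilation a B u *v k)))"
          using K by (intro sum.cong refl arg_cong[of _ _ norm] ck) auto
        then show "(\<Sum>k\<in>K. norm (fourier_coeff (periodize gg) k)) \<le> sqrt (Z * (R * \<Gamma>))" using coeff_sum[OF u K] by simp
        show "(\<Sum>k\<in>K. (norm (fourier_coeff (periodize gg) k))\<^sup>2) \<le> W"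
          using fin_le[OF K] unfolding W(1) by (simp only: ennreal_le_iff[OF W(2)])
      qed
      moreover have "(norm (periodize gg v - fourier_coeff (periodize gg) 0))\<^sup>2 = (?E (u, v) - ?I)\<^sup>2" for v
      proof -
        have "norm (periodize gg v - fourier_coeff (periodize gg) 0) = \<bar>?E (u, v) - ?I\<bar>"
          unfolding coeff_zero[OF u] periodize_complex[OF u, symmetric] of_real_diff[symmetric] norm_of_real ..
        then show ?thesis by simp
      qed
      ultimately have le: "(LINT v:unit_cube|lborel. (?E (u, v) - ?I)\<^sup>2) \<le> W" by simp
      have cont: "continuous_on unit_cube (\<lambda>v. ?E (u, v))"
        unfolding explicit_rule_periodize[OF B_inv a uses u]
        by (intro periodize_cont deriv_familyD(1)[OF pullback_family[OF adm fam]])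
      have m: "(\<lambda>v. ennreal ((?E (u, v) - ?I)\<^sup>2)) \<in> borel_measurable borel"
        unfolding explicit_rule_def fst_conv snd_conv by measurable
      have "(\<integral>\<^sup>+v. ennreal ((?E (u, v) - ?I)\<^sup>2) \<partial>v_dist) = (\<integral>\<^sup>+v. ennreal (indicator unit_cube v *\<^sub>R (?E (u, v) - ?I)\<^sup>2) \<partial>lborel)"
        unfolding nn_integral_v_dist[OF m] by (intro nn_integral_cong) (auto split: split_indicator)
      also have "\<dots> = ennreal (LINT v:unit_cube|lborel. (?E (u, v) - ?I)\<^sup>2)"
        unfolding set_lebesgue_integral_def
        by (rule nn_integral_eq_integral[OF borel_integrable_compact[OF compact_cbox]]) (intro continuous_intros cont, simp)
      also have "\<dots> \<le> ennreal W" by (rule ennreal_leI[OF le])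
      finally show ?thesis unfolding W(1) .
    qed
  qed
  have plan: "(\<integral>\<^sup>+x. c2 x * indicator {x. T \<le> (\<Prod>j\<in>UNIV. \<bar>x $ j\<bar>)} x \<partial>lborel) \<le> ennreal (\<nu> * \<Gamma>)"
  proof -
    let ?G = "\<lambda>\<alpha> x. complex_of_real (pullback \<psi> F \<alpha> x)"
    have Gc: "continuous_on X (?G \<alpha>)" for X \<alpha>
      by (intro continuous_intros deriv_familyD(1)[OF pullback_family[OF adm fam]])
    note fourier_coeff_measurable[OF Gc, measurable]
    have pt: "c2 x * indicator {x. T \<le> (\<Prod>j\<in>UNIV. \<bar>x $ j\<bar>)} x \<le> ennreal \<nu> * (\<Sum>\<alpha>\<in>A. ennreal ((norm (fourier_coeff (?G \<alpha>) x))\<^sup>2))" for x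
    proof (cases "T \<le> (\<Prod>j\<in>UNIV. \<bar>x $ j\<bar>)")
      case True
      have fw: "freq_weight A x * (norm (fourier_coeff gg x))\<^sup>2 = (\<Sum>\<alpha>\<in>A. (norm (fourier_coeff (?G \<alpha>) x))\<^sup>2)"
        by (rule freq_weight_coeff[OF pullback_family[OF adm fam] pullback_outside[OF adm]])
      have "1 * (norm (fourier_coeff gg x))\<^sup>2 \<le> \<nu> * freq_weight A x * (norm (fourier_coeff gg x))\<^sup>2"
        using \<nu>(2)[of x] True by (intro mult_right_mono) (auto simp: T_def)
      also have "\<dots> = \<nu> * (\<Sum>\<alpha>\<in>A. (norm (fourier_coeff (?G \<alpha>) x))\<^sup>2)"
        by (simp only: mult.assoc fw)
      finally have "c2 x \<le> ennreal (\<nu> * (\<Sum>\<alpha>\<in>A. (norm (fourier_coeff (?G \<alpha>) x))\<^sup>2))"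
        unfolding c2_def by (intro ennreal_leI) simp
      also have "\<dots> = ennreal \<nu> * (\<Sum>\<alpha>\<in>A. ennreal ((norm (fourier_coeff (?G \<alpha>) x))\<^sup>2))"
        using \<nu>(1) by (subst ennreal_mult') (auto simp: sum_ennreal)
      finally show ?thesis using True by simp
    qed simp
    have "(\<integral>\<^sup>+x. c2 x * indicator {x. T \<le> (\<Prod>j\<in>UNIV. \<bar>x $ j\<bar>)} x \<partial>lborel)
      \<le> (\<integral>\<^sup>+x. ennreal \<nu> * (\<Sum>\<alpha>\<in>A. ennreal ((norm (fourier_coeff (?G \<alpha>) x))\<^sup>2)) \<partial>lborel)"
      by (rule nn_integral_mono) (rule pt)
    also have "\<dots> = ennreal \<nu> * (\<Sum>\<alpha>\<in>A. \<integral>\<^sup>+x. ennreal ((norm (fourier_coeff (?G \<alpha>) x))\<^sup>2) \<partial>lborel)"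
      by (subst nn_integral_cmult, measurable) (subst nn_integral_sum, measurable)
    also have "\<dots> \<le> ennreal \<nu> * (\<Sum>\<alpha>\<in>A. ennreal (LINT x:unit_cube|lborel. (norm (?G \<alpha> x))\<^sup>2))"
      by (intro mult_left_mono sum_mono plancherel_le Gc) auto
    also have "(\<Sum>\<alpha>\<in>A. ennreal (LINT x:unit_cube|lborel. (norm (?G \<alpha> x))\<^sup>2)) = ennreal \<Gamma>"
    proof -
      have "(LINT x:unit_cube|lborel. (norm (?G \<alpha> x))\<^sup>2) = (\<integral>x. (pullback \<psi> F \<alpha> x)\<^sup>2 \<partial>lborel)" for \<alpha>
        unfolding set_lebesgue_integral_def
        using pullback_outside[OF adm] by (intro Bochner_Integration.integral_cong refl) (auto split: split_indicator)
      then show ?thesis unfolding family_energy_def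
        by (subst sum_ennreal[symmetric]) (auto intro: Bochner_Integration.integral_nonneg)
    qed
    also have "ennreal \<nu> * ennreal \<Gamma> = ennreal (\<nu> * \<Gamma>)" using \<nu>(1) by (simp add: ennreal_mult')
    finally show ?thesis .
  qed
  have "(\<integral>\<^sup>+\<omega>. ennreal ((?E \<omega> - ?I)\<^sup>2) \<partial>(u_dist \<Otimes>\<^sub>M v_dist))
    = (\<integral>\<^sup>+u. (\<integral>\<^sup>+v. ennreal ((?E (u, v) - ?I)\<^sup>2) \<partial>v_dist) \<partial>u_dist)"
    using Hm by (intro sigma_finite_measure.nn_integral_fst[symmetric] prob_space_imp_sigma_finite prob_space_v_dist)
  also have "\<dots> \<le> (\<integral>\<^sup>+u. (\<integral>\<^sup>+k. c2 (dilation a B u *v k) \<partial>count_space ?L) \<partial>u_dist)"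
    by (rule nn_integral_mono_AE, rule AE_mp[OF AE_u_dist], rule AE_I2, rule impI, rule inner)
  also have "\<dots> = (\<integral>\<^sup>+k. (\<integral>\<^sup>+u. c2 (dilation a B u *v k) \<partial>u_dist) \<partial>count_space ?L)"
    by (rule nn_integral_count_space_nn_integral[OF cntL]) simp
  also have "\<dots> \<le> ennreal (4 / T * (\<nu> * \<Gamma>) / \<rho>)"
  proof (rule nn_integral_count_space_le[OF cntL])
    fix K :: "(real^'d) set" assume K: "finite K" "K \<subseteq> ?L"
    have "(\<Sum>k\<in>K. \<integral>\<^sup>+u. c2 (dilation a B u *v k) \<partial>u_dist) = (\<Sum>k\<in>K. (\<integral>\<^sup>+u. c2 (dilation a B u *v k) * indicator u_box u \<partial>lborel) / ennreal \<rho>)"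
      by (intro sum.cong refl) (simp add: nn_integral_uniform_measure emeasure_u_box \<rho>)
    also have "\<dots> = (\<Sum>k\<in>K. \<integral>\<^sup>+u. c2 (dilation a B u *v k) * indicator u_box u \<partial>lborel) / ennreal \<rho>"
      unfolding divide_ennreal_def by (rule sum_distrib_right[symmetric])
    also have "\<dots> \<le> ennreal (4 / T) * (\<integral>\<^sup>+x. c2 x * indicator {x. T \<le> (\<Prod>j\<in>UNIV. \<bar>x $ j\<bar>)} x \<partial>lborel) / ennreal \<rho>"
      unfolding divide_ennreal_def T_def by (intro mult_right_mono frolov_average[OF B a c2m K]) simp
    also have "\<dots> \<le> ennreal (4 / T) * ennreal (\<nu> * \<Gamma>) / ennreal \<rho>"
      unfolding divide_ennreal_def by (intro mult_right_mono mult_left_mono plan) auto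
    also have "\<dots> = ennreal (4 / T * (\<nu> * \<Gamma>) / \<rho>)"
    proof -
      have nn: "0 \<le> \<nu> * \<Gamma>" using \<nu>(1) family_energy_nonneg[of A "pullback \<psi> F"] by simp
      have "ennreal (4 / T) * ennreal (\<nu> * \<Gamma>) = ennreal (4 / T * (\<nu> * \<Gamma>))"
        using nn T by (intro ennreal_mult[symmetric]) auto
      then show ?thesis using nn T \<rho>0 by (simp only:) (rule divide_ennreal, auto)
    qed
    finally show "(\<Sum>k\<in>K. \<integral>\<^sup>+u. c2 (dilation a B u *v k) \<partial>u_dist) \<le> ennreal (4 / T * (\<nu> * \<Gamma>) / \<rho>)" .
  qed
  finally show ?thesis by (simp only: T_def)
qed

text \<open>From the second to the first moment. The root of the second moment bound may be zero,
  while the passage needs a positive number; hence any positive \<open>t\<close> above the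
  root.\<close>

lemma mean_error_smooth:
  assumes \<nu>: "\<nu> \<ge> 0" "\<And>\<xi>. a ^ CARD('d) \<le> (\<Prod>j\<in>UNIV. \<bar>\<xi> $ j\<bar>) \<Longrightarrow> 1 \<le> \<nu> * freq_weight A \<xi>"
    and \<rho>: "\<rho> = (2 powr (1 / real CARD('d)) - 1) ^ CARD('d)"
    and t: "t > 0" "sqrt (4 / a ^ CARD('d) * (\<nu> * \<Gamma>) / \<rho>) \<le> t"
  shows "mean_error \<psi> a B (F (\<lambda>_. 0)) \<le> ennreal t"
proof -
  let ?E = "explicit_rule a B (pullback \<psi> F (\<lambda>_. 0))"
  let ?I = "cube_integral (F (\<lambda>_. 0))"
  let ?UV = "u_dist \<Otimes>\<^sub>M (v_dist :: (real^'d) measure)"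
  have [measurable]: "pullback \<psi> F (\<lambda>_. 0) \<in> borel_measurable borel"
    by (intro borel_measurable_continuous_onI deriv_familyD(1)[OF pullback_family[OF adm fam]])
  have "(\<lambda>\<omega>. ?E \<omega> - ?I) \<in> borel_measurable (borel \<Otimes>\<^sub>M borel)" by measurable
  then have m: "(\<lambda>\<omega>. ?E \<omega> - ?I) \<in> borel_measurable ?UV" by (simp only: measurable_cong_sets[OF sets_uv refl])
  have "mean_error \<psi> a B (F (\<lambda>_. 0)) = (\<integral>\<^sup>+\<omega>. ennreal \<bar>M_method \<psi> a B \<omega> (F (\<lambda>_. 0)) - ?I\<bar> \<partial>?UV)"
    unfolding mean_error_def uv_measure_def by (rule nn_integral_completion)
  also have "\<dots> = (\<integral>\<^sup>+\<omega>. ennreal \<bar>?E \<omega> - ?I\<bar> \<partial>?UV)"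
    by (rule nn_integral_cong_AE, rule AE_mp[OF AE_realizations]) (simp add: M_method_pullback)
  also have "\<dots> \<le> ennreal t"
  proof (rule nn_integral_le_of_square[OF prob_space_uv t(1) _ m])
    have "4 / a ^ CARD('d) * (\<nu> * \<Gamma>) / \<rho> \<le> t\<^sup>2" using t(2) by (rule sqrt_le_D)
    then show "(\<integral>\<^sup>+\<omega>. ennreal ((?E \<omega> - ?I)\<^sup>2) \<partial>?UV) \<le> ennreal (t\<^sup>2)"
      using second_moment_smooth[OF \<nu> \<rho>] by (meson ennreal_leI order_trans)
  qed
  finally show ?thesis .
qed

end

section \<open>Passage from smooth integrands to the Sobolev space\<close>

text \<open>For fixed \<open>a\<close> and \<open>B\<close> the rule is a finite sum with bounded
  weights. \<open>Q\<close> carries no uniformity in \<open>a\<close>; this is harmless because the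
  approximation error \<open>e\<close> is sent to zero with \<open>a\<close> fixed.\<close>

lemma M_method_perturb:
  fixes B :: "real^'d^'d::finite"
  assumes B: "invertible B" and a: "a > 0" and uses: "uses_at_most N a B"
  obtains Q where "Q \<ge> 0" "\<And>\<omega> f g e. \<omega> \<in> realizations \<Longrightarrow> 0 \<le> e \<Longrightarrow> (\<And>x. x \<in> unit_cube \<Longrightarrow> \<bar>f x - g x\<bar> \<le> e) \<Longrightarrow>
    \<bar>M_method \<psi> a B \<omega> f - M_method \<psi> a B \<omega> g\<bar> \<le> Q * e"
proof -
  have "bounded (DPsi \<psi> ` (unit_cube :: (real^'d) set))"
    by (intro compact_imp_bounded compact_continuous_image DPsi_cont[OF adm] compact_cbox)
  then obtain b where b: "\<And>x :: real^'d. x \<in> unit_cube \<Longrightarrow> \<bar>DPsi \<psi> x\<bar> \<le> b"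
    unfolding bounded_iff by (auto simp: real_norm_def)
  have bb: "\<bar>DPsi \<psi> x\<bar> \<le> \<bar>b\<bar>" for x :: "real^'d"
    using b[of x] DPsi_outside[OF adm, of x] by (cases "x \<in> unit_cube") auto
  let ?n = "real (card (node_set a B))"
  let ?c = "a ^ CARD('d) * \<bar>det B\<bar>"
  have c: "?c > 0" using B a by (simp add: invertible_det_nz)
  show thesis
  proof (rule that[of "1 / ?c * (?n * \<bar>b\<bar>)"])
    show "0 \<le> 1 / ?c * (?n * \<bar>b\<bar>)" using c by simp
    fix \<omega> :: "(real^'d) \<times> (real^'d)" and f g :: "real^'d \<Rightarrow> real" and e :: real
    assume \<omega>: "\<omega> \<in> realizations" and e: "0 \<le> e" and close: "\<And>x. x \<in> unit_cube \<Longrightarrow> \<bar>f x - g x\<bar> \<le> e"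
    let ?d = "\<bar>det (dilation a B (fst \<omega>))\<bar>"
    let ?x = "explicit_node a B (fst \<omega>) (snd \<omega>)"
    have u: "fst \<omega> \<in> u_box" using \<omega> by (auto simp: realizations_def)
    have d: "1 / ?d \<le> 1 / ?c" using det_dilation_ge[OF u a, of B] c by (intro frac_le) auto
    have "M_method \<psi> a B \<omega> f - M_method \<psi> a B \<omega> g
      = 1 / ?d * (\<Sum>m\<in>node_set a B. (f (Psi \<psi> (?x m)) - g (Psi \<psi> (?x m))) * DPsi \<psi> (?x m))"
      unfolding M_method_explicit[OF adm B a uses \<omega>] explicit_rule_def
      by (simp add: diff_divide_distrib[symmetric] sum_subtractf[symmetric] left_diff_distrib)
    then have "\<bar>M_method \<psi> a B \<omega> f - M_method \<psi> a B \<omega> g\<bar>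
      = 1 / ?d * \<bar>\<Sum>m\<in>node_set a B. (f (Psi \<psi> (?x m)) - g (Psi \<psi> (?x m))) * DPsi \<psi> (?x m)\<bar>"
      by (simp add: abs_mult)
    also have "\<dots> \<le> 1 / ?c * (?n * (e * \<bar>b\<bar>))"
    proof (intro mult_mono d)
      have "\<bar>(f (Psi \<psi> (?x m)) - g (Psi \<psi> (?x m))) * DPsi \<psi> (?x m)\<bar> \<le> e * \<bar>b\<bar>" for m
        unfolding abs_mult using close[OF Psi_in_cube[OF adm]] bb e by (intro mult_mono) auto
      then show "\<bar>\<Sum>m\<in>node_set a B. (f (Psi \<psi> (?x m)) - g (Psi \<psi> (?x m))) * DPsi \<psi> (?x m)\<bar> \<le> ?n * (e * \<bar>b\<bar>)"
        by (intro order_trans[OF sum_abs] sum_bounded_above)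
    qed (use c in auto)
    finally show "\<bar>M_method \<psi> a B \<omega> f - M_method \<psi> a B \<omega> g\<bar> \<le> 1 / ?c * (?n * \<bar>b\<bar>) * e" by (simp add: mult_ac)
  qed
qed

text \<open>The difference of the integrals is the coefficient of \<open>f - g\<close> at frequency
  zero, which the sup norm bounds.\<close>

lemma cube_integral_perturb:
  fixes f g :: "real^'d::finite \<Rightarrow> real"
  assumes f: "continuous_on unit_cube f" and g: "continuous_on unit_cube g"
    and close: "\<And>x. x \<in> unit_cube \<Longrightarrow> \<bar>f x - g x\<bar> \<le> e"
  shows "\<bar>cube_integral f - cube_integral g\<bar> \<le> e"
proof -
  have "norm (fourier_coeff (\<lambda>x. complex_of_real (f x - g x)) 0) \<le> e"
  proof (rule norm_fourier_coeff_le)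
    show "continuous_on unit_cube (\<lambda>x. complex_of_real (f x - g x))" by (intro continuous_intros f g)
    show "norm (complex_of_real (f x - g x)) \<le> e" if "x \<in> unit_cube" for x
      using close[OF that] by (simp only: norm_of_real)
  qed
  moreover have "fourier_coeff (\<lambda>x. complex_of_real (f x - g x)) 0 = complex_of_real (cube_integral f - cube_integral g)"
  proof -
    have "fourier_coeff (\<lambda>x. complex_of_real (f x - g x)) 0 = (\<integral>x. complex_of_real (indicator unit_cube x *\<^sub>R (f x - g x)) \<partial>lborel)"
      by (simp add: fourier_coeff_def set_lebesgue_integral_def scaleR_conv_of_real)
    also have "\<dots> = complex_of_real (LINT x:unit_cube|lborel. f x - g x)"
      unfolding set_lebesgue_integral_def
      by (rule Bochner_Integration.integral_of_real) (intro borel_integrable_compact compact_cbox continuous_intros f g)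
    also have "(LINT x:unit_cube|lborel. f x - g x) = cube_integral f - cube_integral g"
      unfolding cube_integral_continuous[OF f] cube_integral_continuous[OF g]
      by (intro set_integral_diff(2) set_integrable_cube f g)
    finally show ?thesis .
  qed
  ultimately show ?thesis by (simp only: norm_of_real)
qed

text \<open>The derivative \<open>\<alpha>\<close> of the transformed function involves all
  \<open>F \<gamma>\<close> with \<open>\<gamma> \<le> \<alpha>\<close>, so the index set has to be
  closed downwards for the Sobolev norm over \<open>A\<close> to control them.\<close>

lemma family_energy_bound:
  fixes A :: "('d::finite \<Rightarrow> nat) set"
  assumes A: "finite A" "\<And>\<alpha>. \<alpha> \<in> A \<Longrightarrow> {..\<alpha>} \<subseteq> A"
  obtains C where "C > 0" "\<And>f F. deriv_family F \<Longrightarrow>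
      (\<And>\<beta>. \<beta> \<in> A \<Longrightarrow> (LINT x:unit_cube|lborel. (F \<beta> x)\<^sup>2) \<le> 2 ^ CARD('d) * (L2_norm_cube (weak_deriv \<beta> f))\<^sup>2) \<Longrightarrow>
      family_energy A (pullback \<psi> F) \<le> C * (sobolev_norm A f)\<^sup>2"
proof -
  have "\<exists>C. \<forall>\<alpha> :: 'd \<Rightarrow> nat. 0 \<le> C \<alpha> \<and> (\<forall>F. deriv_family F \<longrightarrow> (\<integral>x. (pullback \<psi> F \<alpha> x)\<^sup>2 \<partial>lborel)
    \<le> C \<alpha> * (\<Sum>\<gamma>\<in>{..\<alpha>}. LINT x:unit_cube|lborel. (F \<gamma> x)\<^sup>2))"
    using pullback_L2_bound[OF adm] by (intro choice) blast
  then obtain C :: "('d \<Rightarrow> nat) \<Rightarrow> real" where C0: "\<And>\<alpha>. 0 \<le> C \<alpha>" and C: "\<And>\<alpha> F. deriv_family F \<Longrightarrow> (\<integral>x. (pullback \<psi> F \<alpha> x)\<^sup>2 \<partial>lborel)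
    \<le> C \<alpha> * (\<Sum>\<gamma>\<in>{..\<alpha>}. LINT x:unit_cube|lborel. (F \<gamma> x)\<^sup>2)" by blast
  define C' where "C' = (\<Sum>\<alpha>\<in>A. C \<alpha>) * 2 ^ CARD('d) + 1"
  have C'0: "0 \<le> (\<Sum>\<alpha>\<in>A. C \<alpha>)" using C0 by (intro sum_nonneg) auto
  show thesis
  proof (rule that[of C'])
    show "C' > 0" using C'0 by (simp add: C'_def add_nonneg_pos)
    fix f and F :: "('d \<Rightarrow> nat) \<Rightarrow> real^'d \<Rightarrow> real"
    assume F: "deriv_family F" and le: "\<And>\<beta>. \<beta> \<in> A \<Longrightarrow> (LINT x:unit_cube|lborel. (F \<beta> x)\<^sup>2) \<le> 2 ^ CARD('d) * (L2_norm_cube (weak_deriv \<beta> f))\<^sup>2"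
    have nn: "0 \<le> (LINT x:unit_cube|lborel. (F \<beta> x)\<^sup>2)" for \<beta>
      unfolding set_lebesgue_integral_def by (intro Bochner_Integration.integral_nonneg) auto
    have norm: "(sobolev_norm A f)\<^sup>2 = (\<Sum>\<beta>\<in>A. (L2_norm_cube (weak_deriv \<beta> f))\<^sup>2)"
      unfolding sobolev_norm_def by (rule real_sqrt_pow2) (intro sum_nonneg, simp)
    let ?s = "\<Sum>\<beta>\<in>A. LINT x:unit_cube|lborel. (F \<beta> x)\<^sup>2"
    have s: "?s \<le> 2 ^ CARD('d) * (sobolev_norm A f)\<^sup>2"
      unfolding norm sum_distrib_left by (rule sum_mono) (rule le)
    have "family_energy A (pullback \<psi> F) \<le> (\<Sum>\<alpha>\<in>A. C \<alpha> * ?s)"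
      unfolding family_energy_def
    proof (rule sum_mono)
      fix \<alpha> assume \<alpha>: "\<alpha> \<in> A"
      have "(\<Sum>\<gamma>\<in>{..\<alpha>}. LINT x:unit_cube|lborel. (F \<gamma> x)\<^sup>2) \<le> ?s"
        using A(1) A(2)[OF \<alpha>] nn by (intro sum_mono2) auto
      then have "C \<alpha> * (\<Sum>\<gamma>\<in>{..\<alpha>}. LINT x:unit_cube|lborel. (F \<gamma> x)\<^sup>2) \<le> C \<alpha> * ?s" by (intro mult_left_mono C0)
      then show "(\<integral>x. (pullback \<psi> F \<alpha> x)\<^sup>2 \<partial>lborel) \<le> C \<alpha> * ?s" using C[OF F, of \<alpha>] by linarith
    qed
    also have "\<dots> = (\<Sum>\<alpha>\<in>A. C \<alpha>) * ?s" by (rule sum_distrib_right[symmetric])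
    also have "\<dots> \<le> (\<Sum>\<alpha>\<in>A. C \<alpha>) * (2 ^ CARD('d) * (sobolev_norm A f)\<^sup>2)" by (rule mult_left_mono[OF s C'0])
    also have "\<dots> \<le> C' * (sobolev_norm A f)\<^sup>2" by (simp add: C'_def algebra_simps)
    finally show "family_energy A (pullback \<psi> F) \<le> C' * (sobolev_norm A f)\<^sup>2" .
  qed
qed

text \<open>By density of the smooth functions the bounds extend to the whole Sobolev space.\<close>

lemma error_constantD:
  fixes B :: "real^'d^'d::finite"
  assumes "error_constant \<psi> A C" "frolov_matrix B" "a > 0" "uses_at_most N a B" "f \<in> sobolev_space A"
    "continuous_on unit_cube f" "weight_sums_le A a B Z"
  shows "worst_error \<psi> a B f \<le> ennreal (C * sqrt (Z * (real N / (a ^ CARD('d) * \<bar>det B\<bar>))) * sobolev_norm A f)"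
    and "\<nu> \<ge> 0 \<Longrightarrow> (\<And>\<xi>. a ^ CARD('d) \<le> (\<Prod>j\<in>UNIV. \<bar>\<xi> $ j\<bar>) \<Longrightarrow> 1 \<le> \<nu> * freq_weight A \<xi>) \<Longrightarrow>
      mean_error \<psi> a B f \<le> ennreal (C * sqrt (\<nu> / a ^ CARD('d)) * sobolev_norm A f)"
  using assms unfolding error_constant_def by simp_all

lemma ex_error_constant:
  fixes A :: "('d::finite \<Rightarrow> nat) set"
  assumes A: "finite A" "(\<lambda>_. 0) \<in> A" "\<And>\<alpha>. \<alpha> \<in> A \<Longrightarrow> {..\<alpha>} \<subseteq> A"
  shows "\<exists>C. error_constant \<psi> A C"
proof -
  obtain Cp where Cp: "Cp > 0" and energy: "\<And>f F. deriv_family F \<Longrightarrow>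
      (\<And>\<beta>. \<beta> \<in> A \<Longrightarrow> (LINT x:unit_cube|lborel. (F \<beta> x)\<^sup>2) \<le> 2 ^ CARD('d) * (L2_norm_cube (weak_deriv \<beta> f))\<^sup>2) \<Longrightarrow>
      family_energy A (pullback \<psi> F) \<le> Cp * (sobolev_norm A f)\<^sup>2"
    by (rule family_energy_bound[OF A(1,3)]) blast+
  define \<rho> where "\<rho> = (2 powr (1 / real CARD('d)) - 1) ^ CARD('d)"
  have \<rho>: "\<rho> > 0" unfolding \<rho>_def using two_root_gt_1[where 'd = 'd] by simp
  \<comment> \<open>The first root is the constant of the worst case; the second, with the 4 of the
    averaging and the density \<open>1 / \<rho>\<close> of the dilation, is that of the mean
    error.\<close>
  define C where "C = sqrt Cp + sqrt (4 * Cp / \<rho>)"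
  have C1: "sqrt Cp \<le> C" and C2: "sqrt (4 * Cp / \<rho>) \<le> C" and C0: "C > 0"
    using Cp \<rho> by (auto simp: C_def add_pos_nonneg)
  have norm0: "0 \<le> sobolev_norm A f" for f :: "real^'d \<Rightarrow> real"
    unfolding sobolev_norm_def by (intro real_sqrt_ge_zero sum_nonneg) auto
  show ?thesis
    unfolding error_constant_def
  proof (intro exI[of _ C] conjI allI impI C0)
    fix B :: "real^'d^'d" and a Z :: real and N :: nat and f :: "real^'d \<Rightarrow> real"
    assume B: "frolov_matrix B" and a: "a > 0" and uses: "uses_at_most N a B"
      and f: "f \<in> sobolev_space A" "continuous_on unit_cube f" and sums: "weight_sums_le A a B Z"
    have Z: "(\<Sum>k\<in>K. 1 / freq_weight A (dilation a B u *v k)) \<le> Z"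
      if "u \<in> u_box" "finite K" "K \<subseteq> int_lattice - {0}" for u K
      using sums that unfolding weight_sums_le_def by blast
    have Binv: "invertible B" using B by (simp add: frolov_matrix_def)
    obtain Q where Q: "Q \<ge> 0" "\<And>\<omega> f g e. \<omega> \<in> realizations \<Longrightarrow> 0 \<le> e \<Longrightarrow> (\<And>x. x \<in> unit_cube \<Longrightarrow> \<bar>f x - g x\<bar> \<le> e) \<Longrightarrow>
      \<bar>M_method \<psi> a B \<omega> f - M_method \<psi> a B \<omega> g\<bar> \<le> Q * e"
      by (rule M_method_perturb[OF Binv a uses]) blast
    let ?R = "real N / (a ^ CARD('d) * \<bar>det B\<bar>)"
    have Z0: "0 \<le> Z" using Z[of 1 "{}"] two_root_gt_1[where 'd = 'd] by (simp add: u_box_iff less_imp_le)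
    have R0: "0 \<le> ?R" using a by simp
    have diff: "\<bar>M_method \<psi> a B \<omega> f - cube_integral f\<bar> \<le> \<bar>M_method \<psi> a B \<omega> g - cube_integral g\<bar> + (Q + 1) * e"
      if "\<omega> \<in> realizations" "0 \<le> e" "continuous_on unit_cube g" "\<And>x. x \<in> unit_cube \<Longrightarrow> \<bar>g x - f x\<bar> \<le> e" for \<omega> e g
    proof -
      have close: "\<bar>f x - g x\<bar> \<le> e" if "x \<in> unit_cube" for x using \<open>\<And>x. x \<in> unit_cube \<Longrightarrow> \<bar>g x - f x\<bar> \<le> e\<close>[OF that] by (simp add: abs_minus_commute)
      have "\<bar>M_method \<psi> a B \<omega> f - M_method \<psi> a B \<omega> g\<bar> \<le> Q * e" by (rule Q(2)[OF that(1,2) close])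
      moreover have "\<bar>cube_integral f - cube_integral g\<bar> \<le> e" by (rule cube_integral_perturb[OF f(2) that(3) close])
      moreover have "(Q + 1) * e = Q * e + e" by (simp add: distrib_right)
      ultimately show ?thesis by linarith
    qed
    show "worst_error \<psi> a B f \<le> ennreal (C * sqrt (Z * ?R) * sobolev_norm A f)"
      unfolding worst_error_def
    proof (rule SUP_least, rule ennreal_leI, rule field_le_epsilon)
      fix \<omega> :: "(real^'d) \<times> (real^'d)" and e :: real assume \<omega>: "\<omega> \<in> realizations" and e: "0 < e"
      \<comment> \<open>\<open>Q * e'\<close> is the change of the rule and one more
        \<open>e'\<close> that of the integral.\<close>
      define e' where "e' = e / (Q + 1)"
      have e': "e' > 0" "(Q + 1) * e' = e" using e Q(1) by (auto simp: e'_def)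
      obtain F where F: "deriv_family F" "\<And>x. x \<in> unit_cube \<Longrightarrow> \<bar>F (\<lambda>_. 0) x - f x\<bar> \<le> e'"
        "\<And>\<beta>. \<beta> \<in> A \<Longrightarrow> (LINT x:unit_cube|lborel. (F \<beta> x)\<^sup>2) \<le> 2 ^ CARD('d) * (L2_norm_cube (weak_deriv \<beta> f))\<^sup>2"
        by (rule sobolev_approx[OF adm f e'(1)]) blast
      have "\<bar>M_method \<psi> a B \<omega> f - cube_integral f\<bar> \<le> \<bar>M_method \<psi> a B \<omega> (F (\<lambda>_. 0)) - cube_integral (F (\<lambda>_. 0))\<bar> + e"
        using diff[OF \<omega> _ deriv_familyD(1)[OF F(1)] F(2)] e' by simp
      also have "\<bar>M_method \<psi> a B \<omega> (F (\<lambda>_. 0)) - cube_integral (F (\<lambda>_. 0))\<bar> \<le> sqrt (Z * (?R * family_energy A (pullback \<psi> F)))"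
        by (rule worst_error_smooth[OF B a uses F(1) A(1,2) Z \<omega>])
      also have "\<dots> \<le> sqrt (Z * (?R * (Cp * (sobolev_norm A f)\<^sup>2)))"
        by (intro real_sqrt_le_mono mult_left_mono energy[OF F(1,3)] Z0 R0)
      also have "\<dots> = sqrt (Cp * (Z * ?R) * (sobolev_norm A f)\<^sup>2)" by (simp only: mult_ac)
      also have "\<dots> = sqrt Cp * sqrt (Z * ?R) * sobolev_norm A f"
        by (simp only: real_sqrt_mult real_sqrt_abs abs_of_nonneg[OF norm0])
      also have "\<dots> \<le> C * sqrt (Z * ?R) * sobolev_norm A f"
        using Z0 R0 by (intro mult_right_mono C1 norm0 real_sqrt_ge_zero mult_nonneg_nonneg)
      finally show "\<bar>M_method \<psi> a B \<omega> f - cube_integral f\<bar> \<le> C * sqrt (Z * ?R) * sobolev_norm A f + e" by simp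
    qed
    fix \<nu> :: real
    assume \<nu>0: "\<nu> \<ge> 0" and \<nu>1: "\<forall>\<xi>. a ^ CARD('d) \<le> (\<Prod>j\<in>UNIV. \<bar>\<xi> $ j\<bar>) \<longrightarrow> 1 \<le> \<nu> * freq_weight A \<xi>"
    note \<nu> = \<nu>0 \<nu>1[rule_format]
    show "mean_error \<psi> a B f \<le> ennreal (C * sqrt (\<nu> / a ^ CARD('d)) * sobolev_norm A f)"
    proof (rule ennreal_le_epsilon)
      fix e :: real assume e: "0 < e"
      \<comment> \<open>One share more than in the worst case: \<open>?t\<close> may be zero, and
        the smooth bound is applied with the positive number \<open>?t + e'\<close>.\<close>
      define e' where "e' = e / (Q + 2)"
      have e': "e' > 0" "(Q + 2) * e' = e" using e Q(1) by (auto simp: e'_def)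
      obtain F where F: "deriv_family F" "\<And>x. x \<in> unit_cube \<Longrightarrow> \<bar>F (\<lambda>_. 0) x - f x\<bar> \<le> e'"
        "\<And>\<beta>. \<beta> \<in> A \<Longrightarrow> (LINT x:unit_cube|lborel. (F \<beta> x)\<^sup>2) \<le> 2 ^ CARD('d) * (L2_norm_cube (weak_deriv \<beta> f))\<^sup>2"
        by (rule sobolev_approx[OF adm f e'(1)]) blast
      let ?f = "F (\<lambda>_. 0)"
      let ?UV = "u_dist \<Otimes>\<^sub>M (v_dist :: (real^'d) measure)"
      let ?t = "C * sqrt (\<nu> / a ^ CARD('d)) * sobolev_norm A f"
      have t0: "0 \<le> ?t" using C0 \<nu>(1) a norm0[of f] by simp
      have "sqrt (4 / a ^ CARD('d) * (\<nu> * family_energy A (pullback \<psi> F)) / \<rho>)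
        \<le> sqrt (4 / a ^ CARD('d) * (\<nu> * (Cp * (sobolev_norm A f)\<^sup>2)) / \<rho>)"
        using a \<nu>(1) \<rho> by (intro real_sqrt_le_mono divide_right_mono mult_left_mono energy[OF F(1,3)]) auto
      also have "\<dots> = sqrt ((4 * Cp / \<rho>) * ((\<nu> / a ^ CARD('d)) * (sobolev_norm A f)\<^sup>2))"
        by (simp add: mult_ac)
      also have "\<dots> = sqrt (4 * Cp / \<rho>) * sqrt (\<nu> / a ^ CARD('d)) * sobolev_norm A f"
        unfolding real_sqrt_mult[of "4 * Cp / \<rho>"] real_sqrt_mult[of "\<nu> / a ^ CARD('d)"] using norm0[of f] by simp
      also have "\<dots> \<le> ?t"
        using \<nu>(1) a by (intro mult_right_mono C2 norm0 real_sqrt_ge_zero divide_nonneg_nonneg) auto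
      finally have st: "sqrt (4 / a ^ CARD('d) * (\<nu> * family_energy A (pullback \<psi> F)) / \<rho>) \<le> ?t + e'" using e' by linarith
      have tp: "0 < ?t + e'" using t0 e'(1) by linarith
      have sm: "mean_error \<psi> a B ?f \<le> ennreal (?t + e')"
        by (rule mean_error_smooth[OF B a uses F(1) A(1,2) Z \<nu> \<rho>_def tp st])
      have meq: "M_method \<psi> a B \<omega> ?f = explicit_rule a B (pullback \<psi> F (\<lambda>_. 0)) \<omega>" if "\<omega> \<in> realizations" for \<omega>
        by (rule M_method_pullback[OF B a uses F(1) A(1,2) Z that])
      have "mean_error \<psi> a B f = (\<integral>\<^sup>+\<omega>. ennreal \<bar>M_method \<psi> a B \<omega> f - cube_integral f\<bar> \<partial>?UV)"
        unfolding mean_error_def uv_measure_def by (rule nn_integral_completion)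
      \<comment> \<open>\<open>explicit_rule\<close> takes the place of \<open>M_method\<close>
        because its measurability is at hand, which the splitting of the integral below
        requires.\<close>
      also have "\<dots> \<le> (\<integral>\<^sup>+\<omega>. ennreal \<bar>explicit_rule a B (pullback \<psi> F (\<lambda>_. 0)) \<omega> - cube_integral ?f\<bar> + ennreal ((Q + 1) * e') \<partial>?UV)"
      proof (rule nn_integral_mono_AE, rule AE_mp[OF AE_realizations], rule AE_I2, rule impI)
        fix \<omega> :: "(real^'d) \<times> (real^'d)" assume \<omega>: "\<omega> \<in> realizations"
        have "ennreal \<bar>M_method \<psi> a B \<omega> f - cube_integral f\<bar> \<le> ennreal (\<bar>M_method \<psi> a B \<omega> ?f - cube_integral ?f\<bar> + (Q + 1) * e')"
          using diff[OF \<omega> _ deriv_familyD(1)[OF F(1)] F(2)] e' by (intro ennreal_leI) simp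
        also have "\<dots> = ennreal \<bar>M_method \<psi> a B \<omega> ?f - cube_integral ?f\<bar> + ennreal ((Q + 1) * e')"
          using Q(1) e' by (intro ennreal_plus) auto
        finally show "ennreal \<bar>M_method \<psi> a B \<omega> f - cube_integral f\<bar>
          \<le> ennreal \<bar>explicit_rule a B (pullback \<psi> F (\<lambda>_. 0)) \<omega> - cube_integral ?f\<bar> + ennreal ((Q + 1) * e')"
          by (simp only: meq[OF \<omega>])
      qed
      also have "\<dots> = (\<integral>\<^sup>+\<omega>. ennreal \<bar>explicit_rule a B (pullback \<psi> F (\<lambda>_. 0)) \<omega> - cube_integral ?f\<bar> \<partial>?UV) + ennreal ((Q + 1) * e')"
      proof (subst nn_integral_add)
        have [measurable]: "pullback \<psi> F (\<lambda>_. 0) \<in> borel_measurable borel"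
          by (intro borel_measurable_continuous_onI deriv_familyD(1)[OF pullback_family[OF adm F(1)]])
        have "(\<lambda>\<omega>. ennreal \<bar>explicit_rule a B (pullback \<psi> F (\<lambda>_. 0)) \<omega> - cube_integral ?f\<bar>) \<in> borel_measurable (borel \<Otimes>\<^sub>M borel)"
          by measurable
        then show "(\<lambda>\<omega>. ennreal \<bar>explicit_rule a B (pullback \<psi> F (\<lambda>_. 0)) \<omega> - cube_integral ?f\<bar>) \<in> borel_measurable ?UV"
          by (simp only: measurable_cong_sets[OF sets_uv refl])
      qed (simp_all add: prob_space.emeasure_space_1[OF prob_space_uv[where 'd = 'd]])
      also have "(\<integral>\<^sup>+\<omega>. ennreal \<bar>explicit_rule a B (pullback \<psi> F (\<lambda>_. 0)) \<omega> - cube_integral ?f\<bar> \<partial>?UV) = mean_error \<psi> a B ?f"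
        unfolding mean_error_def uv_measure_def nn_integral_completion
        by (rule nn_integral_cong_AE, rule AE_mp[OF AE_realizations])
          (simp add: meq)
      also have "mean_error \<psi> a B ?f + ennreal ((Q + 1) * e') \<le> ennreal (?t + e') + ennreal ((Q + 1) * e')"
        by (rule add_right_mono[OF sm])
      also have "\<dots> = ennreal (?t + e)"
        using tp e' Q(1) by (subst ennreal_plus[symmetric]) (auto simp: algebra_simps)
      also have "\<dots> = ennreal ?t + ennreal e" using t0 e by (intro ennreal_plus) auto
      finally show "mean_error \<psi> a B f \<le> ennreal ?t + ennreal e" .
    qed
  qed
qed

end

section \<open>Choice of the scaling and of the constants\<close>

lemma mix_indices_zero: "(\<lambda>_. 0) \<in> mix_indices r"
  by (simp add: mix_indices_def)

lemma iso_indices_zero: "(\<lambda>_. 0) \<in> iso_indices s"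
  by (simp add: iso_indices_def)

lemma mix_indices_down: "\<alpha> \<in> mix_indices r \<Longrightarrow> {..\<alpha>} \<subseteq> mix_indices r"
  by (auto simp: mix_indices_def le_fun_def) (meson order_trans)

lemma iso_indices_down: "\<alpha> \<in> iso_indices s \<Longrightarrow> {..\<alpha>} \<subseteq> iso_indices s"
proof
  fix \<beta> assume "\<alpha> \<in> iso_indices s" "\<beta> \<in> {..\<alpha>}"
  then have "(\<Sum>i\<in>UNIV. \<beta> i) \<le> (\<Sum>i\<in>UNIV. \<alpha> i)" "(\<Sum>i\<in>UNIV. \<alpha> i) \<le> s"
    by (auto simp: iso_indices_def le_fun_def intro: sum_mono)
  then show "\<beta> \<in> iso_indices s" by (simp add: iso_indices_def)
qed

text \<open>\<open>k\<close> is the integer part of \<open>n\<close> to the power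
  \<open>1 / D\<close>. As \<open>n\<close> is at least one, rounding down loses at most a factor 2,
  which accounts for \<open>2 / a0\<close>.\<close>

lemma dilation_parameter:
  fixes n D :: nat
  assumes n: "n \<ge> 1" and D: "D \<ge> 1" and a0: "0 < a0" "a0 \<le> 1"
  obtains k :: nat where "k \<ge> 1" "k ^ D \<le> n" "1 / (a0 * real k) \<le> 2 / a0 * real n powr (- 1 / real D)"
    "1 / (a0 * real k) ^ D \<le> (2 / a0) ^ D / real n" "(a0 * real k) ^ D \<le> real n"
proof -
  define k where "k = nat \<lfloor>real n powr (1 / real D)\<rfloor>"
  let ?x = "real n powr (1 / real D)"
  have xD: "?x ^ D = real n" using n D by (simp add: powr_realpow[symmetric] powr_powr)
  have x1: "1 \<le> ?x" using n by (intro ge_one_powr_ge_zero) auto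
  have k: "real k \<le> ?x" "?x < real k + 1" using x1 unfolding k_def by linarith+
  have k1: "k \<ge> 1" using k x1 by linarith
  have xk: "?x \<le> 2 * real k" using k k1 by linarith
  have "real (k ^ D) \<le> real n" using power_mono[OF k(1), of D] xD by simp
  then have kn: "k ^ D \<le> n" by (simp only: of_nat_le_iff)
  have x0: "0 < ?x" using x1 by linarith
  have ak: "0 < a0 * real k" using a0 k1 by simp
  have k0: "0 < real k" using k1 by simp
  have inv: "1 / (a0 * real k) \<le> 2 / a0 * (1 / ?x)"
    using xk a0(1) k0 x0 by (simp add: divide_simps)
  also have "1 / ?x = real n powr (- 1 / real D)" by (simp add: powr_minus_divide)
  finally have 3: "1 / (a0 * real k) \<le> 2 / a0 * real n powr (- 1 / real D)" .
  have "(1 / (a0 * real k)) ^ D \<le> (2 / a0 * (1 / ?x)) ^ D"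
    using ak by (intro power_mono inv) simp
  then have 4: "1 / (a0 * real k) ^ D \<le> (2 / a0) ^ D / real n"
    by (simp only: power_mult_distrib power_divide xD power_one times_divide_eq_right mult_1_right)
  have "(a0 * real k) ^ D \<le> real k ^ D" using a0 by (intro power_mono) (auto intro: mult_left_le_one_le)
  also have "\<dots> \<le> real n" using kn by (simp flip: of_nat_power)
  finally show thesis using that[OF k1 kn 3 4] by simp
qed

text \<open>Rounding up to a power of two costs one \<open>ln 2\<close> and the added level another;
  \<open>n > 1\<close> bounds each by \<open>ln n\<close>, and together with \<open>ln n\<close>
  itself this makes three.\<close>

lemma dyadic_level_ln:
  assumes n: "n > 1" and T: "T \<le> real n"
  shows "real (dyadic_level T + 1) \<le> 3 / ln 2 * ln (real n)"
proof -
  have "2 ^ dyadic_level T \<le> 2 * max 1 T" by (rule dyadic_level_le)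
  also have "\<dots> \<le> 2 * real n" using n T by simp
  finally have "ln (2 ^ dyadic_level T) \<le> ln (2 * real n)" using n by (intro ln_mono) auto
  then have "real (dyadic_level T) * ln 2 \<le> ln 2 + ln (real n)" using n by (simp add: ln_realpow ln_mult)
  moreover have l: "ln 2 \<le> ln (real n)" using n by (intro ln_mono) auto
  ultimately have "real (dyadic_level T + 1) * ln 2 \<le> 3 * ln (real n)" by (simp add: distrib_right)
  then show ?thesis by (simp add: field_simps)
qed

lemma sqrt_power_powr: "0 < x \<Longrightarrow> sqrt (x ^ m) = x powr (real m / 2)"
  by (simp add: powr_half_sqrt[symmetric] powr_realpow[symmetric] powr_powr)

lemma powr_power_nat: "0 < x \<Longrightarrow> (x powr y) ^ m = x powr (real m * y)"
  by (simp add: powr_realpow[symmetric] powr_powr mult.commute)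

text \<open>The scaling \<open>a\<close> is chosen as large as the budget of \<open>n\<close> nodes permits, so that \<open>a^d\<close> is
  comparable to \<open>n\<close>.\<close>

theorem mainTheorem1:
  fixes B :: "real^'d^'d::finite" and \<psi> :: "real \<Rightarrow> real" and r s :: nat
  assumes "admissible_psi \<psi>"
    and "r \<ge> 1"
    and "s \<ge> 1"
    and "real s > real CARD('d) / 2"
    and "frolov_matrix B"
  shows "\<exists>c::real. c > 0 \<and> (\<forall>n::nat. n \<ge> 1 \<longrightarrow> (\<exists>a::real. a > 0 \<and>
    uses_at_most n a B \<and>
    (\<forall>f\<in>L1_cube.
       has_bochner_integral uv_measure (\<lambda>\<omega>. M_method \<psi> a B \<omega> f) (cube_integral f)) \<and>
    (n > 1 \<longrightarrow> (\<forall>f\<in>H_mix r.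
       mean_error \<psi> a B f \<le> ennreal (c * real n powr (- real r - 1 / 2) *
         ln (real n) powr ((real CARD('d) - 1) / 2) * H_mix_norm r f))) \<and>
    (n > 1 \<longrightarrow> (\<forall>f\<in>H_mix r.
       worst_error \<psi> a B f \<le> ennreal (c * real n powr (- real r) *
         ln (real n) powr ((real CARD('d) - 1) / 2) * H_mix_norm r f))) \<and>
    (\<forall>f\<in>H_iso s.
       mean_error \<psi> a B f \<le> ennreal (c * real n powr (- real s / real CARD('d) - 1 / 2) *
         H_iso_norm s f)) \<and>
    (\<forall>f\<in>H_iso s.
       worst_error \<psi> a B f \<le> ennreal (c * real n powr (- real s / real CARD('d)) *
         H_iso_norm s f))))"
proof -
  note adm = assms(1) and r = assms(2) and s = assms(4) and B = assms(5)
  let ?D = "CARD('d)"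
  have D: "?D \<ge> 1" by (simp add: Suc_leI)
  have Binv: "invertible B" using B by (simp add: frolov_matrix_def)
  have detB: "\<bar>det B\<bar> > 0" using Binv by (simp add: invertible_det_nz)
  obtain a0 where a0: "0 < a0" "a0 \<le> 1" and nodes: "\<And>k. k \<ge> 1 \<Longrightarrow> uses_at_most (k ^ ?D) (a0 * real k) B"
    by (rule uses_at_most_power[OF Binv]) blast
  obtain Y where Y: "Y \<ge> 0" and mix_sum: "\<And>a u K. a > 0 \<Longrightarrow> u \<in> u_box \<Longrightarrow> finite K \<Longrightarrow> K \<subseteq> int_lattice - {0} \<Longrightarrow>
    (\<Sum>k\<in>K. 1 / freq_weight (mix_indices r) (dilation a B u *v k))
    \<le> Y * real (dyadic_level (a ^ ?D) + 1) ^ (?D - 1) * (1 / a ^ ?D) ^ (2 * r)"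
    using lattice_sum_mix[OF B r] by auto
  define q where "q = 2 / a0"
  define \<delta> where "\<delta> = 1 / (a0 ^ ?D * \<bar>det B\<bar>)"
  define V where "V = 2 * 2 ^ (1 + ?D + 2 * s) * \<delta>"
  let ?h = "(real ?D - 1) / 2"
  have q: "q > 0" and \<delta>: "\<delta> > 0" and V: "V > 0" using a0 detB by (simp_all add: q_def \<delta>_def V_def)
  obtain C where mix: "error_constant \<psi> (mix_indices r :: ('d \<Rightarrow> nat) set) C"
    using ex_error_constant[OF adm finite_mix_indices mix_indices_zero mix_indices_down] by blast
  obtain C' where iso: "error_constant \<psi> (iso_indices s :: ('d \<Rightarrow> nat) set) C'"
    using ex_error_constant[OF adm finite_iso_indices iso_indices_zero iso_indices_down] by blast
  have C: "C > 0" and C': "C' > 0" using mix iso by (simp_all add: error_constant_def)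
  \<comment> \<open>The mean error bound for the mixed norm comes out without a logarithm. Division
    by \<open>ln 2 powr ?h\<close> pays for inserting the power of \<open>ln n\<close>, which is at
    least that of \<open>ln 2\<close> when \<open>n > 1\<close>.\<close>
  define c1 where "c1 = C * (q ^ ?D) ^ r * sqrt (q ^ ?D) / ln 2 powr ?h"
  define c2 where "c2 = C * sqrt (Y * \<delta>) * (3 / ln 2) powr ?h * (q ^ ?D) ^ r"
  define c3 where "c3 = C' * q ^ s * sqrt (q ^ ?D)"
  define c4 where "c4 = C' * sqrt V * q ^ s"
  define c where "c = c1 + c2 + c3 + c4"
  have pos: "0 < c1" "0 \<le> c2" "0 < c3" "0 < c4"
    using C C' q V Y \<delta> by (auto simp: c1_def c2_def c3_def c4_def)
  have c: "c > 0" "c1 \<le> c" "c2 \<le> c" "c3 \<le> c" "c4 \<le> c" using pos by (simp_all add: c_def)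
  have norm0: "0 \<le> sobolev_norm A f" for A and f :: "real^'d \<Rightarrow> real"
    unfolding sobolev_norm_def by (intro real_sqrt_ge_zero sum_nonneg) auto
  show ?thesis
  proof (rule exI[of _ c], intro conjI allI impI c(1))
    fix n :: nat assume n: "n \<ge> 1"
    then have n0: "0 < real n" by simp
    obtain k where k: "k \<ge> 1" "k ^ ?D \<le> n" "1 / (a0 * real k) \<le> 2 / a0 * real n powr (- 1 / real ?D)"
      "1 / (a0 * real k) ^ ?D \<le> (2 / a0) ^ ?D / real n" "(a0 * real k) ^ ?D \<le> real n"
      by (rule dilation_parameter[OF n D a0])
    define a where "a = a0 * real k"
    have a: "a > 0" using a0 k(1) by (simp add: a_def)
    then have aD: "a ^ ?D > 0" by simp
    have uses: "uses_at_most (k ^ ?D) a B" unfolding a_def by (rule nodes[OF k(1)])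
    \<comment> \<open>Nodes over determinant: with \<open>a = a0 * k\<close> the powers of
      \<open>k\<close> cancel, so the Bessel factor does not grow with \<open>n\<close>.\<close>
    have quot: "real (k ^ ?D) / (a ^ ?D * \<bar>det B\<bar>) = \<delta>"
      using k(1) by (simp add: a_def \<delta>_def power_mult_distrib)
    have inv_a: "1 / a \<le> q * real n powr (- 1 / real ?D)" and inv_aD: "1 / a ^ ?D \<le> q ^ ?D / real n"
      using k(3,4) by (simp_all only: a_def q_def)
    have inv_s: "(1 / a) ^ s \<le> q ^ s * real n powr (- real s / real ?D)"
    proof -
      have "(1 / a) ^ s \<le> (q * real n powr (- 1 / real ?D)) ^ s" using inv_a a by (intro power_mono) auto
      also have "\<dots> = q ^ s * real n powr (- real s / real ?D)"
        by (simp only: power_mult_distrib powr_power_nat[OF n0]) simp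
      finally show ?thesis .
    qed
    have inv_r: "(1 / a ^ ?D) ^ r \<le> (q ^ ?D) ^ r * real n powr (- real r)"
    proof -
      have "(1 / a ^ ?D) ^ r \<le> (q ^ ?D / real n) ^ r" using inv_aD a by (intro power_mono) auto
      also have "\<dots> = (q ^ ?D) ^ r * real n powr (- real r)"
        using n0 by (simp add: powr_minus powr_realpow divide_inverse power_mult_distrib power_inverse)
      finally show ?thesis .
    qed
    have half: "real n powr (- 1 / 2) = inverse (sqrt (real n))"
    proof -
      have "(- 1 / 2 :: real) = - (1 / 2)" by simp
      then show ?thesis by (simp only: powr_minus powr_half_sqrt[OF less_imp_le[OF n0]])
    qed
    have inv_half: "sqrt (1 / a ^ ?D) \<le> sqrt (q ^ ?D) * real n powr (- 1 / 2)"
    proof -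
      have "sqrt (1 / a ^ ?D) \<le> sqrt (q ^ ?D / real n)" by (rule real_sqrt_le_mono[OF inv_aD])
      also have "\<dots> = sqrt (q ^ ?D) * real n powr (- 1 / 2)"
        unfolding real_sqrt_divide half by (rule divide_inverse)
      finally show ?thesis .
    qed
    have sqrt_sq: "sqrt (x ^ (2 * m)) = x ^ m" if "0 \<le> x" for x :: real and m
    proof -
      have "x ^ (2 * m) = (x ^ m)\<^sup>2" by (simp only: power_mult[symmetric] mult.commute)
      then show ?thesis using that by (simp only: real_sqrt_abs abs_of_nonneg zero_le_power)
    qed
    have unb: "has_bochner_integral uv_measure (\<lambda>\<omega>. M_method \<psi> a B \<omega> f) (cube_integral f)" if "f \<in> L1_cube" for f
      by (rule M_method_unbiased[OF adm Binv a uses that])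
    have Zi: "weight_sums_le (iso_indices s) a B (2 * 2 ^ (1 + ?D + 2 * s) * (1 / a) ^ (2 * s))"
      unfolding weight_sums_le_def using lattice_sum_iso[OF B s a] by blast
    have Zm: "weight_sums_le (mix_indices r) a B (Y * real (dyadic_level (a ^ ?D) + 1) ^ (?D - 1) * (1 / a ^ ?D) ^ (2 * r))"
      unfolding weight_sums_le_def using mix_sum[OF a] by blast
    have iso_w: "worst_error \<psi> a B f \<le> ennreal (c * real n powr (- real s / real ?D) * H_iso_norm s f)"
      if f: "f \<in> sobolev_space (iso_indices s)" "continuous_on unit_cube f" for f
    proof (rule order_trans[OF error_constantD(1)[OF adm iso B a uses f Zi]])
      have "sqrt (2 * 2 ^ (1 + ?D + 2 * s) * (1 / a) ^ (2 * s) * \<delta>) = sqrt (V * (1 / a) ^ (2 * s))"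
        unfolding V_def by (simp only: mult_ac)
      also have "\<dots> = sqrt V * (1 / a) ^ s"
        unfolding real_sqrt_mult by (subst sqrt_sq) (use a in auto)
      finally have "C' * sqrt (2 * 2 ^ (1 + ?D + 2 * s) * (1 / a) ^ (2 * s) * \<delta>) = C' * sqrt V * (1 / a) ^ s" by simp
      also have "\<dots> \<le> C' * sqrt V * (q ^ s * real n powr (- real s / real ?D))"
        using C' V by (intro mult_left_mono inv_s) auto
      also have "\<dots> = c4 * real n powr (- real s / real ?D)" by (simp add: c4_def)
      also have "\<dots> \<le> c * real n powr (- real s / real ?D)" by (intro mult_right_mono c) auto
      finally show "ennreal (C' * sqrt (2 * 2 ^ (1 + ?D + 2 * s) * (1 / a) ^ (2 * s) * (real (k ^ ?D) / (a ^ ?D * \<bar>det B\<bar>))) * H_iso_norm s f)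
        \<le> ennreal (c * real n powr (- real s / real ?D) * H_iso_norm s f)"
        unfolding quot by (intro ennreal_leI mult_right_mono norm0)
    qed
    have iso_m: "mean_error \<psi> a B f \<le> ennreal (c * real n powr (- real s / real ?D - 1 / 2) * H_iso_norm s f)"
      if f: "f \<in> sobolev_space (iso_indices s)" "continuous_on unit_cube f" for f
    \<comment> \<open>If the product of the coordinates is at least \<open>a ^ d\<close>, one
      coordinate is at least \<open>a\<close>, and the weight at least \<open>a ^ (2 * s)\<close>;
      its inverse serves as \<open>\<nu>\<close>.\<close>
    proof (rule order_trans[OF error_constantD(2)[OF adm iso B a uses f Zi, of "(1 / a) ^ (2 * s)"]])
      show "0 \<le> (1 / a) ^ (2 * s)" using a by simp
      show "1 \<le> (1 / a) ^ (2 * s) * freq_weight (iso_indices s) \<xi>" if \<xi>: "a ^ ?D \<le> (\<Prod>j\<in>UNIV. \<bar>\<xi> $ j\<bar>)" for \<xi> :: "real^'d"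
      proof -
        have "\<exists>j. a \<le> \<bar>\<xi> $ j\<bar>"
        proof (rule ccontr)
          assume "\<nexists>j. a \<le> \<bar>\<xi> $ j\<bar>"
          then have "(\<Prod>j\<in>UNIV. \<bar>\<xi> $ j\<bar>) < (\<Prod>j\<in>(UNIV :: 'd set). a)"
            using a by (intro prod_mono_strict[of undefined]) (auto simp: not_le intro: less_imp_le)
          then show False using \<xi> by simp
        qed
        then obtain j where "a \<le> \<bar>\<xi> $ j\<bar>" ..
        then have "a ^ (2 * s) \<le> \<bar>\<xi> $ j\<bar> ^ (2 * s)" using a by (intro power_mono) auto
        also have "\<dots> \<le> freq_weight (iso_indices s) \<xi>" by (rule freq_weight_iso_ge)
        finally have "(1 / a) ^ (2 * s) * a ^ (2 * s) \<le> (1 / a) ^ (2 * s) * freq_weight (iso_indices s) \<xi>"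
          using a by (intro mult_left_mono) auto
        then show ?thesis using a by (simp flip: power_mult_distrib)
      qed
      have "sqrt ((1 / a) ^ (2 * s) / a ^ ?D) = (1 / a) ^ s * sqrt (1 / a ^ ?D)"
        using sqrt_sq[of "1 / a" s] a by (simp add: real_sqrt_divide)
      also have "\<dots> \<le> (q ^ s * real n powr (- real s / real ?D)) * (sqrt (q ^ ?D) * real n powr (- 1 / 2))"
        using a q by (intro mult_mono inv_s inv_half) auto
      finally have "C' * sqrt ((1 / a) ^ (2 * s) / a ^ ?D)
        \<le> C' * ((q ^ s * real n powr (- real s / real ?D)) * (sqrt (q ^ ?D) * real n powr (- 1 / 2)))"
        using C' by (intro mult_left_mono) auto
      also have "\<dots> = c3 * (real n powr (- real s / real ?D) * real n powr (- 1 / 2))"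
        by (simp only: c3_def mult_ac)
      also have "real n powr (- real s / real ?D) * real n powr (- 1 / 2) = real n powr (- real s / real ?D - 1 / 2)"
        by (simp flip: powr_add)
      also have "c3 * \<dots> \<le> c * \<dots>" by (intro mult_right_mono c) auto
      finally show "ennreal (C' * sqrt ((1 / a) ^ (2 * s) / a ^ ?D) * H_iso_norm s f)
        \<le> ennreal (c * real n powr (- real s / real ?D - 1 / 2) * H_iso_norm s f)"
        by (intro ennreal_leI mult_right_mono norm0)
    qed
    have mix_w: "worst_error \<psi> a B f \<le> ennreal (c * real n powr (- real r) * ln (real n) powr ?h * H_mix_norm r f)"
      if n2: "n > 1" and f: "f \<in> sobolev_space (mix_indices r)" "continuous_on unit_cube f" for f
    proof (rule order_trans[OF error_constantD(1)[OF adm mix B a uses f Zm]])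
      let ?l = "real (dyadic_level (a ^ ?D) + 1)"
      have ln0: "0 < ln (real n)" using n2 by simp
      have l: "?l \<le> 3 / ln 2 * ln (real n)" by (rule dyadic_level_ln[OF n2]) (use k(5) in \<open>simp add: a_def\<close>)
      have hD: "real (?D - 1) / 2 = ?h" using D by (simp add: of_nat_diff)
      \<comment> \<open>The root of the number of dyadic level vectors; this is the logarithmic
        factor of the worst case bound.\<close>
      have "sqrt (?l ^ (?D - 1)) = ?l powr ?h" by (simp only: sqrt_power_powr[of ?l "?D - 1"] hD)
      also have "\<dots> \<le> (3 / ln 2 * ln (real n)) powr ?h" using l D by (intro powr_mono2) auto
      also have "\<dots> = (3 / ln 2) powr ?h * ln (real n) powr ?h" by (rule powr_mult)
      finally have lev: "sqrt (?l ^ (?D - 1)) \<le> (3 / ln 2) powr ?h * ln (real n) powr ?h" .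
      have "sqrt (Y * ?l ^ (?D - 1) * (1 / a ^ ?D) ^ (2 * r) * \<delta>) = sqrt (Y * \<delta> * (?l ^ (?D - 1)) * (1 / a ^ ?D) ^ (2 * r))"
        by (simp only: mult_ac)
      also have "\<dots> = sqrt (Y * \<delta>) * sqrt (?l ^ (?D - 1)) * (1 / a ^ ?D) ^ r"
        unfolding real_sqrt_mult[of "Y * \<delta> * (?l ^ (?D - 1))"] real_sqrt_mult[of "Y * \<delta>"] by (subst sqrt_sq) (use a in auto)
      also have "\<dots> \<le> sqrt (Y * \<delta>) * ((3 / ln 2) powr ?h * ln (real n) powr ?h) * ((q ^ ?D) ^ r * real n powr (- real r))"
        using Y \<delta> a by (intro mult_mono lev inv_r mult_left_mono) auto
      finally have "C * sqrt (Y * ?l ^ (?D - 1) * (1 / a ^ ?D) ^ (2 * r) * \<delta>)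
        \<le> C * (sqrt (Y * \<delta>) * ((3 / ln 2) powr ?h * ln (real n) powr ?h) * ((q ^ ?D) ^ r * real n powr (- real r)))"
        using C by (intro mult_left_mono) auto
      also have "\<dots> = c2 * (real n powr (- real r) * ln (real n) powr ?h)" by (simp only: c2_def mult_ac)
      also have "\<dots> \<le> c * (real n powr (- real r) * ln (real n) powr ?h)" by (intro mult_right_mono c) auto
      finally show "ennreal (C * sqrt (Y * ?l ^ (?D - 1) * (1 / a ^ ?D) ^ (2 * r) * (real (k ^ ?D) / (a ^ ?D * \<bar>det B\<bar>))) * H_mix_norm r f)
        \<le> ennreal (c * real n powr (- real r) * ln (real n) powr ?h * H_mix_norm r f)"
        unfolding quot by (intro ennreal_leI mult_right_mono norm0) (simp only: mult.assoc)
    qed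
    have mix_m: "mean_error \<psi> a B f \<le> ennreal (c * real n powr (- real r - 1 / 2) * ln (real n) powr ?h * H_mix_norm r f)"
      if n2: "n > 1" and f: "f \<in> sobolev_space (mix_indices r)" "continuous_on unit_cube f" for f
    \<comment> \<open>The mixed weight dominates the product of the coordinates to the power
      \<open>2 * r\<close>, so on the region its inverse is at most this \<open>\<nu>\<close>, with
      no count of level vectors involved.\<close>
    proof (rule order_trans[OF error_constantD(2)[OF adm mix B a uses f Zm, of "(1 / a ^ ?D) ^ (2 * r)"]])
      show "0 \<le> (1 / a ^ ?D) ^ (2 * r)" using a by simp
      show "1 \<le> (1 / a ^ ?D) ^ (2 * r) * freq_weight (mix_indices r) \<xi>" if \<xi>: "a ^ ?D \<le> (\<Prod>j\<in>UNIV. \<bar>\<xi> $ j\<bar>)" for \<xi> :: "real^'d"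
      proof -
        have "a ^ ?D \<le> (\<Prod>j\<in>UNIV. max 1 \<bar>\<xi> $ j\<bar>)"
          using \<xi> by (rule order_trans) (intro prod_mono, auto)
        then have "(a ^ ?D) ^ (2 * r) \<le> (\<Prod>j\<in>UNIV. max 1 \<bar>\<xi> $ j\<bar>) ^ (2 * r)" using a by (intro power_mono) auto
        also have "\<dots> \<le> freq_weight (mix_indices r) \<xi>" by (rule freq_weight_mix_ge)
        finally have "(1 / a ^ ?D) ^ (2 * r) * (a ^ ?D) ^ (2 * r) \<le> (1 / a ^ ?D) ^ (2 * r) * freq_weight (mix_indices r) \<xi>"
          using a by (intro mult_left_mono) auto
        then show ?thesis unfolding power_mult_distrib[symmetric] using a by simp
      qed
      have ln2: "ln 2 powr ?h \<le> ln (real n) powr ?h" using n2 D by (intro powr_mono2 ln_mono) auto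
      have "sqrt ((1 / a ^ ?D) ^ (2 * r) / a ^ ?D) = sqrt ((1 / a ^ ?D) ^ (2 * r) * (1 / a ^ ?D))" by simp
      also have "\<dots> = (1 / a ^ ?D) ^ r * sqrt (1 / a ^ ?D)"
        unfolding real_sqrt_mult by (subst sqrt_sq) (use a in auto)
      also have "\<dots> \<le> ((q ^ ?D) ^ r * real n powr (- real r)) * (sqrt (q ^ ?D) * real n powr (- 1 / 2))"
        using a q by (intro mult_mono inv_r inv_half) auto
      finally have "C * sqrt ((1 / a ^ ?D) ^ (2 * r) / a ^ ?D)
        \<le> C * (((q ^ ?D) ^ r * real n powr (- real r)) * (sqrt (q ^ ?D) * real n powr (- 1 / 2)))"
        using C by (intro mult_left_mono) auto
      also have "\<dots> = C * (q ^ ?D) ^ r * sqrt (q ^ ?D) * (real n powr (- real r) * real n powr (- 1 / 2))"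
        by (simp only: mult_ac)
      also have "C * (q ^ ?D) ^ r * sqrt (q ^ ?D) = c1 * ln 2 powr ?h" by (simp add: c1_def)
      also have "real n powr (- real r) * real n powr (- 1 / 2) = real n powr (- real r - 1 / 2)"
        by (simp flip: powr_add)
      also have "c1 * ln 2 powr ?h * \<dots> \<le> c * ln (real n) powr ?h * \<dots>"
        using c by (intro mult_right_mono mult_mono ln2) auto
      finally show "ennreal (C * sqrt ((1 / a ^ ?D) ^ (2 * r) / a ^ ?D) * H_mix_norm r f)
        \<le> ennreal (c * real n powr (- real r - 1 / 2) * ln (real n) powr ?h * H_mix_norm r f)"
        by (intro ennreal_leI mult_right_mono norm0) (simp only: mult_ac)
    qed
    show "\<exists>a>0. uses_at_most n a B \<and>
      (\<forall>f\<in>L1_cube. has_bochner_integral uv_measure (\<lambda>\<omega>. M_method \<psi> a B \<omega> f) (cube_integral f)) \<and>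
      (n > 1 \<longrightarrow> (\<forall>f\<in>H_mix r. mean_error \<psi> a B f \<le> ennreal (c * real n powr (- real r - 1 / 2) *
         ln (real n) powr ?h * H_mix_norm r f))) \<and>
      (n > 1 \<longrightarrow> (\<forall>f\<in>H_mix r. worst_error \<psi> a B f \<le> ennreal (c * real n powr (- real r) *
         ln (real n) powr ?h * H_mix_norm r f))) \<and>
      (\<forall>f\<in>H_iso s. mean_error \<psi> a B f \<le> ennreal (c * real n powr (- real s / real ?D - 1 / 2) * H_iso_norm s f)) \<and>
      (\<forall>f\<in>H_iso s. worst_error \<psi> a B f \<le> ennreal (c * real n powr (- real s / real ?D) * H_iso_norm s f))"
    proof (intro exI[of _ a] conjI ballI impI a uses_at_most_mono[OF uses k(2)])
    qed (use unb mix_m mix_w iso_m iso_w in \<open>simp_all only: H_mix_def H_iso_def mem_Collect_eq\<close>)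
  qed
qed

end
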